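(* Let $u_1,u_2,v\in\mathcal{O}_{F_0}^\times$, $\epsilon_1=\chi(-u_1u_2)$, $\epsilon_2=\chi(-v)$. Let $a\ge b$ be non-negative integers and $S=\mathrm{Diag}\{v,1\}$, $\mathcal{H}=\begin{pmatrix}0&\pi^{-1}\\-\pi^{-1}&0\end{pmatrix}$. (1) If $T=\mathrm{Diag}\{u_1(-\pi_0)^a,u_2(-\pi_0)^b\}$, then $$\alpha(S,T,X)=(1-X)(1+\epsilon_2+q\epsilon_2)\sum_{e=0}^b(qX)^e-\epsilon_1q^{b+1}X^{a+1}(1-X)\sum_{e=0}^b(q^{-1}X)^e-\epsilon_1(1+q)(X^{a+b+2}+\epsilon_1\epsilon_2)+(1+\epsilon_2)q^{b+1}X^{b+1}(1+\epsilon_1X^{a-b}),$$ and $$\alpha(\mathcal{H},T,X)=(1-q^{-2}X)\Big(\sum_{e=0}^bq^eX^e+\epsilon_1\sum_{e=a+1}^{a+b+1}q^{a+b+1-e}X^e\Big).$$ (2) If $T=\begin{pmatrix}0&(-\pi)^{2a-1}\\ \pi^{2a-1}&0\end{pmatrix}$ with $a\ge0$, then $$\alpha(S,T,X)=(1-X)(1+\epsilon_2+q\epsilon_2)\sum_{e=0}^a(qX)^e-q^{2a+1}(1-X)\sum_{e=a+1}^{2a}(q^{-1}X)^e-(q+1)(X^{2a+1}+\epsilon_2)+(q+1)(1+\epsilon_2)q^aX^{a+1},$$ and $$\alpha(\mathcal{H},T,X)=(1-q^{-2}X)\Big(\sum_{e=0}^aq^eX^e+\sum_{e=a+1}^{2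a}q^{2a-e}X^e\Big).$$
   Context: $p$ is an odd prime, $F_0/\mathbb{Q}_p$ a finite extension with residue field $\mathbb{F}_q$, $F/F_0$ a ramified quadratic extension, $\pi$ a uniformizer of $F$ with $\pi_0:=\pi^2\in\mathcal{O}_{F_0}$. $\chi:F_0^\times\to\{\pm1\}$ is the quadratic character of $F/F_0$ ($\chi(c)=1$ iff $c\in\mathrm{Nm}_{F/F_0}(F^\times)$). $X^*={}^t\bar X$. $\mathrm{Herm}_n(F_0)$ is the set of $n\times n$ matrices over $F$ with $X=X^*$, and $\mathrm{Herm}_n(\mathcal{O}_{F_0})$ those with entries in $\mathcal{O}_F$. Fix an additive character $\psi$ of $F_0$ with conductor $\mathcal{O}_{F_0}$. For nondegenerate hermitian $S$ (size $m$) and $T$ (size $n$), with $S[X]=X^*SX$, $$\alpha(S,T)=\int_{\mathrm{Herm}_n(F_0)}\int_{M_{m,n}(\mathcal{O}_F)}\psi(\mathrm{Tr}(Y(S[X]-T)))\,dX\,dY,$$ with Haar measures giving $M_{m,n}(\mathcal{O}_F)$ and $\mathrm{Herm}_n(\mathcal{O}_{F_0})$ volume $1$ (the outer integral being the limit over $\pi_0^{-\ell}\mathrm{Herm}_n(\mathcal{O}_{F_0})$, $\ell\to\infty$). When $S,T$ lie in $\mathrm{Herm}^\vee(\mathcal{O}_{F_0})$ (hermitian matrices with diagonal entries in $\mathcal{O}_{F_0}$ and off-diagonal entries in $\pi^{-1}\mathcal{O}_F$), this equals $q^{\ell n(n-2m)}\,|\{X\in M_{m,n}(\mathcal{O}_F/\pi_0^\ell):S[X]-T\in\pi_0^\ell\mathrm{Herm}_n^\vee(\mathcal{O}_{F_0})\}|$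 for $\ell$ sufficiently large. $\alpha(S,T,X)\in\mathbb{Q}[X]$ is the polynomial with $\alpha(S\oplus\mathcal{H}^r,T)=\alpha(S,T,q^{-2r})$ for all integers $r\ge0$, where $\mathcal{H}^r$ is the orthogonal sum of $r$ copies of $\mathcal{H}$. Empty sums are $0$. *)

theory Defs
  imports
    "HOL-Analysis.Analysis"
    "HOL-Algebra.Algebraic_Closure_Type"
    "Jordan_Normal_Form.Matrix"
begin

section \<open>The fields\<close>

text \<open>All fields are subfields of one field \<open>F\<close>, the type \<open>'a\<close>, with absolute value \<open>av\<close>.\<close>

definition int_ring :: "('a \<Rightarrow> real) \<Rightarrow> 'a set \<Rightarrow> 'a set" where
  "int_ring av E = {x \<in> E. av x \<le> 1}"

definition max_ideal :: "('a \<Rightarrow> real) \<Rightarrow> 'a set \<Rightarrow> 'a set" where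
  "max_ideal av E = {x \<in> E. av x < 1}"

definition is_uniformizer :: "('a :: field \<Rightarrow> real) \<Rightarrow> 'a set \<Rightarrow> 'a \<Rightarrow> bool" where
  "is_uniformizer av E x \<longleftrightarrow> x \<in> E \<and> max_ideal av E = (\<lambda>y. x * y) ` int_ring av E"

definition residue_card :: "('a :: field \<Rightarrow> real) \<Rightarrow> 'a set \<Rightarrow> nat" where
  "residue_card av E = card ((\<lambda>x. (\<lambda>y. x + y) ` max_ideal av E) ` int_ring av E)"

text \<open>
  \<open>Qp\<close> is a completion of the rationals for the \<open>p\<close>-adic absolute value, \<open>F0\<close> is a finite
  extension of \<open>Qp\<close>, and \<open>F\<close> is a ramified quadratic extension of \<open>F0\<close> with non-trivial
  \<open>F0\<close>-automorphism \<open>bar\<close> and uniformizer \<open>\<pi>\<close>. The absolute value \<open>av\<close> is the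
  extension to \<open>F\<close> of the \<open>p\<close>-adic one (so \<open>av p = 1 / p\<close>).
\<close>

locale ramified_quadratic_extension =
  fixes p :: nat
    and av :: "'a :: field_char_0 \<Rightarrow> real"
    and Qp F0 :: "'a set"
    and bar :: "'a \<Rightarrow> 'a"
    and \<pi> :: 'a
  assumes prime_p: "Factorial_Ring.prime p" and odd_p: "odd p"
    and av_nonneg: "\<And>x. av x \<ge> 0"
    and av_eq_0: "\<And>x. av x = 0 \<longleftrightarrow> x = 0"
    and av_mult: "\<And>x y. av (x * y) = av x * av y"
    and av_add: "\<And>x y. av (x + y) \<le> max (av x) (av y)"
    and av_padic: "\<And>k :: int. k \<noteq> 0 \<Longrightarrow> av (of_int k) = (1 / real p) ^ multiplicity (int p) k"
    and subfield_Qp: "subfield Qp (ring_of_type_algebra :: 'a ring)"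
    and rats_dense: "\<And>x e. x \<in> Qp \<Longrightarrow> e > 0 \<Longrightarrow> \<exists>r \<in> \<rat>. av (x - r) < e"
    and complete_Qp: "\<And>s :: nat \<Rightarrow> 'a. \<lbrakk>\<forall>n. s n \<in> Qp;
            \<forall>e > 0. \<exists>N. \<forall>m \<ge> N. \<forall>n \<ge> N. av (s m - s n) < e\<rbrakk>
          \<Longrightarrow> \<exists>L \<in> Qp. (\<lambda>n. av (s n - L)) \<longlonglongrightarrow> 0"
    and subfield_F0: "subfield F0 (ring_of_type_algebra :: 'a ring)"
    and Qp_F0: "Qp \<subseteq> F0"
    and finite_F0: "ring.finite_dimension (ring_of_type_algebra :: 'a ring) Qp F0"
    and quadratic: "ring.dimension (ring_of_type_algebra :: 'a ring) 2 F0 UNIV"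
    and bij_bar: "bij bar"
    and bar_add: "\<And>x y. bar (x + y) = bar x + bar y"
    and bar_mult: "\<And>x y. bar (x * y) = bar x * bar y"
    and bar_F0: "\<And>x. x \<in> F0 \<Longrightarrow> bar x = x"
    and bar_nontrivial: "bar \<noteq> id"
    and ramified: "\<not> (\<exists>x. is_uniformizer av F0 x \<and> is_uniformizer av UNIV x)"
    and pi_uniformizer: "is_uniformizer av UNIV \<pi>"
    and pi_square: "\<pi>\<^sup>2 \<in> int_ring av F0"

text \<open>The quadratic character of \<open>F/F0\<close>, to be used on non-zero elements of \<open>F0\<close> only.\<close>

definition quad_char :: "('a :: field \<Rightarrow> 'a) \<Rightarrow> 'a \<Rightarrow> int" where
  "quad_char bar c = (if \<exists>x. x \<noteq> 0 \<and> c = x * bar x then 1 else - 1)"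

text \<open>Unitary continuous characters of \<open>F0\<close> with conductor the ring of integers of \<open>F0\<close>;
  values of \<open>\<psi>\<close> outside \<open>F0\<close> are irrelevant.\<close>

definition unramified_additive_character ::
    "('a :: field \<Rightarrow> real) \<Rightarrow> 'a set \<Rightarrow> ('a \<Rightarrow> complex) \<Rightarrow> bool" where
  "unramified_additive_character av F0 \<psi> \<longleftrightarrow>
     (\<forall>x \<in> F0. \<forall>y \<in> F0. \<psi> (x + y) = \<psi> x * \<psi> y) \<and>
     (\<forall>x \<in> F0. norm (\<psi> x) = 1) \<and>
     (\<forall>x \<in> F0. \<forall>e > 0. \<exists>d > 0. \<forall>y \<in> F0. av (y - x) < d \<longrightarrow> norm (\<psi> y - \<psi> x) < e) \<and>
     {x \<in> F0. \<forall>y \<in> int_ring av F0. \<psi> (x * y) = 1} = int_ring av F0"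

section \<open>Hermitian matrices and Haar measures\<close>

definition adj :: "('a \<Rightarrow> 'a) \<Rightarrow> 'a mat \<Rightarrow> 'a mat" where
  "adj bar Z = map_mat bar (transpose_mat Z)"

definition mat_tr :: "'a :: comm_monoid_add mat \<Rightarrow> 'a" where
  "mat_tr A = (\<Sum>i < dim_row A. A $$ (i, i))"

definition int_mats :: "('a \<Rightarrow> real) \<Rightarrow> nat \<Rightarrow> nat \<Rightarrow> 'a mat set" where
  "int_mats av m n = {Z \<in> carrier_mat m n. \<forall>i < m. \<forall>j < n. Z $$ (i, j) \<in> int_ring av UNIV}"

definition herm :: "('a \<Rightarrow> 'a) \<Rightarrow> nat \<Rightarrow> 'a mat set" where
  "herm bar n = {Z \<in> carrier_mat n n. adj bar Z = Z}"

definition int_herm :: "('a \<Rightarrow> real) \<Rightarrow> ('a \<Rightarrow> 'a) \<Rightarrow> nat \<Rightarrow> 'a mat set" where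
  "int_herm av bar n = herm bar n \<inter> int_mats av n n"

definition rel_open :: "('a :: minus \<Rightarrow> real) \<Rightarrow> 'a mat set \<Rightarrow> 'a mat set \<Rightarrow> bool" where
  "rel_open av G U \<longleftrightarrow> U \<subseteq> G \<and>
     (\<forall>A \<in> U. \<exists>e > 0. \<forall>B \<in> G.
        (\<forall>i < dim_row A. \<forall>j < dim_col A. av (B $$ (i, j) - A $$ (i, j)) < e) \<longrightarrow> B \<in> U)"

text \<open>\<open>M\<close> is the Haar measure, on the Borel sets of the additive group \<open>G\<close> of matrices of a
  fixed size, that gives \<open>K\<close> volume 1. For a compact open subgroup \<open>K\<close> of a second
  countable group \<open>G\<close>, such a measure is automatically finite on compact sets and regular.\<close>

definition is_haar_measure ::
    "('a :: ab_group_add \<Rightarrow> real) \<Rightarrow> 'a mat set \<Rightarrow> 'a mat set \<Rightarrow> 'a mat measure \<Rightarrow> bool" where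
  "is_haar_measure av G K M \<longleftrightarrow>
     space M = G \<and> sets M = sigma_sets G {U. rel_open av G U} \<and>
     (\<forall>A \<in> G. \<forall>E \<in> sets M. emeasure M ((\<lambda>Z. A + Z) ` E) = emeasure M E) \<and>
     emeasure M K = 1"

section \<open>Local densities\<close>

locale local_density_setting = ramified_quadratic_extension p av Qp F0 bar \<pi>
  for p :: nat and av :: "'a :: field_char_0 \<Rightarrow> real" and Qp F0 :: "'a set"
    and bar :: "'a \<Rightarrow> 'a" and \<pi> :: 'a +
  fixes \<psi> :: "'a \<Rightarrow> complex"
    and \<mu> :: "nat \<Rightarrow> nat \<Rightarrow> 'a mat measure"
    and \<nu> :: "nat \<Rightarrow> 'a mat measure"
  assumes psi: "unramified_additive_character av F0 \<psi>"
    and mu: "\<And>m n. is_haar_measure av (carrier_mat m n) (int_mats av m n) (\<mu> m n)"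
    and nu: "\<And>n. is_haar_measure av (herm bar n) (int_herm av bar n) (\<nu> n)"

text \<open>The double integral with the outer variable restricted to
  \<open>\<pi>0\<^sup>-\<^sup>l Herm\<^sub>n(O\<^sub>F\<^sub>0)\<close>, where \<open>\<pi>0 = \<pi>\<^sup>2\<close>.\<close>

definition truncated_density where
  "truncated_density av bar \<pi> \<psi> \<mu> \<nu> S T l =
     (LINT Y : (\<lambda>Y. inverse ((\<pi>\<^sup>2) ^ l) \<cdot>\<^sub>m Y) ` int_herm av bar (dim_row T) | \<nu> (dim_row T).
        (LINT Z : int_mats av (dim_row S) (dim_row T) | \<mu> (dim_row S) (dim_row T).
           \<psi> (mat_tr (Y * (adj bar Z * S * Z - T)))))"
  for av :: "'a :: field \<Rightarrow> real" and \<psi> :: "'a \<Rightarrow> complex"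

text \<open>The relation \<open>\<alpha>(S,T) = c\<close>.\<close>

definition has_local_density where
  "has_local_density av bar \<pi> \<psi> \<mu> \<nu> S T c \<longleftrightarrow>
     (\<lambda>l. truncated_density av bar \<pi> \<psi> \<mu> \<nu> S T l) \<longlonglongrightarrow> c"

definition diag2 :: "'a :: zero \<Rightarrow> 'a \<Rightarrow> 'a mat" where
  "diag2 x y = mat_of_rows_list 2 [[x, 0], [0, y]]"

definition antidiag2 :: "'a :: zero \<Rightarrow> 'a \<Rightarrow> 'a mat" where
  "antidiag2 x y = mat_of_rows_list 2 [[0, x], [y, 0]]"

definition hyperbolic :: "'a :: field \<Rightarrow> 'a mat" where
  "hyperbolic \<pi> = antidiag2 (inverse \<pi>) (- inverse \<pi>)"

text \<open>\<open>\<alpha>(S,T,X) = P\<close>: for each \<open>r\<close>, the local density of the sum of \<open>S\<close> and \<open>r\<close> hyperbolic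
  planes exists and is \<open>P(q\<^sup>-\<^sup>2\<^sup>r)\<close>.\<close>

definition has_density_poly where
  "has_density_poly av F0 bar \<pi> \<psi> \<mu> \<nu> S T P \<longleftrightarrow>
     (\<forall>r :: nat. has_local_density av bar \<pi> \<psi> \<mu> \<nu>
        (diag_block_mat (S # replicate r (hyperbolic \<pi>))) T
        (of_rat (poly P (1 / of_nat (residue_card av F0) ^ (2 * r)))))"

lemma has_density_poly_unique:
  assumes "has_density_poly av F0 bar \<pi> \<psi> \<mu> \<nu> S T P"
    and "has_density_poly av F0 bar \<pi> \<psi> \<mu> \<nu> S T Q"
    and q: "residue_card av F0 > 1"
  shows "P = Q"
proof -
  define x :: "nat \<Rightarrow> rat" where "x r = 1 / of_nat (residue_card av F0) ^ (2 * r)" for r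
  have eq: "poly P (x r) = poly Q (x r)" for r
  proof -
    have "(of_rat (poly P (x r)) :: complex) = of_rat (poly Q (x r))"
      using assms(1,2) unfolding has_density_poly_def has_local_density_def x_def
      by (blast intro: LIMSEQ_unique)
    then show ?thesis by simp
  qed
  have "inj x"
    using q by (auto simp: inj_def x_def)
  then have inf: "infinite (range x)"
    by (simp add: finite_image_iff)
  have "range x \<subseteq> {y. poly (P - Q) y = 0}"
    using eq by auto
  with inf have "infinite {y. poly (P - Q) y = 0}"
    using finite_subset by blast
  then show ?thesis
    using poly_roots_finite[of "P - Q"] by auto
qed

end

theory Submission
  imports Defs
begin

text \<open>
  Why the theorem holds. The inner integral over matrices \<open>V\<close> only depends on the class of the
  hermitian matrix \<open>Y\<close> modulo integral hermitian matrices, and for \<open>Y\<close> with entries in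
  \<open>\<pi>\<^sub>0\<^sup>-\<^sup>l O\<^sub>F\<close> its integrand only depends on \<open>V\<close> modulo \<open>\<pi>\<^sup>2\<^sup>l\<^sup>+\<^sup>1\<close>. So the truncated
  density is a finite sum over \<open>Y\<close> modulo integral matrices, in which the orthogonal sum of \<open>S\<close> and
  \<open>r\<close> hyperbolic planes contributes the product of the contribution of \<open>S\<close> and the \<open>r\<close>-th power of
  the contribution of \<open>H\<close> (\<open>truncated_density_eq\<close>).

  Such a \<open>Y\<close> is equivalent, over \<open>O\<^sub>F\<close> and modulo integral matrices, to a diagonal matrix or to a
  block whose off-diagonal entry has the dominating pole. The hyperbolic plane contributes the volume of
  the vectors that \<open>Y\<close> maps to integral vectors, and the form \<open>Diag(v,1)\<close> contributes a product of
  Gauss sums. In both cases a diagonal entry with a pole of order \<open>s\<close> in \<open>\<pi>\<^sub>0\<close> gives the factor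
  \<open>\<theta> Z\<^sup>s\<close>, and a block with a pole of order \<open>e\<close> in \<open>\<pi>\<close> gives \<open>\<theta>\<^sup>2 Z\<^sup>e\<close>, where
  \<open>Z = q\<^sup>-\<^sup>2\<close>, and \<open>\<theta> = 1\<close> for the hyperbolic plane but \<open>\<theta> = \<chi>(-v) q\<close> for \<open>Diag(v,1)\<close>.
  That the product of two Gauss sums has this simple form is \<open>gauss_product\<close>; the axiomatic
  description of both contributions is \<open>polar_weight\<close>. Hence one calculation serves all four
  densities, and the hyperbolic planes only replace \<open>Z\<close> by \<open>q\<^sup>-\<^sup>2\<^sup>-\<^sup>2\<^sup>r\<close>, so that \<open>q\<^sup>2 Z\<close> is the
  value \<open>q\<^sup>-\<^sup>2\<^sup>r\<close> of the variable of the density polynomial.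

  To sum a polar weight against \<open>\<psi>(- tr(YT))\<close>, the matrices \<open>Y\<close> are sorted by their dominating
  entry (\<open>form_sum_eq\<close>). Completing the square turns each part into a product of a geometric
  sum and of a sum of Ramanujan sums over the values that \<open>T\<close> takes on the vectors \<open>(z, 1)\<close> or
  \<open>(1, z)\<close>. For diagonal \<open>T\<close> these values are counted by the norm form, which represents a unit \<open>c\<close> with
  density proportional to \<open>1 + \<chi>(c)\<close>; for antidiagonal \<open>T\<close> they are traces. The parts of order up to
  the smaller exponent are those of \<open>T = 0\<close>, which gives the geometric main terms, and only few
  boundary terms follow: for diagonal \<open>T\<close>, one at order \<open>b + 1\<close> and one at order \<open>a + 1\<close>, which carries
  \<open>\<chi>(- u\<^sub>1 u\<^sub>2)\<close> (\<open>diagonal_form_sum\<close>), and for antidiagonal \<open>T\<close> a single one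
  (\<open>antidiagonal_form_sum\<close>). All later parts vanish, so the truncated densities are
  constant from \<open>l = a + 1\<close> on. The rest is the comparison of two closed expressions in geometric sums.
\<close>

section \<open>Sums over quotients of additive groups\<close>

definition add_subgroup :: "'b :: ab_group_add set \<Rightarrow> bool" where
  "add_subgroup B \<longleftrightarrow> 0 \<in> B \<and> (\<forall>x \<in> B. \<forall>y \<in> B. x - y \<in> B)"

definition transversal :: "'b :: ab_group_add set \<Rightarrow> 'b set \<Rightarrow> 'b set \<Rightarrow> bool" where
  "transversal A B T \<longleftrightarrow> T \<subseteq> A \<and> (\<forall>x \<in> A. \<exists>!t. t \<in> T \<and> x - t \<in> B)"

definition finite_index :: "'b :: ab_group_add set \<Rightarrow> 'b set \<Rightarrow> bool" where
  "finite_index A B \<longleftrightarrow> add_subgroup A \<and> add_subgroup B \<and> B \<subseteq> A \<and>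
     (\<exists>T. finite T \<and> transversal A B T)"

text \<open>Sums over quotients \<open>A/B\<close> are expressed by representatives, which keeps all functions defined on
  the field itself; \<open>qsum\<close> is only meaningful for functions that are \<open>periodic\<close> modulo \<open>B\<close>.\<close>

definition some_transversal :: "'b :: ab_group_add set \<Rightarrow> 'b set \<Rightarrow> 'b set" where
  "some_transversal A B = (SOME T. finite T \<and> transversal A B T)"

definition periodic :: "'b :: ab_group_add set \<Rightarrow> 'b set \<Rightarrow> ('b \<Rightarrow> 'c) \<Rightarrow> bool" where
  "periodic A B f \<longleftrightarrow> (\<forall>x \<in> A. \<forall>y \<in> A. x - y \<in> B \<longrightarrow> f x = f y)"

definition qsum :: "'b :: ab_group_add set \<Rightarrow> 'b set \<Rightarrow> ('b \<Rightarrow> 'c :: comm_monoid_add) \<Rightarrow> 'c" where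
  "qsum A B f = sum f (some_transversal A B)"

definition idx :: "'b :: ab_group_add set \<Rightarrow> 'b set \<Rightarrow> nat" where
  "idx A B = card (some_transversal A B)"

lemma add_subgroupD:
  assumes "add_subgroup B"
  shows "0 \<in> B" "x \<in> B \<Longrightarrow> y \<in> B \<Longrightarrow> x - y \<in> B" "x \<in> B \<Longrightarrow> - x \<in> B"
    "x \<in> B \<Longrightarrow> y \<in> B \<Longrightarrow> x + y \<in> B"
proof -
  show 0: "0 \<in> B" and d: "\<And>x y. x \<in> B \<Longrightarrow> y \<in> B \<Longrightarrow> x - y \<in> B"
    using assms by (auto simp: add_subgroup_def)
  show m: "\<And>x. x \<in> B \<Longrightarrow> - x \<in> B"
    using d[OF 0] by simp
  show "x \<in> B \<Longrightarrow> y \<in> B \<Longrightarrow> x + y \<in> B"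
    using d[of x "- y"] m[of y] by simp
qed

lemma add_subgroup_diff_swap: "add_subgroup B \<Longrightarrow> x - y \<in> B \<longleftrightarrow> y - x \<in> B"
  using add_subgroupD(3)[of B "x - y"] add_subgroupD(3)[of B "y - x"] by auto

lemma add_subgroup_trans: "add_subgroup B \<Longrightarrow> x - y \<in> B \<Longrightarrow> y - z \<in> B \<Longrightarrow> x - z \<in> B"
  using add_subgroupD(4)[of B "x - y" "y - z"] by simp

lemma finite_indexD:
  assumes "finite_index A B"
  shows "add_subgroup A" "add_subgroup B" "B \<subseteq> A"
    "finite (some_transversal A B)" "transversal A B (some_transversal A B)"
    "some_transversal A B \<subseteq> A"
proof -
  show "add_subgroup A" "add_subgroup B" "B \<subseteq> A"
    using assms by (auto simp: finite_index_def)
  have "\<exists>T. finite T \<and> transversal A B T"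
    using assms by (auto simp: finite_index_def)
  then have "finite (some_transversal A B) \<and> transversal A B (some_transversal A B)"
    unfolding some_transversal_def by (rule someI_ex)
  then show "finite (some_transversal A B)" "transversal A B (some_transversal A B)"
    "some_transversal A B \<subseteq> A"
    by (auto simp: transversal_def)
qed

lemma transversalE:
  assumes "transversal A B T" "x \<in> A"
  obtains t where "t \<in> T" "t \<in> A" "x - t \<in> B"
  using assms unfolding transversal_def by blast

lemma transversal_unique:
  assumes "transversal A B T" "x \<in> A" "s \<in> T" "t \<in> T" "x - s \<in> B" "x - t \<in> B"
  shows "s = t"
  using assms unfolding transversal_def by blast

lemma finite_indexI:
  "add_subgroup A \<Longrightarrow> add_subgroup B \<Longrightarrow> B \<subseteq> A \<Longrightarrow> finite T \<Longrightarrow> transversal A B T \<Longrightarrow> finite_index A B"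
  by (auto simp: finite_index_def)

text \<open>A transversal of \<open>A'/B'\<close> is obtained from one of \<open>A/B\<close> along any map that induces a
  bijection of the quotients; it need not be additive.\<close>

lemma transversal_image:
  assumes A: "add_subgroup A" and B: "add_subgroup B'" and T: "transversal A B T"
    and h: "\<And>x. x \<in> A \<Longrightarrow> h x \<in> A'"
    and inj: "\<And>x y. x \<in> A \<Longrightarrow> y \<in> A \<Longrightarrow> h x - h y \<in> B' \<longleftrightarrow> x - y \<in> B"
    and surj: "\<And>y. y \<in> A' \<Longrightarrow> \<exists>x \<in> A. y - h x \<in> B'"
  shows "transversal A' B' (h ` T)" "inj_on h T"
proof -
  have TA: "T \<subseteq> A" and un: "\<And>x. x \<in> A \<Longrightarrow> \<exists>!t. t \<in> T \<and> x - t \<in> B"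
    using T by (auto simp: transversal_def)
  have ex: "\<exists>!t. t \<in> h ` T \<and> y - t \<in> B'" if y: "y \<in> A'" for y
  proof -
    obtain x where x: "x \<in> A" "y - h x \<in> B'" using surj[OF y] by blast
    obtain t where t: "t \<in> T" "x - t \<in> B" using un[OF x(1)] by blast
    have "h x - h t \<in> B'" using inj[of x t] x t TA by auto
    with x have yt: "y - h t \<in> B'" using add_subgroup_trans[OF B] by blast
    show ?thesis
    proof (rule ex1I[of _ "h t"])
      show "h t \<in> h ` T \<and> y - h t \<in> B'" using t yt by auto
      fix s' assume "s' \<in> h ` T \<and> y - s' \<in> B'"
      then obtain s where s: "s \<in> T" "s' = h s" "y - h s \<in> B'" by auto
      have "h x - h s \<in> B'"
        using s(3) x(2) add_subgroup_diff_swap[OF B] add_subgroup_trans[OF B] by blast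
      then have "x - s \<in> B" using inj[of x s] x s TA by auto
      then have "s = t" using un[OF x(1)] s t by blast
      then show "s' = h t" using s by simp
    qed
  qed
  show "transversal A' B' (h ` T)"
    unfolding transversal_def using TA h ex by auto
  show "inj_on h T"
  proof (rule inj_onI)
    fix x y assume xy: "x \<in> T" "y \<in> T" "h x = h y"
    have xyA: "x \<in> A" "y \<in> A" using xy TA by auto
    have z: "h x - h y \<in> B'" "h x - h x \<in> B'" using add_subgroupD(1)[OF B] xy by simp_all
    have "x - y \<in> B" "x - x \<in> B" using inj[OF xyA] inj[of x x] xyA z by simp_all
    then show "x = y" using transversal_unique[OF T xyA(1) xy(1,2)] by blast
  qed
qed

lemma qsum_eq_sum:
  assumes fi: "finite_index A B" and T: "transversal A B T" and f: "periodic A B f"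
  shows "qsum A B f = sum f T"
proof -
  define U where "U = some_transversal A B"
  have U: "transversal A B U" and UA: "U \<subseteq> A" and TA: "T \<subseteq> A"
    using finite_indexD[OF fi] T by (auto simp: U_def transversal_def)
  have B: "add_subgroup B" using finite_indexD[OF fi] by simp
  define h where "h = (\<lambda>u. THE t. t \<in> T \<and> u - t \<in> B)"
  have h: "h u \<in> T \<and> u - h u \<in> B" if "u \<in> A" for u
    unfolding h_def by (rule theI') (use T that in \<open>auto simp: transversal_def\<close>)
  have "bij_betw h U T"
  proof (rule bij_betwI')
    fix x y assume xy: "x \<in> U" "y \<in> U"
    show "(h x = h y) = (x = y)"
    proof
      assume e: "h x = h y"
      have "x - h x \<in> B" "y - h x \<in> B" using h[of x] h[of y] xy UA e by auto
      then have "x - y \<in> B"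
        using add_subgroup_diff_swap[OF B] add_subgroup_trans[OF B] by blast
      then show "x = y"
        using U xy UA unfolding transversal_def
        by (metis add_subgroupD(1)[OF B] in_mono right_minus_eq)
    qed simp
  next
    fix x assume "x \<in> U" then show "h x \<in> T" using h UA by auto
  next
    fix t assume t: "t \<in> T"
    then obtain u where u: "u \<in> U" "t - u \<in> B" using U TA by (meson in_mono transversalE)
    then have "u - t \<in> B" using add_subgroup_diff_swap[OF B] by blast
    moreover have "u \<in> A" using u UA by auto
    ultimately have "h u = t" using transversal_unique[OF T, of u "h u" t] h[of u] t by blast
    then show "\<exists>x \<in> U. t = h x" using u by blast
  qed
  then have "sum f T = sum (\<lambda>u. f (h u)) U"
    by (rule sum.reindex_bij_betw[symmetric])
  also have "\<dots> = sum f U"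
  proof (rule sum.cong)
    fix u assume "u \<in> U"
    then have "u \<in> A" using UA by auto
    with h[of u] TA f show "f (h u) = f u"
      unfolding periodic_def by (metis in_mono)
  qed simp
  finally show ?thesis by (simp add: qsum_def U_def)
qed

lemma idx_eq_card: "finite_index A B \<Longrightarrow> transversal A B T \<Longrightarrow> idx A B = card T"
  using qsum_eq_sum[of A B T "\<lambda>_. 1 :: nat"] by (simp add: qsum_def idx_def periodic_def)

lemma qsum_const: "qsum A B (\<lambda>_. c) = of_nat (idx A B) * (c :: 'c :: semiring_1)"
  by (simp add: qsum_def idx_def)

lemma qsum_cong:
  assumes "finite_index A B" and "\<And>x. x \<in> A \<Longrightarrow> f x = g x"
  shows "qsum A B f = qsum A B g"
  unfolding qsum_def using finite_indexD(6)[OF assms(1)] assms(2) by (intro sum.cong) auto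

lemma qsum_add: "qsum A B (\<lambda>x. f x + g x) = qsum A B f + qsum A B g"
  by (simp add: qsum_def sum.distrib)

lemma qsum_diff: "qsum A B (\<lambda>x. f x - g x) = qsum A B f - (qsum A B g :: 'c :: ab_group_add)"
  by (simp add: qsum_def sum_subtractf)

lemma qsum_mult_left: "qsum A B (\<lambda>x. c * f x) = c * (qsum A B f :: 'c :: semiring_0)"
  by (simp add: qsum_def sum_distrib_left)

lemma qsum_mult_right: "qsum A B (\<lambda>x. f x * c) = (qsum A B f :: 'c :: semiring_0) * c"
  by (simp add: qsum_def sum_distrib_right)

lemma qsum_swap: "qsum A B (\<lambda>x. qsum C D (\<lambda>y. f x y)) = qsum C D (\<lambda>y. qsum A B (\<lambda>x. f x y))"
  unfolding qsum_def by (rule sum.swap)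

lemma idx_pos: "finite_index A B \<Longrightarrow> idx A B > 0"
proof -
  assume f: "finite_index A B"
  have "0 \<in> A" using finite_indexD(1)[OF f] add_subgroupD(1) by blast
  then have "some_transversal A B \<noteq> {}"
    using finite_indexD(5)[OF f] by (auto simp: transversal_def)
  then show ?thesis using finite_indexD(4)[OF f] by (simp add: idx_def card_gt_0_iff)
qed

text \<open>Change of variables along a map that induces a bijection \<open>A/B \<rightarrow> A'/B'\<close>.\<close>

lemma qsum_bij:
  assumes fi: "finite_index A B" and A': "add_subgroup A'" and B': "add_subgroup B'" "B' \<subseteq> A'"
    and h: "\<And>x. x \<in> A \<Longrightarrow> h x \<in> A'"
    and inj: "\<And>x y. x \<in> A \<Longrightarrow> y \<in> A \<Longrightarrow> h x - h y \<in> B' \<longleftrightarrow> x - y \<in> B"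
    and surj: "\<And>y. y \<in> A' \<Longrightarrow> \<exists>x \<in> A. y - h x \<in> B'"
  shows "finite_index A' B'" "periodic A' B' f \<Longrightarrow> qsum A' B' f = qsum A B (\<lambda>x. f (h x))"
    "idx A' B' = idx A B"
proof -
  let ?T = "some_transversal A B"
  note fiD = finite_indexD[OF fi]
  have T: "transversal A' B' (h ` ?T)" and i: "inj_on h ?T"
    using transversal_image[OF fiD(1) B'(1) fiD(5), of h A'] h inj surj by auto
  show fi': "finite_index A' B'"
    using finite_indexI[OF A' B' _ T] fiD(4) by simp
  show "idx A' B' = idx A B"
    using idx_eq_card[OF fi' T] i by (simp add: card_image idx_def)
  assume f: "periodic A' B' f"
  then show "qsum A' B' f = qsum A B (\<lambda>x. f (h x))"
    using qsum_eq_sum[OF fi' T f] i by (simp add: sum.reindex qsum_def)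
qed

lemma qsum_shift:
  assumes fi: "finite_index A B" and f: "periodic A B f" and c: "c \<in> A"
  shows "qsum A B (\<lambda>x. f (x + c)) = qsum A B f"
proof -
  note fiD = finite_indexD[OF fi]
  have "qsum A B f = qsum A B (\<lambda>x. f (x + c))"
  proof (rule qsum_bij(2)[OF fi fiD(1,2,3) _ _ _ f])
    fix y assume "y \<in> A"
    then have "y - c \<in> A" "y - (y - c + c) \<in> B"
      using add_subgroupD[OF fiD(1)] add_subgroupD[OF fiD(2)] c by auto
    then show "\<exists>x \<in> A. y - (x + c) \<in> B" by blast
  qed (use add_subgroupD[OF fiD(1)] c in auto)
  then show ?thesis by simp
qed

lemma
  assumes AB: "finite_index A B" and BC: "finite_index B C"
  shows finite_index_trans: "finite_index A C"
    and idx_trans: "idx A C = idx A B * idx B C"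
    and qsum_tower: "periodic A C f \<Longrightarrow> qsum A C f = qsum A B (\<lambda>x. qsum B C (\<lambda>y. f (x + y)))"
proof -
  let ?T = "some_transversal A B" and ?U = "some_transversal B C"
  note 1 = finite_indexD[OF AB] and 2 = finite_indexD[OF BC]
  let ?h = "\<lambda>(x, y). x + y"
  note A = add_subgroupD[OF 1(1)] and B = add_subgroupD[OF 1(2)] and C = add_subgroupD[OF 2(2)]
  have inj: "inj_on ?h (?T \<times> ?U)"
  proof (rule inj_onI, clarify)
    fix x y x' y'
    assume a: "x \<in> ?T" "x' \<in> ?T" "y \<in> ?U" "y' \<in> ?U" and e: "x + y = x' + y'"
    then have yB: "y \<in> B" "y' \<in> B" using 2(6) by auto
    have "x' - x = y - y'" using e by (simp add: algebra_simps)
    then have "x' - x \<in> B" "x' - x' \<in> B" using B(1,2) yB by auto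
    then have x: "x = x'" using a 1(5,6) unfolding transversal_def by blast
    then have "y = y'" using e by simp
    with x show "x = x' \<and> y = y'" by simp
  qed
  have T: "transversal A C (?h ` (?T \<times> ?U))"
    unfolding transversal_def
  proof (intro conjI ballI)
    show "?h ` (?T \<times> ?U) \<subseteq> A" using 1(3,6) 2(6) by (auto intro!: A(4))
    fix x assume x: "x \<in> A"
    obtain t where t: "t \<in> ?T" "x - t \<in> B" using transversalE[OF 1(5) x] by blast
    obtain u where u: "u \<in> ?U" "x - t - u \<in> C" using transversalE[OF 2(5) t(2)] by blast
    show "\<exists>!s. s \<in> ?h ` (?T \<times> ?U) \<and> x - s \<in> C"
    proof (rule ex1I[of _ "t + u"])
      show "t + u \<in> ?h ` (?T \<times> ?U) \<and> x - (t + u) \<in> C"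
        using t u by (auto simp: algebra_simps)
      fix s assume "s \<in> ?h ` (?T \<times> ?U) \<and> x - s \<in> C"
      then obtain t' u' where s: "t' \<in> ?T" "u' \<in> ?U" "s = t' + u'" "x - (t' + u') \<in> C" by auto
      have "u' \<in> B" "x - (t' + u') \<in> B" using s 2(3,6) by auto
      then have "x - (t' + u') + u' \<in> B" using B(4) by blast
      then have "x - t' \<in> B" by (simp add: algebra_simps)
      then have t': "t' = t" using 1(5) x s t unfolding transversal_def by blast
      then have "x - t - u' \<in> C" using s by (simp add: algebra_simps)
      then have "u' = u" using 2(5) t s u unfolding transversal_def by blast
      then show "s = t + u" using s t' by simp
    qed
  qed
  show fi: "finite_index A C"
    using finite_indexI[OF 1(1) 2(2) _ _ T] 1(3,4) 2(3,4) by auto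
  show "idx A C = idx A B * idx B C"
    using idx_eq_card[OF fi T] inj by (simp add: card_image card_cartesian_product idx_def)
  assume f: "periodic A C f"
  have "qsum A C f = (\<Sum>p \<in> ?T \<times> ?U. f (?h p))"
    using qsum_eq_sum[OF fi T f] inj by (simp add: sum.reindex)
  then show "qsum A C f = qsum A B (\<lambda>x. qsum B C (\<lambda>y. f (x + y)))"
    by (simp add: qsum_def sum.cartesian_product split_beta)
qed

lemma periodic_mono: "periodic A C f \<Longrightarrow> B \<subseteq> A \<Longrightarrow> D \<subseteq> C \<Longrightarrow> periodic B D f"
  by (auto simp: periodic_def)

lemma qsum_coarser:
  assumes AB: "finite_index A B" and BC: "finite_index B C" and f: "periodic A B f"
  shows "qsum A C f = of_nat (idx B C) * (qsum A B f :: 'c :: comm_semiring_1)"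
proof -
  note 1 = finite_indexD[OF AB] and 2 = finite_indexD[OF BC]
  have p: "periodic A C f" using periodic_mono[OF f _ 2(3)] by simp
  have "qsum A C f = qsum A B (\<lambda>x. qsum B C (\<lambda>y. f (x + y)))"
    by (rule qsum_tower[OF AB BC p])
  also have "\<dots> = qsum A B (\<lambda>x. qsum B C (\<lambda>y. f x))"
  proof (intro qsum_cong[OF AB] qsum_cong[OF BC])
    fix x y assume "x \<in> A" "y \<in> B"
    then show "f (x + y) = f x"
      using f[unfolded periodic_def, rule_format, of "x + y" x] add_subgroupD(4)[OF 1(1)] 1(3) by auto
  qed
  finally show ?thesis by (simp add: qsum_const qsum_mult_left)
qed

lemma qsum_single:
  assumes AB: "finite_index A B"
  shows "qsum A B (\<lambda>x. if x \<in> B then c else 0) = c"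
proof -
  note 1 = finite_indexD[OF AB]
  have 0: "0 \<in> A" using add_subgroupD(1)[OF 1(1)] .
  obtain t where t: "t \<in> some_transversal A B" "0 - t \<in> B"
    using transversalE[OF 1(5) 0] by blast
  have u: "s = t" if "s \<in> some_transversal A B" "s \<in> B" for s
    using transversal_unique[OF 1(5) 0 that(1) t(1) _ t(2)] add_subgroupD(3)[OF 1(2) that(2)] by simp
  have tB: "t \<in> B" using add_subgroupD(3)[OF 1(2) t(2)] by simp
  have "qsum A B (\<lambda>x. if x \<in> B then c else 0) = (\<Sum>x \<in> some_transversal A B. if x = t then c else 0)"
    unfolding qsum_def using u tB by (intro sum.cong[OF refl]) metis
  also have "\<dots> = c" using t(1) 1(4) by (simp add: sum.delta)
  finally show ?thesis .
qed

lemma qsum_restrict: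
  assumes AB: "finite_index A B" and BC: "finite_index B C" and f: "periodic B C f"
  shows "qsum A C (\<lambda>x. if x \<in> B then f x else 0) = qsum B C f"
proof -
  note 1 = finite_indexD[OF AB] and 2 = finite_indexD[OF BC]
  note B = add_subgroupD[OF 1(2)]
  have inB: "x + y \<in> B \<longleftrightarrow> x \<in> B" if "y \<in> B" for x y
    using B(4)[OF _ that] B(2)[of "x + y" y] that by auto
  have p: "periodic A C (\<lambda>x. if x \<in> B then f x else 0)"
    unfolding periodic_def
  proof (intro ballI impI)
    fix x y assume "x - y \<in> C"
    then have xy: "x - y \<in> B" "x - y \<in> C" using 2(3) by auto
    then have "x \<in> B \<longleftrightarrow> y \<in> B" using inB[of "x - y" y] by simp
    then show "(if x \<in> B then f x else 0) = (if y \<in> B then f y else 0)"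
      using xy f by (auto simp: periodic_def)
  qed
  have "qsum A C (\<lambda>x. if x \<in> B then f x else 0)
      = qsum A B (\<lambda>x. qsum B C (\<lambda>y. if x + y \<in> B then f (x + y) else 0))"
    using qsum_tower[OF AB BC p] .
  also have "\<dots> = qsum A B (\<lambda>x. if x \<in> B then qsum B C f else 0)"
  proof (rule qsum_cong[OF AB])
    fix x
    have "qsum B C (\<lambda>y. if x + y \<in> B then f (x + y) else 0) = qsum B C (\<lambda>y. if x \<in> B then f (x + y) else 0)"
      by (rule qsum_cong[OF BC]) (simp add: inB)
    also have "\<dots> = (if x \<in> B then qsum B C f else 0)"
      using qsum_shift[OF BC f, of x] by (simp add: add.commute qsum_def)
    finally show "qsum B C (\<lambda>y. if x + y \<in> B then f (x + y) else 0) = (if x \<in> B then qsum B C f else 0)" .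
  qed
  finally show ?thesis using qsum_single[OF AB] by simp
qed

text \<open>Orthogonality: translating by an element \<open>c\<close> multiplies the sum by \<open>\<phi>(c) \<noteq> 1\<close>.\<close>

lemma qsum_character:
  fixes \<phi> :: "'b :: ab_group_add \<Rightarrow> 'c :: idom"
  assumes fi: "finite_index A B" and per: "periodic A B \<phi>"
    and mult: "\<And>x y. x \<in> A \<Longrightarrow> y \<in> A \<Longrightarrow> \<phi> (x + y) = \<phi> x * \<phi> y"
    and c: "c \<in> A" "\<phi> c \<noteq> 1"
  shows "qsum A B \<phi> = 0"
proof -
  have "qsum A B \<phi> = qsum A B (\<lambda>x. \<phi> (x + c))"
    by (rule qsum_shift[OF fi per c(1), symmetric])
  also have "\<dots> = qsum A B (\<lambda>x. \<phi> x * \<phi> c)"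
    by (rule qsum_cong[OF fi]) (simp add: mult c)
  also have "\<dots> = qsum A B \<phi> * \<phi> c" by (rule qsum_mult_right)
  finally have "qsum A B \<phi> * (\<phi> c - 1) = 0" by (simp add: algebra_simps)
  then show ?thesis using c by simp
qed

section \<open>Valuations\<close>

lemma subfield_of_typeD:
  fixes K :: "'b :: field set"
  assumes "subfield K (ring_of_type_algebra :: 'b ring)"
  shows "0 \<in> K" "1 \<in> K" "x \<in> K \<Longrightarrow> - x \<in> K" "x \<in> K \<Longrightarrow> y \<in> K \<Longrightarrow> x + y \<in> K"
    "x \<in> K \<Longrightarrow> y \<in> K \<Longrightarrow> x - y \<in> K" "x \<in> K \<Longrightarrow> y \<in> K \<Longrightarrow> x * y \<in> K"
    "x \<in> K \<Longrightarrow> inverse x \<in> K" "x \<in> K \<Longrightarrow> y \<in> K \<Longrightarrow> x / y \<in> K" "x \<in> K \<Longrightarrow> x ^ n \<in> K"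
    "x \<in> K \<Longrightarrow> x powi k \<in> K" "of_nat n \<in> K" "of_int k \<in> K" "numeral w \<in> K"
proof -
  let ?R = "ring_of_type_algebra :: 'b ring"
  interpret R: ring ?R by (rule ring_from_type_algebra)
  have r: "subring K ?R" using subfieldE(1)[OF assms] .
  have s: "\<zero>\<^bsub>?R\<^esub> = 0" "\<one>\<^bsub>?R\<^esub> = 1" "\<And>x y. x \<otimes>\<^bsub>?R\<^esub> y = x * y" "\<And>x y. x \<oplus>\<^bsub>?R\<^esub> y = x + y"
    "carrier ?R = UNIV"
    by (simp_all add: ring_of_type_algebra_def)
  have m: "\<ominus>\<^bsub>?R\<^esub> x = - x" for x
    using R.r_neg[of x] by (simp add: s) (metis add_eq_0_iff)
  show 0: "0 \<in> K" and 1: "1 \<in> K"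
    using subringE(2,3)[OF r] by (simp_all add: s)
  show mi: "\<And>x. x \<in> K \<Longrightarrow> - x \<in> K" using subringE(5)[OF r] by (simp add: m)
  show ad: "\<And>x y. x \<in> K \<Longrightarrow> y \<in> K \<Longrightarrow> x + y \<in> K" using subringE(7)[OF r] by (simp add: s)
  show mu: "\<And>x y. x \<in> K \<Longrightarrow> y \<in> K \<Longrightarrow> x * y \<in> K" using subringE(6)[OF r] by (simp add: s)
  show "x \<in> K \<Longrightarrow> y \<in> K \<Longrightarrow> x - y \<in> K" using ad[of x "- y"] mi[of y] by simp
  show inv: "\<And>x. x \<in> K \<Longrightarrow> inverse x \<in> K"
  proof -
    fix x assume x: "x \<in> K"
    show "inverse x \<in> K"
    proof (cases "x = 0")
      case False
      then have "x \<in> K - {\<zero>\<^bsub>?R\<^esub>}" using x by (simp add: s)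
      from R.subfield_m_inv[OF assms this]
      have "inv\<^bsub>?R\<^esub> x \<in> K" "x * inv\<^bsub>?R\<^esub> x = 1" by (simp_all add: s)
      then show ?thesis by (metis inverse_unique)
    qed (simp add: 0)
  qed
  show "x \<in> K \<Longrightarrow> y \<in> K \<Longrightarrow> x / y \<in> K" using mu[of x "inverse y"] inv[of y] by (simp add: field_simps)
  show po: "\<And>x n. x \<in> K \<Longrightarrow> x ^ n \<in> K"
  proof -
    fix x n assume "x \<in> K" then show "x ^ n \<in> K" by (induction n) (auto simp: 1 mu)
  qed
  show "x \<in> K \<Longrightarrow> x powi k \<in> K" by (simp add: power_int_def po inv)
  show nat: "\<And>n. of_nat n \<in> K"
  proof -
    fix n show "of_nat n \<in> K" by (induction n) (auto simp: 0 1 ad)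
  qed
  show "of_int k \<in> K"
    using nat[of "nat k"] mi[OF nat[of "nat (- k)"]] by (cases "k \<ge> 0") auto
  show "numeral w \<in> K" using nat[of "numeral w"] by simp
qed

context ramified_quadratic_extension
begin

lemmas F0 = subfield_of_typeD[OF subfield_F0]
lemmas Qp = subfield_of_typeD[OF subfield_Qp]

lemma av_0 [simp]: "av 0 = 0"
  using av_eq_0 by simp

lemma av_1 [simp]: "av 1 = 1"
proof -
  have "av 1 * av 1 = av 1" using av_mult[of 1 1] by simp
  then show ?thesis using av_eq_0[of 1] by simp
qed

lemma av_pos: "x \<noteq> 0 \<Longrightarrow> av x > 0"
  using av_nonneg[of x] av_eq_0[of x] by simp

lemma av_minus [simp]: "av (- x) = av x"
proof -
  have "av (- 1) * av (- 1) = 1" using av_mult[of "- 1" "- 1"] by simp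
  then have "av (- 1) = 1" using av_nonneg[of "- 1"]
    by (metis abs_of_nonneg abs_square_eq_1 power2_eq_square)
  then show ?thesis using av_mult[of "- 1" x] by simp
qed

lemma av_diff: "av (x - y) \<le> max (av x) (av y)"
  using av_add[of x "- y"] by simp

lemma av_diff_commute: "av (x - y) = av (y - x)"
  by (metis av_minus minus_diff_eq)

lemma av_inverse: "av (inverse x) = inverse (av x)"
proof (cases "x = 0")
  case False
  then have "av (inverse x) * av x = 1" using av_mult[of "inverse x" x] by simp
  then show ?thesis by (metis inverse_unique mult.commute)
qed simp

lemma av_divide: "av (x / y) = av x / av y"
  by (simp add: divide_inverse av_mult av_inverse)

lemma av_power: "av (x ^ n) = av x ^ n"
  by (induction n) (simp_all add: av_mult)

lemma av_powi: "av (x powi k) = av x powi k"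
  by (simp add: power_int_def av_power av_inverse)

lemma av_add_eq: "av y < av x \<Longrightarrow> av (x + y) = av x"
  using av_add[of x y] av_diff[of "x + y" y] by simp

lemma pi_nonzero: "\<pi> \<noteq> 0" and av_pi_less_1: "av \<pi> < 1"
proof -
  have e: "max_ideal av UNIV = (\<lambda>y. \<pi> * y) ` int_ring av UNIV"
    using pi_uniformizer by (simp add: is_uniformizer_def)
  have p: "p > 1" using prime_p prime_gt_1_nat by blast
  have "multiplicity (int p) (int p) = 1"
    using p by (simp add: multiplicity_self)
  then have "av (of_int (int p)) = 1 / real p" using av_padic[of "int p"] p by simp
  then have "of_nat p \<in> max_ideal av UNIV" using p by (simp add: max_ideal_def)
  then obtain y where "of_nat p = \<pi> * y" using e by auto
  moreover have "(of_nat p :: 'a) \<noteq> 0" using p by simp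
  ultimately show "\<pi> \<noteq> 0" by auto
  have "\<pi> * 1 \<in> max_ideal av UNIV" unfolding e by (auto simp: int_ring_def)
  then show "av \<pi> < 1" by (simp add: max_ideal_def)
qed

lemma av_pi_pos: "av \<pi> > 0"
  using av_pos pi_nonzero by blast

lemma av_2 [simp]: "av 2 = 1"
proof -
  have "\<not> int p dvd 2"
  proof
    assume "int p dvd 2"
    then have "p dvd 2" using int_dvd_int_iff[of p 2] by simp
    then have "p \<le> 2" by (simp add: dvd_imp_le)
    then show False using odd_p prime_p prime_gt_1_nat[of p] by (cases "p = 2") auto
  qed
  then have "multiplicity (int p) 2 = 0" by (rule not_dvd_imp_multiplicity_0)
  then show ?thesis using av_padic[of 2] by simp
qed

definition P :: "int \<Rightarrow> 'a set" where
  "P k = {x. av x \<le> av \<pi> powi k}"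

definition P0 :: "int \<Rightarrow> 'a set" where
  "P0 k = F0 \<inter> P (2 * k)"

lemma powi_le_iff: "av \<pi> powi j \<le> av \<pi> powi k \<longleftrightarrow> k \<le> j"
proof (cases "k \<le> j")
  case True
  then show ?thesis using power_int_decreasing[of k j "av \<pi>"] av_pi_pos av_pi_less_1 by simp
next
  case False
  then show ?thesis using power_int_strict_decreasing[of j k "av \<pi>"] av_pi_pos av_pi_less_1 by simp
qed

lemma powi_less_iff: "av \<pi> powi j < av \<pi> powi k \<longleftrightarrow> k < j"
  using powi_le_iff[of k j] by linarith

lemma powi_eq_iff: "av \<pi> powi j = av \<pi> powi k \<longleftrightarrow> j = k"
  using powi_le_iff[of j k] powi_le_iff[of k j] by (metis order_antisym order_refl)

lemma powi_add: "av \<pi> powi (j + k) = av \<pi> powi j * av \<pi> powi k"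
  using av_pi_pos by (intro power_int_add) auto

lemma P_subgroup: "add_subgroup (P k)"
proof -
  have "av (x - y) \<le> av \<pi> powi k" if "av x \<le> av \<pi> powi k" "av y \<le> av \<pi> powi k" for x y
    using av_diff[of x y] that by simp
  then show ?thesis using av_pi_pos by (auto simp: add_subgroup_def P_def)
qed

lemma P0_subgroup: "add_subgroup (P0 k)"
  using P_subgroup[of "2 * k"] F0 by (auto simp: add_subgroup_def P0_def)

lemmas P_0 [simp] = add_subgroupD(1)[OF P_subgroup]
lemmas P_diff = add_subgroupD(2)[OF P_subgroup]
lemmas P_minus = add_subgroupD(3)[OF P_subgroup]
lemmas P_add = add_subgroupD(4)[OF P_subgroup]
lemmas P0_0 [simp] = add_subgroupD(1)[OF P0_subgroup]
lemmas P0_diff = add_subgroupD(2)[OF P0_subgroup]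
lemmas P0_minus = add_subgroupD(3)[OF P0_subgroup]
lemmas P0_add = add_subgroupD(4)[OF P0_subgroup]

lemma P_minus_iff [simp]: "- x \<in> P k \<longleftrightarrow> x \<in> P k"
  by (simp add: P_def)

lemma P0_F0: "x \<in> P0 k \<Longrightarrow> x \<in> F0" and P0_P: "x \<in> P0 k \<Longrightarrow> x \<in> P (2 * k)"
  by (auto simp: P0_def)

lemma P_mult: "x \<in> P j \<Longrightarrow> y \<in> P k \<Longrightarrow> x * y \<in> P (j + k)"
  using av_nonneg av_pi_pos by (auto simp: P_def av_mult powi_add intro!: mult_mono)

lemma P0_mult: "x \<in> P0 j \<Longrightarrow> y \<in> P0 k \<Longrightarrow> x * y \<in> P0 (j + k)"
  using P_mult[of x "2 * j" y "2 * k"] F0 by (auto simp: P0_def algebra_simps)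

lemma P_antimono: "j \<le> k \<Longrightarrow> P k \<subseteq> P j"
proof
  fix x assume "j \<le> k" "x \<in> P k"
  then have "av x \<le> av \<pi> powi k" "av \<pi> powi k \<le> av \<pi> powi j"
    using powi_le_iff by (auto simp: P_def)
  then show "x \<in> P j" by (simp add: P_def)
qed

lemma P0_antimono: "j \<le> k \<Longrightarrow> P0 k \<subseteq> P0 j"
  using P_antimono[of "2 * j" "2 * k"] by (auto simp: P0_def)

lemma P_mult_iff:
  assumes "av d = av \<pi> powi j"
  shows "d * x \<in> P k \<longleftrightarrow> x \<in> P (k - j)"
proof -
  have pos: "av \<pi> powi j > 0" using av_pi_pos by simp
  have "av \<pi> powi k = av \<pi> powi j * av \<pi> powi (k - j)" using powi_add[of j "k - j"] by simp
  then show ?thesis using pos by (simp add: P_def av_mult assms)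
qed

lemma F0_mult_iff: "d \<in> F0 \<Longrightarrow> d \<noteq> 0 \<Longrightarrow> d * x \<in> F0 \<longleftrightarrow> x \<in> F0"
  using F0(8)[of "d * x" d] F0(6)[of d x] by auto

lemma av_powi_nonzero: "av d = av \<pi> powi j \<Longrightarrow> d \<noteq> 0"
  using av_pi_pos zero_less_power_int[of "av \<pi>" j] by auto

lemma P0_mult_iff:
  assumes "d \<in> F0" "av d = av \<pi> powi (2 * j)"
  shows "d * x \<in> P0 k \<longleftrightarrow> x \<in> P0 (k - j)"
  using P_mult_iff[OF assms(2), of x "2 * k"] F0_mult_iff[OF assms(1) av_powi_nonzero[OF assms(2)], of x]
  by (simp add: P0_def right_diff_distrib)

lemma av_P: "av x = av \<pi> powi k \<Longrightarrow> x \<in> P k"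
  by (simp add: P_def)

lemma P_int_ring: "P 0 = int_ring av UNIV" and P0_int_ring: "P0 0 = int_ring av F0"
  by (auto simp: P0_def P_def int_ring_def)

text \<open>Every nonzero element is a unit times a power of \<open>\<pi>\<close>; the exponent of an element of \<open>F0\<close>
  is even because \<open>F/F0\<close> is ramified.\<close>

lemma value_group:
  assumes "x \<noteq> 0"
  obtains k :: int where "av x = av \<pi> powi k"
proof -
  have int: "\<exists>m :: nat. av y = av \<pi> ^ m" if "av \<pi> ^ n < av y" "av y \<le> 1" for y n
    using that
  proof (induction n arbitrary: y)
    case (Suc n)
    show ?case
    proof (cases "av y = 1")
      case True
      then show ?thesis by (intro exI[of _ 0]) simp
    next
      case False
      then have "y \<in> max_ideal av UNIV" using Suc.prems by (simp add: max_ideal_def)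
      then obtain z where z: "y = \<pi> * z" "av z \<le> 1"
        using pi_uniformizer by (auto simp: is_uniformizer_def int_ring_def)
      then have "av \<pi> ^ n < av z" using Suc.prems av_pi_pos by (simp add: av_mult)
      from Suc.IH[OF this z(2)] obtain m where "av z = av \<pi> ^ m" by blast
      then have "av y = av \<pi> ^ Suc m" by (simp add: z av_mult)
      then show ?thesis by blast
    qed
  qed simp
  have small: "\<exists>k :: int. av y = av \<pi> powi k" if y: "y \<noteq> 0" "av y \<le> 1" for y
  proof -
    obtain n where "av \<pi> ^ n < av y"
      using real_arch_pow_inv[OF av_pos[OF y(1)] av_pi_less_1] by blast
    from int[OF this y(2)] show ?thesis by (metis power_int_of_nat)
  qed
  show ?thesis
  proof (cases "av x \<le> 1")
    case True
    then show ?thesis using small[OF assms] that by blast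
  next
    case False
    then have "av (inverse x) \<le> 1" using av_inverse by (simp add: inverse_le_1_iff)
    moreover have "inverse x \<noteq> 0" using assms by simp
    ultimately obtain k where "av (inverse x) = av \<pi> powi k" using small by blast
    then have "av x = av \<pi> powi (- k)"
      by (simp add: av_inverse power_int_minus) (metis inverse_inverse_eq)
    then show ?thesis using that by blast
  qed
qed

lemma uniformizer_of_av:
  assumes x: "x \<in> E" "av x = av \<pi>" and E: "\<And>y z. y \<in> E \<Longrightarrow> z \<in> E \<Longrightarrow> y * z \<in> E \<and> y / z \<in> E"
  shows "is_uniformizer av E x"
proof -
  have x0: "x \<noteq> 0" using x av_pi_pos by auto
  have "y \<in> (\<lambda>y. x * y) ` int_ring av E" if y: "y \<in> max_ideal av E" for y
  proof -
    have yE: "y \<in> E" "av y < 1" using y by (auto simp: max_ideal_def)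
    then have "y \<in> max_ideal av UNIV" by (simp add: max_ideal_def)
    then obtain z where z: "y = \<pi> * z" "av z \<le> 1"
      using pi_uniformizer by (auto simp: is_uniformizer_def int_ring_def)
    have "av (y / x) \<le> 1" using z x av_pi_pos by (simp add: av_divide av_mult)
    then have "y / x \<in> int_ring av E" using E yE x by (simp add: int_ring_def)
    then show ?thesis using x0 by (intro image_eqI[of _ _ "y / x"]) auto
  qed
  moreover have "x * z \<in> max_ideal av E" if "z \<in> int_ring av E" for z
  proof -
    have z: "z \<in> E" "av z \<le> 1" using that by (auto simp: int_ring_def)
    have "av \<pi> * av z \<le> av \<pi>" using z av_pi_pos by (simp add: mult_left_le)
    then have "av \<pi> * av z < 1" using av_pi_less_1 by simp
    then show ?thesis using E z x by (simp add: max_ideal_def av_mult)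
  qed
  ultimately show ?thesis using x by (auto simp: is_uniformizer_def)
qed

lemma pi2_F0: "\<pi> ^ 2 \<in> F0"
  using pi_square by (simp add: int_ring_def)

lemma even_value_F0:
  assumes x: "x \<in> F0" "av x = av \<pi> powi k"
  shows "even k"
proof (rule ccontr)
  assume "odd k"
  then obtain m where m: "k = 2 * m + 1" by (elim oddE)
  define y where "y = x * (\<pi> ^ 2) powi (- m)"
  have yF: "y \<in> F0" using x pi2_F0 F0 by (simp add: y_def)
  have "av y = av \<pi> powi k * av \<pi> powi (2 * (- m))"
    by (simp add: y_def av_mult av_powi x av_power power_int_power)
  also have "\<dots> = av \<pi> powi (k + 2 * (- m))" by (rule powi_add[symmetric])
  finally have av: "av y = av \<pi>" by (simp add: m)
  have "is_uniformizer av F0 y" "is_uniformizer av UNIV y"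
    using uniformizer_of_av[OF yF av] uniformizer_of_av[OF UNIV_I av] F0(6,8) by auto
  then show False using ramified by blast
qed

lemma value_group_F0:
  assumes "x \<in> F0" "x \<noteq> 0"
  obtains k :: int where "av x = av \<pi> powi (2 * k)"
proof -
  obtain j where j: "av x = av \<pi> powi j" using value_group[OF assms(2)] .
  then have "even j" using even_value_F0[OF assms(1)] by blast
  then obtain k where "j = 2 * k" by (elim evenE)
  then show ?thesis using that j by blast
qed

text \<open>Elements of \<open>F0\<close> have even order, so a bound by an odd power of \<open>\<pi>\<close> improves by one.\<close>

lemma F0_P_odd: "x \<in> F0 \<Longrightarrow> x \<in> P (2 * k - 1) \<Longrightarrow> x \<in> P0 k"
proof (cases "x = 0")
  case False
  assume x: "x \<in> F0" "x \<in> P (2 * k - 1)"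
  obtain j where j: "av x = av \<pi> powi (2 * j)" using value_group_F0[OF x(1) False] .
  then have "2 * k - 1 \<le> 2 * j" using x powi_le_iff[of "2 * j" "2 * k - 1"] by (simp add: P_def)
  then have "2 * k \<le> 2 * j" by presburger
  then show ?thesis using x powi_le_iff[of "2 * j" "2 * k"] by (simp add: P0_def P_def j)
qed simp

lemma F0_P_iff: "x \<in> F0 \<Longrightarrow> x \<in> P k \<longleftrightarrow> x \<in> P0 ((k + 1) div 2)"
proof (cases "even k")
  case True
  assume "x \<in> F0"
  moreover have "2 * ((k + 1) div 2) = k" using True by presburger
  ultimately show ?thesis by (simp add: P0_def)
next
  case False
  assume x: "x \<in> F0"
  define m where "m = (k + 1) div 2"
  have k: "k = 2 * m - 1" using False unfolding m_def by presburger
  show ?thesis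
    using F0_P_odd[OF x, of m] P_antimono[of k "2 * m"] unfolding m_def[symmetric] k by (auto simp: P0_def)
qed

lemma shell_iff: "x \<in> P k \<and> x \<notin> P (k + 1) \<longleftrightarrow> av x = av \<pi> powi k"
proof
  assume a: "x \<in> P k \<and> x \<notin> P (k + 1)"
  then have "x \<noteq> 0" by auto
  then obtain j where j: "av x = av \<pi> powi j" using value_group by blast
  then have "k \<le> j" "\<not> k + 1 \<le> j" using a powi_le_iff by (auto simp: P_def)
  then have "j = k" by simp
  then show "av x = av \<pi> powi k" using j by simp
next
  assume "av x = av \<pi> powi k"
  then show "x \<in> P k \<and> x \<notin> P (k + 1)" using powi_le_iff[of k "k + 1"] by (simp add: P_def)
qed

lemma shell0_iff: "x \<in> P0 k \<and> x \<notin> P0 (k + 1) \<longleftrightarrow> x \<in> F0 \<and> av x = av \<pi> powi (2 * k)"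
proof -
  have "x \<in> P0 (k + 1) \<longleftrightarrow> x \<in> P (2 * k + 1)" if "x \<in> F0"
    using F0_P_iff[OF that, of "2 * k + 1"] by (simp add: add.commute)
  then show ?thesis using shell_iff[of x "2 * k"] by (auto simp: P0_def)
qed

text \<open>\<open>F = F0 + \<pi> F0\<close>, and the two summands never have the same absolute value.\<close>

lemma pi_notin_F0: "\<pi> \<notin> F0"
  using even_value_F0[of \<pi> 1] by auto

lemma F0_decomp:
  obtains \<alpha> \<beta> where "\<alpha> \<in> F0" "\<beta> \<in> F0" "x = \<alpha> + \<pi> * \<beta>"
proof -
  let ?R = "ring_of_type_algebra :: 'a ring"
  interpret R: ring ?R by (rule ring_from_type_algebra)
  have le: "R.line_extension K u E = {c * u + e | c e. c \<in> K \<and> e \<in> E}" for K u E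
    unfolding R.line_extension_def set_add_def' r_coset_def
    by (auto simp: ring_of_type_algebra_def)
  have "R.dimension 2 F0 UNIV" by (rule quadratic)
  then obtain v E where v: "UNIV = R.line_extension F0 v E" "R.dimension 1 F0 E"
    by (cases rule: R.dimension.cases) (simp_all add: numeral_2_eq_2)
  have "\<exists>w. E = R.line_extension F0 w {0}"
    using v(2)
  proof (cases rule: R.dimension.cases)
    case (Suc_dim w E' n)
    then have "R.dimension 0 F0 E'" by simp
    then have "E' = {0}" by (cases rule: R.dimension.cases) (auto simp: ring_of_type_algebra_def)
    then show ?thesis using Suc_dim by blast
  qed simp
  then obtain w where w: "E = R.line_extension F0 w {0}" by blast
  have span: "\<exists>\<alpha> \<beta>. \<alpha> \<in> F0 \<and> \<beta> \<in> F0 \<and> y = \<alpha> * v + \<beta> * w" for y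
  proof -
    have "y \<in> {c * v + e | c e. c \<in> F0 \<and> e \<in> E}" using v(1) le[of F0 v E] by (metis UNIV_I)
    then obtain c e where ce: "y = c * v + e" "c \<in> F0" "e \<in> E" by blast
    moreover obtain c' where "e = c' * w" "c' \<in> F0" using ce(3) w le[of F0 w "{0}"] by auto
    ultimately show ?thesis by blast
  qed
  have "\<exists>u. \<forall>y. \<exists>\<alpha> \<beta>. \<alpha> \<in> F0 \<and> \<beta> \<in> F0 \<and> y = \<alpha> + \<beta> * u"
  proof -
    obtain \<gamma> \<delta> where g: "\<gamma> \<in> F0" "\<delta> \<in> F0" "1 = \<gamma> * v + \<delta> * w" using span by blast
    show ?thesis
    proof (cases "\<gamma> = 0")
      case True
      then have "\<delta> * w = 1" using g by simp
      then have w: "w = 1 / \<delta>" by (metis mult_zero_left nonzero_mult_div_cancel_left zero_neq_one)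
      then have wF: "w \<in> F0" using g F0 by simp
      show ?thesis
      proof (rule exI[of _ v], rule allI)
        fix y obtain \<alpha> \<beta> where "\<alpha> \<in> F0" "\<beta> \<in> F0" "y = \<alpha> * v + \<beta> * w" using span by blast
        then have "\<beta> * w \<in> F0 \<and> \<alpha> \<in> F0 \<and> y = \<beta> * w + \<alpha> * v"
          using F0(6)[of \<beta> w] wF by simp
        then show "\<exists>\<alpha> \<beta>. \<alpha> \<in> F0 \<and> \<beta> \<in> F0 \<and> y = \<alpha> + \<beta> * v" by blast
      qed
    next
      case False
      then have v: "v = 1 / \<gamma> - \<delta> / \<gamma> * w" using g(3) by (simp add: field_simps)
      show ?thesis
      proof (rule exI[of _ w], rule allI)
        fix y obtain \<alpha> \<beta> where y: "\<alpha> \<in> F0" "\<beta> \<in> F0" "y = \<alpha> * v + \<beta> * w" using span by blast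
        have "y = \<alpha> / \<gamma> + (\<beta> - \<alpha> * \<delta> / \<gamma>) * w"
          unfolding y(3) v using False by (simp add: field_simps)
        moreover have "\<alpha> / \<gamma> \<in> F0" "\<beta> - \<alpha> * \<delta> / \<gamma> \<in> F0" using F0 g y by auto
        ultimately show "\<exists>\<alpha> \<beta>. \<alpha> \<in> F0 \<and> \<beta> \<in> F0 \<and> y = \<alpha> + \<beta> * w" by blast
      qed
    qed
  qed
  then obtain u where u: "\<And>y. \<exists>\<alpha> \<beta>. \<alpha> \<in> F0 \<and> \<beta> \<in> F0 \<and> y = \<alpha> + \<beta> * u" by blast
  obtain \<gamma> \<delta> where g: "\<gamma> \<in> F0" "\<delta> \<in> F0" "\<pi> = \<gamma> + \<delta> * u" using u by blast
  then have d: "\<delta> \<noteq> 0" using pi_notin_F0 by auto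
  then have u': "u = (\<pi> - \<gamma>) / \<delta>" using g by (simp add: field_simps)
  obtain \<alpha> \<beta> where y: "\<alpha> \<in> F0" "\<beta> \<in> F0" "x = \<alpha> + \<beta> * u" using u by blast
  have "x = (\<alpha> - \<beta> * \<gamma> / \<delta>) + \<pi> * (\<beta> / \<delta>)"
    unfolding y(3) u' using d by (simp add: field_simps)
  then show ?thesis using that[of "\<alpha> - \<beta> * \<gamma> / \<delta>" "\<beta> / \<delta>"] F0 g y by auto
qed

lemma av_F0_pi_ne:
  assumes "\<alpha> \<in> F0" "\<beta> \<in> F0" "\<alpha> \<noteq> 0 \<or> \<beta> \<noteq> 0"
  shows "av \<alpha> \<noteq> av (\<pi> * \<beta>)"
proof (cases "\<alpha> = 0 \<or> \<beta> = 0")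
  case True
  then show ?thesis using assms av_pos[of \<alpha>] av_pos[of "\<pi> * \<beta>"] pi_nonzero by auto
next
  case False
  obtain j where j: "av \<alpha> = av \<pi> powi (2 * j)" using value_group_F0[of \<alpha>] False assms by blast
  obtain k where k: "av \<beta> = av \<pi> powi (2 * k)" using value_group_F0[of \<beta>] False assms by blast
  have "av (\<pi> * \<beta>) = av \<pi> powi (1 + 2 * k)" unfolding powi_add by (simp add: av_mult k)
  moreover have "2 * j \<noteq> 1 + 2 * k" by presburger
  ultimately show ?thesis using j powi_eq_iff by simp
qed

lemma av_decomp:
  assumes "\<alpha> \<in> F0" "\<beta> \<in> F0"
  shows "av (\<alpha> + \<pi> * \<beta>) = max (av \<alpha>) (av (\<pi> * \<beta>))"
proof (cases "\<alpha> = 0 \<and> \<beta> = 0")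
  case False
  then have "av \<alpha> \<noteq> av (\<pi> * \<beta>)" using av_F0_pi_ne assms by blast
  then show ?thesis
    using av_add_eq[of "\<pi> * \<beta>" \<alpha>] av_add_eq[of \<alpha> "\<pi> * \<beta>"] by (auto simp: add.commute max_def)
qed simp

lemma P_pi_iff: "\<pi> * x \<in> P k \<longleftrightarrow> x \<in> P (k - 1)"
  using P_mult_iff[of \<pi> 1] by simp

lemma P_decomp_iff:
  assumes "\<alpha> \<in> F0" "\<beta> \<in> F0"
  shows "\<alpha> + \<pi> * \<beta> \<in> P k \<longleftrightarrow> \<alpha> \<in> P0 ((k + 1) div 2) \<and> \<beta> \<in> P0 (k div 2)"
proof -
  have "\<alpha> + \<pi> * \<beta> \<in> P k \<longleftrightarrow> \<alpha> \<in> P k \<and> \<pi> * \<beta> \<in> P k"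
    using av_decomp[OF assms] by (auto simp: P_def)
  then show ?thesis using F0_P_iff[of \<alpha> k] F0_P_iff[of \<beta> "k - 1"] assms P_pi_iff by simp
qed

lemma F0_decomp_unique:
  assumes "\<alpha> \<in> F0" "\<beta> \<in> F0" "\<alpha> + \<pi> * \<beta> = 0"
  shows "\<alpha> = 0 \<and> \<beta> = 0"
proof (rule ccontr)
  assume "\<not> ?thesis"
  then have "av \<alpha> \<noteq> av (\<pi> * \<beta>)" using av_F0_pi_ne assms by blast
  moreover have "\<alpha> = - (\<pi> * \<beta>)" using assms(3) by (simp add: eq_neg_iff_add_eq_0)
  ultimately show False by simp
qed

lemma bar_0 [simp]: "bar 0 = 0" and bar_1 [simp]: "bar 1 = 1"
  using bar_F0 F0 by auto

lemma bar_minus [simp]: "bar (- x) = - bar x"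
  using bar_add[of x "- x"] by (simp add: eq_neg_iff_add_eq_0 add.commute)

lemma bar_diff: "bar (x - y) = bar x - bar y"
  using bar_add[of x "- y"] by simp

text \<open>The conjugation fixes \<open>\<pi>\<^sup>2\<close>, so it sends \<open>\<pi>\<close> to \<open>\<pi>\<close> or \<open>- \<pi>\<close>; it cannot fix \<open>\<pi>\<close>, because
  \<open>F = F0 + \<pi> F0\<close> and it is not the identity.\<close>

lemma bar_pi [simp]: "bar \<pi> = - \<pi>"
proof -
  have "bar \<pi> * bar \<pi> = \<pi> * \<pi>"
    using bar_F0[OF pi2_F0] bar_mult[of \<pi> \<pi>] by (simp add: power2_eq_square)
  then have "bar \<pi> = \<pi> \<or> bar \<pi> = - \<pi>" by (simp add: square_eq_iff)
  moreover have "bar \<pi> \<noteq> \<pi>"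
  proof
    assume e: "bar \<pi> = \<pi>"
    have "bar x = x" for x
    proof -
      obtain \<alpha> \<beta> where "\<alpha> \<in> F0" "\<beta> \<in> F0" "x = \<alpha> + \<pi> * \<beta>" by (rule F0_decomp)
      then show ?thesis using e by (simp add: bar_add bar_mult bar_F0)
    qed
    then show False using bar_nontrivial by auto
  qed
  ultimately show ?thesis by blast
qed

lemma bar_decomp: "\<alpha> \<in> F0 \<Longrightarrow> \<beta> \<in> F0 \<Longrightarrow> bar (\<alpha> + \<pi> * \<beta>) = \<alpha> - \<pi> * \<beta>"
  by (simp add: bar_add bar_mult bar_F0)

lemma bar_bar [simp]: "bar (bar x) = x"
proof -
  obtain \<alpha> \<beta> where "\<alpha> \<in> F0" "\<beta> \<in> F0" "x = \<alpha> + \<pi> * \<beta>" by (rule F0_decomp)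
  then show ?thesis using bar_diff by (simp add: bar_decomp bar_mult bar_F0)
qed

lemma av_bar [simp]: "av (bar x) = av x"
proof -
  obtain \<alpha> \<beta> where d: "\<alpha> \<in> F0" "\<beta> \<in> F0" "x = \<alpha> + \<pi> * \<beta>" by (rule F0_decomp)
  then have "bar x = \<alpha> + \<pi> * (- \<beta>)" by (simp add: bar_decomp)
  then show ?thesis using av_decomp[of \<alpha> \<beta>] av_decomp[of \<alpha> "- \<beta>"] d F0 by (simp add: av_mult)
qed

lemma bar_P [simp]: "bar x \<in> P k \<longleftrightarrow> x \<in> P k"
  by (simp add: P_def)

lemma bar_fixed_iff: "bar x = x \<longleftrightarrow> x \<in> F0"
proof
  assume a: "bar x = x"
  obtain \<alpha> \<beta> where d: "\<alpha> \<in> F0" "\<beta> \<in> F0" "x = \<alpha> + \<pi> * \<beta>" by (rule F0_decomp)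
  then have "- (\<pi> * \<beta>) = \<pi> * \<beta>" using a by (simp add: bar_decomp)
  then have "\<pi> * \<beta> + \<pi> * \<beta> = 0" by (metis add.left_inverse)
  then have "2 * (\<pi> * \<beta>) = 0" by (simp only: mult_2)
  then show "x \<in> F0" using d pi_nonzero by simp
qed (rule bar_F0)

definition Tr :: "'a \<Rightarrow> 'a" where "Tr x = x + bar x"

definition Nm :: "'a \<Rightarrow> 'a" where "Nm x = x * bar x"

lemma Tr_F0: "Tr x \<in> F0" and Nm_F0: "Nm x \<in> F0"
  unfolding bar_fixed_iff[symmetric] Tr_def Nm_def by (simp_all add: bar_add bar_mult)

lemma Tr_add: "Tr (x + y) = Tr x + Tr y" and Tr_diff: "Tr (x - y) = Tr x - Tr y"
    and Tr_minus: "Tr (- x) = - Tr x" and Tr_bar: "Tr (bar x) = Tr x" and Tr_0 [simp]: "Tr 0 = 0"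
  by (simp_all add: Tr_def bar_add bar_diff)

lemma Tr_mult_F0: "c \<in> F0 \<Longrightarrow> Tr (c * x) = c * Tr x"
  by (simp add: Tr_def bar_mult bar_F0 algebra_simps)

lemma Nm_mult: "Nm (x * y) = Nm x * Nm y" and Nm_0 [simp]: "Nm 0 = 0" and Nm_1 [simp]: "Nm 1 = 1"
    and Nm_bar: "Nm (bar x) = Nm x" and Nm_minus: "Nm (- x) = Nm x"
  by (simp_all add: Nm_def bar_mult)

lemma Nm_of_F0: "c \<in> F0 \<Longrightarrow> Nm c = c ^ 2"
  by (simp add: Nm_def bar_F0 power2_eq_square)

lemma Nm_add: "Nm (x + y) = Nm x + Nm y + Tr (x * bar y)"
  by (simp add: Nm_def Tr_def bar_add bar_mult algebra_simps)

lemma Nm_pi: "Nm \<pi> = - (\<pi> ^ 2)"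
  by (simp add: Nm_def power2_eq_square)

lemma Nm_decomp: "\<alpha> \<in> F0 \<Longrightarrow> \<beta> \<in> F0 \<Longrightarrow> Nm (\<alpha> + \<pi> * \<beta>) = \<alpha> ^ 2 - \<pi> ^ 2 * \<beta> ^ 2"
proof -
  assume "\<alpha> \<in> F0" "\<beta> \<in> F0"
  then have "Nm (\<alpha> + \<pi> * \<beta>) = (\<alpha> + \<pi> * \<beta>) * (\<alpha> - \<pi> * \<beta>)"
    by (simp only: Nm_def bar_decomp)
  also have "\<dots> = \<alpha> ^ 2 - \<pi> ^ 2 * \<beta> ^ 2" by (simp add: algebra_simps power2_eq_square)
  finally show ?thesis .
qed

lemma av_Nm: "av (Nm x) = av x ^ 2"
  by (simp add: Nm_def av_mult power2_eq_square)

lemma Tr_P: "x \<in> P k \<Longrightarrow> Tr x \<in> P0 ((k + 1) div 2)"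
  using F0_P_iff[OF Tr_F0] P_add[of x k "bar x"] by (simp add: Tr_def)

lemma Nm_P: "x \<in> P k \<Longrightarrow> Nm x \<in> P0 k"
  using P_mult[of x k "bar x" k] Nm_F0[of x] by (simp add: Nm_def P0_def)

end

lemma finite_index_of_cover:
  assumes A: "add_subgroup A" and B: "add_subgroup B" "B \<subseteq> A"
    and T: "finite T" "T \<subseteq> A" "\<And>x. x \<in> A \<Longrightarrow> \<exists>t \<in> T. x - t \<in> B"
  shows "finite_index A B"
proof -
  define c where "c = (\<lambda>x. SOME t. t \<in> T \<and> x - t \<in> B)"
  have c: "c x \<in> T" "x - c x \<in> B" if "x \<in> A" for x
  proof -
    have "\<exists>t. t \<in> T \<and> x - t \<in> B" using T(3)[OF that] by blast
    then have "c x \<in> T \<and> x - c x \<in> B" unfolding c_def by (rule someI_ex)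
    then show "c x \<in> T" "x - c x \<in> B" by auto
  qed
  have cong: "c x = c y" if "x - y \<in> B" for x y
  proof -
    have "x - t \<in> B \<longleftrightarrow> y - t \<in> B" for t
      using that add_subgroup_trans[OF B(1), of x y t] add_subgroup_trans[OF B(1), of y x t]
        add_subgroup_diff_swap[OF B(1), of x y] by blast
    then show ?thesis unfolding c_def by simp
  qed
  have "transversal A B (c ` A)"
    unfolding transversal_def
  proof (intro conjI ballI)
    show "c ` A \<subseteq> A" using c T by auto
    fix x assume x: "x \<in> A"
    show "\<exists>!t. t \<in> c ` A \<and> x - t \<in> B"
    proof (rule ex1I[of _ "c x"])
      show "c x \<in> c ` A \<and> x - c x \<in> B" using c x by auto
      fix s assume "s \<in> c ` A \<and> x - s \<in> B"
      then obtain y where y: "y \<in> A" "s = c y" "x - c y \<in> B" by auto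
      have "x - y \<in> B"
        using y c(2)[OF y(1)] add_subgroup_trans[OF B(1), of x "c y" y]
          add_subgroup_diff_swap[OF B(1), of y "c y"] by blast
      then show "s = c x" using y cong by simp
    qed
  qed
  moreover have "finite (c ` A)" using c T by (meson finite_subset image_subsetI)
  ultimately show ?thesis using finite_indexI[OF A B] by blast
qed

lemma finite_index_refl: "add_subgroup A \<Longrightarrow> finite_index A A" and idx_refl: "add_subgroup A \<Longrightarrow> idx A A = 1"
proof -
  assume A: "add_subgroup A"
  have T: "transversal A A {0}" using add_subgroupD[OF A] by (auto simp: transversal_def)
  show fi: "finite_index A A" using finite_indexI[OF A A _ _ T] by simp
  show "idx A A = 1" using idx_eq_card[OF fi T] by simp
qed

lemma line_extension_of_type:
  fixes K :: "'b :: comm_ring_1 set"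
  shows "ring.line_extension (ring_of_type_algebra :: 'b ring) K u E = {c * u + e | c e. c \<in> K \<and> e \<in> E}"
proof -
  interpret R: ring "ring_of_type_algebra :: 'b ring" by (rule ring_from_type_algebra)
  show ?thesis unfolding R.line_extension_def set_add_def' r_coset_def
    by (auto simp: ring_of_type_algebra_def)
qed

section \<open>Completeness and finiteness\<close>

context ramified_quadratic_extension
begin

definition cauchy :: "(nat \<Rightarrow> 'a) \<Rightarrow> bool" where
  "cauchy s \<longleftrightarrow> (\<forall>e > 0. \<exists>N. \<forall>m \<ge> N. \<forall>n \<ge> N. av (s m - s n) < e)"

definition complete_set :: "'a set \<Rightarrow> bool" where
  "complete_set E \<longleftrightarrow>
     (\<forall>s. (\<forall>n. s n \<in> E) \<and> cauchy s \<longrightarrow> (\<exists>L \<in> E. (\<lambda>n. av (s n - L)) \<longlonglongrightarrow> 0))"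

definition bounded_sets_precompact :: "'a set \<Rightarrow> bool" where
  "bounded_sets_precompact E \<longleftrightarrow>
     (\<forall>R. \<forall>e > 0. \<exists>T. finite T \<and> T \<subseteq> E \<and> (\<forall>x \<in> E. av x \<le> R \<longrightarrow> (\<exists>y \<in> T. av (x - y) < e)))"

definition Qp_subspace :: "'a set \<Rightarrow> bool" where
  "Qp_subspace E \<longleftrightarrow> 0 \<in> E \<and> (\<forall>x \<in> E. \<forall>y \<in> E. x + y \<in> E) \<and> (\<forall>c \<in> Qp. \<forall>x \<in> E. c * x \<in> E)"

lemma bounded_sets_precompactE:
  assumes "bounded_sets_precompact E" "e > 0"
  obtains T where "finite T" "T \<subseteq> E" "\<And>x. x \<in> E \<Longrightarrow> av x \<le> R \<Longrightarrow> \<exists>y \<in> T. av (x - y) < e"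
  using assms unfolding bounded_sets_precompact_def by meson

lemma av_limit_0:
  assumes "(\<lambda>n. av (s n)) \<longlonglongrightarrow> 0" "e > 0"
  shows "\<exists>N. \<forall>n \<ge> N. av (s n) < e"
  using LIMSEQ_D[OF assms] av_nonneg by auto

lemma av_int_le:
  assumes "int p ^ n dvd z"
  shows "av (of_int z) \<le> (1 / real p) ^ n"
proof (cases "z = 0")
  case False
  have p: "p > 1" using prime_p prime_gt_1_nat by blast
  then have "n \<le> multiplicity (int p) z"
    using multiplicity_geI[of z "int p" n] False assms by simp
  then show ?thesis using av_padic[OF False] p by (simp add: power_decreasing)
qed simp

lemma av_int_unit: "\<not> int p dvd z \<Longrightarrow> av (of_int z) = 1"
  using av_padic[of z] by (cases "z = 0") (auto simp: not_dvd_imp_multiplicity_0)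

text \<open>Rational numbers are dense, and a rational number that is integral at \<open>p\<close> is close to a natural
  number below a power of \<open>p\<close>. So a ball is covered by balls around finitely many fractions with
  denominator \<open>p\<^sup>k\<close>.\<close>

lemma precompact_Qp: "bounded_sets_precompact Qp"
  unfolding bounded_sets_precompact_def
proof (intro allI impI)
  fix R e :: real assume e: "e > 0"
  have p: "p > 1" using prime_p prime_gt_1_nat by blast
  obtain k where k: "max R 1 < real p ^ k" using real_arch_pow[of "real p" "max R 1"] p by auto
  obtain m where m: "(1 / real p) ^ m < e" using real_arch_pow_inv[of e "1 / real p"] e p by auto
  define n where "n = k + m"
  define T :: "'a set" where "T = (\<lambda>i. of_nat i / of_nat p ^ k) ` {..< p ^ n}"
  have avp: "av (of_nat p) = 1 / real p"
  proof -
    have "multiplicity (int p) (int p) = 1" using p by (simp add: multiplicity_self)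
    then show ?thesis using av_padic[of "int p"] p by simp
  qed
  have "\<exists>y \<in> T. av (x - y) < e" if x: "x \<in> Qp" "av x \<le> R" for x
  proof -
    obtain r where r: "r \<in> \<rat>" "av (x - r) < min e 1" using rats_dense[OF x(1), of "min e 1"] e by auto
    have "r = x - (x - r)" by simp
    then have "av r \<le> max (av x) (av (x - r))" using av_diff[of x "x - r"] by simp
    then have avr: "av r < real p ^ k" using x(2) r(2) k by linarith
    define \<rho> where "\<rho> = r * of_nat p ^ k"
    have "\<rho> \<in> \<rat>" using r by (simp add: \<rho>_def)
    then obtain A B where AB: "B > 0" "coprime A B" "\<rho> = of_int A / of_int B" by (rule Rats_cases')
    have "av \<rho> = av r / real p ^ k" by (simp add: \<rho>_def av_mult av_power avp power_divide)
    then have avrho: "av \<rho> < 1" using avr p by (simp add: divide_less_eq)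
    have nB: "\<not> int p dvd B"
    proof
      assume B: "int p dvd B"
      have "\<not> int p dvd A"
      proof
        assume "int p dvd A"
        then have "is_unit (int p)" using coprime_common_divisor[OF AB(2)] B by blast
        then show False using p by simp
      qed
      then have "av (of_int A) = 1" by (rule av_int_unit)
      moreover have "av (of_int B) \<le> 1"
      proof -
        have "av (of_int B) \<le> (1 / real p) ^ 1" using av_int_le[of 1 B] B by simp
        also have "\<dots> \<le> 1" using p by simp
        finally show ?thesis .
      qed
      moreover have "av (of_int B) > 0" using AB(1) by (intro av_pos) simp
      ultimately have "1 \<le> av \<rho>" by (simp add: AB(3) av_divide)
      then show False using avrho by simp
    qed
    have "coprime B (int p ^ n)"
      using nB prime_p by (metis coprime_commute coprime_power_right_iff prime_imp_coprime prime_nat_int_transfer)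
    then obtain u v where "u * B + v * int p ^ n = 1" using bezout_int[of B "int p ^ n"] by auto
    then have "A * (u * B + v * int p ^ n) = A" by simp
    then have "A - B * (u * A) = A * v * int p ^ n" by (simp add: algebra_simps)
    then obtain j where j: "int p ^ n dvd A - B * j" by (metis dvd_triv_right)
    define i where "i = nat (j mod int p ^ n)"
    have i: "int i = j mod int p ^ n" using p by (simp add: i_def)
    have il: "i < p ^ n"
    proof -
      have "int i < int p ^ n" using i p by simp
      then show ?thesis by (metis of_nat_less_iff of_nat_power)
    qed
    have "int p ^ n dvd j - int i" unfolding i by (metis dvd_minus_mod)
    then have "int p ^ n dvd (A - B * j) + B * (j - int i)" using j by (intro dvd_add dvd_mult)
    then have "int p ^ n dvd A - B * int i" by (simp add: algebra_simps)
    then have le: "av (of_int (A - B * int i)) \<le> (1 / real p) ^ n" by (rule av_int_le)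
    have "\<rho> - of_nat i = of_int (A - B * int i) / of_int B"
      using AB by (simp add: field_simps)
    then have le2: "av (\<rho> - of_nat i) \<le> (1 / real p) ^ n" using le av_int_unit[OF nB] by (simp add: av_divide)
    have "r - of_nat i / of_nat p ^ k = (\<rho> - of_nat i) / of_nat p ^ k"
      using p by (simp add: \<rho>_def field_simps)
    then have "av (r - of_nat i / of_nat p ^ k) = av (\<rho> - of_nat i) * real p ^ k"
      by (simp add: av_divide av_power avp power_divide)
    also have "\<dots> \<le> (1 / real p) ^ n * real p ^ k" using le2 by (intro mult_right_mono) auto
    also have "\<dots> = (1 / real p) ^ m" using p by (simp add: n_def power_add power_divide)
    finally have ri: "av (r - of_nat i / of_nat p ^ k) < e" using m by simp
    have "x - of_nat i / of_nat p ^ k = (x - r) + (r - of_nat i / of_nat p ^ k)" by simp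
    then have "av (x - of_nat i / of_nat p ^ k) \<le> max (av (x - r)) (av (r - of_nat i / of_nat p ^ k))"
      by (metis av_add)
    then have "av (x - of_nat i / of_nat p ^ k) < e" using ri r(2) by linarith
    then show ?thesis using il by (auto simp: T_def)
  qed
  moreover have "finite T" "T \<subseteq> Qp" using Qp by (auto simp: T_def)
  ultimately show "\<exists>T. finite T \<and> T \<subseteq> Qp \<and> (\<forall>x \<in> Qp. av x \<le> R \<longrightarrow> (\<exists>y \<in> T. av (x - y) < e))" by blast
qed

lemma Qp_subspaceD:
  assumes "Qp_subspace E"
  shows "0 \<in> E" "x \<in> E \<Longrightarrow> y \<in> E \<Longrightarrow> x + y \<in> E" "c \<in> Qp \<Longrightarrow> x \<in> E \<Longrightarrow> c * x \<in> E"
    "x \<in> E \<Longrightarrow> - x \<in> E" "x \<in> E \<Longrightarrow> y \<in> E \<Longrightarrow> x - y \<in> E"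
proof -
  show a: "0 \<in> E" "\<And>x y. x \<in> E \<Longrightarrow> y \<in> E \<Longrightarrow> x + y \<in> E" and b: "\<And>c x. c \<in> Qp \<Longrightarrow> x \<in> E \<Longrightarrow> c * x \<in> E"
    using assms by (auto simp: Qp_subspace_def)
  show c: "x \<in> E \<Longrightarrow> - x \<in> E" for x using b[of "- 1" x] Qp by simp
  show "x \<in> E \<Longrightarrow> y \<in> E \<Longrightarrow> x - y \<in> E" using a(2)[of x "- y"] c[of y] by simp
qed

text \<open>A complete subspace has positive distance from every outside point.\<close>

lemma distance_complete:
  assumes E: "Qp_subspace E" "complete_set E" and v: "v \<notin> E"
  obtains \<delta> where "\<delta> > 0" "\<And>c w. c \<in> Qp \<Longrightarrow> w \<in> E \<Longrightarrow> \<delta> * av c \<le> av (c * v + w)"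
proof -
  have "\<exists>\<delta> > 0. \<forall>w \<in> E. \<delta> \<le> av (v - w)"
  proof (rule ccontr)
    assume "\<not> ?thesis"
    then have "\<forall>n :: nat. \<exists>w. w \<in> E \<and> av (v - w) < 1 / real (Suc n)"
      by (metis not_le zero_less_divide_1_iff of_nat_0_less_iff zero_less_Suc)
    then obtain w where w: "\<And>n. w n \<in> E" "\<And>n. av (v - w n) < 1 / real (Suc n)" by metis
    have small: "\<exists>N. \<forall>n \<ge> N. av (v - w n) < e" if e: "e > 0" for e
    proof -
      obtain N where N: "1 / real (Suc N) < e" using e by (metis nat_approx_posE)
      have "av (v - w n) < e" if "n \<ge> N" for n
      proof -
        have "1 / real (Suc n) \<le> 1 / real (Suc N)" using that by (simp add: field_simps)
        then show ?thesis using w(2)[of n] N by linarith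
      qed
      then show ?thesis by blast
    qed
    have "cauchy w"
      unfolding cauchy_def
    proof (intro allI impI)
      fix e :: real assume "e > 0"
      then obtain N where N: "\<And>n. n \<ge> N \<Longrightarrow> av (v - w n) < e" using small by blast
      have "av (w m - w n) < e" if "m \<ge> N" "n \<ge> N" for m n
      proof -
        have "w m - w n = (v - w n) - (v - w m)" by simp
        then have "av (w m - w n) \<le> max (av (v - w n)) (av (v - w m))" using av_diff by metis
        then show ?thesis using N that by (smt (verit))
      qed
      then show "\<exists>N. \<forall>m \<ge> N. \<forall>n \<ge> N. av (w m - w n) < e" by blast
    qed
    then obtain L where L: "L \<in> E" "(\<lambda>n. av (w n - L)) \<longlonglongrightarrow> 0"
      using E(2) w(1) unfolding complete_set_def by blast
    have "av (v - L) < e" if e: "e > 0" for e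
    proof -
      obtain N where N: "\<And>n. n \<ge> N \<Longrightarrow> av (v - w n) < e" using small[OF e] by blast
      obtain M where M: "\<And>n. n \<ge> M \<Longrightarrow> av (w n - L) < e" using av_limit_0[OF L(2) e] by blast
      define n where "n = max M N"
      have "v - L = (v - w n) + (w n - L)" by simp
      then have "av (v - L) \<le> max (av (v - w n)) (av (w n - L))" using av_add by metis
      then show ?thesis using N[of n] M[of n] by (simp add: n_def)
    qed
    then have "av (v - L) = 0" using av_nonneg[of "v - L"] by (metis less_irrefl order_less_le)
    then show False using L v av_eq_0[of "v - L"] by simp
  qed
  then obtain \<delta> where d: "\<delta> > 0" "\<And>w. w \<in> E \<Longrightarrow> \<delta> \<le> av (v - w)" by blast
  have "\<delta> * av c \<le> av (c * v + w)" if cw: "c \<in> Qp" "w \<in> E" for c w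
  proof (cases "c = 0")
    case True
    then show ?thesis using av_nonneg by simp
  next
    case False
    have "inverse (- c) * w \<in> E" using Qp cw Qp_subspaceD[OF E(1)] by simp
    then have "\<delta> \<le> av (v - inverse (- c) * w)" using d by blast
    moreover have "c * v + w = c * (v - inverse (- c) * w)" using False by (simp add: field_simps)
    ultimately show ?thesis using av_nonneg[of c] mult_left_mono[of \<delta> "av (v - inverse (- c) * w)" "av c"]
      by (simp only: av_mult mult.commute[of \<delta>])
  qed
  then show ?thesis using d that by blast
qed

lemma cauchy_diff:
  assumes "cauchy s" "cauchy u" shows "cauchy (\<lambda>n. s n - u n)"
  unfolding cauchy_def
proof (intro allI impI)
  fix e :: real assume e: "e > 0"
  obtain M where M: "\<And>m n. m \<ge> M \<Longrightarrow> n \<ge> M \<Longrightarrow> av (s m - s n) < e" using assms(1) e unfolding cauchy_def by blast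
  obtain N where N: "\<And>m n. m \<ge> N \<Longrightarrow> n \<ge> N \<Longrightarrow> av (u m - u n) < e" using assms(2) e unfolding cauchy_def by blast
  have "av ((s m - u m) - (s n - u n)) < e" if "m \<ge> max M N" "n \<ge> max M N" for m n
  proof -
    have "(s m - u m) - (s n - u n) = (s m - s n) - (u m - u n)" by simp
    then have "av ((s m - u m) - (s n - u n)) \<le> max (av (s m - s n)) (av (u m - u n))" using av_diff by metis
    then show ?thesis using M[of m n] N[of m n] that by simp
  qed
  then show "\<exists>N. \<forall>m \<ge> N. \<forall>n \<ge> N. av ((s m - u m) - (s n - u n)) < e" by blast
qed

lemma cauchy_mult:
  assumes "cauchy s" shows "cauchy (\<lambda>n. s n * v)"
proof (cases "v = 0")
  case False
  show ?thesis unfolding cauchy_def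
  proof (intro allI impI)
    fix e :: real assume e: "e > 0"
    have "e / av v > 0" using e av_pos[OF False] by simp
    then obtain M where M: "\<And>m n. m \<ge> M \<Longrightarrow> n \<ge> M \<Longrightarrow> av (s m - s n) < e / av v"
      using assms(1) unfolding cauchy_def by blast
    have "av (s m * v - s n * v) < e" if "m \<ge> M" "n \<ge> M" for m n
      using M[OF that] av_pos[OF False] by (simp add: pos_less_divide_eq av_mult flip: left_diff_distrib)
    then show "\<exists>N. \<forall>m \<ge> N. \<forall>n \<ge> N. av (s m * v - s n * v) < e" by blast
  qed
qed (simp add: cauchy_def)

text \<open>By the positive distance of \<open>v\<close> from \<open>E\<close>, the coordinates of a Cauchy sequence are Cauchy
  sequences, so they converge.\<close>

lemma line_extension_complete:
  assumes E: "Qp_subspace E" "complete_set E" and v: "v \<notin> E"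
  shows "complete_set {c * v + w | c w. c \<in> Qp \<and> w \<in> E}"
  unfolding complete_set_def
proof (intro allI impI, elim conjE)
  fix s assume s: "\<forall>n. s n \<in> {c * v + w | c w. c \<in> Qp \<and> w \<in> E}" "cauchy s"
  obtain \<delta> where d: "\<delta> > 0" "\<And>c w. c \<in> Qp \<Longrightarrow> w \<in> E \<Longrightarrow> \<delta> * av c \<le> av (c * v + w)"
    using distance_complete[OF assms] by blast
  have "\<forall>n. \<exists>c w. c \<in> Qp \<and> w \<in> E \<and> s n = c * v + w" using s(1) by blast
  then obtain c w where cw: "\<And>n. c n \<in> Qp" "\<And>n. w n \<in> E" "\<And>n. s n = c n * v + w n" by metis
  have cc: "cauchy c"
    unfolding cauchy_def
  proof (intro allI impI)
    fix e :: real assume e: "e > 0"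
    then have "\<delta> * e > 0" using d by simp
    then obtain M where M: "\<And>m n. m \<ge> M \<Longrightarrow> n \<ge> M \<Longrightarrow> av (s m - s n) < \<delta> * e"
      using s(2) unfolding cauchy_def by blast
    have "av (c m - c n) < e" if "m \<ge> M" "n \<ge> M" for m n
    proof -
      have "s m - s n = (c m - c n) * v + (w m - w n)" by (simp add: cw(3) algebra_simps)
      moreover have "\<delta> * av (c m - c n) \<le> av ((c m - c n) * v + (w m - w n))"
        using d(2)[of "c m - c n" "w m - w n"] cw(1,2) Qp(5) Qp_subspaceD(5)[OF E(1)] by blast
      ultimately have "\<delta> * av (c m - c n) \<le> av (s m - s n)" by (simp only:)
      then have "\<delta> * av (c m - c n) < \<delta> * e" using M[OF that] by simp
      then show ?thesis using d by simp
    qed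
    then show "\<exists>N. \<forall>m \<ge> N. \<forall>n \<ge> N. av (c m - c n) < e" by blast
  qed
  then obtain C where C: "C \<in> Qp" "(\<lambda>n. av (c n - C)) \<longlonglongrightarrow> 0"
    using complete_Qp[of c] cw(1) unfolding cauchy_def by blast
  have "cauchy (\<lambda>n. s n - c n * v)" using cauchy_diff[OF s(2) cauchy_mult[OF cc]] .
  moreover have "(\<lambda>n. s n - c n * v) = w" by (simp add: cw(3) fun_eq_iff)
  ultimately have "cauchy w" by simp
  then obtain W where W: "W \<in> E" "(\<lambda>n. av (w n - W)) \<longlonglongrightarrow> 0"
    using E(2) cw(2) unfolding complete_set_def by blast
  have "(\<lambda>n. av (s n - (C * v + W))) \<longlonglongrightarrow> 0"
  proof (rule tendsto_sandwich[of "\<lambda>_. 0" _ _ "\<lambda>n. av (c n - C) * av v + av (w n - W)"])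
    show "(\<lambda>n. av (c n - C) * av v + av (w n - W)) \<longlonglongrightarrow> 0"
      using tendsto_add[OF tendsto_mult[OF C(2) tendsto_const] W(2)] by simp
    have "av (s n - (C * v + W)) \<le> av (c n - C) * av v + av (w n - W)" for n
    proof -
      have "s n - (C * v + W) = (c n - C) * v + (w n - W)" by (simp add: cw(3) algebra_simps)
      then have "av (s n - (C * v + W)) \<le> max (av ((c n - C) * v)) (av (w n - W))" using av_add by metis
      also have "\<dots> \<le> av ((c n - C) * v) + av (w n - W)" using av_nonneg by (simp add: max_def)
      finally show ?thesis by (simp add: av_mult)
    qed
    then show "\<forall>\<^sub>F n in sequentially. av (s n - (C * v + W)) \<le> av (c n - C) * av v + av (w n - W)" by simp
  qed (use av_nonneg in auto)
  then show "\<exists>L \<in> {c * v + w | c w. c \<in> Qp \<and> w \<in> E}. (\<lambda>n. av (s n - L)) \<longlonglongrightarrow> 0"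
    using C(1) W(1) by blast
qed

text \<open>The positive distance of \<open>v\<close> from \<open>E\<close> bounds the coordinates of the elements of a ball.\<close>

lemma line_extension_precompact:
  assumes E: "Qp_subspace E" "complete_set E" "bounded_sets_precompact E" and v: "v \<notin> E"
  shows "bounded_sets_precompact {c * v + w | c w. c \<in> Qp \<and> w \<in> E}"
  unfolding bounded_sets_precompact_def
proof (intro allI impI)
  fix R e :: real assume e: "e > 0"
  obtain \<delta> where d: "\<delta> > 0" "\<And>c w. c \<in> Qp \<Longrightarrow> w \<in> E \<Longrightarrow> \<delta> * av c \<le> av (c * v + w)"
    using distance_complete[OF E(1,2) v] by blast
  have v0: "av v > 0" using v Qp_subspaceD(1)[OF E(1)] by (intro av_pos) auto
  then have "e / av v > 0" using e by simp
  then obtain T where T: "finite T" "T \<subseteq> Qp" "\<And>c. c \<in> Qp \<Longrightarrow> av c \<le> R / \<delta> \<Longrightarrow> \<exists>y \<in> T. av (c - y) < e / av v"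
    using bounded_sets_precompactE[OF precompact_Qp] by blast
  define R2 where "R2 = max R (R / \<delta> * av v)"
  obtain U where U: "finite U" "U \<subseteq> E" "\<And>w. w \<in> E \<Longrightarrow> av w \<le> R2 \<Longrightarrow> \<exists>y \<in> U. av (w - y) < e"
    using bounded_sets_precompactE[OF E(3) e] by blast
  define N where "N = {c * v + w | c w. c \<in> T \<and> w \<in> U}"
  have "\<exists>y \<in> N. av (x - y) < e" if x: "x \<in> {c * v + w | c w. c \<in> Qp \<and> w \<in> E}" "av x \<le> R" for x
  proof -
    obtain c w where cw: "c \<in> Qp" "w \<in> E" "x = c * v + w" using x by blast
    have "\<delta> * av c \<le> R" using d(2)[OF cw(1,2)] x cw by simp
    then have ac: "av c \<le> R / \<delta>" using d by (simp add: field_simps)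
    have "w = x - c * v" using cw by simp
    then have "av w \<le> max (av x) (av c * av v)" using av_diff[of x "c * v"] by (simp add: av_mult)
    then have "av w \<le> R2"
      using x(2) mult_right_mono[OF ac, of "av v"] v0 by (auto simp: R2_def max_def split: if_splits)
    then obtain w' where w': "w' \<in> U" "av (w - w') < e" using U(3) cw by blast
    obtain c' where c': "c' \<in> T" "av (c - c') < e / av v" using T(3) cw ac by blast
    have "x - (c' * v + w') = (c - c') * v + (w - w')" using cw by (simp add: algebra_simps)
    then have "av (x - (c' * v + w')) \<le> max (av (c - c') * av v) (av (w - w'))"
      using av_add[of "(c - c') * v" "w - w'"] by (simp only: av_mult)
    moreover have "av (c - c') * av v < e" using c' v0 by (simp add: field_simps)
    ultimately have "av (x - (c' * v + w')) < e" using w' by simp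
    then show ?thesis using c' w' by (auto simp: N_def)
  qed
  moreover have "finite N" "N \<subseteq> {c * v + w | c w. c \<in> Qp \<and> w \<in> E}"
    using T(1,2) U(1,2) unfolding N_def by (auto intro!: finite_image_set2)
  ultimately show "\<exists>N. finite N \<and> N \<subseteq> {c * v + w | c w. c \<in> Qp \<and> w \<in> E} \<and>
      (\<forall>x \<in> {c * v + w | c w. c \<in> Qp \<and> w \<in> E}. av x \<le> R \<longrightarrow> (\<exists>y \<in> N. av (x - y) < e))" by blast
qed

text \<open>Induction on the dimension, adding one line at a time.\<close>

lemma finite_dimensional_complete:
  assumes "ring.dimension (ring_of_type_algebra :: 'a ring) n Qp E"
  shows "Qp_subspace E \<and> complete_set E \<and> bounded_sets_precompact E"
proof -
  interpret R: ring "ring_of_type_algebra :: 'a ring" by (rule ring_from_type_algebra)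
  have "K = Qp \<Longrightarrow> Qp_subspace E \<and> complete_set E \<and> bounded_sets_precompact E" if "R.dimension n K E" for K
    using that
  proof (induction rule: R.dimension.induct)
    case (zero_dim K)
    have "s = (\<lambda>_. 0) \<Longrightarrow> (\<lambda>n. av (s n - 0)) \<longlonglongrightarrow> 0" for s by simp
    then have "complete_set {0}" by (auto simp: complete_set_def)
    moreover have "bounded_sets_precompact {0}"
      unfolding bounded_sets_precompact_def by (intro allI impI exI[of _ "{0}"]) auto
    ultimately show ?case by (simp add: Qp_subspace_def ring_of_type_algebra_def)
  next
    case (Suc_dim v E n K)
    then have E: "Qp_subspace E" "complete_set E" "bounded_sets_precompact E" by auto
    have le: "R.line_extension K v E = {c * v + w | c w. c \<in> Qp \<and> w \<in> E}"
      using Suc_dim line_extension_of_type[of Qp v E] by simp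
    have "Qp_subspace {c * v + w | c w. c \<in> Qp \<and> w \<in> E}"
      unfolding Qp_subspace_def
    proof (intro conjI ballI)
      show "0 \<in> {c * v + w | c w. c \<in> Qp \<and> w \<in> E}"
        using Qp(1) Qp_subspaceD(1)[OF E(1)] by (auto intro!: exI[of _ 0])
    next
      fix x y assume "x \<in> {c * v + w | c w. c \<in> Qp \<and> w \<in> E}" "y \<in> {c * v + w | c w. c \<in> Qp \<and> w \<in> E}"
      then obtain c w c' w' where *: "c \<in> Qp" "w \<in> E" "c' \<in> Qp" "w' \<in> E" "x = c * v + w" "y = c' * v + w'" by blast
      then have "x + y = (c + c') * v + (w + w')" by (simp add: algebra_simps)
      moreover have "c + c' \<in> Qp" "w + w' \<in> E" using * Qp Qp_subspaceD[OF E(1)] by auto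
      ultimately show "x + y \<in> {c * v + w | c w. c \<in> Qp \<and> w \<in> E}" by blast
    next
      fix k x assume k: "k \<in> Qp" and "x \<in> {c * v + w | c w. c \<in> Qp \<and> w \<in> E}"
      then obtain c w where *: "c \<in> Qp" "w \<in> E" "x = c * v + w" by blast
      then have "k * x = (k * c) * v + k * w" by (simp add: algebra_simps)
      moreover have "k * c \<in> Qp" "k * w \<in> E" using * k Qp Qp_subspaceD[OF E(1)] by auto
      ultimately show "k * x \<in> {c * v + w | c w. c \<in> Qp \<and> w \<in> E}" by blast
    qed
    then show ?case unfolding le
      using line_extension_complete[OF E(1,2) Suc_dim.hyps(2)]
        line_extension_precompact[OF E Suc_dim.hyps(2)] by simp
  qed
  then show ?thesis using assms by blast
qed

lemma F0_complete: "complete_set F0" and F0_precompact: "bounded_sets_precompact F0"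
proof -
  interpret R: ring "ring_of_type_algebra :: 'a ring" by (rule ring_from_type_algebra)
  obtain n where "R.dimension n Qp F0" using finite_F0 unfolding R.finite_dimension_def by blast
  then show "complete_set F0" "bounded_sets_precompact F0" using finite_dimensional_complete by blast+
qed

text \<open>The integers of \<open>F0\<close> are covered by finitely many balls of radius less than one, and each of them
  lies in one residue class.\<close>

lemma finite_residue_field: "finite_index (P0 0) (P0 1)"
proof -
  obtain T where T: "finite T" "T \<subseteq> F0" "\<And>x. x \<in> F0 \<Longrightarrow> av x \<le> 1 \<Longrightarrow> \<exists>y \<in> T. av (x - y) < 1"
    using bounded_sets_precompactE[OF F0_precompact, of 1 1] by auto
  show ?thesis
  proof (rule finite_index_of_cover[OF P0_subgroup P0_subgroup P0_antimono, of 0 1 "T \<inter> P0 0"])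
    fix x assume x: "x \<in> P0 0"
    then have xF: "x \<in> F0" "av x \<le> 1" by (auto simp: P0_def P_def)
    then obtain y where y: "y \<in> T" "av (x - y) < 1" using T by blast
    have d: "x - y \<in> F0" using xF y T F0 by auto
    have "x - y \<in> P0 1"
    proof (cases "x - y = 0")
      case False
      obtain k where k: "av (x - y) = av \<pi> powi (2 * k)" using value_group_F0[OF d False] .
      then have "0 < 2 * k" using y powi_less_iff[of "2 * k" 0] by simp
      then have "2 * 1 \<le> 2 * k" by simp
      then show ?thesis using d k powi_le_iff[of "2 * k" "2 * 1"] by (simp add: P0_def P_def)
    qed (metis P0_0)
    moreover from this have "y \<in> P0 0"
      using P0_diff[OF x, of "x - y"] P0_antimono[of 0 1] by auto
    ultimately show "\<exists>t \<in> T \<inter> P0 0. x - t \<in> P0 1" using y by blast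
  qed (use T in auto)
qed

abbreviation q :: nat where "q \<equiv> residue_card av F0"

lemma max_ideal_P0: "max_ideal av F0 = P0 1"
proof -
  have "x \<in> P0 1 \<longleftrightarrow> av x < 1" if xF: "x \<in> F0" for x
  proof (cases "x = 0")
    case False
    obtain k where k: "av x = av \<pi> powi (2 * k)" using value_group_F0[OF xF False] .
    have "x \<in> P0 1 \<longleftrightarrow> 2 \<le> 2 * k" using xF k powi_le_iff[of "2 * k" 2] by (simp add: P0_def P_def)
    also have "\<dots> \<longleftrightarrow> 0 < 2 * k" by auto
    finally show ?thesis using k powi_less_iff[of "2 * k" 0] by simp
  qed simp
  then show ?thesis using P0_F0 by (auto simp: max_ideal_def)
qed

lemma idx_residue: "idx (P0 0) (P0 1) = q"
proof -
  define T where "T = some_transversal (P0 0) (P0 1)"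
  note fi = finite_indexD[OF finite_residue_field, folded T_def]
  define C where "C = (\<lambda>x. (\<lambda>y. x + y) ` P0 1)"
  have C_eq: "C x = C y \<longleftrightarrow> x - y \<in> P0 1" for x y
  proof
    assume "C x = C y"
    moreover have "x \<in> C x" by (auto simp: C_def intro!: image_eqI[of _ _ 0])
    ultimately obtain z where "z \<in> P0 1" "x = y + z" by (auto simp: C_def)
    then show "x - y \<in> P0 1" by simp
  next
    assume a: "x - y \<in> P0 1"
    have sub: "C x \<subseteq> C y" if "x - y \<in> P0 1" for x y
    proof
      fix z assume "z \<in> C x"
      then obtain w where w: "w \<in> P0 1" "z = x + w" by (auto simp: C_def)
      then have "z = y + (x - y + w)" "x - y + w \<in> P0 1" using P0_add that by auto
      then show "z \<in> C y" unfolding C_def by blast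
    qed
    show "C x = C y" using sub[OF a] sub[of y x] add_subgroup_diff_swap[OF P0_subgroup] a by blast
  qed
  have "C ` P0 0 = C ` T"
  proof
    show "C ` T \<subseteq> C ` P0 0" using fi(6) by blast
    show "C ` P0 0 \<subseteq> C ` T"
    proof
      fix c assume "c \<in> C ` P0 0"
      then obtain x where x: "x \<in> P0 0" "c = C x" by blast
      obtain t where "t \<in> T" "x - t \<in> P0 1" using transversalE[OF fi(5) x(1)] by blast
      then show "c \<in> C ` T" using x C_eq by blast
    qed
  qed
  moreover have "inj_on C T"
  proof (rule inj_onI)
    fix x y assume xy: "x \<in> T" "y \<in> T" "C x = C y"
    then have "x - y \<in> P0 1" "x - x \<in> P0 1" "x \<in> P0 0" using C_eq fi(6) by auto
    then show "x = y" using transversal_unique[OF fi(5)] xy by blast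
  qed
  ultimately have "card (C ` P0 0) = card T" by (simp add: card_image)
  then show ?thesis
    by (simp add: residue_card_def max_ideal_P0 P0_int_ring[symmetric] C_def T_def idx_def)
qed

lemma pi2_powi: "av ((\<pi> ^ 2) powi k) = av \<pi> powi (2 * k)" "(\<pi> ^ 2) powi k \<in> F0"
  by (simp add: av_powi av_power power_int_power) (rule F0(10)[OF pi2_F0])

lemma P0_step: "finite_index (P0 k) (P0 (k + 1))" "idx (P0 k) (P0 (k + 1)) = q"
proof -
  define d where "d = (\<pi> ^ 2) powi k"
  have d: "d \<in> F0" "av d = av \<pi> powi (2 * k)" using pi2_powi by (simp_all add: d_def)
  note it = P0_mult_iff[OF d]
  have surj: "\<exists>x \<in> P0 0. y - d * x \<in> P0 (k + 1)" if "y \<in> P0 k" for y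
  proof -
    have e: "d * (y / d) = y" using av_powi_nonzero[OF d(2)] by simp
    then have "y / d \<in> P0 0" using it[of "y / d" k] that by simp
    then show ?thesis using e by (intro bexI[of _ "y / d"]) auto
  qed
  have *: "x \<in> P0 0 \<Longrightarrow> d * x \<in> P0 k" "d * x - d * y \<in> P0 (k + 1) \<longleftrightarrow> x - y \<in> P0 1" for x y
    using it[of x k] it[of "x - y" "k + 1"] by (simp_all add: right_diff_distrib)
  show "finite_index (P0 k) (P0 (k + 1))" "idx (P0 k) (P0 (k + 1)) = q"
    using qsum_bij(1,3)[OF finite_residue_field P0_subgroup P0_subgroup P0_antimono, of k "k + 1" "\<lambda>x. d * x"]
      * surj idx_residue by auto
qed

text \<open>By \<open>F = F0 + \<pi> F0\<close>, each step of the filtration of \<open>F\<close> is a step of the filtration of \<open>F0\<close> in one of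
  the two coordinates: \<open>F\<close> and \<open>F0\<close> have the same residue field.\<close>

lemma P_step: "finite_index (P k) (P (k + 1))" "idx (P k) (P (k + 1)) = q"
proof -
  define d where "d = \<pi> powi k"
  have d: "av d = av \<pi> powi k" by (simp add: d_def av_powi)
  note it = P_mult_iff[OF d]
  have surj: "\<exists>x \<in> P0 0. y - d * x \<in> P (k + 1)" if "y \<in> P k" for y
  proof -
    have e: "d * (y / d) = y" using av_powi_nonzero[OF d] by simp
    then have "y / d \<in> P 0" using it[of "y / d" k] that by simp
    moreover obtain \<alpha> \<beta> where "\<alpha> \<in> F0" "\<beta> \<in> F0" "y / d = \<alpha> + \<pi> * \<beta>" by (rule F0_decomp)
    ultimately have ab: "\<alpha> \<in> P0 0" "\<beta> \<in> P0 0" "y / d = \<alpha> + \<pi> * \<beta>"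
      using P_decomp_iff[of \<alpha> \<beta> 0] by simp_all
    then have "y - d * \<alpha> = d * (\<pi> * \<beta>)" using e by (simp add: algebra_simps)
    moreover have "\<pi> * \<beta> \<in> P 1" using ab P0_P[of \<beta> 0] P_pi_iff[of \<beta> 1] by simp
    ultimately have "y - d * \<alpha> \<in> P (k + 1)" using it[of "\<pi> * \<beta>" "k + 1"] by simp
    then show ?thesis using ab by blast
  qed
  have *: "d * x \<in> P k" "d * x - d * y \<in> P (k + 1) \<longleftrightarrow> x - y \<in> P0 1" if "x \<in> P0 0" "y \<in> P0 0" for x y
  proof -
    show "d * x \<in> P k" using it[of x k] P0_P[OF that(1)] by simp
    have "x - y \<in> F0" using that P0_F0 F0 by auto
    then show "d * x - d * y \<in> P (k + 1) \<longleftrightarrow> x - y \<in> P0 1"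
      using it[of "x - y" "k + 1"] F0_P_iff[of "x - y" 1] by (simp add: right_diff_distrib)
  qed
  show "finite_index (P k) (P (k + 1))" "idx (P k) (P (k + 1)) = q"
    using qsum_bij(1,3)[OF finite_residue_field P_subgroup P_subgroup P_antimono, of k "k + 1" "\<lambda>x. d * x"]
      * surj idx_residue by auto
qed

lemma
  assumes "j \<le> k"
  shows finite_index_P0: "finite_index (P0 j) (P0 k)" and idx_P0: "idx (P0 j) (P0 k) = q ^ nat (k - j)"
    and finite_index_P: "finite_index (P j) (P k)" and idx_P: "idx (P j) (P k) = q ^ nat (k - j)"
proof -
  have "(finite_index (P0 j) (P0 k) \<and> idx (P0 j) (P0 k) = q ^ nat (k - j)) \<and>
        (finite_index (P j) (P k) \<and> idx (P j) (P k) = q ^ nat (k - j))"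
    using assms
  proof (induction k rule: int_ge_induct)
    case base
    show ?case
      by (simp add: finite_index_refl[OF P0_subgroup] finite_index_refl[OF P_subgroup]
          idx_refl[OF P0_subgroup] idx_refl[OF P_subgroup])
  next
    case (step k)
    have e: "nat (k + 1 - j) = Suc (nat (k - j))" using step(1) by simp
    show ?case unfolding e
      using step(2) finite_index_trans[of "P0 j" "P0 k" "P0 (k + 1)"] idx_trans[of "P0 j" "P0 k" "P0 (k + 1)"]
        finite_index_trans[of "P j" "P k" "P (k + 1)"] idx_trans[of "P j" "P k" "P (k + 1)"] P0_step P_step
      by (simp add: mult.commute)
  qed
  then show "finite_index (P0 j) (P0 k)" "idx (P0 j) (P0 k) = q ^ nat (k - j)"
    "finite_index (P j) (P k)" "idx (P j) (P k) = q ^ nat (k - j)" by auto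
qed

lemma one_notin_P0: "1 \<notin> P0 1"
  using av_pi_pos av_pi_less_1 by (simp add: P0_def P_def power_less_one_iff abs_square_less_1 not_le)

lemma q_gt_1: "q > 1"
proof -
  have "q \<noteq> 0" using idx_pos[OF finite_residue_field] idx_residue by simp
  moreover have "q \<noteq> 1"
  proof
    assume "q = 1"
    then obtain t where t: "some_transversal (P0 0) (P0 1) = {t}"
      using idx_residue by (auto simp: idx_def card_1_singleton_iff)
    note tr = finite_indexD(5)[OF finite_residue_field]
    have "1 \<in> P0 0" using F0 by (simp add: P0_def P_def)
    then have "1 - t \<in> P0 1" "0 - t \<in> P0 1"
      using transversalE[OF tr, of 1] transversalE[OF tr, of 0] t by auto
    then have "(1 - t) - (0 - t) \<in> P0 1" by (rule P0_diff)
    then show False using one_notin_P0 by simp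
  qed
  ultimately show ?thesis by simp
qed

section \<open>Square roots and the quadratic character\<close>

text \<open>Newton iteration for the square root converges, because \<open>2\<close> is a unit and \<open>F0\<close> is complete.\<close>

lemma exact_sqrt:
  assumes c: "c \<in> F0" "av c = 1" and z: "z \<in> F0" "c - z ^ 2 \<in> P0 1"
  obtains y where "y \<in> F0" "y ^ 2 = c"
proof -
  define \<tau> where "\<tau> = av \<pi> ^ 2"
  have tau: "0 < \<tau>" "\<tau> < 1" using av_pi_pos av_pi_less_1 by (auto simp: \<tau>_def power_less_one_iff)
  \<comment> \<open>the Newton iteration for \<open>y\<^sup>2 = c\<close>, starting at \<open>z\<close>\<close>
  define s where "s = rec_nat z (\<lambda>_ x. (x + c / x) / 2)"
  have s0: "s 0 = z" and sS: "\<And>n. s (Suc n) = (s n + c / s n) / 2" by (simp_all add: s_def)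
  have "av (z ^ 2 - c) \<le> \<tau>" using z(2) av_diff_commute[of c "z ^ 2"] by (simp add: P0_def P_def \<tau>_def)
  then have "av (c + (z ^ 2 - c)) = 1" using c tau av_add_eq[of "z ^ 2 - c" c] by simp
  then have "av z ^ 2 = 1" by (simp add: av_power)
  then have avz: "av z = 1" using av_nonneg[of z] by (simp add: power2_eq_1_iff)
  have inv: "s n \<in> F0 \<and> av (s n) = 1 \<and> av (s n ^ 2 - c) \<le> \<tau> ^ Suc n" for n
  proof (induction n)
    case 0
    then show ?case using z avz \<open>av (z ^ 2 - c) \<le> \<tau>\<close> by (simp add: s0)
  next
    case (Suc n)
    then have n0: "s n \<noteq> 0" by auto
    have d: "s (Suc n) = s n + (c - s n ^ 2) / (2 * s n)"
      using n0 by (simp add: sS field_simps power2_eq_square)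
    have le: "av (s n ^ 2 - c) < 1"
      using Suc tau power_Suc_less_one[of \<tau> n] by simp
    have "av ((c - s n ^ 2) / (2 * s n)) < av (s n)"
      using Suc le av_diff_commute[of c] by (simp add: av_divide av_mult)
    then have 1: "av (s (Suc n)) = 1" using Suc d av_add_eq by simp
    have "s (Suc n) ^ 2 - c = ((s n ^ 2 - c) / (2 * s n)) ^ 2"
      using n0 by (simp add: sS field_simps power2_eq_square)
    then have "av (s (Suc n) ^ 2 - c) = av (s n ^ 2 - c) ^ 2"
      using Suc by (simp add: av_power av_divide av_mult)
    also have "\<dots> \<le> (\<tau> ^ Suc n) ^ 2" using Suc av_nonneg by (intro power_mono) auto
    also have "\<dots> \<le> \<tau> ^ Suc (Suc n)"
      unfolding power_mult[symmetric] using tau by (intro power_decreasing) auto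
    finally show ?case using 1 Suc c F0 by (simp add: sS)
  qed
  have diff: "av (s (Suc n) - s n) \<le> \<tau> ^ Suc n" for n
  proof -
    have n0: "s n \<noteq> 0" using inv[of n] by auto
    have "s (Suc n) - s n = (c - s n ^ 2) / (2 * s n)"
      using n0 by (simp add: sS field_simps power2_eq_square)
    then show ?thesis using inv[of n] av_diff_commute[of c] by (simp add: av_divide av_mult)
  qed
  have step: "av (s (n + k) - s n) \<le> \<tau> ^ Suc n" for n k
  proof (induction k)
    case (Suc k)
    have "s (n + Suc k) - s n = (s (Suc (n + k)) - s (n + k)) + (s (n + k) - s n)" by simp
    then have "av (s (n + Suc k) - s n) \<le> max (av (s (Suc (n + k)) - s (n + k))) (av (s (n + k) - s n))"
      using av_add by metis
    moreover have "\<tau> ^ Suc (n + k) \<le> \<tau> ^ Suc n" using tau by (intro power_decreasing) auto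
    ultimately show ?case using Suc diff[of "n + k"] by simp
  qed (use tau in simp)
  have "cauchy s"
    unfolding cauchy_def
  proof (intro allI impI)
    fix e :: real assume "e > 0"
    then obtain N where N: "\<tau> ^ N < e" using real_arch_pow_inv tau by blast
    have small: "av (s m - s N) < e" if "m \<ge> N" for m
    proof -
      have "\<tau> ^ Suc N \<le> \<tau> ^ N" using tau by (intro power_decreasing) auto
      then show ?thesis using step[of N "m - N"] that N by simp
    qed
    have "av (s m - s n) < e" if "m \<ge> N" "n \<ge> N" for m n
    proof -
      have "s m - s n = (s m - s N) - (s n - s N)" by simp
      then have "av (s m - s n) \<le> max (av (s m - s N)) (av (s n - s N))" using av_diff by metis
      then show ?thesis using small that by (smt (verit))
    qed
    then show "\<exists>N. \<forall>m \<ge> N. \<forall>n \<ge> N. av (s m - s n) < e" by blast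
  qed
  then obtain L where L: "L \<in> F0" "(\<lambda>n. av (s n - L)) \<longlonglongrightarrow> 0"
    using F0_complete inv unfolding complete_set_def by blast
  have "av (L ^ 2 - c) \<le> e" if e: "e > 0" for e
  proof -
    obtain N where N: "\<tau> ^ N < e" using real_arch_pow_inv[OF e tau(2)] by blast
    have "min e 1 > 0" using e by simp
    then obtain M where M: "\<And>n. n \<ge> M \<Longrightarrow> av (s n - L) < min e 1" using av_limit_0[OF L(2)] by blast
    define n where "n = max M N"
    have n: "av (s n - L) < min e 1" using M[of n] by (simp add: n_def)
    have "L ^ 2 - c = (s n ^ 2 - c) - (s n - L) * (2 * s n - (s n - L))" by (simp add: algebra_simps power2_eq_square)
    then have "av (L ^ 2 - c) \<le> max (av (s n ^ 2 - c)) (av (s n - L) * av (2 * s n - (s n - L)))"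
      using av_diff[of "s n ^ 2 - c" "(s n - L) * (2 * s n - (s n - L))"] by (simp only: av_mult)
    moreover have "av (2 * s n - (s n - L)) \<le> 1"
      using av_diff[of "2 * s n" "s n - L"] n inv[of n] by (simp add: av_mult)
    then have "av (s n - L) * av (2 * s n - (s n - L)) \<le> e"
      using n mult_left_le[of "av (2 * s n - (s n - L))" "av (s n - L)"] av_nonneg by (smt (verit))
    moreover have "\<tau> ^ Suc n \<le> \<tau> ^ N" using tau by (intro power_decreasing) (auto simp: n_def)
    ultimately show ?thesis using inv[of n] N by (smt (verit))
  qed
  then have "av (L ^ 2 - c) = 0" using av_nonneg[of "L ^ 2 - c"] by (metis dense_ge order_antisym)
  then have "L ^ 2 = c" using av_eq_0 by simp
  then show ?thesis using L that by blast
qed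

abbreviation chi :: "'a \<Rightarrow> int" where "chi \<equiv> quad_char bar"

lemma chi_cases: "chi c = 1 \<or> chi c = - 1"
  by (auto simp: quad_char_def)

lemma chi_eq_1_iff_square:
  assumes c: "c \<in> F0" "av c = 1"
  shows "chi c = 1 \<longleftrightarrow> (\<exists>y \<in> F0. y ^ 2 = c)"
proof
  assume "chi c = 1"
  then obtain x where x: "x \<noteq> 0" "c = Nm x" by (auto simp: quad_char_def Nm_def split: if_splits)
  obtain \<alpha> \<beta> where d: "\<alpha> \<in> F0" "\<beta> \<in> F0" "x = \<alpha> + \<pi> * \<beta>" by (rule F0_decomp)
  have "av x ^ 2 = 1" using c x av_Nm by simp
  then have "x \<in> P 0" using av_nonneg[of x] by (simp add: P_def power2_eq_1_iff)
  then have b: "\<beta> \<in> P0 0" using P_decomp_iff[OF d(1,2), of 0] d by simp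
  have "c - \<alpha> ^ 2 = - (\<pi> ^ 2 * \<beta> ^ 2)" using x d Nm_decomp by simp
  moreover have "\<pi> ^ 2 * (\<beta> * \<beta>) \<in> P0 1"
    using P0_mult[OF b b] P0_mult_iff[of "\<pi> ^ 2" 1] pi2_F0 by (simp add: av_power)
  ultimately have "c - \<alpha> ^ 2 \<in> P0 1" using P0_minus by (simp add: power2_eq_square)
  then show "\<exists>y \<in> F0. y ^ 2 = c" using exact_sqrt[OF c d(1)] by blast
next
  assume "\<exists>y \<in> F0. y ^ 2 = c"
  then obtain y where "y \<in> F0" "c = y * bar y" by (auto simp: bar_F0 power2_eq_square)
  moreover from this have "y \<noteq> 0" using c by auto
  ultimately show "chi c = 1" by (auto simp: quad_char_def)
qed

text \<open>On units the character \<open>\<chi>\<close> is the quadratic residue symbol: a norm of a unit \<open>\<alpha> + \<pi> \<beta>\<close> is congruent to the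
  square \<open>\<alpha>\<^sup>2\<close>, and unit squares modulo \<open>\<pi>\<^sub>0\<close> lift to squares.\<close>

lemma chi_eq_1_iff_residue:
  assumes c: "c \<in> F0" "av c = 1"
  shows "chi c = 1 \<longleftrightarrow> (\<exists>z \<in> F0. c - z ^ 2 \<in> P0 1)"
  using chi_eq_1_iff_square[OF c] exact_sqrt[OF c] by (metis P0_0 diff_self)

lemma chi_mult_square: 
  assumes "y \<in> F0" "y \<noteq> 0"
  shows "chi (y ^ 2 * c) = chi c"
proof -
  have "(\<exists>x. x \<noteq> 0 \<and> y ^ 2 * c = x * bar x) \<longleftrightarrow> (\<exists>x. x \<noteq> 0 \<and> c = x * bar x)"
  proof
    assume "\<exists>x. x \<noteq> 0 \<and> y ^ 2 * c = x * bar x"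
    then obtain x where x: "x \<noteq> 0" "y ^ 2 * c = x * bar x" by blast
    have "bar (x / y) * y = bar x" using bar_mult[of "x / y" y] bar_F0[OF assms(1)] assms by simp
    then have "bar (x / y) = bar x / y" using assms by (simp add: field_simps)
    moreover have "c = x * bar x / y ^ 2" using x assms by (simp add: field_simps)
    ultimately have "c = (x / y) * bar (x / y)" by (simp add: power2_eq_square)
    then show "\<exists>x. x \<noteq> 0 \<and> c = x * bar x" using x assms by (intro exI[of _ "x / y"]) auto
  next
    assume "\<exists>x. x \<noteq> 0 \<and> c = x * bar x"
    then obtain x where x: "x \<noteq> 0" "c = x * bar x" by blast
    then show "\<exists>x. x \<noteq> 0 \<and> y ^ 2 * c = x * bar x"
      using assms by (intro exI[of _ "y * x"]) (simp add: bar_mult bar_F0 power2_eq_square)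
  qed
  then show ?thesis by (simp add: quad_char_def)
qed

lemma qsum_point:
  assumes "finite_index A B" "y \<in> A"
  shows "qsum A B (\<lambda>x. of_bool (x - y \<in> B)) = 1"
proof -
  note f = finite_indexD[OF assms(1)]
  have "periodic A B (\<lambda>x. of_bool (x - y \<in> B) :: 'c :: {comm_monoid_add, zero_neq_one})"
    unfolding periodic_def
  proof (intro ballI impI)
    fix x z assume "x - z \<in> B"
    then have "x - y \<in> B \<longleftrightarrow> z - y \<in> B"
      using add_subgroup_trans[OF f(2)] add_subgroup_diff_swap[OF f(2)] by blast
    then show "of_bool (x - y \<in> B) = (of_bool (z - y \<in> B) :: 'c)" by simp
  qed
  then have "qsum A B (\<lambda>x. of_bool (x + y - y \<in> B)) = qsum A B (\<lambda>x. of_bool (x - y \<in> B) :: 'c)"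
    using qsum_shift[OF assms(1) _ assms(2)] by blast
  then show ?thesis using qsum_single[OF assms(1), of "1 :: 'c"] by (simp add: of_bool_def)
qed

text \<open>If \<open>y\<^sup>2 = c\<close>, then \<open>x\<^sup>2 - c = (x - y)(x + y)\<close>, and only one factor can be a non-unit, since \<open>2y\<close> is
  a unit. So \<open>y\<close> and \<open>- y\<close> are the only roots modulo any power.\<close>

lemma count_square_roots:
  assumes c: "c \<in> F0" "av c = 1" and j: "j \<ge> 1"
  shows "qsum (P0 0) (P0 j) (\<lambda>x. of_bool (x ^ 2 - c \<in> P0 j)) = (1 + of_int (chi c) :: complex)"
proof (cases "chi c = 1")
  case True
  then obtain y where y: "y \<in> F0" "y ^ 2 = c" using chi_eq_1_iff_square[OF c] by blast
  have avy: "av y = 1"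
  proof -
    have "av y ^ 2 = 1" using y c av_power[of y 2] by simp
    then show ?thesis using av_nonneg[of y] by (simp add: power2_eq_1_iff)
  qed
  then have yO: "y \<in> P0 0" using y by (simp add: P0_def P_def)
  have fi: "finite_index (P0 0) (P0 j)" using finite_index_P0 j by simp
  have sub: "P0 j \<subseteq> P0 1" using P0_antimono j by simp
  have "(of_bool (x ^ 2 - c \<in> P0 j) :: complex) = of_bool (x - y \<in> P0 j) + of_bool (x - (- y) \<in> P0 j)"
    if x: "x \<in> P0 0" for x
  proof -
    have f: "x ^ 2 - c = (x - y) * (x + y)" using y by (simp add: algebra_simps power2_eq_square)
    have F: "x - y \<in> F0" "x + y \<in> F0" using x y P0_F0 F0 by auto
    have O: "x - y \<in> P0 0" "x + y \<in> P0 0" using x yO P0_add P0_diff by auto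
    have unit: "av w = 1" if "w \<in> P0 0" "w \<notin> P0 1" for w
      using shell0_iff[of w 0] that by simp
    have ne: "\<not> (x - y \<in> P0 1 \<and> x + y \<in> P0 1)"
    proof
      assume "x - y \<in> P0 1 \<and> x + y \<in> P0 1"
      then have "(x + y) - (x - y) \<in> P0 1" using P0_diff by blast
      then have "2 * y \<in> P0 1" by simp
      moreover have "av (2 * y) = 1" using avy by (simp add: av_mult)
      ultimately show False using one_notin_P0 F0 by (simp add: P0_def P_def)
    qed
    have "(x - y) * (x + y) \<in> P0 j \<longleftrightarrow> x - y \<in> P0 j \<or> x + y \<in> P0 j"
    proof (cases "x - y \<in> P0 1")
      case True
      then have u: "av (x + y) = 1" using unit[OF O(2)] ne by blast
      have "x + y \<notin> P0 j" using ne True sub by blast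
      then show ?thesis using P0_mult_iff[OF F(2), of 0 "x - y" j] u by (simp add: mult.commute)
    next
      case False
      then have u: "av (x - y) = 1" using unit[OF O(1)] by blast
      have "x - y \<notin> P0 j" using False sub by blast
      then show ?thesis using P0_mult_iff[OF F(1), of 0 "x + y" j] u by simp
    qed
    then show ?thesis using ne sub by (auto simp: f of_bool_def)
  qed
  then have "qsum (P0 0) (P0 j) (\<lambda>x. of_bool (x ^ 2 - c \<in> P0 j))
      = qsum (P0 0) (P0 j) (\<lambda>x. of_bool (x - y \<in> P0 j) + of_bool (x - (- y) \<in> P0 j) :: complex)"
    by (rule qsum_cong[OF fi])
  also have "\<dots> = 1 + 1"
    unfolding qsum_add qsum_point[OF fi yO] qsum_point[OF fi P0_minus[OF yO]] ..
  finally show ?thesis using True by simp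
next
  case False
  have "x ^ 2 - c \<notin> P0 j" if "x \<in> P0 0" for x
  proof
    assume "x ^ 2 - c \<in> P0 j"
    then have "c - x ^ 2 \<in> P0 1"
      using P0_antimono[of 1 j] j add_subgroup_diff_swap[OF P0_subgroup, of "x ^ 2" c] by auto
    then show False using chi_eq_1_iff_residue[OF c] False P0_F0[OF that] by blast
  qed
  then have "qsum (P0 0) (P0 j) (\<lambda>x. of_bool (x ^ 2 - c \<in> P0 j)) = qsum (P0 0) (P0 j) (\<lambda>x. 0 :: complex)"
    using j by (intro qsum_cong finite_index_P0) auto
  then show ?thesis using False chi_cases[of c] by (simp add: qsum_const)
qed

end

section \<open>Integrals over the ring of integers as averages over quotients\<close>

context local_density_setting
begin

lemma psi_add: "x \<in> F0 \<Longrightarrow> y \<in> F0 \<Longrightarrow> \<psi> (x + y) = \<psi> x * \<psi> y"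
  using psi by (auto simp: unramified_additive_character_def)

lemma conductor: "{x \<in> F0. \<forall>y \<in> P0 0. \<psi> (x * y) = 1} = P0 0"
  using psi by (auto simp: unramified_additive_character_def P0_int_ring)

lemma one_P0 [simp]: "1 \<in> P0 0"
  using F0 by (simp add: P0_def P_def)

lemma psi_O: "x \<in> P0 0 \<Longrightarrow> \<psi> x = 1"
proof -
  assume "x \<in> P0 0"
  then have "\<forall>y \<in> P0 0. \<psi> (x * y) = 1" using conductor by blast
  then have "\<psi> (x * 1) = 1" using one_P0 by blast
  then show "\<psi> x = 1" by simp
qed

lemma psi_nontrivial:
  assumes "x \<in> F0" "x \<notin> P0 0"
  obtains y where "y \<in> P0 0" "\<psi> (x * y) \<noteq> 1"
  using conductor assms by blast

lemma psi_cong: "x \<in> F0 \<Longrightarrow> y \<in> F0 \<Longrightarrow> x - y \<in> P0 0 \<Longrightarrow> \<psi> x = \<psi> y"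
  using psi_add[of "x - y" y] psi_O[of "x - y"] F0 by simp

lemma psi_0 [simp]: "\<psi> 0 = 1"
  by (simp add: psi_O)

text \<open>The character \<open>x \<mapsto> \<psi>(dx)\<close> is trivial on \<open>\<pi>\<^sub>0\<^sup>i O\<close> exactly if \<open>\<pi>\<^sub>0\<^sup>i d\<close> is integral, as the conductor of \<open>\<psi>\<close> is
  the ring of integers.\<close>

lemma qsum_psi:
  assumes ij: "i \<le> j" and d: "d \<in> P0 (- j)"
  shows "qsum (P0 i) (P0 j) (\<lambda>x. \<psi> (d * x)) = of_nat q ^ nat (j - i) * of_bool (d \<in> P0 (- i))"
proof (cases "d \<in> P0 (- i)")
  case True
  have "qsum (P0 i) (P0 j) (\<lambda>x. \<psi> (d * x)) = qsum (P0 i) (P0 j) (\<lambda>x. 1)"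
    using P0_mult[OF True, of _ i] by (intro qsum_cong finite_index_P0 ij psi_O) simp
  then show ?thesis using True ij by (simp add: qsum_const idx_P0)
next
  case False
  have dF: "d \<in> F0" using d P0_F0 by blast
  let ?u = "(\<pi> ^ 2) powi i"
  have "?u * d \<notin> P0 0"
    using P0_mult_iff[OF pi2_powi(2,1), of i d 0] False by simp
  then obtain y where y: "y \<in> P0 0" "\<psi> (?u * d * y) \<noteq> 1"
    using psi_nontrivial[OF F0(6)[OF pi2_powi(2) dF]] by blast
  have c: "?u * y \<in> P0 i" using P0_mult_iff[OF pi2_powi(2,1), of i y i] y by simp
  have "qsum (P0 i) (P0 j) (\<lambda>x. \<psi> (d * x)) = 0"
  proof (rule qsum_character[OF finite_index_P0[OF ij] _ _ c])
    show "periodic (P0 i) (P0 j) (\<lambda>x. \<psi> (d * x))"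
      unfolding periodic_def
    proof (intro ballI impI psi_cong)
      fix x y assume xy: "x \<in> P0 i" "y \<in> P0 i" "x - y \<in> P0 j"
      show "d * x \<in> F0" "d * y \<in> F0" using P0_F0[OF xy(1)] P0_F0[OF xy(2)] dF F0(6) by blast+
      show "d * x - d * y \<in> P0 0"
        using P0_mult[OF d xy(3)] by (simp add: right_diff_distrib)
    qed
    show "\<psi> (d * (x + y)) = \<psi> (d * x) * \<psi> (d * y)" if "x \<in> P0 i" "y \<in> P0 i" for x y
      using that psi_add[of "d * x" "d * y"] dF P0_F0 F0 by (simp add: distrib_left)
    show "\<psi> (d * (?u * y)) \<noteq> 1" using y by (simp add: algebra_simps)
  qed
  then show ?thesis using False by simp
qed

text \<open>The shift by one reflects that the inverse different of \<open>F/F0\<close> is \<open>\<pi>\<^sup>-\<^sup>1 O\<^sub>F\<close>.\<close>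

lemma qsum_psi_Tr:
  assumes ij: "i \<le> j" and d: "d \<in> P (- j - 1)"
  shows "qsum (P i) (P j) (\<lambda>x. \<psi> (Tr (d * x))) = of_nat q ^ nat (j - i) * of_bool (d \<in> P (- i - 1))"
proof (cases "d \<in> P (- i - 1)")
  case True
  have "qsum (P i) (P j) (\<lambda>x. \<psi> (Tr (d * x))) = qsum (P i) (P j) (\<lambda>x. 1)"
    using P_mult[OF True, of _ i] Tr_P[of _ "- 1"] by (intro qsum_cong finite_index_P ij psi_O) fastforce
  then show ?thesis using True ij by (simp add: qsum_const idx_P)
next
  case False
  let ?u = "\<pi> powi i"
  have u: "av ?u = av \<pi> powi i" by (simp add: av_powi)
  have nt: "\<exists>y \<in> P 0. \<psi> (Tr (w * y)) \<noteq> 1" if w: "w \<notin> P (- 1)" for w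
  proof -
    obtain \<alpha> \<beta> where ab: "\<alpha> \<in> F0" "\<beta> \<in> F0" "w = \<alpha> + \<pi> * \<beta>" by (rule F0_decomp)
    have half: "y / 2 \<in> P0 0" if "y \<in> P0 0" for y
      using that F0 by (simp add: P0_def P_def av_divide)
    show ?thesis
    proof (cases "\<alpha> \<in> P0 0")
      case False
      then obtain y where y: "y \<in> P0 0" "\<psi> (\<alpha> * y) \<noteq> 1" using psi_nontrivial[OF ab(1)] by blast
      have "bar (y / 2) = y / 2" using P0_F0[OF half[OF y(1)]] by (rule bar_F0)
      then have "Tr (w * (y / 2)) = (\<alpha> + \<pi> * \<beta>) * (y / 2) + (\<alpha> - \<pi> * \<beta>) * (y / 2)"
        unfolding ab(3) by (simp only: Tr_def bar_mult bar_decomp[OF ab(1,2)])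
      also have "\<dots> = \<alpha> * y" by (simp add: field_simps)
      finally have "Tr (w * (y / 2)) = \<alpha> * y" .
      then show ?thesis using y half[OF y(1)] P0_P[of "y / 2" 0] by (intro bexI[of _ "y / 2"]) auto
    next
      case True
      then have b: "\<beta> \<notin> P0 (- 1)" using w P_decomp_iff[OF ab(1,2), of "- 1"] ab by simp
      have "\<pi> ^ 2 * \<beta> \<notin> P0 0"
        using P0_mult_iff[of "\<pi> ^ 2" 1 \<beta> 0] b pi2_F0 by (simp add: av_power)
      moreover have "\<pi> ^ 2 * \<beta> \<in> F0" using pi2_F0 ab F0 by simp
      ultimately obtain y where y: "y \<in> P0 0" "\<psi> (\<pi> ^ 2 * \<beta> * y) \<noteq> 1"
        using psi_nontrivial by blast
      have yF: "y \<in> F0" using y P0_F0 by blast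
      have "Tr (w * (\<pi> * (y / 2))) = \<pi> ^ 2 * \<beta> * y"
      proof -
        have "bar (y / 2) = y / 2" using yF F0 by (intro bar_F0) simp
        then have "Tr (w * (\<pi> * (y / 2))) = (\<alpha> + \<pi> * \<beta>) * (\<pi> * (y / 2)) + (\<alpha> - \<pi> * \<beta>) * (- \<pi> * (y / 2))"
          unfolding ab(3) by (simp only: Tr_def bar_mult bar_decomp[OF ab(1,2)] bar_pi)
        also have "\<dots> = \<pi> ^ 2 * \<beta> * y" by (simp add: field_simps power2_eq_square)
        finally show ?thesis .
      qed
      moreover have "\<pi> * (y / 2) \<in> P 0"
        using P_pi_iff[of "y / 2" 0] P0_P[OF half[OF y(1)]] P_antimono[of "- 1" 0] by auto
      ultimately show ?thesis using y by (intro bexI[of _ "\<pi> * (y / 2)"]) auto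
    qed
  qed
  have "?u * d \<notin> P (- 1)" using P_mult_iff[OF u, of d "- 1"] False by (metis diff_minus_eq_add minus_diff_commute diff_conv_add_uminus add.commute)
  then obtain y where y: "y \<in> P 0" "\<psi> (Tr (?u * d * y)) \<noteq> 1" using nt by blast
  have c: "?u * y \<in> P i" using P_mult_iff[OF u, of y i] y by simp
  have "qsum (P i) (P j) (\<lambda>x. \<psi> (Tr (d * x))) = 0"
  proof (rule qsum_character[OF finite_index_P[OF ij] _ _ c])
    show "periodic (P i) (P j) (\<lambda>x. \<psi> (Tr (d * x)))"
      unfolding periodic_def
    proof (intro ballI impI psi_cong Tr_F0)
      fix x y assume "x - y \<in> P j"
      then have "d * (x - y) \<in> P (- 1)" using P_mult[OF d, of "x - y" j] by simp
      then show "Tr (d * x) - Tr (d * y) \<in> P0 0"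
        using Tr_P[of "d * (x - y)" "- 1"] by (simp add: right_diff_distrib Tr_diff)
    qed
    show "\<psi> (Tr (d * (x + y))) = \<psi> (Tr (d * x)) * \<psi> (Tr (d * y))" for x y
      by (simp add: distrib_left Tr_add psi_add Tr_F0)
    show "\<psi> (Tr (d * (?u * y))) \<noteq> 1" using y by (simp add: algebra_simps)
  qed
  then show ?thesis using False by simp
qed

text \<open>\<open>mean N f\<close> is the integral over \<open>O\<^sub>F\<close> of a function that is periodic modulo \<open>\<pi>\<^sup>N\<close>,
  for the Haar measure of total mass one.\<close>

definition mean :: "nat \<Rightarrow> ('a \<Rightarrow> complex) \<Rightarrow> complex" where
  "mean N f = qsum (P 0) (P (int N)) f / of_nat q ^ N"

abbreviation periodic_O :: "nat \<Rightarrow> ('a \<Rightarrow> 'c) \<Rightarrow> bool" where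
  "periodic_O N f \<equiv> periodic (P 0) (P (int N)) f"

lemma q_nonzero [simp]: "q \<noteq> 0" "(of_nat q :: complex) \<noteq> 0"
  using q_gt_1 by auto

lemma fin_O: "finite_index (P 0) (P (int N))"
  by (rule finite_index_P) simp

lemma mean_cong: "(\<And>x. x \<in> P 0 \<Longrightarrow> f x = g x) \<Longrightarrow> mean N f = mean N g"
  unfolding mean_def using qsum_cong[OF fin_O] by metis

lemma mean_const [simp]: "mean N (\<lambda>_. c) = c"
  by (simp add: mean_def qsum_const idx_P)

lemma mean_mult_left: "mean N (\<lambda>x. c * f x) = c * mean N f"
  by (simp add: mean_def qsum_mult_left)

lemma mean_mult_right: "mean N (\<lambda>x. f x * c) = mean N f * c"
  by (simp add: mean_def qsum_mult_right)

lemma mean_product: "mean N f * mean N g = mean N (\<lambda>x. mean N (\<lambda>y. f x * g y))"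
  by (simp add: mean_mult_left mean_mult_right)

lemma mean_swap: "mean N (\<lambda>x. mean M (\<lambda>y. f x y)) = mean M (\<lambda>y. mean N (\<lambda>x. f x y))"
proof -
  have d: "qsum A B (\<lambda>x. g x / c) = qsum A B g / (c :: complex)" for A B :: "'a set" and g c
    by (simp add: qsum_def sum_divide_distrib)
  show ?thesis
    unfolding mean_def d by (subst qsum_swap) (simp add: mult.commute)
qed

lemma mean_shift: "periodic_O N f \<Longrightarrow> c \<in> P 0 \<Longrightarrow> mean N (\<lambda>x. f (x + c)) = mean N f"
  unfolding mean_def using qsum_shift[OF fin_O] by metis

lemma mean_unit:
  assumes f: "periodic_O N f" and u: "av u = 1"
  shows "mean N (\<lambda>x. f (u * x)) = mean N f"
proof -
  have u0: "u \<noteq> 0" using u by auto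
  have i: "u * x \<in> P k \<longleftrightarrow> x \<in> P k" for x k using P_mult_iff[of u 0 x k] u by simp
  have surj: "\<exists>x \<in> P 0. y - u * x \<in> P (int N)" if "y \<in> P 0" for y
    using that i[of "y / u" 0] u0 by (intro bexI[of _ "y / u"]) auto
  have "qsum (P 0) (P (int N)) f = qsum (P 0) (P (int N)) (\<lambda>x. f (u * x))"
    using qsum_bij(2)[OF fin_O[of N] P_subgroup P_subgroup P_antimono, of 0 "int N" "\<lambda>x. u * x" f]
      f i surj by (simp add: right_diff_distrib[symmetric])
  then show ?thesis by (simp add: mean_def)
qed

lemma mean_coarser:
  assumes "periodic_O M f" "M \<le> N"
  shows "mean N f = mean M f"
proof -
  have "qsum (P 0) (P (int N)) f = of_nat (idx (P (int M)) (P (int N))) * qsum (P 0) (P (int M)) f"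
    using assms by (intro qsum_coarser fin_O finite_index_P) auto
  also have "idx (P (int M)) (P (int N)) = q ^ (N - M)" using assms by (simp add: idx_P nat_diff_distrib)
  finally show ?thesis using assms(2) by (simp add: mean_def field_simps flip: power_add)
qed

text \<open>The substitution \<open>x = \<pi>\<^sup>k y\<close> on the ideal generated by \<open>\<pi>\<^sup>k\<close>, whose volume is \<open>q\<^sup>-\<^sup>k\<close>.\<close>

lemma mean_restrict:
  assumes f: "periodic_O N f" and k: "k \<le> N"
  shows "mean N (\<lambda>x. of_bool (x \<in> P (int k)) * f x) = mean N (\<lambda>x. f (\<pi> ^ k * x)) / of_nat q ^ k"
proof -
  have u: "av (\<pi> ^ k) = av \<pi> powi int k" by (simp add: av_power)
  note i = P_mult_iff[OF u]
  have fk: "periodic (P (int k)) (P (int N)) f" using periodic_mono[OF f P_antimono] by simp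
  have fiN: "finite_index (P (int k)) (P (int N))" using finite_index_P k by simp
  have surj: "\<exists>x \<in> P 0. y - \<pi> ^ k * x \<in> P (int N)" if "y \<in> P (int k)" for y
    using that i[of "y / \<pi> ^ k" "int k"] pi_nonzero by (intro bexI[of _ "y / \<pi> ^ k"]) auto
  have *: "\<pi> ^ k * x - \<pi> ^ k * y \<in> P (int N) \<longleftrightarrow> x - y \<in> P (int (N - k))" for x y
    using i[of "x - y" "int N"] k by (simp add: right_diff_distrib[symmetric] of_nat_diff)
  have "qsum (P 0) (P (int N)) (\<lambda>x. of_bool (x \<in> P (int k)) * f x)
      = qsum (P 0) (P (int N)) (\<lambda>x. if x \<in> P (int k) then f x else 0)"
    by (intro qsum_cong fin_O) simp
  also have "\<dots> = qsum (P (int k)) (P (int N)) f"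
    by (rule qsum_restrict[OF fin_O fiN fk])
  also have "\<dots> = qsum (P 0) (P (int (N - k))) (\<lambda>x. f (\<pi> ^ k * x))"
    using qsum_bij(2)[OF fin_O[of "N - k"] P_subgroup P_subgroup P_antimono, of "int k" "int N" "\<lambda>x. \<pi> ^ k * x" f]
      fk i surj * k by simp
  finally have "mean N (\<lambda>x. of_bool (x \<in> P (int k)) * f x) = mean (N - k) (\<lambda>x. f (\<pi> ^ k * x)) / of_nat q ^ k"
    using k by (simp add: mean_def field_simps flip: power_add)
  moreover have "periodic_O (N - k) (\<lambda>x. f (\<pi> ^ k * x))"
    unfolding periodic_def
  proof (intro ballI impI)
    fix x y assume xy: "x \<in> P 0" "y \<in> P 0" "x - y \<in> P (int (N - k))"
    show "f (\<pi> ^ k * x) = f (\<pi> ^ k * y)"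
    proof (rule fk[unfolded periodic_def, rule_format])
      show "\<pi> ^ k * x \<in> P (int k)" "\<pi> ^ k * y \<in> P (int k)" using xy i[of _ "int k"] by simp_all
      show "\<pi> ^ k * x - \<pi> ^ k * y \<in> P (int N)" using xy(3) * by blast
    qed
  qed
  ultimately show ?thesis using mean_coarser[of "N - k" "\<lambda>x. f (\<pi> ^ k * x)" N] by simp
qed

lemma mean_ball: "k \<le> N \<Longrightarrow> mean N (\<lambda>x. of_bool (x \<in> P (int k))) = 1 / of_nat q ^ k"
  using mean_restrict[of N "\<lambda>_. 1" k] by (simp add: periodic_def)

lemma mean_psi_Tr:
  assumes "d \<in> P (- int N - 1)"
  shows "mean N (\<lambda>x. \<psi> (Tr (d * x))) = of_bool (d \<in> P (- 1))"
  using qsum_psi_Tr[of 0 "int N" d] assms by (simp add: mean_def)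

text \<open>Expand \<open>N(x) - N(y)\<close> into the norm of \<open>x - y\<close> and a trace. The trace maps \<open>\<pi>\<^sup>m O\<^sub>F\<close> into an even power of \<open>\<pi>\<close>,
  which is where the rounding comes from.\<close>

lemma Nm_cong:
  assumes "x \<in> P 0" "y \<in> P 0" "x - y \<in> P m" "m \<ge> 1"
  shows "Nm x - Nm y \<in> P0 ((m + 1) div 2)"
proof -
  have "Nm x - Nm y = Nm (x - y) + Tr ((x - y) * bar y)"
    using Nm_add[of "x - y" y] by simp
  moreover have "Nm (x - y) \<in> P0 ((m + 1) div 2)"
  proof -
    have "(m + 1) div 2 \<le> m" using assms(4) by presburger
    then show ?thesis using Nm_P[OF assms(3)] P0_antimono by blast
  qed
  moreover have "Tr ((x - y) * bar y) \<in> P0 ((m + 1) div 2)"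
    using P_mult[OF assms(3), of "bar y" 0] assms(2) by (intro Tr_P) simp
  ultimately show ?thesis using P0_add by simp
qed

lemma periodic_psi_Nm:
  assumes d: "d \<in> P0 (- int s)" and N: "N \<ge> 1" "N + 1 \<ge> 2 * s"
  shows "periodic_O N (\<lambda>x. \<psi> (d * Nm x))"
  unfolding periodic_def
proof (intro ballI impI psi_cong)
  fix x y assume xy: "x \<in> P 0" "y \<in> P 0" "x - y \<in> P (int N)"
  then have "Nm x - Nm y \<in> P0 ((int N + 1) div 2)" using N by (intro Nm_cong) auto
  moreover have "int s \<le> (int N + 1) div 2" using N by linarith
  ultimately have "Nm x - Nm y \<in> P0 (int s)" using P0_antimono by blast
  then show "d * Nm x - d * Nm y \<in> P0 0"
    using P0_mult[OF d, of "Nm x - Nm y" "int s"] by (simp add: right_diff_distrib)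
qed (use d P0_F0 Nm_F0 F0 in auto)

section \<open>Gauss sums of the norm form\<close>

definition gauss :: "nat \<Rightarrow> 'a \<Rightarrow> complex" where
  "gauss N d = mean N (\<lambda>x. \<psi> (d * Nm x))"

lemma gauss_integral: "d \<in> P0 0 \<Longrightarrow> gauss N d = 1"
proof -
  assume d: "d \<in> P0 0"
  have "gauss N d = mean N (\<lambda>_. 1)"
    unfolding gauss_def
    using P0_mult[OF d] Nm_P[of _ 0] by (intro mean_cong psi_O) fastforce
  then show ?thesis by simp
qed

lemma shell_P0: "d \<in> F0 \<Longrightarrow> av d = av \<pi> powi (2 * k) \<Longrightarrow> d \<in> P0 k"
  using shell0_iff by blast

text \<open>The form \<open>d N(x) - d N(uy)\<close> is hyperbolic: in terms of \<open>x - uy\<close> and \<open>y\<close>, it is a norm of the first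
  variable plus a trace that is linear in \<open>y\<close>. Integrating over \<open>y\<close> restricts the first variable to the ideal
  generated by \<open>\<pi>\<^sup>2\<^sup>s\<^sup>-\<^sup>1\<close>, where the norm term is integral; the result is the volume of this ideal.\<close>

lemma gauss_hyperbolic:
  assumes d: "d \<in> F0" "av d = av \<pi> powi (- 2 * int s)" and s: "s \<ge> 1" and N: "N \<ge> 2 * s"
    and u: "av u = 1"
  shows "gauss N d * gauss N (- Nm u * d) = of_nat q / of_nat q ^ (2 * s)"
proof -
  have dP: "d \<in> P0 (- int s)" using shell_P0[of d "- int s"] d by simp
  have ndP: "- d \<in> P0 (- int s)" using P0_minus[OF dP] .
  have per: "periodic_O N (\<lambda>x. \<psi> (- d * Nm x))" "periodic_O N (\<lambda>x. \<psi> (d * Nm x))"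
    using periodic_psi_Nm[OF ndP] periodic_psi_Nm[OF dP] s N by auto
  have "gauss N (- Nm u * d) = mean N (\<lambda>x. \<psi> (- d * Nm (u * x)))"
    unfolding gauss_def by (intro mean_cong) (simp add: Nm_mult algebra_simps)
  also have "\<dots> = gauss N (- d)"
    unfolding gauss_def by (rule mean_unit[OF per(1) u])
  finally have "gauss N d * gauss N (- Nm u * d) = mean N (\<lambda>y. \<psi> (- d * Nm y) * mean N (\<lambda>x. \<psi> (d * Nm x)))"
    by (simp add: gauss_def mean_mult_right mult.commute)
  also have "\<dots> = mean N (\<lambda>y. mean N (\<lambda>x. \<psi> (d * Nm x) * \<psi> (Tr (d * bar x * y))))"
  proof (rule mean_cong)
    fix y assume y: "y \<in> P 0"
    have "\<psi> (- d * Nm y) * mean N (\<lambda>x. \<psi> (d * Nm x)) = \<psi> (- d * Nm y) * mean N (\<lambda>x. \<psi> (d * Nm (x + y)))"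
      using mean_shift[OF per(2) y] by simp
    also have "\<dots> = mean N (\<lambda>x. \<psi> (- d * Nm y) * \<psi> (d * Nm (x + y)))"
      by (rule mean_mult_left[symmetric])
    also have "\<dots> = mean N (\<lambda>x. \<psi> (d * Nm x) * \<psi> (Tr (d * bar x * y)))"
    proof (rule mean_cong)
      fix x
      have "Tr (d * bar x * y) = d * Tr (x * bar y)"
        using Tr_bar[of "bar x * y"] Tr_mult_F0[OF d(1), of "bar x * y"] by (simp add: bar_mult algebra_simps)
      then have "- d * Nm y + d * Nm (x + y) = d * Nm x + Tr (d * bar x * y)"
        by (simp add: Nm_add algebra_simps)
      then show "\<psi> (- d * Nm y) * \<psi> (d * Nm (x + y)) = \<psi> (d * Nm x) * \<psi> (Tr (d * bar x * y))"
        using psi_add[of "- d * Nm y" "d * Nm (x + y)"] psi_add[of "d * Nm x" "Tr (d * bar x * y)"] d Nm_F0 Tr_F0 F0 by simp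
    qed
    finally show "\<psi> (- d * Nm y) * mean N (\<lambda>x. \<psi> (d * Nm x)) = mean N (\<lambda>x. \<psi> (d * Nm x) * \<psi> (Tr (d * bar x * y)))" .
  qed
  also have "\<dots> = mean N (\<lambda>x. \<psi> (d * Nm x) * mean N (\<lambda>y. \<psi> (Tr (d * bar x * y))))"
    unfolding mean_swap[of N N "\<lambda>y x. \<psi> (d * Nm x) * \<psi> (Tr (d * bar x * y))"] by (simp add: mean_mult_left)
  also have "\<dots> = mean N (\<lambda>x. of_bool (x \<in> P (int (2 * s - 1))))"
  proof (rule mean_cong)
    fix x assume x: "x \<in> P 0"
    have "d * bar x \<in> P (- 2 * int s)" using P_mult[OF P0_P[OF dP], of "bar x" 0] x by simp
    then have "d * bar x \<in> P (- int N - 1)" using P_antimono[of "- int N - 1" "- 2 * int s"] N by auto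
    then have 1: "mean N (\<lambda>y. \<psi> (Tr (d * bar x * y))) = of_bool (d * bar x \<in> P (- 1))"
      by (rule mean_psi_Tr)
    have 2: "d * bar x \<in> P (- 1) \<longleftrightarrow> x \<in> P (int (2 * s - 1))"
      using P_mult_iff[OF d(2), of "bar x" "- 1"] s by (simp add: of_nat_diff)
    have 3: "\<psi> (d * Nm x) = 1" if "x \<in> P (int (2 * s - 1))"
    proof (rule psi_O)
      have "Nm x \<in> P0 (int s)" using Nm_P[OF that] P0_antimono[of "int s" "int (2 * s - 1)"] s by auto
      then show "d * Nm x \<in> P0 0" using P0_mult[OF dP, of "Nm x" "int s"] by simp
    qed
    show "\<psi> (d * Nm x) * mean N (\<lambda>y. \<psi> (Tr (d * bar x * y))) = of_bool (x \<in> P (int (2 * s - 1)))"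
      using 1 2 3 by simp
  qed
  also have "\<dots> = 1 / of_nat q ^ (2 * s - 1)" using N by (intro mean_ball) simp
  also have "\<dots> = of_nat q / of_nat q ^ (2 * s)" using s by (simp add: power_diff)
  finally show ?thesis .
qed

text \<open>The case of a residue field: the values of \<open>x\<^sup>2\<close> and of \<open>\<eta>x\<^sup>2\<close> together
  cover each residue class exactly twice when \<open>\<eta>\<close> is not a square.\<close>

lemma gauss_nonnorm_residue:
  assumes d: "d \<in> F0" "av d = av \<pi> powi (- 2)" and \<eta>: "\<eta> \<in> F0" "av \<eta> = 1" "chi \<eta> = - 1"
  shows "qsum (P0 0) (P0 1) (\<lambda>x. \<psi> (d * x ^ 2)) + qsum (P0 0) (P0 1) (\<lambda>x. \<psi> (d * \<eta> * x ^ 2)) = 0"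
proof -
  define T where "T = some_transversal (P0 0) (P0 1)"
  note fi = finite_residue_field
  note fiD = finite_indexD[OF fi, folded T_def]
  have TO: "x \<in> P0 0" if "x \<in> T" for x using that fiD(6) by blast
  have dP: "d \<in> P0 (- 1)" using shell_P0[of d "- 1"] d by simp
  have eO: "\<eta> \<in> P0 0" using \<eta> by (simp add: P0_def P_def)
  have sq: "x ^ 2 \<in> P0 0" if "x \<in> P0 0" for x using P0_mult[OF that that] by (simp add: power2_eq_square)
  have uniq: "c = c'" if "c \<in> T" "c' \<in> T" "c - c' \<in> P0 1" for c c'
    using transversal_unique[OF fiD(5), of c c c'] that TO by simp
  define n where "n = (\<lambda>\<xi> c. card {x \<in> T. \<xi> * x ^ 2 - c \<in> P0 1})"
  have fin: "finite {x \<in> T. \<xi> * x ^ 2 - c \<in> P0 1}" for \<xi> c using fiD(4) by simp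
  have count: "(\<Sum>x \<in> T. \<phi> (\<xi> * x ^ 2)) = (\<Sum>c \<in> T. of_nat (n \<xi> c) * \<phi> c)"
    if per: "periodic (P0 0) (P0 1) \<phi>" and xi: "\<xi> \<in> P0 0" for \<xi> and \<phi> :: "'a \<Rightarrow> complex"
  proof -
    have "\<phi> (\<xi> * x ^ 2) = (\<Sum>c \<in> T. of_bool (\<xi> * x ^ 2 - c \<in> P0 1) * \<phi> c)" if x: "x \<in> T" for x
    proof -
      have y: "\<xi> * x ^ 2 \<in> P0 0" using P0_mult[OF xi sq[OF TO[OF x]]] by simp
      obtain t where t: "t \<in> T" "\<xi> * x ^ 2 - t \<in> P0 1" using transversalE[OF fiD(5) y] by blast
      have "(\<Sum>c \<in> T. of_bool (\<xi> * x ^ 2 - c \<in> P0 1) * \<phi> c) = (\<Sum>c \<in> T. if c = t then \<phi> c else 0)"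
      proof (intro sum.cong refl)
        fix c assume c: "c \<in> T"
        have "\<xi> * x ^ 2 - c \<in> P0 1 \<longleftrightarrow> c = t" using t transversal_unique[OF fiD(5) y c t(1)] by blast
        then show "of_bool (\<xi> * x ^ 2 - c \<in> P0 1) * \<phi> c = (if c = t then \<phi> c else 0)" by simp
      qed
      also have "\<dots> = \<phi> t" using t fiD(4) by simp
      finally show ?thesis using per t y TO[OF t(1)] unfolding periodic_def by metis
    qed
    then have "(\<Sum>x \<in> T. \<phi> (\<xi> * x ^ 2)) = (\<Sum>x \<in> T. \<Sum>c \<in> T. of_bool (\<xi> * x ^ 2 - c \<in> P0 1) * \<phi> c)" by simp
    also have "\<dots> = (\<Sum>c \<in> T. (\<Sum>x \<in> T. of_bool (\<xi> * x ^ 2 - c \<in> P0 1)) * \<phi> c)"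
      by (subst sum.swap) (simp add: sum_distrib_right)
    also have "\<dots> = (\<Sum>c \<in> T. of_nat (n \<xi> c) * \<phi> c)"
      using fiD(4) by (simp add: n_def sum.If_cases of_bool_def Int_def)
    finally show ?thesis .
  qed
  have unit: "av c = 1" if "c \<in> P0 0" "c \<notin> P0 1" for c using shell0_iff[of c 0] that by simp
  have n2: "n \<xi> c \<le> (if c \<in> P0 1 then 1 else 2)" if xi: "\<xi> \<in> F0" "av \<xi> = 1" and c: "c \<in> T" for \<xi> c
  proof (cases "{x \<in> T. \<xi> * x ^ 2 - c \<in> P0 1} = {}")
    case False
    then obtain y where y: "y \<in> T" "\<xi> * y ^ 2 - c \<in> P0 1" by blast
    have mem: "x - y \<in> P0 1 \<or> x + y \<in> P0 1" if x: "x \<in> T" "\<xi> * x ^ 2 - c \<in> P0 1" for x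
    proof (rule ccontr)
      assume a: "\<not> ?thesis"
      have O: "x - y \<in> P0 0" "x + y \<in> P0 0" using TO[OF x(1)] TO[OF y(1)] P0_add P0_diff by auto
      have "(\<xi> * x ^ 2 - c) - (\<xi> * y ^ 2 - c) \<in> P0 1" using x y P0_diff by blast
      moreover have "(\<xi> * x ^ 2 - c) - (\<xi> * y ^ 2 - c) = \<xi> * ((x - y) * (x + y))" by (simp add: algebra_simps power2_eq_square)
      ultimately have "(x - y) * (x + y) \<in> P0 1" using P0_mult_iff[of \<xi> 0] xi by simp
      moreover have "av ((x - y) * (x + y)) = 1" using a unit[OF O(1)] unit[OF O(2)] by (simp add: av_mult)
      ultimately show False using one_notin_P0 F0 by (simp add: P0_def P_def)
    qed
    obtain y' where y': "y' \<in> T" "- y - y' \<in> P0 1" using transversalE[OF fiD(5) P0_minus[OF TO[OF y(1)]]] by blast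
    have sub: "{x \<in> T. \<xi> * x ^ 2 - c \<in> P0 1} \<subseteq> {y, y'}"
    proof
      fix x assume "x \<in> {x \<in> T. \<xi> * x ^ 2 - c \<in> P0 1}"
      then have x: "x \<in> T" "\<xi> * x ^ 2 - c \<in> P0 1" by auto
      from mem[OF this] show "x \<in> {y, y'}"
      proof
        assume "x + y \<in> P0 1"
        then have "(x + y) + (- y - y') \<in> P0 1" using y' P0_add by blast
        then show ?thesis using uniq[OF x(1) y'(1)] by simp
      qed (use uniq[OF x(1) y(1)] in simp)
    qed
    show ?thesis
    proof (cases "c \<in> P0 1")
      case True
      have "\<xi> * y ^ 2 \<in> P0 1" using P0_add[OF y(2) True] by simp
      then have "y ^ 2 \<in> P0 1" using P0_mult_iff[of \<xi> 0] xi by simp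
      have "y \<in> P0 1"
      proof (rule ccontr)
        assume "y \<notin> P0 1"
        then have "av (y ^ 2) = 1" using unit TO[OF y(1)] by (simp add: av_power)
        then show False using \<open>y ^ 2 \<in> P0 1\<close> one_notin_P0 F0 by (simp add: P0_def P_def)
      qed
      have "y' = y"
      proof (rule uniq[OF y'(1) y(1)])
        have "- (- y - y') - (y + y) \<in> P0 1" using \<open>y \<in> P0 1\<close> y'(2) P0_minus P0_add P0_diff by blast
        then show "y' - y \<in> P0 1" by simp
      qed
      then have "n \<xi> c \<le> card {y}" using sub unfolding n_def by (intro card_mono) auto
      then show ?thesis using True by simp
    next
      case False
      have "n \<xi> c \<le> card {y, y'}" using sub unfolding n_def by (intro card_mono) auto
      also have "\<dots> \<le> 2" by (cases "y = y'") auto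
      finally show ?thesis using False by simp
    qed
  next
    case True
    then show ?thesis unfolding n_def True by simp
  qed
  have le2: "n 1 c + n \<eta> c \<le> 2" if c: "c \<in> T" for c
  proof (cases "c \<in> P0 1")
    case True
    then show ?thesis using n2[of 1 c] n2[of \<eta> c] F0 \<eta> c by simp
  next
    case False
    have "n 1 c = 0 \<or> n \<eta> c = 0"
    proof (rule ccontr)
      assume "\<not> ?thesis"
      then have "{x \<in> T. 1 * x ^ 2 - c \<in> P0 1} \<noteq> {}" "{x \<in> T. \<eta> * x ^ 2 - c \<in> P0 1} \<noteq> {}"
        unfolding n_def by (metis card.empty)+
      then obtain x y where x: "x \<in> T" "x ^ 2 - c \<in> P0 1" and y: "y \<in> T" "\<eta> * y ^ 2 - c \<in> P0 1" by auto
      have yu: "y \<notin> P0 1"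
      proof
        assume "y \<in> P0 1"
        then have "\<eta> * (y * y) \<in> P0 (0 + (1 + 0))" using TO[OF y(1)] by (intro P0_mult eO)
        then have "\<eta> * y ^ 2 \<in> P0 1" by (simp add: power2_eq_square)
        from P0_diff[OF this y(2)] show False using False by simp
      qed
      have avy: "av y = 1" using unit[OF TO[OF y(1)] yu] .
      have yF: "y \<in> F0" "x \<in> F0" using TO x y P0_F0 by auto
      have y0: "y \<noteq> 0" using avy by auto
      have "(\<eta> * y ^ 2 - c) - (x ^ 2 - c) \<in> P0 1" using x y P0_diff by blast
      moreover have "(\<eta> * y ^ 2 - c) - (x ^ 2 - c) = y ^ 2 * (\<eta> - (x / y) ^ 2)"
        using y0 by (simp add: field_simps)
      ultimately have "\<eta> - (x / y) ^ 2 \<in> P0 1"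
        using P0_mult_iff[of "y ^ 2" 0] yF avy F0 by (simp add: av_power)
      then have "chi \<eta> = 1" using chi_eq_1_iff_residue[OF \<eta>(1,2)] F0(8)[OF yF(2,1)] by blast
      then show False using \<eta> by simp
    qed
    then show ?thesis using n2[of 1 c] n2[of \<eta> c] F0 \<eta> c False by auto
  qed
  have tot: "(\<Sum>c \<in> T. n \<xi> c) = card T" if "\<xi> \<in> P0 0" for \<xi>
  proof -
    have "(of_nat (\<Sum>c \<in> T. n \<xi> c) :: complex) = of_nat (card T)"
      using count[of "\<lambda>_. 1" \<xi>] that by (simp add: periodic_def)
    then show ?thesis by (simp only: of_nat_eq_iff)
  qed
  have eq2: "n 1 c + n \<eta> c = 2" if c: "c \<in> T" for c
  proof (rule ccontr)
    assume a: "n 1 c + n \<eta> c \<noteq> 2"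
    have "(\<Sum>c \<in> T. n 1 c + n \<eta> c) < (\<Sum>c \<in> T. 2)"
    proof (rule sum_strict_mono_ex1[OF fiD(4)])
      show "\<exists>c \<in> T. n 1 c + n \<eta> c < 2" using a c le2[OF c] by (intro bexI[of _ c]) linarith+
    qed (use le2 in blast)
    then show False using tot[of 1] tot[OF eO] by (simp add: sum.distrib)
  qed
  have per: "periodic (P0 0) (P0 1) (\<lambda>c. \<psi> (d * c))"
    unfolding periodic_def
  proof (intro ballI impI psi_cong)
    fix x y assume xy: "x \<in> P0 0" "y \<in> P0 0" "x - y \<in> P0 1"
    show "d * x \<in> F0" "d * y \<in> F0" using P0_F0[OF xy(1)] P0_F0[OF xy(2)] d(1) F0(6) by blast+
    show "d * x - d * y \<in> P0 0"
      using P0_mult[OF dP xy(3)] by (simp add: right_diff_distrib)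
  qed
  have "(\<Sum>x \<in> T. \<psi> (d * (1 * x ^ 2))) + (\<Sum>x \<in> T. \<psi> (d * (\<eta> * x ^ 2)))
      = (\<Sum>c \<in> T. of_nat (n 1 c + n \<eta> c) * \<psi> (d * c))"
    unfolding count[OF per one_P0] count[OF per eO] by (simp add: sum.distrib distrib_right)
  also have "\<dots> = 2 * qsum (P0 0) (P0 1) (\<lambda>c. \<psi> (d * c))"
    using eq2 by (simp add: qsum_def T_def sum_distrib_left)
  also have "d \<notin> P0 0" using shell0_iff[of d "- 1"] d by simp
  then have "qsum (P0 0) (P0 1) (\<lambda>c. \<psi> (d * c)) = 0" using qsum_psi[of 0 1 d] dP by simp
  finally show ?thesis by (simp add: qsum_def T_def mult.assoc)
qed

text \<open>Translating by \<open>\<pi>\<^sup>2\<^sup>s\<^sup>-\<^sup>2\<close> shows that only \<open>x \<in> \<pi>O\<^sub>F\<close> contributes, which lowers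
  the pole order of \<open>d\<close> by one.\<close>

lemma gauss_descent:
  assumes d: "d \<in> F0" "av d = av \<pi> powi (- 2 * int s)" and s: "s \<ge> 2" and N: "N \<ge> 2 * s"
  shows "gauss N d = gauss N (d * Nm \<pi>) / of_nat q"
proof -
  have dP: "d \<in> P0 (- int s)" using shell_P0[of d "- int s"] d by simp
  have per: "periodic_O N (\<lambda>x. \<psi> (d * Nm x))" using periodic_psi_Nm[OF dP] s N by auto
  define w where "w = \<pi> ^ (2 * s - 2)"
  have aw: "av w = av \<pi> powi (2 * int s - 2)"
  proof -
    have "int (2 * s - 2) = 2 * int s - 2" using s by (simp add: of_nat_diff)
    then show ?thesis unfolding w_def av_power by (metis power_int_of_nat)
  qed
  then have wP: "w \<in> P (2 * int s - 2)" by (rule av_P)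
  have "gauss N d = mean N (\<lambda>y. mean N (\<lambda>x. \<psi> (d * Nm (x + w * y))))"
  proof -
    have "mean N (\<lambda>x. \<psi> (d * Nm (x + w * y))) = gauss N d" if "y \<in> P 0" for y
    proof -
      have "w * y \<in> P 0" using P_mult[OF wP that] P_antimono[of 0 "2 * int s - 2"] s by auto
      then show ?thesis unfolding gauss_def by (rule mean_shift[OF per])
    qed
    then have "mean N (\<lambda>y. mean N (\<lambda>x. \<psi> (d * Nm (x + w * y)))) = mean N (\<lambda>y. gauss N d)"
      by (rule mean_cong)
    then show ?thesis by simp
  qed
  also have "\<dots> = mean N (\<lambda>x. mean N (\<lambda>y. \<psi> (d * Nm x) * \<psi> (Tr (d * bar x * w * y))))"
  proof (subst mean_swap, intro mean_cong)
    fix x y assume x: "x \<in> P 0" and y: "y \<in> P 0"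
    have t: "Tr (d * bar x * w * y) = d * Tr (x * bar (w * y))"
      using Tr_bar[of "bar x * (w * y)"] Tr_mult_F0[OF d(1), of "bar x * (w * y)"] by (simp add: bar_mult algebra_simps)
    have "d * Nm (w * y) \<in> P0 0"
    proof -
      have "Nm (w * y) \<in> P0 (2 * int s - 2)" using P_mult[OF wP y] Nm_P by simp
      then have "Nm (w * y) \<in> P0 (int s)" using P0_antimono[of "int s" "2 * int s - 2"] s by auto
      then show ?thesis using P0_mult[OF dP, of _ "int s"] by simp
    qed
    then have "\<psi> (d * Nm (x + w * y)) = \<psi> (d * Nm x + Tr (d * bar x * w * y))"
      unfolding t using d Nm_F0 Tr_F0 F0 by (intro psi_cong) (auto simp: Nm_add algebra_simps)
    then show "\<psi> (d * Nm (x + w * y)) = \<psi> (d * Nm x) * \<psi> (Tr (d * bar x * w * y))"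
      using psi_add[of "d * Nm x" "Tr (d * bar x * w * y)"] d Nm_F0 Tr_F0 F0 by simp
  qed
  also have "\<dots> = mean N (\<lambda>x. of_bool (x \<in> P (int 1)) * \<psi> (d * Nm x))"
  proof (rule mean_cong)
    fix x assume x: "x \<in> P 0"
    have adw: "av (d * w) = av \<pi> powi (- 2)"
      using powi_add[of "- 2 * int s" "2 * int s - 2"] d aw by (simp add: av_mult)
    then have e: "d * bar x * w \<in> P k \<longleftrightarrow> x \<in> P (k + 2)" for k
      using P_mult_iff[OF adw, of "bar x" k] by (simp add: mult.commute mult.left_commute)
    have "x \<in> P (- int N - 1 + 2)" using x P_antimono[of "- int N - 1 + 2" 0] N s by auto
    then have "d * bar x * w \<in> P (- int N - 1)" using e by blast
    then have "mean N (\<lambda>y. \<psi> (Tr (d * bar x * w * y))) = of_bool (d * bar x * w \<in> P (- 1))"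
      by (rule mean_psi_Tr)
    then show "mean N (\<lambda>y. \<psi> (d * Nm x) * \<psi> (Tr (d * bar x * w * y))) = of_bool (x \<in> P (int 1)) * \<psi> (d * Nm x)"
      using e[of "- 1"] by (simp add: mean_mult_left)
  qed
  also have "\<dots> = mean N (\<lambda>x. \<psi> (d * Nm (\<pi> ^ 1 * x))) / of_nat q ^ 1"
    using N s by (intro mean_restrict per) simp
  finally show ?thesis by (simp add: gauss_def Nm_mult mult.assoc)
qed

text \<open>Descend to a pole of order one, where the sum lives on the residue field.\<close>

lemma gauss_nonnorm:
  assumes d: "d \<in> F0" "av d = av \<pi> powi (- 2 * int s)" and s: "s \<ge> 1" and N: "N \<ge> 2 * s"
    and \<eta>: "\<eta> \<in> F0" "av \<eta> = 1" "chi \<eta> = - 1"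
  shows "gauss N (d * \<eta>) = - gauss N d"
  using s d N
proof (induction s arbitrary: d rule: dec_induct)
  case base
  have red: "gauss N c = qsum (P0 0) (P0 1) (\<lambda>x. \<psi> (c * x ^ 2)) / of_nat q" if c: "c \<in> P0 (- int 1)" for c
  proof -
    have per: "periodic_O 1 (\<lambda>x. \<psi> (c * Nm x))" using periodic_psi_Nm[OF c, of 1] by simp
    have "gauss N c = mean 1 (\<lambda>x. \<psi> (c * Nm x))"
      unfolding gauss_def using per base by (intro mean_coarser) auto
    moreover have "qsum (P 0) (P 1) (\<lambda>x. \<psi> (c * Nm x)) = qsum (P0 0) (P0 1) (\<lambda>x. \<psi> (c * Nm x))"
    proof (rule qsum_bij(2)[OF finite_residue_field P_subgroup P_subgroup P_antimono])
      fix y assume y: "y \<in> P 0"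
      obtain \<alpha> \<beta> where ab: "\<alpha> \<in> F0" "\<beta> \<in> F0" "y = \<alpha> + \<pi> * \<beta>" by (rule F0_decomp)
      then have O: "\<alpha> \<in> P0 0" "\<beta> \<in> P0 0" using y P_decomp_iff[OF ab(1,2), of 0] by auto
      have "\<pi> * \<beta> \<in> P 1" using P_pi_iff[of \<beta> 1] P0_P[OF O(2)] by simp
      then show "\<exists>x \<in> P0 0. y - x \<in> P 1" using O ab by (intro bexI[of _ \<alpha>]) auto
    next
      fix x y assume xy: "x \<in> P0 0" "y \<in> P0 0"
      then have "x - y \<in> F0" using P0_F0 F0 by auto
      then show "x - y \<in> P 1 \<longleftrightarrow> x - y \<in> P0 1" using F0_P_iff[of "x - y" 1] by simp
    qed (use P0_P[of _ 0] per in auto)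
    moreover have "qsum (P0 0) (P0 1) (\<lambda>x. \<psi> (c * Nm x)) = qsum (P0 0) (P0 1) (\<lambda>x. \<psi> (c * x ^ 2))"
      using P0_F0 Nm_of_F0 by (intro qsum_cong finite_residue_field) auto
    ultimately show ?thesis by (simp add: mean_def)
  qed
  have dP: "d \<in> P0 (- int 1)" using shell_P0[of d "- 1"] base by simp
  have "d * \<eta> \<in> P0 (- int 1 + 0)" using \<eta> by (intro P0_mult dP) (simp add: P0_def P_def)
  then have "gauss N d + gauss N (d * \<eta>) =
      (qsum (P0 0) (P0 1) (\<lambda>x. \<psi> (d * x ^ 2)) + qsum (P0 0) (P0 1) (\<lambda>x. \<psi> (d * \<eta> * x ^ 2))) / of_nat q"
    using red[OF dP] red[of "d * \<eta>"] by (simp add: add_divide_distrib)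
  also have "\<dots> = 0" using gauss_nonnorm_residue[OF _ _ \<eta>, of d] base by simp
  finally show ?case by (simp add: eq_neg_iff_add_eq_0 add.commute)
next
  case (step n)
  have d': "d * Nm \<pi> \<in> F0" "av (d * Nm \<pi>) = av \<pi> powi (- 2 * int n)"
  proof -
    show "d * Nm \<pi> \<in> F0" using step Nm_F0 F0 by simp
    have "av (d * Nm \<pi>) = av \<pi> powi (- 2 * int (Suc n)) * av \<pi> powi 2"
      using step by (simp add: av_mult av_Nm)
    also have "\<dots> = av \<pi> powi (- 2 * int (Suc n) + 2)" by (rule powi_add[symmetric])
    also have "- 2 * int (Suc n) + 2 = - 2 * int n" by simp
    finally show "av (d * Nm \<pi>) = av \<pi> powi (- 2 * int n)" .
  qed
  have a: "av (d * \<eta>) = av \<pi> powi (- 2 * int (Suc n))" "d * \<eta> \<in> F0"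
    using step \<eta> F0 by (simp_all add: av_mult)
  have "gauss N (d * \<eta>) = gauss N (d * Nm \<pi> * \<eta>) / of_nat q"
    using gauss_descent[OF a(2,1)] step by (simp add: ac_simps)
  also have "\<dots> = - gauss N (d * Nm \<pi>) / of_nat q"
    using step.IH[OF d'] step.prems by simp
  also have "\<dots> = - gauss N d"
    using gauss_descent[of d "Suc n" N] step by simp
  finally show ?case .
qed

text \<open>If \<open>- v\<close> is a norm, the form \<open>N(x) + v N(y)\<close> is hyperbolic. Otherwise, replacing \<open>v\<close> by \<open>- 1\<close> makes it
  hyperbolic at the cost of a sign.\<close>

lemma gauss_product:
  assumes d: "d \<in> F0" "av d = av \<pi> powi (- 2 * int s)" and s: "s \<ge> 1" and N: "N \<ge> 2 * s"
    and v: "v \<in> F0" "av v = 1"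
  shows "gauss N d * gauss N (v * d) = of_int (chi (- v)) * of_nat q / of_nat q ^ (2 * s)"
proof -
  have mv: "- v \<in> F0" "av (- v) = 1" using v F0 by auto
  show ?thesis
  proof (cases "chi (- v) = 1")
    case True
    then obtain y where y: "y \<in> F0" "y ^ 2 = - v" using chi_eq_1_iff_square[OF mv] by blast
    then have "v = - Nm y" by (simp add: Nm_of_F0)
    moreover have "av y = 1"
    proof -
      have "av y ^ 2 = 1" using y v av_power[of y 2] by simp
      then show ?thesis using av_nonneg[of y] by (simp add: power2_eq_1_iff)
    qed
    ultimately show ?thesis using gauss_hyperbolic[OF d s N, of y] True by simp
  next
    case False
    then have c: "chi (- v) = - 1" using chi_cases by blast
    have md: "- d \<in> F0" "av (- d) = av \<pi> powi (- 2 * int s)" using d F0 by auto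
    have "gauss N (v * d) = - gauss N (- Nm 1 * d)"
      using gauss_nonnorm[OF md s N mv c] by (simp add: mult.commute)
    then show ?thesis using gauss_hyperbolic[OF d s N, of 1] c by simp
  qed
qed

end

section \<open>Integrals attached to a binary hermitian form\<close>

context local_density_setting
begin

text \<open>The order of the pole in terms of \<open>\<pi>\<^sub>0\<close>, as it is applied to elements of \<open>F0\<close>.\<close>

definition pole :: "'a \<Rightarrow> nat" where
  "pole d = (LEAST s. d \<in> P0 (- int s))"

lemma pole_exists:
  assumes "d \<in> F0"
  shows "\<exists>s. d \<in> P0 (- int s)"
proof (cases "d = 0")
  case False
  obtain k where "av d = av \<pi> powi (2 * k)" using value_group_F0[OF assms False] .
  then have "d \<in> P0 k" using shell_P0 assms by blast
  moreover have "- int (nat (- k)) \<le> k" by simp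
  ultimately show ?thesis using P0_antimono by blast
qed auto

lemma pole_le_iff: "d \<in> F0 \<Longrightarrow> pole d \<le> s \<longleftrightarrow> d \<in> P0 (- int s)"
proof
  assume d: "d \<in> F0"
  have p: "d \<in> P0 (- int (pole d))" unfolding pole_def using pole_exists[OF d] by (rule LeastI_ex)
  show "d \<in> P0 (- int s)" if "pole d \<le> s" using p P0_antimono[of "- int s" "- int (pole d)"] that by auto
  show "pole d \<le> s" if "d \<in> P0 (- int s)" unfolding pole_def using that by (rule Least_le)
qed

lemma pole_eq_0_iff: "d \<in> F0 \<Longrightarrow> pole d = 0 \<longleftrightarrow> d \<in> P0 0"
  using pole_le_iff[of d 0] by simp

lemma pole_P0: "d \<in> F0 \<Longrightarrow> d \<in> P0 (- int (pole d))"
  using pole_le_iff by blast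

lemma pole_av:
  assumes "d \<in> F0" "pole d \<noteq> 0"
  shows "av d = av \<pi> powi (- 2 * int (pole d))"
proof -
  obtain k where k: "pole d = Suc k" using assms(2) by (cases "pole d") auto
  have "d \<in> P0 (- int (pole d))" "d \<notin> P0 (- int (pole d) + 1)"
    using pole_le_iff[OF assms(1), of "pole d"] pole_le_iff[OF assms(1), of k] k by simp_all
  then show ?thesis using shell0_iff[of d "- int (pole d)"] by simp
qed

lemma pole_unit_mult:
  assumes "v \<in> F0" "av v = 1" "d \<in> F0"
  shows "pole (v * d) = pole d"
proof -
  have "v * d \<in> P0 k \<longleftrightarrow> d \<in> P0 k" for k using P0_mult_iff[of v 0 d k] assms by simp
  then show ?thesis by (simp add: pole_def)
qed

text \<open>The hermitian form with Gram entries \<open>a, d\<close> on the diagonal and \<open>c\<close> off it.\<close>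

definition qform :: "'a \<Rightarrow> 'a \<Rightarrow> 'a \<Rightarrow> 'a \<Rightarrow> 'a \<Rightarrow> 'a" where
  "qform a d c x y = a * Nm x + d * Nm y + Tr (c * x * bar y)"

definition form_gauss :: "nat \<Rightarrow> 'a \<Rightarrow> 'a \<Rightarrow> 'a \<Rightarrow> complex" where
  "form_gauss N a d c = mean N (\<lambda>x. mean N (\<lambda>y. \<psi> (qform a d c x y)))"

text \<open>The volume of the pairs that the Gram matrix maps to integral vectors.\<close>

definition form_volume :: "nat \<Rightarrow> 'a \<Rightarrow> 'a \<Rightarrow> 'a \<Rightarrow> complex" where
  "form_volume N a d c =
     mean N (\<lambda>x. mean N (\<lambda>y. of_bool (a * x + bar c * y \<in> P 0) * of_bool (c * x + d * y \<in> P 0)))"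

lemma qform_F0: "a \<in> F0 \<Longrightarrow> d \<in> F0 \<Longrightarrow> qform a d c x y \<in> F0"
  using Nm_F0 Tr_F0 F0 by (simp add: qform_def)

lemma qform_swap: "qform a d c x y = qform d a (bar c) y x"
  using Tr_bar[of "c * x * bar y"] by (simp add: qform_def bar_mult algebra_simps)

lemma form_gauss_swap: "form_gauss N a d c = form_gauss N d a (bar c)"
  unfolding form_gauss_def by (subst mean_swap) (simp add: qform_swap[of a d c])

lemma form_volume_swap: "form_volume N a d c = form_volume N d a (bar c)"
  unfolding form_volume_def by (subst mean_swap) (simp add: add.commute mult.commute)

lemma qform_cong:
  assumes a: "a \<in> P0 (- int l)" "d \<in> P0 (- int l)" "c \<in> P (- int k)" and N: "N \<ge> 2 * l" "N \<ge> k" "N \<ge> 1"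
    and x: "x \<in> P 0" "x' \<in> P 0" "y \<in> P 0" "y' \<in> P 0" and d: "x - x' \<in> P (int N)" "y - y' \<in> P (int N)"
  shows "qform a d c x y - qform a d c x' y' \<in> P0 0"
proof -
  have nm: "e * (Nm w - Nm w') \<in> P0 0" if "e \<in> P0 (- int l)" "w \<in> P 0" "w' \<in> P 0" "w - w' \<in> P (int N)" for e w w'
  proof -
    have "Nm w - Nm w' \<in> P0 ((int N + 1) div 2)" using Nm_cong that N by simp
    moreover have "int l \<le> (int N + 1) div 2" using N by linarith
    ultimately have "Nm w - Nm w' \<in> P0 (int l)" using P0_antimono by blast
    then show ?thesis using P0_mult[OF that(1), of _ "int l"] by simp
  qed
  have cO: "c * u \<in> P 0" if "u \<in> P (int N)" for u
    using P_mult[OF a(3) that] P_antimono[of 0 "- int k + int N"] N by auto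
  have "(x - x') * bar y + x' * bar (y - y') \<in> P (int N)"
    using P_mult[OF d(1), of "bar y" 0] P_mult[OF x(2), of "bar (y - y')" "int N"] x d by (intro P_add) auto
  then have "Tr (c * ((x - x') * bar y + x' * bar (y - y'))) \<in> P0 0"
    using Tr_P[OF cO] by simp
  moreover have "qform a d c x y - qform a d c x' y'
      = a * (Nm x - Nm x') + d * (Nm y - Nm y') + Tr (c * ((x - x') * bar y + x' * bar (y - y')))"
    unfolding qform_def by (simp add: bar_diff algebra_simps Tr_add Tr_diff)
  ultimately show ?thesis using nm[OF a(1) x(1,2) d(1)] nm[OF a(2) x(3,4) d(2)] P0_add by simp
qed

lemma periodic_qform:
  assumes "a \<in> P0 (- int l)" "d \<in> P0 (- int l)" "c \<in> P (- int k)" "N \<ge> 2 * l" "N \<ge> k" "N \<ge> 1"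
  shows "y \<in> P 0 \<Longrightarrow> periodic_O N (\<lambda>x. \<psi> (qform a d c x y))"
    and "x \<in> P 0 \<Longrightarrow> periodic_O N (\<lambda>y. \<psi> (qform a d c x y))"
proof -
  have F: "a \<in> F0" "d \<in> F0" using assms P0_F0 by auto
  show "periodic_O N (\<lambda>x. \<psi> (qform a d c x y))" if "y \<in> P 0"
    unfolding periodic_def
    using qform_cong[OF assms _ _ that that] qform_F0[OF F] by (auto intro!: psi_cong)
  show "periodic_O N (\<lambda>y. \<psi> (qform a d c x y))" if "x \<in> P 0"
    unfolding periodic_def
    using qform_cong[OF assms that that] qform_F0[OF F] by (auto intro!: psi_cong)
qed

lemma form_gauss_integral:
  assumes "a \<in> P0 0" "d \<in> P0 0" "c \<in> P 0"
  shows "form_gauss N a d c = 1"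
proof -
  have "\<psi> (qform a d c x y) = 1" if "x \<in> P 0" "y \<in> P 0" for x y
  proof (rule psi_O)
    have "c * x * bar y \<in> P (0 + 0 + 0)" using assms that by (intro P_mult) auto
    then have "Tr (c * x * bar y) \<in> P0 0" using Tr_P[of _ 0] by simp
    moreover have "a * Nm x \<in> P0 0" "d * Nm y \<in> P0 0"
      using P0_mult[OF assms(1) Nm_P[OF that(1)]] P0_mult[OF assms(2) Nm_P[OF that(2)]] by simp_all
    ultimately show "qform a d c x y \<in> P0 0" unfolding qform_def by (intro P0_add)
  qed
  then have "form_gauss N a d c = mean N (\<lambda>x. mean N (\<lambda>y. 1))"
    unfolding form_gauss_def by (intro mean_cong)
  then show ?thesis by simp
qed

lemma form_volume_integral:
  assumes "a \<in> P0 0" "d \<in> P0 0" "c \<in> P 0"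
  shows "form_volume N a d c = 1"
proof -
  have "a * x + bar c * y \<in> P 0 \<and> c * x + d * y \<in> P 0" if "x \<in> P 0" "y \<in> P 0" for x y
    using P_mult[OF P0_P[OF assms(1)], of x 0] P_mult[OF P0_P[OF assms(2)], of y 0]
      P_mult[OF assms(3), of x 0] P_mult[of "bar c" 0 y 0] that assms(3) by (auto intro: P_add)
  then have "form_volume N a d c = mean N (\<lambda>x. mean N (\<lambda>y. 1))"
    unfolding form_volume_def by (intro mean_cong) simp
  then show ?thesis by simp
qed

text \<open>Diagonalisable forms: completing the square splits off the variable with the larger pole.\<close>

lemma form_gauss_split:
  assumes d: "d \<in> F0" "2 * pole d \<le> N" "N \<ge> 1" and a: "a \<in> F0" and z: "z \<in> P 0"
  shows "form_gauss N (a + d * Nm z) d (d * z) = gauss N d * gauss N a"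
proof -
  have per: "periodic_O N (\<lambda>y. \<psi> (d * Nm y))" using periodic_psi_Nm[OF pole_P0[OF d(1)]] d by simp
  have "form_gauss N (a + d * Nm z) d (d * z) = mean N (\<lambda>x. \<psi> (a * Nm x) * gauss N d)"
    unfolding form_gauss_def
  proof (rule mean_cong)
    fix x assume x: "x \<in> P 0"
    have "qform (a + d * Nm z) d (d * z) x y = a * Nm x + d * Nm (y + z * x)" for y
    proof -
      have "Tr (d * z * x * bar y) = d * Tr (y * bar (z * x))"
        using Tr_mult_F0[OF d(1), of "z * x * bar y"] Tr_bar[of "z * x * bar y"]
        by (simp add: bar_mult algebra_simps)
      then show ?thesis by (simp add: qform_def Nm_add Nm_mult algebra_simps)
    qed
    then have "\<psi> (qform (a + d * Nm z) d (d * z) x y) = \<psi> (a * Nm x) * \<psi> (d * Nm (y + z * x))" for y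
      using psi_add[of "a * Nm x" "d * Nm (y + z * x)"] a d Nm_F0 F0 by simp
    moreover have "z * x \<in> P 0" using P_mult[OF z x] by simp
    ultimately show "mean N (\<lambda>y. \<psi> (qform (a + d * Nm z) d (d * z) x y)) = \<psi> (a * Nm x) * gauss N d"
      using mean_shift[OF per, of "z * x"] by (simp add: mean_mult_left gauss_def)
  qed
  then show ?thesis by (simp add: mean_mult_right gauss_def mult.commute)
qed

lemma volume_of_pole:
  assumes "d \<in> F0" "2 * pole d \<le> N"
  shows "mean N (\<lambda>x. of_bool (d * x \<in> P 0)) = 1 / of_nat q ^ (2 * pole d)"
proof (cases "pole d = 0")
  case True
  then have "d \<in> P0 0" using pole_eq_0_iff assms by simp
  then have "mean N (\<lambda>x. of_bool (d * x \<in> P 0)) = mean N (\<lambda>x. 1)"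
    using P_mult[OF P0_P, of d 0 _ 0] by (intro mean_cong) simp
  then show ?thesis using True by simp
next
  case False
  have "d * x \<in> P 0 \<longleftrightarrow> x \<in> P (int (2 * pole d))" for x
    using P_mult_iff[OF pole_av[OF assms(1) False], of x 0] by simp
  then show ?thesis using mean_ball[OF assms(2)] by simp
qed

lemma form_volume_split:
  assumes d: "d \<in> F0" "2 * pole d \<le> N" and a: "a \<in> F0" "2 * pole a \<le> N" and z: "z \<in> P 0"
  shows "form_volume N (a + d * Nm z) d (d * z) = 1 / of_nat q ^ (2 * pole d) * (1 / of_nat q ^ (2 * pole a))"
proof -
  have per: "periodic_O N (\<lambda>y. of_bool (d * y \<in> P 0) :: complex)"
    unfolding periodic_def
  proof (intro ballI impI)
    fix y y' assume "y - y' \<in> P (int N)"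
    then have "d * (y - y') \<in> P 0"
      using P_mult[OF P0_P[OF pole_P0[OF d(1)]], of "y - y'" "int N"]
        P_antimono[of 0 "2 * (- int (pole d)) + int N"] d(2) by auto
    then have "d * y \<in> P 0 \<longleftrightarrow> d * y' \<in> P 0"
      using P_add[of "d * (y - y')" 0 "d * y'"] P_diff[of "d * y" 0 "d * (y - y')"] by (auto simp: algebra_simps)
    then show "of_bool (d * y \<in> P 0) = (of_bool (d * y' \<in> P 0) :: complex)" by simp
  qed
  have "form_volume N (a + d * Nm z) d (d * z)
      = mean N (\<lambda>x. of_bool (a * x \<in> P 0) * (1 / of_nat q ^ (2 * pole d)))"
    unfolding form_volume_def
  proof (rule mean_cong)
    fix x assume x: "x \<in> P 0"
    have "of_bool ((a + d * Nm z) * x + bar (d * z) * y \<in> P 0) * of_bool (d * z * x + d * y \<in> P 0)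
        = (of_bool (a * x \<in> P 0) * of_bool (d * (y + z * x) \<in> P 0) :: complex)" for y
    proof (cases "d * (y + z * x) \<in> P 0")
      case True
      have e: "(a + d * Nm z) * x + bar (d * z) * y = a * x + bar z * (d * (y + z * x))"
        using d by (simp add: bar_mult bar_F0 Nm_def algebra_simps)
      have "bar z * (d * (y + z * x)) \<in> P 0" using P_mult[of "bar z" 0 _ 0] z True by simp
      then have "(a + d * Nm z) * x + bar (d * z) * y \<in> P 0 \<longleftrightarrow> a * x \<in> P 0"
        unfolding e using P_add[of "a * x" 0] P_diff[of "a * x + bar z * (d * (y + z * x))" 0 "bar z * (d * (y + z * x))"] by auto
      then show ?thesis using True by (simp add: algebra_simps)
    qed (simp add: algebra_simps)
    moreover have "z * x \<in> P 0" using P_mult[OF z x] by simp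
    ultimately show "mean N (\<lambda>y. of_bool ((a + d * Nm z) * x + bar (d * z) * y \<in> P 0) * of_bool (d * z * x + d * y \<in> P 0))
        = of_bool (a * x \<in> P 0) * (1 / of_nat q ^ (2 * pole d))"
      using mean_shift[OF per, of "z * x"] volume_of_pole[OF d] by (simp add: mean_mult_left)
  qed
  then show ?thesis unfolding mean_mult_right volume_of_pole[OF a] by simp
qed

text \<open>Forms whose off-diagonal entry has the dominating pole. Substituting \<open>x + \<mu>y\<close> for \<open>x\<close>
  with \<open>\<mu> = - d / 2c\<close> lowers the pole of \<open>d\<close> until \<open>d\<close> is integral.\<close>

lemma form_gauss_antidiagonal:
  assumes "av c = av \<pi> powi (- int e)" "e \<ge> 1" "N \<ge> e"
    and "a \<in> P0 (- int (e div 2))" "d \<in> P0 (- int k)" "2 * k + 1 \<le> e"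
  shows "form_gauss N a d c = of_nat q / of_nat q ^ e"
  using assms
proof (induction k arbitrary: d c)
  case 0
  have cP: "c \<in> P (- int e)" using 0 by (simp add: P_def)
  have "form_gauss N a d c = mean N (\<lambda>x. of_bool (x \<in> P (int (e - 1))))"
    unfolding form_gauss_def
  proof (rule mean_cong)
    fix x assume x: "x \<in> P 0"
    have aF: "a \<in> F0" "d \<in> F0" using 0 P0_F0 by auto
    have t: "Tr (c * x * bar y) = Tr (bar c * bar x * y)" for y
      using Tr_bar[of "c * x * bar y"] by (simp add: bar_mult algebra_simps)
    have "\<psi> (qform a d c x y) = \<psi> (a * Nm x) * \<psi> (Tr (bar c * bar x * y))" if y: "y \<in> P 0" for y
    proof -
      have "d * Nm y \<in> P0 0" using P0_mult[of d 0 "Nm y" 0] Nm_P[OF y] 0 by simp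
      then have "\<psi> (qform a d c x y) = \<psi> (a * Nm x + Tr (bar c * bar x * y))"
        using aF Nm_F0 Tr_F0 F0 by (intro psi_cong) (auto simp: qform_def t)
      then show ?thesis using psi_add aF Nm_F0 Tr_F0 F0 by simp
    qed
    then have "mean N (\<lambda>y. \<psi> (qform a d c x y)) = mean N (\<lambda>y. \<psi> (a * Nm x) * \<psi> (Tr (bar c * bar x * y)))"
      by (rule mean_cong)
    also have "\<dots> = \<psi> (a * Nm x) * of_bool (bar c * bar x \<in> P (- 1))"
    proof -
      have "bar c * bar x \<in> P (- int e)" using P_mult[of "bar c" "- int e" "bar x" 0] cP x by simp
      then have "bar c * bar x \<in> P (- int N - 1)" using P_antimono[of "- int N - 1" "- int e"] 0 by auto
      then show ?thesis by (simp add: mean_mult_left mean_psi_Tr)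
    qed
    also have "bar c * bar x \<in> P (- 1) \<longleftrightarrow> x \<in> P (int (e - 1))"
      using P_mult_iff[of "bar c" "- int e" "bar x" "- 1"] 0 by (simp add: of_nat_diff)
    also have "\<psi> (a * Nm x) * of_bool (x \<in> P (int (e - 1))) = of_bool (x \<in> P (int (e - 1)))"
    proof (cases "x \<in> P (int (e - 1))")
      case True
      have "int (e div 2) \<le> int (e - 1)" using 0 by linarith
      then have "Nm x \<in> P0 (int (e div 2))" using Nm_P[OF True] P0_antimono by blast
      then have "a * Nm x \<in> P0 0" using P0_mult[of a "- int (e div 2)" "Nm x" "int (e div 2)"] 0 by simp
      then show ?thesis using psi_O by simp
    qed simp
    finally show "mean N (\<lambda>y. \<psi> (qform a d c x y)) = of_bool (x \<in> P (int (e - 1)))" .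
  qed
  also have "\<dots> = 1 / of_nat q ^ (e - 1)" using 0 by (intro mean_ball) simp
  finally show ?case using 0 by (simp add: power_diff)
next
  case (Suc k)
  have c0: "c \<noteq> 0" using av_powi_nonzero[OF Suc.prems(1)] .
  have aF: "a \<in> F0" "d \<in> F0" using Suc.prems P0_F0 by auto
  have cP: "c \<in> P (- int e)" using Suc.prems by (simp add: P_def)
  define \<mu> where "\<mu> = - d / (2 * c)"
  have mu: "\<mu> \<in> P (int e - 2 * int k - 2)"
  proof -
    have "c * \<mu> = - d / 2" using c0 by (simp add: \<mu>_def)
    moreover have "- d / 2 \<in> P (- 2 * int k - 2)"
    proof -
      have "2 * - int (Suc k) = - 2 * int k - 2" by simp
      then show ?thesis using P0_P[OF Suc.prems(5)] by (simp only: P_def) (simp add: av_divide)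
    qed
    ultimately show ?thesis using P_mult_iff[OF Suc.prems(1), of \<mu> "- 2 * int k - 2"] by (simp add: algebra_simps)
  qed
  have mu1: "\<mu> \<in> P 1" using mu P_antimono[of 1 "int e - 2 * int k - 2"] Suc.prems by auto
  define c' where "c' = c + a * bar \<mu>"
  define d' where "d' = a * Nm \<mu>"
  have q': "qform a d c (x + \<mu> * y) y = qform a d' c' x y" for x y
  proof -
    have cm: "c * \<mu> = - d / 2" using c0 by (simp add: \<mu>_def)
    then have "c * \<mu> \<in> F0" using aF F0 by simp
    then have "Tr (c * \<mu> * (y * bar y)) = c * \<mu> * Tr (Nm y)" unfolding Nm_def by (rule Tr_mult_F0)
    also have "Tr (Nm y) = 2 * Nm y" using bar_F0[OF Nm_F0] by (simp add: Tr_def)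
    finally have tc: "Tr (c * \<mu> * y * bar y) = - d * Nm y" by (simp add: cm mult.assoc)
    have ta: "a * Tr (x * bar (\<mu> * y)) = Tr (a * bar \<mu> * x * bar y)"
      using Tr_mult_F0[OF aF(1), of "x * bar (\<mu> * y)"] by (simp add: bar_mult algebra_simps)
    have "qform a d c (x + \<mu> * y) y
        = a * Nm x + a * Nm \<mu> * Nm y + a * Tr (x * bar (\<mu> * y)) + d * Nm y + Tr (c * x * bar y) + Tr (c * \<mu> * y * bar y)"
      by (simp add: qform_def Nm_add Nm_mult Tr_add algebra_simps)
    also have "\<dots> = qform a d' c' x y"
      unfolding tc ta by (simp add: qform_def c'_def d'_def Tr_add algebra_simps)
    finally show ?thesis .
  qed
  have d'P: "d' \<in> P0 (- int k)"
  proof -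
    have "d' \<in> P0 (- int (e div 2) + (int e - 2 * int k - 2))"
      unfolding d'_def by (intro P0_mult Suc.prems Nm_P mu)
    moreover have "- int k \<le> - int (e div 2) + (int e - 2 * int k - 2)"
    proof -
      have "k + 2 + e div 2 \<le> e" using Suc.prems(6) by presburger
      then show ?thesis by linarith
    qed
    ultimately show ?thesis using P0_antimono by blast
  qed
  have c'av: "av c' = av \<pi> powi (- int e)"
  proof -
    have "a * bar \<mu> \<in> P (2 * (- int (e div 2)) + 1)" using P0_P[OF Suc.prems(4)] mu1 by (intro P_mult) auto
    moreover have "- int e + 1 \<le> 2 * (- int (e div 2)) + 1" by linarith
    ultimately have "a * bar \<mu> \<in> P (- int e + 1)" using P_antimono by blast
    then have "av (a * bar \<mu>) \<le> av \<pi> powi (- int e + 1)" by (simp add: P_def)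
    also have "\<dots> < av c" using Suc.prems powi_less_iff by simp
    finally show ?thesis unfolding c'_def using av_add_eq Suc.prems by simp
  qed
  have "form_gauss N a d c = mean N (\<lambda>y. mean N (\<lambda>x. \<psi> (qform a d c x y)))"
    unfolding form_gauss_def by (rule mean_swap)
  also have "\<dots> = mean N (\<lambda>y. mean N (\<lambda>x. \<psi> (qform a d' c' x y)))"
  proof (rule mean_cong)
    fix y assume y: "y \<in> P 0"
    have "Suc k \<le> e div 2" using Suc.prems(6) by presburger
    then have "d \<in> P0 (- int (e div 2))"
      using Suc.prems(5) P0_antimono[of "- int (e div 2)" "- int (Suc k)"] by auto
    moreover have "a \<in> P0 (- int (e div 2))" "N \<ge> 2 * (e div 2)" "N \<ge> 1" using Suc.prems by auto
    moreover note \<open>Suc k \<le> e div 2\<close>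
    ultimately have per: "periodic_O N (\<lambda>x. \<psi> (qform a d c x y))"
      using periodic_qform(1)[OF _ _ cP] Suc.prems(3) y by blast
    have "\<mu> * y \<in> P 0" using P_mult[OF mu1 y] P_antimono[of 0 1] by auto
    from mean_shift[OF per this]
    show "mean N (\<lambda>x. \<psi> (qform a d c x y)) = mean N (\<lambda>x. \<psi> (qform a d' c' x y))" by (simp add: q')
  qed
  also have "\<dots> = form_gauss N a d' c'"
    unfolding form_gauss_def by (rule mean_swap)
  also have "\<dots> = of_nat q / of_nat q ^ e"
    using Suc.prems d'P c'av by (intro Suc.IH) auto
  finally show ?case .
qed

text \<open>The off-diagonal entry dominates both rows, so the two conditions together say that \<open>x\<close> and \<open>y\<close> are
  divisible by \<open>\<pi>\<^sup>e\<close>.\<close>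

lemma form_volume_antidiagonal:
  assumes c: "av c = av \<pi> powi (- int e)" and N: "N \<ge> e"
    and a: "a \<in> P (- int e)" and d: "d \<in> P (- int e + 1)"
  shows "form_volume N a d c = 1 / of_nat q ^ (2 * e)"
proof -
  have eq: "a * x + bar c * y \<in> P 0 \<and> c * x + d * y \<in> P 0 \<longleftrightarrow> x \<in> P (int e) \<and> y \<in> P (int e)" for x y
  proof
    assume "x \<in> P (int e) \<and> y \<in> P (int e)"
    moreover have "c \<in> P (- int e)" "d \<in> P (- int e)" using c d P_antimono[of "- int e" "- int e + 1"] by (auto simp: P_def)
    ultimately show "a * x + bar c * y \<in> P 0 \<and> c * x + d * y \<in> P 0"
      using P_mult[of _ "- int e" _ "int e"] a by (auto intro!: P_add)
  next
    assume h: "a * x + bar c * y \<in> P 0 \<and> c * x + d * y \<in> P 0"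
    define A where "A = av (c * x)"
    define B where "B = av (c * y)"
    have "bar c * y = (a * x + bar c * y) - a * x" "c * x = (c * x + d * y) - d * y" by simp_all
    then have "av (bar c * y) \<le> max (av (a * x + bar c * y)) (av (a * x))"
      "av (c * x) \<le> max (av (c * x + d * y)) (av (d * y))" using av_diff by metis+
    moreover have "av (a * x) \<le> A"
      using a c av_nonneg by (simp add: A_def av_mult P_def mult_right_mono)
    moreover have "av (d * y) \<le> av \<pi> * B"
    proof -
      have "av d \<le> av \<pi> * av c" using d c powi_add[of "1" "- int e"] by (simp add: P_def add.commute)
      then show ?thesis using mult_right_mono[of "av d" "av \<pi> * av c" "av y"] av_nonneg by (simp add: B_def av_mult mult.assoc)
    qed
    ultimately have AB: "B \<le> max 1 A" "A \<le> max 1 (av \<pi> * B)"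
      using h by (auto simp: A_def B_def av_mult P_def)
    have small: "av \<pi> * B \<le> B" using av_pi_less_1 av_nonneg[of "c * y"] av_pi_pos by (simp add: B_def mult_left_le_one_le)
    have "A \<le> 1"
    proof (rule ccontr)
      assume "\<not> A \<le> 1"
      then have 1: "A \<le> av \<pi> * B" "B \<le> A" using AB by auto
      then have "B > 0" using \<open>\<not> A \<le> 1\<close> small by linarith
      then have "av \<pi> * B < B" using av_pi_less_1 by simp
      then show False using 1 by linarith
    qed
    moreover from this have "B \<le> 1" using AB by simp
    ultimately have "c * x \<in> P 0" "c * y \<in> P 0" by (simp_all add: A_def B_def P_def)
    then show "x \<in> P (int e) \<and> y \<in> P (int e)" using P_mult_iff[OF c, of _ 0] by simp
  qed
  have "form_volume N a d c = mean N (\<lambda>x. mean N (\<lambda>y. of_bool (x \<in> P (int e)) * of_bool (y \<in> P (int e))))"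
    unfolding form_volume_def
  proof (intro mean_cong)
    fix x y
    show "of_bool (a * x + bar c * y \<in> P 0) * of_bool (c * x + d * y \<in> P 0)
        = (of_bool (x \<in> P (int e)) * of_bool (y \<in> P (int e)) :: complex)"
      using eq[of x y] by (simp flip: of_bool_conj)
  qed
  also have "\<dots> = 1 / of_nat q ^ e * (1 / of_nat q ^ e)"
    unfolding mean_product[symmetric] mean_ball[OF N] ..
  finally show ?thesis by (simp add: mult_2 power_add)
qed

section \<open>Polar weights\<close>

text \<open>A polar weight depends only on the elementary divisors of the polar part of the form:
  a diagonal entry with a pole of order \<open>s\<close> contributes \<open>\<theta> Z\<^sup>s\<close>, and an antidiagonal block with
  a pole of order \<open>e\<close> (for \<open>\<pi>\<close>) contributes \<open>\<theta>\<^sup>2 Z\<^sup>e\<close>. Both Gaussian integrals of interest are of this kind;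
  the unimodular plane only changes the value of \<open>\<theta>\<close>.\<close>

definition pole_weight :: "complex \<Rightarrow> complex \<Rightarrow> 'a \<Rightarrow> complex" where
  "pole_weight \<theta> Z d = (if pole d = 0 then 1 else \<theta> * Z ^ pole d)"

definition polar_weight :: "nat \<Rightarrow> complex \<Rightarrow> complex \<Rightarrow> ('a \<Rightarrow> 'a \<Rightarrow> 'a \<Rightarrow> complex) \<Rightarrow> bool" where
  "polar_weight l \<theta> Z f \<longleftrightarrow>
     (\<forall>a \<in> P0 0. \<forall>d \<in> P0 0. \<forall>c \<in> P 0. f a d c = 1) \<and>
     (\<forall>d \<in> P0 (- int l). \<forall>z \<in> P 0. \<forall>a \<in> P0 (- int l).
        f (a + d * Nm z) d (d * z) = pole_weight \<theta> Z d * pole_weight \<theta> Z a) \<and>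
     (\<forall>a \<in> P0 (- int l). \<forall>z \<in> P 0. \<forall>d \<in> P0 (- int l).
        f a (d + a * Nm z) (a * z) = pole_weight \<theta> Z a * pole_weight \<theta> Z d) \<and>
     (\<forall>e k a d c. 1 \<le> e \<and> e \<le> 2 * l \<and> av c = av \<pi> powi (- int e) \<and> a \<in> P0 (- int (e div 2)) \<and>
        d \<in> P0 (- int k) \<and> 2 * k + 1 \<le> e \<longrightarrow> f a d c = \<theta> ^ 2 * Z ^ e)"

lemma polar_weight_volume:
  assumes N: "N \<ge> 2 * l"
  shows "polar_weight l 1 (1 / of_nat q ^ 2) (form_volume N)"
proof -
  have w: "pole_weight 1 (1 / of_nat q ^ 2) d = 1 / of_nat q ^ (2 * pole d)" for d
    by (simp add: pole_weight_def power_one_over power_mult)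
  have split: "form_volume N (a + d * Nm z) d (d * z)
      = pole_weight 1 (1 / of_nat q ^ 2) d * pole_weight 1 (1 / of_nat q ^ 2) a"
    if "d \<in> P0 (- int l)" "z \<in> P 0" "a \<in> P0 (- int l)" for a d z
    unfolding w using that pole_le_iff[of _ l] P0_F0 N by (intro form_volume_split) fastforce+
  have split': "form_volume N a (d + a * Nm z) (a * z)
      = pole_weight 1 (1 / of_nat q ^ 2) a * pole_weight 1 (1 / of_nat q ^ 2) d"
    if "a \<in> P0 (- int l)" "z \<in> P 0" "d \<in> P0 (- int l)" for a d z
    using split[OF that(1), of "bar z" d] that P0_F0[OF that(1)]
    by (simp add: form_volume_swap[of N a] bar_mult bar_F0 Nm_bar)
  have anti: "form_volume N a d c = 1 ^ 2 * (1 / of_nat q ^ 2) ^ e"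
    if "1 \<le> e" "e \<le> 2 * l" "av c = av \<pi> powi (- int e)" "a \<in> P0 (- int (e div 2))"
      "d \<in> P0 (- int k)" "2 * k + 1 \<le> e" for e k a d c
  proof -
    have "- int e \<le> 2 * - int (e div 2)" by linarith
    then have "a \<in> P (- int e)" using P0_P[OF that(4)] P_antimono by blast
    moreover have "d \<in> P (- int e + 1)" using P0_P[OF that(5)] P_antimono[of "- int e + 1" "2 * - int k"] that by auto
    ultimately show ?thesis
      using form_volume_antidiagonal[OF that(3), of N a d] N that by (simp add: power_one_over power_mult)
  qed
  show ?thesis unfolding polar_weight_def
    using form_volume_integral split split' anti by blast
qed

lemma polar_weight_gauss:
  assumes N: "N \<ge> 2 * l" "N \<ge> 1" and v: "v \<in> F0" "av v = 1"
  shows "polar_weight l (of_int (chi (- v)) * of_nat q) (1 / of_nat q ^ 2)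
    (\<lambda>a d c. form_gauss N (v * a) (v * d) (v * c) * form_gauss N a d c)"
proof -
  let ?w = "pole_weight (of_int (chi (- v)) * of_nat q) (1 / of_nat q ^ 2)"
  have w: "gauss N (v * d) * gauss N d = ?w d" if d: "d \<in> P0 (- int l)" for d
  proof (cases "pole d = 0")
    case True
    have dF: "d \<in> F0" using d P0_F0 by blast
    then have "d \<in> P0 0" "v * d \<in> P0 0"
      using True pole_eq_0_iff[of d] pole_eq_0_iff[of "v * d"] pole_unit_mult[OF v dF] v F0 by auto
    then show ?thesis using True by (simp add: gauss_integral pole_weight_def)
  next
    case False
    have dF: "d \<in> F0" using d P0_F0 by blast
    have "2 * pole d \<le> N" using pole_le_iff[OF dF, of l] d N by simp
    then show ?thesis
      using gauss_product[OF dF pole_av[OF dF False] _ _ v, of N] False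
      by (simp add: pole_weight_def mult.commute power_one_over power_mult)
  qed
  have vP: "v * d \<in> P0 k" if "d \<in> P0 k" for d k using P0_mult[of v 0 d k] v that by (simp add: P0_def P_def)
  have g: "form_gauss N (a + d * Nm z) d (d * z) = gauss N d * gauss N a"
    if "d \<in> P0 (- int l)" "z \<in> P 0" "a \<in> P0 (- int l)" for a d z
    using that pole_le_iff[of _ l] P0_F0 N by (intro form_gauss_split) fastforce+
  have split: "form_gauss N (v * (a + d * Nm z)) (v * d) (v * (d * z)) * form_gauss N (a + d * Nm z) d (d * z) = ?w d * ?w a"
    if "d \<in> P0 (- int l)" "z \<in> P 0" "a \<in> P0 (- int l)" for a d z
    using g[OF that] g[OF vP[OF that(1)] that(2) vP[OF that(3)]] w[OF that(1)] w[OF that(3)]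
    by (simp add: algebra_simps)
  have split': "form_gauss N (v * a) (v * (d + a * Nm z)) (v * (a * z)) * form_gauss N a (d + a * Nm z) (a * z) = ?w a * ?w d"
    if "a \<in> P0 (- int l)" "z \<in> P 0" "d \<in> P0 (- int l)" for a d z
    using split[OF that(1), of "bar z" d] that P0_F0[OF that(1)] v
    by (simp add: form_gauss_swap[of N a] form_gauss_swap[of N "v * a"] bar_mult bar_F0 Nm_bar)
  have anti: "form_gauss N (v * a) (v * d) (v * c) * form_gauss N a d c
      = (of_int (chi (- v)) * of_nat q) ^ 2 * (1 / of_nat q ^ 2) ^ e"
    if "1 \<le> e" "e \<le> 2 * l" "av c = av \<pi> powi (- int e)" "a \<in> P0 (- int (e div 2))"
      "d \<in> P0 (- int k)" "2 * k + 1 \<le> e" for e k a d c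
  proof -
    have "form_gauss N a d c = of_nat q / of_nat q ^ e"
      using that N by (intro form_gauss_antidiagonal[of _ _ _ _ _ k]) auto
    moreover have "form_gauss N (v * a) (v * d) (v * c) = of_nat q / of_nat q ^ e"
      using that N vP v by (intro form_gauss_antidiagonal[of _ _ _ _ _ k]) (auto simp: av_mult)
    moreover have "(of_int (chi (- v)) :: complex) ^ 2 = 1" using chi_cases[of "- v"] by auto
    ultimately show ?thesis
      by (simp add: power_mult_distrib power2_eq_square power_one_over flip: power_mult_distrib power_add mult_2)
  qed
  have int: "form_gauss N (v * a) (v * d) (v * c) * form_gauss N a d c = 1"
    if "a \<in> P0 0" "d \<in> P0 0" "c \<in> P 0" for a d c
    using that vP[OF that(1)] vP[OF that(2)] P_mult_iff[of v 0 c 0] v by (simp add: form_gauss_integral)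
  show ?thesis unfolding polar_weight_def using int split split' anti by blast
qed

lemma polar_weightD:
  assumes "polar_weight l \<theta> Z f"
  shows "a \<in> P0 0 \<Longrightarrow> d \<in> P0 0 \<Longrightarrow> c \<in> P 0 \<Longrightarrow> f a d c = 1"
    and "d \<in> P0 (- int l) \<Longrightarrow> z \<in> P 0 \<Longrightarrow> a \<in> P0 (- int l) \<Longrightarrow>
      f (a + d * Nm z) d (d * z) = pole_weight \<theta> Z d * pole_weight \<theta> Z a"
    and "a \<in> P0 (- int l) \<Longrightarrow> z \<in> P 0 \<Longrightarrow> d \<in> P0 (- int l) \<Longrightarrow>
      f a (d + a * Nm z) (a * z) = pole_weight \<theta> Z a * pole_weight \<theta> Z d"
    and "1 \<le> e \<Longrightarrow> e \<le> 2 * l \<Longrightarrow> av c = av \<pi> powi (- int e) \<Longrightarrow> a \<in> P0 (- int (e div 2)) \<Longrightarrow>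
      d \<in> P0 (- int k) \<Longrightarrow> 2 * k + 1 \<le> e \<Longrightarrow> f a d c = \<theta> ^ 2 * Z ^ e"
  using assms unfolding polar_weight_def by blast+

text \<open>The hyperbolic planes have \<open>\<theta> = 1\<close>, so multiplying by their weight only changes \<open>Z\<close>.\<close>

lemma polar_weight_mult:
  assumes f: "polar_weight l \<theta> Z f" and g: "polar_weight l 1 W g"
  shows "polar_weight l \<theta> (Z * W) (\<lambda>a d c. f a d c * g a d c)"
proof -
  have w: "pole_weight \<theta> (Z * W) d = pole_weight \<theta> Z d * pole_weight 1 W d" for d
    by (simp add: pole_weight_def power_mult_distrib)
  have anti: "f a d c * g a d c = \<theta> ^ 2 * (Z * W) ^ e"
    if "1 \<le> e" "e \<le> 2 * l" "av c = av \<pi> powi (- int e)" "a \<in> P0 (- int (e div 2))"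
      "d \<in> P0 (- int k)" "2 * k + 1 \<le> e" for e k a d c
    unfolding polar_weightD(4)[OF f that] polar_weightD(4)[OF g that] by (simp add: power_mult_distrib)
  show ?thesis unfolding polar_weight_def w
  proof (intro conjI ballI allI impI)
    fix a d c assume "a \<in> P0 0" "d \<in> P0 0" "c \<in> P 0"
    then show "f a d c * g a d c = 1" using polar_weightD(1)[OF f] polar_weightD(1)[OF g] by simp
  next
    fix e k a d c
    assume "1 \<le> e \<and> e \<le> 2 * l \<and> av c = av \<pi> powi (- int e) \<and> a \<in> P0 (- int (e div 2)) \<and>
        d \<in> P0 (- int k) \<and> 2 * k + 1 \<le> e"
    then show "f a d c * g a d c = \<theta> ^ 2 * (Z * W) ^ e" using anti by blast
  qed (simp_all add: polar_weightD(2,3)[OF f] polar_weightD(2,3)[OF g])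
qed

lemma polar_weight_power:
  assumes "polar_weight l \<theta> Z f" "polar_weight l 1 W g"
  shows "polar_weight l \<theta> (Z * W ^ r) (\<lambda>a d c. f a d c * g a d c ^ r)"
proof (induction r)
  case 0
  show ?case using assms(1) by simp
next
  case (Suc r)
  from polar_weight_mult[OF Suc assms(2)] show ?case by (simp add: mult.assoc mult.left_commute mult.commute)
qed

end

lemma qsum_split:
  assumes AB: "finite_index A B" and BC: "finite_index B C" and f: "periodic B C f"
  shows "qsum A C f = qsum B C f + qsum A C (\<lambda>x. of_bool (x \<notin> B) * (f x :: 'c :: comm_semiring_1))"
proof -
  have "qsum A C f = qsum A C (\<lambda>x. (if x \<in> B then f x else 0) + of_bool (x \<notin> B) * f x)"
    by (intro qsum_cong finite_index_trans[OF AB BC]) simp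
  then show ?thesis using qsum_restrict[OF AB BC f] by (simp add: qsum_add)
qed

section \<open>Summing a polar weight over all hermitian forms\<close>

context local_density_setting
begin

lemma P0_minus_iff [simp]: "- x \<in> P0 k \<longleftrightarrow> x \<in> P0 k"
  using P0_minus[of x k] P0_minus[of "- x" k] by auto

text \<open>The sum of \<open>\<psi>(- d t)\<close> over the \<open>d\<close> modulo integers with a pole of order exactly \<open>s\<close>.\<close>

definition ramanujan :: "nat \<Rightarrow> 'a \<Rightarrow> complex" where
  "ramanujan s t = of_nat q ^ s * of_bool (t \<in> P0 (int s)) - of_nat q ^ (s - 1) * of_bool (t \<in> P0 (int s - 1))"

lemma fin_P0_neg: "finite_index (P0 (- int s)) (P0 0)" and fin_P_neg: "finite_index (P (- int s)) (P 0)"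
  by (simp_all add: finite_index_P0 finite_index_P)

lemma periodic_psi_mult:
  assumes "t \<in> P0 0"
  shows "periodic (P0 k) (P0 0) (\<lambda>d. \<psi> (- (d * t)))"
  unfolding periodic_def
proof (intro ballI impI psi_cong)
  fix x y assume xy: "x \<in> P0 k" "y \<in> P0 k" "x - y \<in> P0 0"
  show "- (x * t) \<in> F0" "- (y * t) \<in> F0" using F0(6)[OF P0_F0[OF xy(1)] P0_F0[OF assms]]
      F0(6)[OF P0_F0[OF xy(2)] P0_F0[OF assms]] F0(3) by auto
  have "- ((x - y) * t) \<in> P0 0" using P0_mult[OF xy(3) assms] by simp
  then show "- (x * t) - - (y * t) \<in> P0 0" by (simp add: algebra_simps)
qed

lemma qsum_psi_neg:
  assumes "t \<in> P0 0"
  shows "qsum (P0 (- int s)) (P0 0) (\<lambda>d. \<psi> (- (d * t))) = of_nat q ^ s * of_bool (t \<in> P0 (int s))"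
  using qsum_psi[of "- int s" 0 "- t"] assms by (simp add: mult.commute)

lemma qsum_psi_shell:
  assumes t: "t \<in> P0 0" and s: "s \<ge> 1"
  shows "qsum (P0 (- int s)) (P0 0) (\<lambda>d. of_bool (d \<notin> P0 (- int (s - 1))) * \<psi> (- (d * t))) = ramanujan s t"
proof -
  have "finite_index (P0 (- int s)) (P0 (- int (s - 1)))" using s by (intro finite_index_P0) simp
  from qsum_split[OF this fin_P0_neg periodic_psi_mult[OF t], unfolded qsum_psi_neg[OF t]]
  have "qsum (P0 (- int s)) (P0 0) (\<lambda>d. of_bool (d \<notin> P0 (- int (s - 1))) * \<psi> (- (d * t)))
      = of_nat q ^ s * of_bool (t \<in> P0 (int s)) - of_nat q ^ (s - 1) * of_bool (t \<in> P0 (int (s - 1)))"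
    by (simp only: add_diff_cancel_left')
  also have "int (s - 1) = int s - 1" using s by (simp add: of_nat_diff)
  finally show ?thesis using s by (simp only: ramanujan_def of_nat_diff of_nat_1)
qed

lemma qsum_psi_Tr_shell:
  assumes t: "\<tau> \<in> P (- 1)" and e: "e \<ge> 1"
  shows "qsum (P (- int e)) (P 0) (\<lambda>c. of_bool (c \<notin> P (- int (e - 1))) * \<psi> (- Tr (c * \<tau>)))
     = of_nat q ^ e * of_bool (\<tau> \<in> P (int e - 1)) - of_nat q ^ (e - 1) * of_bool (\<tau> \<in> P (int e - 2))"
proof -
  have per: "periodic (P k) (P 0) (\<lambda>c. \<psi> (- Tr (c * \<tau>)))" for k
    unfolding periodic_def
  proof (intro ballI impI psi_cong)
    fix x y assume "x - y \<in> P 0"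
    then have "- ((x - y) * \<tau>) \<in> P (- 1)" using P_mult[of "x - y" 0 \<tau> "- 1"] t by simp
    from Tr_P[OF this] show "- Tr (x * \<tau>) - - Tr (y * \<tau>) \<in> P0 0"
      by (simp add: algebra_simps Tr_diff)
  qed (use Tr_F0 F0 in auto)
  have sum: "qsum (P (- int k)) (P 0) (\<lambda>c. \<psi> (- Tr (c * \<tau>))) = of_nat q ^ k * of_bool (\<tau> \<in> P (int k - 1))" for k
    using qsum_psi_Tr[of "- int k" 0 "- \<tau>"] t by (simp add: Tr_minus mult.commute)
  have "finite_index (P (- int e)) (P (- int (e - 1)))" using e by (intro finite_index_P) simp
  from qsum_split[OF this fin_P_neg per, unfolded sum]
  have "qsum (P (- int e)) (P 0) (\<lambda>c. of_bool (c \<notin> P (- int (e - 1))) * \<psi> (- Tr (c * \<tau>)))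
      = of_nat q ^ e * of_bool (\<tau> \<in> P (int e - 1)) - of_nat q ^ (e - 1) * of_bool (\<tau> \<in> P (int (e - 1) - 1))"
    by (simp only: add_diff_cancel_left')
  moreover have "int (e - 1) - 1 = int e - 2" using e by (simp add: of_nat_diff)
  ultimately show ?thesis by (simp only:)
qed

lemma pole_eq_shell: "d \<in> F0 \<Longrightarrow> s \<ge> 1 \<Longrightarrow> d \<in> P0 (- int s) \<Longrightarrow> d \<notin> P0 (- int (s - 1)) \<Longrightarrow> pole d = s"
  using pole_le_iff[of d s] pole_le_iff[of d "s - 1"] by linarith

text \<open>The sum of a diagonal polar weight against \<open>\<psi>(- at)\<close> over all \<open>a\<close> with a pole of order at most \<open>s\<close>,
  see \<open>qsum_pole_weight\<close>.\<close>

definition pole_sum :: "complex \<Rightarrow> complex \<Rightarrow> nat \<Rightarrow> 'a \<Rightarrow> complex" where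
  "pole_sum \<theta> Z s t = 1 + \<theta> * (\<Sum>\<sigma> = 1..s. Z ^ \<sigma> * ramanujan \<sigma> t)"

lemma qsum_pole_weight:
  assumes t: "t \<in> P0 0"
  shows "qsum (P0 (- int s)) (P0 0) (\<lambda>a. pole_weight \<theta> Z a * \<psi> (- (a * t))) = pole_sum \<theta> Z s t"
proof (induction s)
  case 0
  have "qsum (P0 0) (P0 0) (\<lambda>a. pole_weight \<theta> Z a * \<psi> (- (a * t))) = qsum (P0 0) (P0 0) (\<lambda>a. 1)"
  proof (intro qsum_cong finite_index_P0)
    fix a assume a: "a \<in> P0 0"
    then have "pole a = 0" using pole_eq_0_iff P0_F0 by blast
    moreover have "- (a * t) \<in> P0 0" using P0_mult[OF a t] by simp
    ultimately show "pole_weight \<theta> Z a * \<psi> (- (a * t)) = 1" using psi_O by (simp add: pole_weight_def)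
  qed simp
  then show ?case by (simp add: qsum_const idx_P0 pole_sum_def)
next
  case (Suc s)
  have fi: "finite_index (P0 (- int (Suc s))) (P0 (- int s))" by (intro finite_index_P0) simp
  have pw: "pole_weight \<theta> Z x = pole_weight \<theta> Z y" if "x \<in> F0" "y \<in> F0" "x - y \<in> P0 0" for x y
  proof -
    have "x \<in> P0 (- int k) \<longleftrightarrow> y \<in> P0 (- int k)" for k
    proof -
      have "x - y \<in> P0 (- int k)" using that(3) P0_antimono[of "- int k" 0] by auto
      then show ?thesis using P0_add[of "x - y" "- int k" y] P0_diff[of x "- int k" "x - y"] by auto
    qed
    then have "pole x = pole y" by (simp add: pole_def)
    then show ?thesis by (simp add: pole_weight_def)
  qed
  have per: "periodic (P0 (- int s)) (P0 0) (\<lambda>a. pole_weight \<theta> Z a * \<psi> (- (a * t)))"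
    using periodic_psi_mult[OF t, of "- int s"] pw P0_F0 unfolding periodic_def by metis
  have "qsum (P0 (- int (Suc s))) (P0 0) (\<lambda>a. of_bool (a \<notin> P0 (- int s)) * (pole_weight \<theta> Z a * \<psi> (- (a * t))))
      = qsum (P0 (- int (Suc s))) (P0 0) (\<lambda>a. \<theta> * Z ^ Suc s * (of_bool (a \<notin> P0 (- int (Suc s - 1))) * \<psi> (- (a * t))))"
  proof (intro qsum_cong fin_P0_neg)
    fix a assume a: "a \<in> P0 (- int (Suc s))"
    show "of_bool (a \<notin> P0 (- int s)) * (pole_weight \<theta> Z a * \<psi> (- (a * t)))
        = \<theta> * Z ^ Suc s * (of_bool (a \<notin> P0 (- int (Suc s - 1))) * \<psi> (- (a * t)))"
      using pole_eq_shell[OF P0_F0[OF a], of "Suc s"] a by (cases "a \<in> P0 (- int s)") (auto simp: pole_weight_def)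
  qed
  also have "\<dots> = \<theta> * Z ^ Suc s * ramanujan (Suc s) t"
    unfolding qsum_mult_left by (subst qsum_psi_shell[OF t]) simp_all
  finally show ?case
    using qsum_split[OF fi fin_P0_neg per] Suc by (simp add: pole_sum_def algebra_simps)
qed

lemma psi_phase_cong:
  assumes t: "t1 \<in> P0 0" "t2 \<in> P0 0" "\<tau> \<in> P (- 1)"
    and F: "a \<in> F0" "a' \<in> F0" "d \<in> F0" "d' \<in> F0"
    and diff: "a - a' \<in> P0 0" "d - d' \<in> P0 0" "c - c' \<in> P 0"
  shows "\<psi> (- (a * t1 + d * t2 + Tr (c * \<tau>))) = \<psi> (- (a' * t1 + d' * t2 + Tr (c' * \<tau>)))"
proof (rule psi_cong)
  show "- (a * t1 + d * t2 + Tr (c * \<tau>)) \<in> F0" "- (a' * t1 + d' * t2 + Tr (c' * \<tau>)) \<in> F0"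
    using Tr_F0 P0_F0[OF t(1)] P0_F0[OF t(2)] F0 F by simp_all
  have "Tr ((c - c') * \<tau>) \<in> P0 0"
    using Tr_P[of "(c - c') * \<tau>" "- 1"] P_mult[OF diff(3) t(3)] by simp
  moreover have "(a - a') * t1 \<in> P0 0" "(d - d') * t2 \<in> P0 0"
    using P0_mult[OF diff(1) t(1)] P0_mult[OF diff(2) t(2)] by simp_all
  ultimately have "- ((a - a') * t1 + (d - d') * t2 + Tr ((c - c') * \<tau>)) \<in> P0 0"
    by (intro P0_minus P0_add)
  then show "- (a * t1 + d * t2 + Tr (c * \<tau>)) - - (a' * t1 + d' * t2 + Tr (c' * \<tau>)) \<in> P0 0"
    by (simp add: algebra_simps Tr_diff)
qed

end

text \<open>A polar weight \<open>f\<close> is to be summed against \<open>\<psi>(- tr(YT))\<close>, where \<open>Y\<close> has the entries \<open>a, d, c\<close>, and \<open>T\<close> has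
  the diagonal entries \<open>t1, t2\<close> and the off-diagonal entry \<open>\<tau>\<close> up to conjugation.\<close>

locale polar_sum = local_density_setting p av Qp F0 bar \<pi> \<psi> \<mu> \<nu>
  for p :: nat and av :: "'a :: field_char_0 \<Rightarrow> real" and Qp F0 :: "'a set"
    and bar :: "'a \<Rightarrow> 'a" and \<pi> :: 'a and \<psi> :: "'a \<Rightarrow> complex"
    and \<mu> :: "nat \<Rightarrow> nat \<Rightarrow> 'a mat measure" and \<nu> :: "nat \<Rightarrow> 'a mat measure" +
  fixes l :: nat and \<theta> Z :: complex and f :: "'a \<Rightarrow> 'a \<Rightarrow> 'a \<Rightarrow> complex" and t1 t2 \<tau> :: 'a
  assumes weight: "polar_weight l \<theta> Z f"
    and f_cong: "\<And>a d c a' d' c'. \<lbrakk>a \<in> F0; a' \<in> F0; d \<in> F0; d' \<in> F0; a - a' \<in> P0 0; d - d' \<in> P0 0; c - c' \<in> P 0\<rbrakk>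
      \<Longrightarrow> f a d c = f a' d' c'"
    and t1: "t1 \<in> P0 0" and t2: "t2 \<in> P0 0" and tau: "\<tau> \<in> P (- 1)"
begin

definition summand :: "'a \<Rightarrow> 'a \<Rightarrow> 'a \<Rightarrow> complex" where
  "summand a d c = f a d c * \<psi> (- (a * t1 + d * t2 + Tr (c * \<tau>)))"

lemma summand_cong:
  assumes "a \<in> F0" "a' \<in> F0" "d \<in> F0" "d' \<in> F0" "a - a' \<in> P0 0" "d - d' \<in> P0 0" "c - c' \<in> P 0"
  shows "summand a d c = summand a' d' c'"
  unfolding summand_def using f_cong[OF assms] psi_phase_cong[OF t1 t2 tau assms] by simp

text \<open>The bounds \<open>i\<close>, \<open>j\<close> and \<open>k\<close> limit the poles of \<open>a\<close>, \<open>d\<close> (in \<open>\<pi>\<^sub>0\<close>) and \<open>c\<close> (in \<open>\<pi>\<close>). They are raised in the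
  cyclic order \<open>c, a, c, d\<close>, so that at each step the new matrices have their dominating pole in the entry
  whose bound was raised.\<close>

definition form_sum :: "nat \<Rightarrow> nat \<Rightarrow> nat \<Rightarrow> complex" where
  "form_sum i j k = qsum (P0 (- int i)) (P0 0) (\<lambda>a. qsum (P0 (- int j)) (P0 0) (\<lambda>d. qsum (P (- int k)) (P 0) (summand a d)))"

lemma periodic_c: "a \<in> F0 \<Longrightarrow> d \<in> F0 \<Longrightarrow> periodic (P k) (P 0) (summand a d)"
  unfolding periodic_def by (auto intro!: summand_cong)

lemma periodic_d: "a \<in> F0 \<Longrightarrow> periodic (P0 k) (P0 0) (\<lambda>d. summand a d c)"
  unfolding periodic_def using P0_F0 by (auto intro!: summand_cong)

lemma periodic_a: "d \<in> F0 \<Longrightarrow> periodic (P0 k) (P0 0) (\<lambda>a. summand a d c)"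
  unfolding periodic_def using P0_F0 by (auto intro!: summand_cong)

lemma periodic_d': "a \<in> F0 \<Longrightarrow> periodic (P0 k) (P0 0) (\<lambda>d. qsum (P (- int j)) (P 0) (summand a d))"
  unfolding periodic_def using P0_F0 by (auto intro!: summand_cong qsum_cong fin_P_neg)

lemma periodic_a': "periodic (P0 k) (P0 0) (\<lambda>a. qsum (P0 (- int i)) (P0 0) (\<lambda>d. qsum (P (- int j)) (P 0) (summand a d)))"
  unfolding periodic_def
proof (intro ballI impI qsum_cong fin_P_neg fin_P0_neg summand_cong)
qed (use P0_F0 in auto)

lemma summand_add:
  assumes "a \<in> F0" "d \<in> F0"
  shows "summand a d c = f a d c * (\<psi> (- (a * t1)) * \<psi> (- (d * t2)) * \<psi> (- Tr (c * \<tau>)))"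
proof -
  have F: "- (a * t1) \<in> F0" "- (d * t2) \<in> F0" "- Tr (c * \<tau>) \<in> F0"
    using assms Tr_F0 P0_F0[OF t1] P0_F0[OF t2] F0 by simp_all
  have "- (a * t1 + d * t2 + Tr (c * \<tau>)) = - (a * t1) + (- (d * t2) + - Tr (c * \<tau>))" by simp
  then have "\<psi> (- (a * t1 + d * t2 + Tr (c * \<tau>))) = \<psi> (- (a * t1)) * (\<psi> (- (d * t2)) * \<psi> (- Tr (c * \<tau>)))"
    by (simp only: psi_add[OF F(1) F0(4)[OF F(2,3)]] psi_add[OF F(2,3)])
  then show ?thesis by (simp only: summand_def mult.assoc)
qed

lemma form_sum_0: "form_sum 0 0 0 = 1"
proof -
  have "form_sum 0 0 0 = qsum (P0 0) (P0 0) (\<lambda>a. qsum (P0 0) (P0 0) (\<lambda>d. qsum (P 0) (P 0) (\<lambda>c. 1)))"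
    unfolding form_sum_def of_nat_0 minus_zero
  proof (intro qsum_cong finite_index_P finite_index_P0 order_refl)
    fix a d c assume *: "a \<in> P0 0" "d \<in> P0 0" "c \<in> P 0"
    then have "summand a d c = summand 0 0 0" using P0_F0 F0 by (intro summand_cong) auto
    then show "summand a d c = 1" using polar_weightD(1)[OF weight, of 0 0 0] by (simp add: summand_def)
  qed
  then show ?thesis by (simp add: qsum_const idx_P0 idx_P)
qed

text \<open>The matrices whose off-diagonal entry has a pole of order \<open>e\<close> that dominates the diagonal: their weight is
  constant, so the three entries are summed independently.\<close>

definition antidiagonal_part :: "nat \<Rightarrow> complex" where
  "antidiagonal_part e = \<theta> ^ 2 * Z ^ e *
     (of_nat q ^ (e div 2) * of_bool (t1 \<in> P0 (int (e div 2)))) *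
     (of_nat q ^ ((e - 1) div 2) * of_bool (t2 \<in> P0 (int ((e - 1) div 2)))) *
     (of_nat q ^ e * of_bool (\<tau> \<in> P (int e - 1)) - of_nat q ^ (e - 1) * of_bool (\<tau> \<in> P (int e - 2)))"

lemma form_sum_step_c:
  assumes e: "1 \<le> e" "e \<le> 2 * l"
  shows "form_sum (e div 2) ((e - 1) div 2) e = form_sum (e div 2) ((e - 1) div 2) (e - 1) + antidiagonal_part e"
proof -
  let ?i = "e div 2" and ?j = "(e - 1) div 2"
  have fi: "finite_index (P (- int e)) (P (- int (e - 1)))" using e by (intro finite_index_P) simp
  have "form_sum ?i ?j e = qsum (P0 (- int ?i)) (P0 0) (\<lambda>a. qsum (P0 (- int ?j)) (P0 0) (\<lambda>d.
      qsum (P (- int (e - 1))) (P 0) (summand a d) + \<theta> ^ 2 * Z ^ e * (\<psi> (- (a * t1)) * (\<psi> (- (d * t2)) *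
        (of_nat q ^ e * of_bool (\<tau> \<in> P (int e - 1)) - of_nat q ^ (e - 1) * of_bool (\<tau> \<in> P (int e - 2)))))))"
    unfolding form_sum_def
  proof (intro qsum_cong fin_P0_neg)
    fix a d assume ad: "a \<in> P0 (- int ?i)" "d \<in> P0 (- int ?j)"
    have F: "a \<in> F0" "d \<in> F0" using ad P0_F0 by auto
    have "of_bool (c \<notin> P (- int (e - 1))) * summand a d c
        = \<theta> ^ 2 * Z ^ e * \<psi> (- (a * t1)) * \<psi> (- (d * t2)) * (of_bool (c \<notin> P (- int (e - 1))) * \<psi> (- Tr (c * \<tau>)))"
      if c: "c \<in> P (- int e)" for c
    proof (cases "c \<in> P (- int (e - 1))")
      case False
      then have "av c = av \<pi> powi (- int e)" using shell_iff[of c "- int e"] c e by (simp add: of_nat_diff)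
      then have "f a d c = \<theta> ^ 2 * Z ^ e"
        using e ad by (intro polar_weightD(4)[OF weight, of _ _ _ _ ?j]) auto
      then show ?thesis using False summand_add[OF F, of c] by (simp add: mult.assoc)
    qed simp
    then have "qsum (P (- int e)) (P 0) (\<lambda>c. of_bool (c \<notin> P (- int (e - 1))) * summand a d c)
        = qsum (P (- int e)) (P 0) (\<lambda>c. \<theta> ^ 2 * Z ^ e * \<psi> (- (a * t1)) * \<psi> (- (d * t2)) *
            (of_bool (c \<notin> P (- int (e - 1))) * \<psi> (- Tr (c * \<tau>))))"
      by (intro qsum_cong fin_P_neg)
    also have "\<dots> = \<theta> ^ 2 * Z ^ e * (\<psi> (- (a * t1)) * (\<psi> (- (d * t2)) *
        (of_nat q ^ e * of_bool (\<tau> \<in> P (int e - 1)) - of_nat q ^ (e - 1) * of_bool (\<tau> \<in> P (int e - 2)))))"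
      unfolding qsum_mult_left qsum_psi_Tr_shell[OF tau e(1)] by (simp only: mult.assoc)
    finally show "qsum (P (- int e)) (P 0) (summand a d) = qsum (P (- int (e - 1))) (P 0) (summand a d) +
        \<theta> ^ 2 * Z ^ e * (\<psi> (- (a * t1)) * (\<psi> (- (d * t2)) *
        (of_nat q ^ e * of_bool (\<tau> \<in> P (int e - 1)) - of_nat q ^ (e - 1) * of_bool (\<tau> \<in> P (int e - 2)))))"
      using qsum_split[OF fi fin_P_neg periodic_c[OF F]] by simp
  qed
  also have "\<dots> = form_sum ?i ?j (e - 1) + antidiagonal_part e"
    unfolding qsum_add qsum_mult_left qsum_mult_right qsum_psi_neg[OF t1] qsum_psi_neg[OF t2]
    by (simp only: form_sum_def antidiagonal_part_def mult.assoc)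
  finally show ?thesis .
qed

text \<open>The matrices that are dominated by \<open>d\<close>, respectively by \<open>a\<close>, with a pole of order \<open>s\<close>. After completing
  the square, the matrix is described by the dominating entry, by the quotient \<open>z\<close> of \<open>c\<close> by it, and by the
  remaining diagonal entry, which is summed to a \<open>pole_sum\<close>. The dominating entry is multiplied in the phase
  by the value of \<open>T\<close> at a vector with coordinates \<open>z\<close> and \<open>1\<close>, and summing over it gives a Ramanujan sum. In the
  second case \<open>z\<close> is divisible by \<open>\<pi>\<close>, because the bound for \<open>c\<close> is odd when the bound for \<open>a\<close> is raised.\<close>

definition diagonal_part2 :: "nat \<Rightarrow> complex" where
  "diagonal_part2 s = \<theta> * Z ^ s * pole_sum \<theta> Z s t1 *
     qsum (P 0) (P (2 * int s)) (\<lambda>z. ramanujan s (t2 + t1 * Nm z + Tr (z * \<tau>)))"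

definition diagonal_part1 :: "nat \<Rightarrow> complex" where
  "diagonal_part1 s = \<theta> * Z ^ s * pole_sum \<theta> Z (s - 1) t2 *
     qsum (P 1) (P (2 * int s)) (\<lambda>z. ramanujan s (t1 + t2 * Nm z + Tr (z * \<tau>)))"

lemma qsum_scale:
  assumes d: "av d = av \<pi> powi (- int k)" and m: "m \<le> int k" and g: "periodic (P (m - int k)) (P 0) g"
  shows "qsum (P (m - int k)) (P 0) g = qsum (P m) (P (int k)) (\<lambda>z. g (d * z))"
proof (rule qsum_bij(2)[OF finite_index_P[OF m] P_subgroup P_subgroup P_antimono _ _ _ g])
  show "m - int k \<le> 0" using m by simp
  show "d * z \<in> P (m - int k)" if "z \<in> P m" for z using P_mult_iff[OF d] that by simp
  show "d * x - d * y \<in> P 0 \<longleftrightarrow> x - y \<in> P (int k)" for x y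
    using P_mult_iff[OF d, of "x - y" 0] by (simp add: right_diff_distrib)
  fix y assume y: "y \<in> P (m - int k)"
  have e: "d * (y / d) = y" using av_powi_nonzero[OF d] by simp
  then have "y / d \<in> P m" using P_mult_iff[OF d, of "y / d" "m - int k"] y by simp
  then show "\<exists>x \<in> P m. y - d * x \<in> P 0" using e by (intro bexI[of _ "y / d"]) simp_all
qed

lemma value_integral: "t \<in> P0 0 \<Longrightarrow> t' \<in> P0 0 \<Longrightarrow> z \<in> P 0 \<Longrightarrow> t + t' * Nm z + Tr (z * \<tau>) \<in> P0 0"
  using Tr_P[of "z * \<tau>" "- 1"] P_mult[of z 0 \<tau> "- 1"] tau P0_mult[of t' 0 "Nm z" 0] Nm_P[of z 0]
  by (simp add: P0_add)

lemma form_sum_step_d: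
  assumes s: "1 \<le> s" "s \<le> l"
  shows "form_sum s s (2 * s) = form_sum s (s - 1) (2 * s) + diagonal_part2 s"
proof -
  have fi: "finite_index (P0 (- int s)) (P0 (- int (s - 1)))" using s by (intro finite_index_P0) simp
  define H where "H = (\<lambda>a d. qsum (P (- int (2 * s))) (P 0) (summand a d))"
  have "form_sum s s (2 * s) = qsum (P0 (- int s)) (P0 0) (\<lambda>a. qsum (P0 (- int (s - 1))) (P0 0) (H a) +
      qsum (P0 (- int s)) (P0 0) (\<lambda>d. of_bool (d \<notin> P0 (- int (s - 1))) * H a d))"
    unfolding form_sum_def H_def
    using qsum_split[OF fi fin_P0_neg periodic_d'] P0_F0 by (intro qsum_cong fin_P0_neg) blast
  then have 1: "form_sum s s (2 * s) = form_sum s (s - 1) (2 * s) +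
      qsum (P0 (- int s)) (P0 0) (\<lambda>d. of_bool (d \<notin> P0 (- int (s - 1))) * qsum (P0 (- int s)) (P0 0) (\<lambda>a. H a d))"
  proof -
    have "qsum (P0 (- int s)) (P0 0) (\<lambda>a. qsum (P0 (- int s)) (P0 0) (\<lambda>d. of_bool (d \<notin> P0 (- int (s - 1))) * H a d))
        = qsum (P0 (- int s)) (P0 0) (\<lambda>d. of_bool (d \<notin> P0 (- int (s - 1))) * qsum (P0 (- int s)) (P0 0) (\<lambda>a. H a d))"
      unfolding qsum_mult_left[symmetric] by (rule qsum_swap)
    moreover have "form_sum s (s - 1) (2 * s) = qsum (P0 (- int s)) (P0 0) (\<lambda>a. qsum (P0 (- int (s - 1))) (P0 0) (H a))"
      by (simp only: form_sum_def H_def)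
    ultimately show ?thesis using \<open>form_sum s s (2 * s) = _\<close> by (simp only: qsum_add)
  qed
  have H: "qsum (P0 (- int s)) (P0 0) (\<lambda>a. H a d)
      = \<theta> * Z ^ s * pole_sum \<theta> Z s t1 * qsum (P 0) (P (2 * int s)) (\<lambda>z. \<psi> (- (d * (t2 + t1 * Nm z + Tr (z * \<tau>)))))"
    if d: "d \<in> P0 (- int s)" "d \<notin> P0 (- int (s - 1))" for d
  proof -
    have dF: "d \<in> F0" using d P0_F0 by blast
    have dl: "d \<in> P0 (- int l)" using d(1) P0_antimono[of "- int l" "- int s"] s by auto
    have pd: "pole d = s" using pole_eq_shell[OF dF s(1) d] .
    have avd: "av d = av \<pi> powi (- int (2 * s))" using pole_av[OF dF] pd s by simp
    have "qsum (P0 (- int s)) (P0 0) (\<lambda>a. H a d)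
        = qsum (P0 (- int s)) (P0 0) (\<lambda>a. qsum (P 0) (P (int (2 * s))) (\<lambda>z. summand a d (d * z)))"
    proof (intro qsum_cong fin_P0_neg)
      fix a assume "a \<in> P0 (- int s)"
      then have "a \<in> F0" using P0_F0 by blast
      then show "H a d = qsum (P 0) (P (int (2 * s))) (\<lambda>z. summand a d (d * z))"
        using qsum_scale[OF avd, of 0 "summand a d"] periodic_c[OF _ dF] unfolding H_def by simp
    qed
    also have "\<dots> = qsum (P 0) (P (int (2 * s))) (\<lambda>z. qsum (P0 (- int s)) (P0 0) (\<lambda>a. summand a d (d * z)))"
      by (rule qsum_swap)
    also have "\<dots> = qsum (P 0) (P (int (2 * s))) (\<lambda>z. \<theta> * Z ^ s * pole_sum \<theta> Z s t1 * \<psi> (- (d * (t2 + t1 * Nm z + Tr (z * \<tau>)))))"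
    proof (intro qsum_cong finite_index_P)
      fix z assume z: "z \<in> P 0"
      have dN: "d * Nm z \<in> P0 (- int s)" using P0_mult[OF d(1) Nm_P[OF z]] by simp
      have "qsum (P0 (- int s)) (P0 0) (\<lambda>a. summand a d (d * z)) = qsum (P0 (- int s)) (P0 0) (\<lambda>a. summand (a + d * Nm z) d (d * z))"
        by (rule qsum_shift[OF fin_P0_neg periodic_a[OF dF] dN, symmetric])
      also have "\<dots> = qsum (P0 (- int s)) (P0 0) (\<lambda>a. \<theta> * Z ^ s * \<psi> (- (d * (t2 + t1 * Nm z + Tr (z * \<tau>)))) * (pole_weight \<theta> Z a * \<psi> (- (a * t1))))"
      proof (intro qsum_cong fin_P0_neg)
        fix a assume a: "a \<in> P0 (- int s)"
        then have aF: "a \<in> F0" and al: "a \<in> P0 (- int l)" using P0_F0 P0_antimono[of "- int l" "- int s"] s by auto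
        have "f (a + d * Nm z) d (d * z) = \<theta> * Z ^ s * pole_weight \<theta> Z a"
          using polar_weightD(2)[OF weight dl z al] pd s by (simp add: pole_weight_def)
        moreover have "\<psi> (- ((a + d * Nm z) * t1 + d * t2 + Tr (d * z * \<tau>))) = \<psi> (- (d * (t2 + t1 * Nm z + Tr (z * \<tau>)))) * \<psi> (- (a * t1))"
        proof -
          have "- ((a + d * Nm z) * t1 + d * t2 + Tr (d * z * \<tau>)) = - (d * (t2 + t1 * Nm z + Tr (z * \<tau>))) + - (a * t1)"
            using Tr_mult_F0[OF dF, of "z * \<tau>"] by (simp add: algebra_simps)
          then show ?thesis using dF aF Tr_F0 Nm_F0 P0_F0[OF t1] P0_F0[OF t2] F0 by (simp only: psi_add)
        qed
        ultimately show "summand (a + d * Nm z) d (d * z)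
            = \<theta> * Z ^ s * \<psi> (- (d * (t2 + t1 * Nm z + Tr (z * \<tau>)))) * (pole_weight \<theta> Z a * \<psi> (- (a * t1)))"
          unfolding summand_def by simp
      qed
      also have "\<dots> = \<theta> * Z ^ s * pole_sum \<theta> Z s t1 * \<psi> (- (d * (t2 + t1 * Nm z + Tr (z * \<tau>))))"
        unfolding qsum_mult_left qsum_pole_weight[OF t1] by simp
      finally show "qsum (P0 (- int s)) (P0 0) (\<lambda>a. summand a d (d * z))
          = \<theta> * Z ^ s * pole_sum \<theta> Z s t1 * \<psi> (- (d * (t2 + t1 * Nm z + Tr (z * \<tau>))))" .
    qed simp
    finally show ?thesis unfolding qsum_mult_left by simp
  qed
  have "qsum (P0 (- int s)) (P0 0) (\<lambda>d. of_bool (d \<notin> P0 (- int (s - 1))) * qsum (P0 (- int s)) (P0 0) (\<lambda>a. H a d))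
      = qsum (P0 (- int s)) (P0 0) (\<lambda>d. \<theta> * Z ^ s * pole_sum \<theta> Z s t1 * qsum (P 0) (P (2 * int s)) (\<lambda>z.
          of_bool (d \<notin> P0 (- int (s - 1))) * \<psi> (- (d * (t2 + t1 * Nm z + Tr (z * \<tau>))))))"
  proof (intro qsum_cong fin_P0_neg)
    fix d assume m: "d \<in> P0 (- int s)"
    show "of_bool (d \<notin> P0 (- int (s - 1))) * qsum (P0 (- int s)) (P0 0) (\<lambda>a. H a d)
      = \<theta> * Z ^ s * pole_sum \<theta> Z s t1 * qsum (P 0) (P (2 * int s)) (\<lambda>z.
          of_bool (d \<notin> P0 (- int (s - 1))) * \<psi> (- (d * (t2 + t1 * Nm z + Tr (z * \<tau>)))))"
    proof (cases "d \<in> P0 (- int (s - 1))")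
      case True
      then show ?thesis by (simp add: qsum_const)
    next
      case False
      then show ?thesis unfolding H[OF m False] by simp
    qed
  qed
  also have "\<dots> = \<theta> * Z ^ s * pole_sum \<theta> Z s t1 * qsum (P 0) (P (2 * int s)) (\<lambda>z.
      qsum (P0 (- int s)) (P0 0) (\<lambda>d. of_bool (d \<notin> P0 (- int (s - 1))) * \<psi> (- (d * (t2 + t1 * Nm z + Tr (z * \<tau>))))))"
    by (subst qsum_mult_left, subst qsum_swap) (rule refl)
  also have "\<dots> = diagonal_part2 s"
    unfolding diagonal_part2_def
    using qsum_psi_shell[OF value_integral[OF t2 t1] s(1)]
    by (intro arg_cong2[of _ _ _ _ "(*)"] refl qsum_cong finite_index_P) auto
  finally show ?thesis using 1 by simp
qed

lemma form_sum_step_a: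
  assumes s: "1 \<le> s" "s \<le> l"
  shows "form_sum s (s - 1) (2 * s - 1) = form_sum (s - 1) (s - 1) (2 * s - 1) + diagonal_part1 s"
proof -
  have fi: "finite_index (P0 (- int s)) (P0 (- int (s - 1)))" using s by (intro finite_index_P0) simp
  define H where "H = (\<lambda>a d. qsum (P (- int (2 * s - 1))) (P 0) (summand a d))"
  have 1: "form_sum s (s - 1) (2 * s - 1) = form_sum (s - 1) (s - 1) (2 * s - 1) +
      qsum (P0 (- int s)) (P0 0) (\<lambda>a. of_bool (a \<notin> P0 (- int (s - 1))) * qsum (P0 (- int (s - 1))) (P0 0) (H a))"
    unfolding form_sum_def H_def by (rule qsum_split[OF fi fin_P0_neg periodic_a'])
  have H: "qsum (P0 (- int (s - 1))) (P0 0) (H a)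
      = \<theta> * Z ^ s * pole_sum \<theta> Z (s - 1) t2 * qsum (P 1) (P (2 * int s)) (\<lambda>z. \<psi> (- (a * (t1 + t2 * Nm z + Tr (z * \<tau>)))))"
    if a: "a \<in> P0 (- int s)" "a \<notin> P0 (- int (s - 1))" for a
  proof -
    have aF: "a \<in> F0" using a P0_F0 by blast
    have al: "a \<in> P0 (- int l)" using a(1) P0_antimono[of "- int l" "- int s"] s by auto
    have pa: "pole a = s" using pole_eq_shell[OF aF s(1) a] .
    have ava: "av a = av \<pi> powi (- int (2 * s))" using pole_av[OF aF] pa s by simp
    have e1: "1 - int (2 * s) = - int (2 * s - 1)" using s by (simp add: of_nat_diff)
    have "qsum (P0 (- int (s - 1))) (P0 0) (H a)
        = qsum (P0 (- int (s - 1))) (P0 0) (\<lambda>d. qsum (P 1) (P (int (2 * s))) (\<lambda>z. summand a d (a * z)))"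
    proof (intro qsum_cong fin_P0_neg)
      fix d assume "d \<in> P0 (- int (s - 1))"
      then have "d \<in> F0" using P0_F0 by blast
      then show "H a d = qsum (P 1) (P (int (2 * s))) (\<lambda>z. summand a d (a * z))"
        using qsum_scale[OF ava, of 1 "summand a d"] periodic_c[OF aF] s unfolding H_def e1 by simp
    qed
    also have "\<dots> = qsum (P 1) (P (int (2 * s))) (\<lambda>z. qsum (P0 (- int (s - 1))) (P0 0) (\<lambda>d. summand a d (a * z)))"
      by (rule qsum_swap)
    also have "\<dots> = qsum (P 1) (P (int (2 * s))) (\<lambda>z. \<theta> * Z ^ s * pole_sum \<theta> Z (s - 1) t2 * \<psi> (- (a * (t1 + t2 * Nm z + Tr (z * \<tau>)))))"
    proof (intro qsum_cong finite_index_P)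
      fix z assume z1: "z \<in> P 1"
      then have z: "z \<in> P 0" using P_antimono[of 0 1] by auto
      have dN: "a * Nm z \<in> P0 (- int (s - 1))" using P0_mult[OF a(1) Nm_P[OF z1]] s by (simp add: of_nat_diff)
      have "qsum (P0 (- int (s - 1))) (P0 0) (\<lambda>d. summand a d (a * z)) = qsum (P0 (- int (s - 1))) (P0 0) (\<lambda>d. summand a (d + a * Nm z) (a * z))"
        by (rule qsum_shift[OF fin_P0_neg periodic_d[OF aF] dN, symmetric])
      also have "\<dots> = qsum (P0 (- int (s - 1))) (P0 0) (\<lambda>d. \<theta> * Z ^ s * \<psi> (- (a * (t1 + t2 * Nm z + Tr (z * \<tau>)))) * (pole_weight \<theta> Z d * \<psi> (- (d * t2))))"
      proof (intro qsum_cong fin_P0_neg)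
        fix d assume d: "d \<in> P0 (- int (s - 1))"
        then have dF: "d \<in> F0" and dl: "d \<in> P0 (- int l)" using P0_F0 P0_antimono[of "- int l" "- int (s - 1)"] s by auto
        have "f a (d + a * Nm z) (a * z) = \<theta> * Z ^ s * pole_weight \<theta> Z d"
          using polar_weightD(3)[OF weight al z dl] pa s by (simp add: pole_weight_def)
        moreover have "\<psi> (- (a * t1 + (d + a * Nm z) * t2 + Tr (a * z * \<tau>))) = \<psi> (- (a * (t1 + t2 * Nm z + Tr (z * \<tau>)))) * \<psi> (- (d * t2))"
        proof -
          have "- (a * t1 + (d + a * Nm z) * t2 + Tr (a * z * \<tau>)) = - (a * (t1 + t2 * Nm z + Tr (z * \<tau>))) + - (d * t2)"
            using Tr_mult_F0[OF aF, of "z * \<tau>"] by (simp add: algebra_simps)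
          then show ?thesis using dF aF Tr_F0 Nm_F0 P0_F0[OF t1] P0_F0[OF t2] F0 by (simp only: psi_add)
        qed
        ultimately show "summand a (d + a * Nm z) (a * z)
            = \<theta> * Z ^ s * \<psi> (- (a * (t1 + t2 * Nm z + Tr (z * \<tau>)))) * (pole_weight \<theta> Z d * \<psi> (- (d * t2)))"
          unfolding summand_def by simp
      qed
      also have "\<dots> = \<theta> * Z ^ s * pole_sum \<theta> Z (s - 1) t2 * \<psi> (- (a * (t1 + t2 * Nm z + Tr (z * \<tau>))))"
        unfolding qsum_mult_left qsum_pole_weight[OF t2] by simp
      finally show "qsum (P0 (- int (s - 1))) (P0 0) (\<lambda>d. summand a d (a * z))
          = \<theta> * Z ^ s * pole_sum \<theta> Z (s - 1) t2 * \<psi> (- (a * (t1 + t2 * Nm z + Tr (z * \<tau>))))" .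
    qed (use s in simp)
    finally show ?thesis unfolding qsum_mult_left by simp
  qed
  have "qsum (P0 (- int s)) (P0 0) (\<lambda>a. of_bool (a \<notin> P0 (- int (s - 1))) * qsum (P0 (- int (s - 1))) (P0 0) (H a))
      = qsum (P0 (- int s)) (P0 0) (\<lambda>a. \<theta> * Z ^ s * pole_sum \<theta> Z (s - 1) t2 * qsum (P 1) (P (2 * int s)) (\<lambda>z.
          of_bool (a \<notin> P0 (- int (s - 1))) * \<psi> (- (a * (t1 + t2 * Nm z + Tr (z * \<tau>))))))"
  proof (intro qsum_cong fin_P0_neg)
    fix a assume m: "a \<in> P0 (- int s)"
    show "of_bool (a \<notin> P0 (- int (s - 1))) * qsum (P0 (- int (s - 1))) (P0 0) (H a)
      = \<theta> * Z ^ s * pole_sum \<theta> Z (s - 1) t2 * qsum (P 1) (P (2 * int s)) (\<lambda>z.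
          of_bool (a \<notin> P0 (- int (s - 1))) * \<psi> (- (a * (t1 + t2 * Nm z + Tr (z * \<tau>)))))"
    proof (cases "a \<in> P0 (- int (s - 1))")
      case True
      then show ?thesis by (simp add: qsum_const)
    next
      case False
      then show ?thesis unfolding H[OF m False] by simp
    qed
  qed
  also have "\<dots> = \<theta> * Z ^ s * pole_sum \<theta> Z (s - 1) t2 * qsum (P 1) (P (2 * int s)) (\<lambda>z.
      qsum (P0 (- int s)) (P0 0) (\<lambda>a. of_bool (a \<notin> P0 (- int (s - 1))) * \<psi> (- (a * (t1 + t2 * Nm z + Tr (z * \<tau>))))))"
    by (subst qsum_mult_left, subst qsum_swap) (rule refl)
  also have "\<dots> = diagonal_part1 s"
    unfolding diagonal_part1_def
  proof (intro arg_cong2[of _ _ _ _ "(*)"] refl qsum_cong finite_index_P)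
    fix z assume "z \<in> P 1"
    then have z: "z \<in> P 0" using P_antimono[of 0 1] by auto
    show "qsum (P0 (- int s)) (P0 0) (\<lambda>a. of_bool (a \<notin> P0 (- int (s - 1))) * \<psi> (- (a * (t1 + t2 * Nm z + Tr (z * \<tau>)))))
        = ramanujan s (t1 + t2 * Nm z + Tr (z * \<tau>))"
      by (rule qsum_psi_shell[OF value_integral[OF t1 t2 z] s(1)])
  qed (use s in simp)
  finally show ?thesis using 1 by simp
qed

theorem form_sum_eq:
  assumes "m \<le> l"
  shows "form_sum m m (2 * m) = 1 + (\<Sum>s = 1..m.
     antidiagonal_part (2 * s - 1) + diagonal_part1 s + antidiagonal_part (2 * s) + diagonal_part2 s)"
  using assms
proof (induction m)
  case 0
  then show ?case by (simp add: form_sum_0)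
next
  case (Suc m)
  have "form_sum (Suc m) (Suc m) (2 * Suc m) = form_sum (Suc m) m (2 * Suc m) + diagonal_part2 (Suc m)"
    using form_sum_step_d[of "Suc m"] Suc by simp
  also have "form_sum (Suc m) m (2 * Suc m) = form_sum (Suc m) m (2 * m + 1) + antidiagonal_part (2 * Suc m)"
    using form_sum_step_c[of "2 * Suc m"] Suc by simp
  also have "form_sum (Suc m) m (2 * m + 1) = form_sum m m (2 * m + 1) + diagonal_part1 (Suc m)"
    using form_sum_step_a[of "Suc m"] Suc by simp
  also have "form_sum m m (2 * m + 1) = form_sum m m (2 * m) + antidiagonal_part (2 * Suc m - 1)"
    using form_sum_step_c[of "2 * m + 1"] Suc by simp
  finally show ?case using Suc by (simp add: algebra_simps)
qed

end

section \<open>Reduction of the density to a finite sum\<close>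

lemma set_integral_disjoint_union:
  fixes f :: "'b \<Rightarrow> 'c :: {banach, second_countable_topology}"
  assumes T: "finite T" and C: "\<And>t. t \<in> T \<Longrightarrow> C t \<in> sets M" "\<And>t. t \<in> T \<Longrightarrow> emeasure M (C t) = ennreal m"
    and m: "m \<ge> 0" and disj: "disjoint_family_on C T" and A: "A = (\<Union>t \<in> T. C t)"
    and f: "\<And>t x. t \<in> T \<Longrightarrow> x \<in> C t \<Longrightarrow> f x = g t"
  shows "(LINT x : A | M. f x) = m *\<^sub>R (\<Sum>t \<in> T. g t)"
proof -
  have eq: "indicator A x *\<^sub>R f x = (\<Sum>t \<in> T. indicator (C t) x *\<^sub>R g t)" for x
  proof (cases "x \<in> A")
    case True
    then obtain t where t: "t \<in> T" "x \<in> C t" using A by blast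
    have "indicator (C s) x *\<^sub>R g s = (if s = t then g t else 0)" if "s \<in> T" for s
      using disj t that unfolding disjoint_family_on_def by (auto simp: indicator_def)
    then have "(\<Sum>s \<in> T. indicator (C s) x *\<^sub>R g s) = (\<Sum>s \<in> T. if s = t then g t else 0)" by (rule sum.cong[OF refl])
    then show ?thesis using True t f T by simp
  next
    case False
    then have "indicator (C t) x *\<^sub>R g t = 0" if "t \<in> T" for t using A that by (auto simp: indicator_def)
    then show ?thesis using False by (simp add: sum.neutral)
  qed
  have int: "integrable M (\<lambda>x. indicator (C t) x *\<^sub>R g t)" if "t \<in> T" for t
    using C[OF that] by (intro integrable_scaleR_left integrable_real_indicator) auto
  have val: "(\<integral>x. indicator (C t) x *\<^sub>R g t \<partial>M) = m *\<^sub>R g t" if "t \<in> T" for t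
  proof -
    have "(\<integral>x. indicator (C t) x *\<^sub>R g t \<partial>M) = integral\<^sup>L M (indicator (C t)) *\<^sub>R g t"
      using C[OF that] by (intro integral_scaleR_left integrable_real_indicator) auto
    also have "integral\<^sup>L M (indicator (C t)) = measure M (C t \<inter> space M)" by (rule Bochner_Integration.integral_indicator)
    also have "C t \<inter> space M = C t" using sets.sets_into_space[OF C(1)[OF that]] by blast
    also have "measure M (C t) = m" using C(2)[OF that] m by (simp add: measure_def)
    finally show ?thesis .
  qed
  have "(LINT x : A | M. f x) = (\<integral>x. (\<Sum>t \<in> T. indicator (C t) x *\<^sub>R g t) \<partial>M)"
    unfolding set_lebesgue_integral_def eq ..
  also have "\<dots> = (\<Sum>t \<in> T. m *\<^sub>R g t)" using int val by (simp add: Bochner_Integration.integral_sum)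
  finally show ?thesis by (simp add: scaleR_sum_right)
qed

lemma mult_mat_entry:
  assumes "A \<in> carrier_mat r s" "B \<in> carrier_mat s t" "i < r" "j < t"
  shows "(A * B) $$ (i, j) = (\<Sum>k < s. A $$ (i, k) * B $$ (k, j))"
  using assms by (simp add: scalar_prod_def atLeast0LessThan)

lemma sum_lessThan_2: "(\<Sum>i < (2 :: nat). f i) = f 0 + f 1"
  by (simp add: numeral_2_eq_2)

lemma sum_lessThan_add: "(\<Sum>k < m + n. f k) = (\<Sum>k < m. f k) + (\<Sum>k < (n :: nat). f (m + k))"
  by (induction n) (simp_all add: add.assoc)

context local_density_setting
begin

definition matrix_ball :: "'a mat set \<Rightarrow> nat \<Rightarrow> nat \<Rightarrow> int \<Rightarrow> 'a mat set" where
  "matrix_ball G m n k = {A \<in> G. \<forall>i < m. \<forall>j < n. A $$ (i, j) \<in> P k}"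

text \<open>The balls around the points of \<open>T\<close> are translates of one ball, so they have the same volume, and a function that
  is constant on them is integrated by summing its values.\<close>

lemma haar_cosets:
  assumes haar: "is_haar_measure av G K M"
    and G: "G \<subseteq> carrier_mat m n" "\<And>A B. A \<in> G \<Longrightarrow> B \<in> G \<Longrightarrow> A + B \<in> G" "\<And>A B. A \<in> G \<Longrightarrow> B \<in> G \<Longrightarrow> A - B \<in> G"
    and A: "A \<subseteq> G" and T: "finite T" "T \<subseteq> A"
    and rep: "\<And>V. V \<in> A \<Longrightarrow> \<exists>!t. t \<in> T \<and> V - t \<in> matrix_ball G m n k"
    and closed: "\<And>V t. V \<in> G \<Longrightarrow> t \<in> T \<Longrightarrow> V - t \<in> matrix_ball G m n k \<Longrightarrow> V \<in> A"
  shows "emeasure M A = of_nat (card T) * emeasure M (matrix_ball G m n k)"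
    and "emeasure M (matrix_ball G m n k) = ennreal c \<Longrightarrow> c \<ge> 0 \<Longrightarrow>
      (\<And>V t. V \<in> A \<Longrightarrow> t \<in> T \<Longrightarrow> V - t \<in> matrix_ball G m n k \<Longrightarrow> f V = (f t :: complex)) \<Longrightarrow>
      (LINT V : A | M. f V) = c *\<^sub>R (\<Sum>t \<in> T. f t)"
proof -
  define L where "L = matrix_ball G m n k"
  define C where "C = (\<lambda>t. {V \<in> G. V - t \<in> L})"
  have sp: "space M = G" "sets M = sigma_sets G {U. rel_open av G U}"
    and inv: "\<And>B E. B \<in> G \<Longrightarrow> E \<in> sets M \<Longrightarrow> emeasure M ((\<lambda>V. B + V) ` E) = emeasure M E"
    using haar unfolding is_haar_measure_def by auto
  have dimG: "dim_row V = m" "dim_col V = n" if "V \<in> G" for V using G(1) that by auto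
  have open_C: "rel_open av G (C t)" if t: "t \<in> G" for t
    unfolding rel_open_def
  proof (intro conjI ballI)
    show "C t \<subseteq> G" by (auto simp: C_def)
    fix V assume V: "V \<in> C t"
    show "\<exists>e > 0. \<forall>B \<in> G. (\<forall>i < dim_row V. \<forall>j < dim_col V. av (B $$ (i, j) - V $$ (i, j)) < e) \<longrightarrow> B \<in> C t"
    proof (intro exI[of _ "av \<pi> powi k"] conjI ballI impI)
      show "av \<pi> powi k > 0" using av_pi_pos by simp
      fix B assume B: "B \<in> G" "\<forall>i < dim_row V. \<forall>j < dim_col V. av (B $$ (i, j) - V $$ (i, j)) < av \<pi> powi k"
      have XG: "V \<in> G" and XL: "V - t \<in> L" using V by (auto simp: C_def)
      have "(B - t) $$ (i, j) \<in> P k" if ij: "i < m" "j < n" for i j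
      proof -
        have "B $$ (i, j) - V $$ (i, j) \<in> P k" using B(2) ij dimG[OF XG] by (simp add: P_def less_imp_le)
        moreover have "(V - t) $$ (i, j) \<in> P k" using XL ij by (auto simp: L_def matrix_ball_def)
        ultimately have "(B $$ (i, j) - V $$ (i, j)) + (V $$ (i, j) - t $$ (i, j)) \<in> P k"
          using dimG[OF XG] dimG[OF t] ij by (intro P_add) auto
        then show ?thesis using dimG[OF t] ij by simp
      qed
      then show "B \<in> C t" using B G(3)[OF B(1) t] by (auto simp: C_def L_def matrix_ball_def)
    qed
  qed
  have sets_C: "C t \<in> sets M" if "t \<in> G" for t
    unfolding sp using open_C[OF that] by (auto intro: sigma_sets.Basic)
  have subL: "L \<subseteq> G" by (auto simp: L_def matrix_ball_def)
  have em: "emeasure M (C t) = emeasure M L" if t: "t \<in> G" for t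
  proof -
    have z: "t - t \<in> G" using G t by blast
    have zc: "V - (t - t) = V" if "V \<in> G" for V
      using dimG[OF that] dimG[OF t] by (intro eq_matI) auto
    have L: "C (t - t) = L" using zc subL by (auto simp: C_def)
    have "(\<lambda>V. t + V) ` L = C t"
    proof (intro equalityI subsetI)
      fix V assume "V \<in> (\<lambda>V. t + V) ` L"
      then obtain Y where Y: "Y \<in> L" "V = t + Y" by blast
      then have "V - t = Y" using subL dimG[of Y] dimG[OF t] by (intro eq_matI) auto
      then show "V \<in> C t" using Y G(2)[OF t] subL by (auto simp: C_def)
    next
      fix V assume V: "V \<in> C t"
      then have "V = t + (V - t)" using dimG[of V] dimG[OF t] by (intro eq_matI) (auto simp: C_def)
      then show "V \<in> (\<lambda>V. t + V) ` L" using V by (auto simp: C_def)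
    qed
    then show ?thesis using inv[OF t, of L] sets_C[OF z] L by simp
  qed
  have TG: "t \<in> G" if "t \<in> T" for t using that T A by blast
  have disj: "disjoint_family_on C T"
    unfolding disjoint_family_on_def
  proof (intro ballI impI)
    fix s t assume st: "s \<in> T" "t \<in> T" "s \<noteq> t"
    show "C s \<inter> C t = {}"
    proof (rule ccontr)
      assume "C s \<inter> C t \<noteq> {}"
      then obtain V where V: "V \<in> G" "V - s \<in> L" "V - t \<in> L" by (auto simp: C_def)
      then have "V \<in> A" using closed[OF V(1) st(1)] by (simp add: L_def)
      then show False using rep V st unfolding L_def by blast
    qed
  qed
  have A_eq: "A = (\<Union>t \<in> T. C t)"
  proof (intro equalityI subsetI)
    fix V assume "V \<in> A"
    then obtain t where "t \<in> T" "V - t \<in> L" using rep[of V] unfolding L_def by blast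
    moreover have "V \<in> G" using \<open>V \<in> A\<close> A by blast
    ultimately show "V \<in> (\<Union>t \<in> T. C t)" by (auto simp: C_def)
  qed (use closed in \<open>auto simp: C_def L_def\<close>)
  have "emeasure M (\<Union>t \<in> T. C t) = (\<Sum>t \<in> T. emeasure M (C t))"
    using T(1) disj sets_C TG by (intro sum_emeasure[symmetric]) blast+
  then show "emeasure M A = of_nat (card T) * emeasure M (matrix_ball G m n k)"
    using em TG by (simp add: A_eq L_def)
  assume c: "emeasure M (matrix_ball G m n k) = ennreal c" "c \<ge> 0"
    and f: "\<And>V t. V \<in> A \<Longrightarrow> t \<in> T \<Longrightarrow> V - t \<in> matrix_ball G m n k \<Longrightarrow> f V = f t"
  show "(LINT V : A | M. f V) = c *\<^sub>R (\<Sum>t \<in> T. f t)"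
  proof (rule set_integral_disjoint_union[OF T(1) _ _ c(2) disj A_eq])
    show "C t \<in> sets M" if "t \<in> T" for t using sets_C TG that by blast
    show "emeasure M (C t) = ennreal c" if "t \<in> T" for t using em TG that c by (simp add: L_def)
    show "f V = f t" if "t \<in> T" "V \<in> C t" for t V
      using f[of V t] closed[of V t] that by (auto simp: C_def L_def)
  qed
qed

subsection \<open>Integral matrices with two columns\<close>

definition reps :: "nat \<Rightarrow> 'a set" where
  "reps N = some_transversal (P 0) (P (int N))"

definition rep_mats :: "nat \<Rightarrow> nat \<Rightarrow> 'a mat set" where
  "rep_mats N m = {V \<in> carrier_mat m 2. \<forall>i < m. \<forall>j < 2. V $$ (i, j) \<in> reps N}"

lemma sum_reps: "(\<Sum>x \<in> reps N. f x) = of_nat q ^ N * mean N f"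
  by (simp add: mean_def qsum_def reps_def)

lemma card_reps: "card (reps N) = q ^ N"
  using idx_P[of 0 "int N"] by (simp add: idx_def reps_def)

lemmas reps_facts = finite_indexD(4,5,6)[OF fin_O, folded reps_def]

lemma finite_rep_mats: "finite (rep_mats N m)"
proof -
  have "rep_mats N m \<subseteq> (\<lambda>g. mat m 2 (\<lambda>(i, j). g (i, j))) ` (PiE ({..<m} \<times> {..<2}) (\<lambda>_. reps N))"
  proof
    fix V assume V: "V \<in> rep_mats N m"
    let ?g = "\<lambda>p \<in> {..<m} \<times> {..<2}. V $$ p"
    have "V = mat m 2 (\<lambda>(i, j). ?g (i, j))" using V by (intro eq_matI) (auto simp: rep_mats_def)
    moreover have "?g \<in> PiE ({..<m} \<times> {..<2}) (\<lambda>_. reps N)" using V by (auto simp: rep_mats_def)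
    ultimately show "V \<in> (\<lambda>g. mat m 2 (\<lambda>(i, j). g (i, j))) ` (PiE ({..<m} \<times> {..<2}) (\<lambda>_. reps N))" by blast
  qed
  moreover have "finite (PiE ({..<m} \<times> {..<2 :: nat}) (\<lambda>_. reps N))"
    by (intro finite_PiE) (auto simp: reps_facts(1))
  ultimately show ?thesis using finite_surj by blast
qed

definition stack :: "nat \<Rightarrow> 'a mat \<Rightarrow> 'a mat \<Rightarrow> 'a mat" where
  "stack m V Y = mat (2 + m) 2 (\<lambda>(i, j). if i < 2 then V $$ (i, j) else Y $$ (i - 2, j))"

lemma stack_split:
  assumes "V \<in> carrier_mat (2 + m) 2"
  shows "stack m (mat 2 2 (\<lambda>(i, j). V $$ (i, j))) (mat m 2 (\<lambda>(i, j). V $$ (2 + i, j))) = V"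
proof (rule eq_matI)
  fix i j assume "i < dim_row V" "j < dim_col V"
  then have ij: "i < 2 + m" "j < 2" using assms by auto
  show "stack m (mat 2 2 (\<lambda>(i, j). V $$ (i, j))) (mat m 2 (\<lambda>(i, j). V $$ (2 + i, j))) $$ (i, j) = V $$ (i, j)"
  proof (cases "i < 2")
    case False
    then obtain k where "i = 2 + k" using le_Suc_ex not_less by blast
    then show ?thesis using ij by (simp add: stack_def)
  qed (use ij in \<open>simp add: stack_def\<close>)
qed (use assms in \<open>auto simp: stack_def\<close>)

lemma sum_rep_mats_stack:
  "(\<Sum>V \<in> rep_mats N (2 + m). g V) = (\<Sum>V \<in> rep_mats N 2. \<Sum>Y \<in> rep_mats N m. g (stack m V Y))"
proof -
  let ?h = "\<lambda>(V, Y). stack m V Y"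
  have "bij_betw ?h (rep_mats N 2 \<times> rep_mats N m) (rep_mats N (2 + m))"
  proof (rule bij_betw_byWitness[where f' = "\<lambda>V. (mat 2 2 (\<lambda>(i, j). V $$ (i, j)), mat m 2 (\<lambda>(i, j). V $$ (2 + i, j)))"])
    show "\<forall>p \<in> rep_mats N 2 \<times> rep_mats N m.
        (mat 2 2 (\<lambda>(i, j). ?h p $$ (i, j)), mat m 2 (\<lambda>(i, j). ?h p $$ (2 + i, j))) = p"
    proof clarify
      fix V Y assume "V \<in> rep_mats N 2" "Y \<in> rep_mats N m"
      then have "V \<in> carrier_mat 2 2" "Y \<in> carrier_mat m 2" by (auto simp: rep_mats_def)
      then show "mat 2 2 (\<lambda>(i, j). stack m V Y $$ (i, j)) = V \<and> mat m 2 (\<lambda>(i, j). stack m V Y $$ (2 + i, j)) = Y"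
        by (auto simp: stack_def intro!: eq_matI)
    qed
    show "\<forall>V \<in> rep_mats N (2 + m). ?h (mat 2 2 (\<lambda>(i, j). V $$ (i, j)), mat m 2 (\<lambda>(i, j). V $$ (2 + i, j))) = V"
    proof
      fix V assume "V \<in> rep_mats N (2 + m)"
      then have "V \<in> carrier_mat (2 + m) 2" by (simp add: rep_mats_def)
      from stack_split[OF this]
      show "?h (mat 2 2 (\<lambda>(i, j). V $$ (i, j)), mat m 2 (\<lambda>(i, j). V $$ (2 + i, j))) = V" by simp
    qed
    show "?h ` (rep_mats N 2 \<times> rep_mats N m) \<subseteq> rep_mats N (2 + m)"
      by (auto simp: rep_mats_def stack_def)
    show "(\<lambda>V. (mat 2 2 (\<lambda>(i, j). V $$ (i, j)), mat m 2 (\<lambda>(i, j). V $$ (2 + i, j)))) ` rep_mats N (2 + m)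
        \<subseteq> rep_mats N 2 \<times> rep_mats N m"
      by (auto simp: rep_mats_def)
  qed
  from sum.reindex_bij_betw[OF this, of g] show ?thesis
    by (simp add: sum.cartesian_product split_beta)
qed

definition mat2 :: "'a \<Rightarrow> 'a \<Rightarrow> 'a \<Rightarrow> 'a \<Rightarrow> 'a mat" where
  "mat2 x y z w = mat 2 2 (\<lambda>(i, j). if i = 0 then (if j = 0 then x else y) else (if j = 0 then z else w))"

lemma mat2_simps [simp]: "mat2 x y z w \<in> carrier_mat 2 2" "dim_row (mat2 x y z w) = 2" "dim_col (mat2 x y z w) = 2"
  "mat2 x y z w $$ (0, 0) = x" "mat2 x y z w $$ (0, Suc 0) = y" "mat2 x y z w $$ (Suc 0, 0) = z" "mat2 x y z w $$ (Suc 0, Suc 0) = w"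
  by (simp_all add: mat2_def)

lemma mat2_eta: "V \<in> carrier_mat 2 2 \<Longrightarrow> mat2 (V $$ (0, 0)) (V $$ (0, 1)) (V $$ (1, 0)) (V $$ (1, 1)) = V"
  by (intro eq_matI) (auto simp: mat2_def less_2_cases_iff)

lemma all_less_2: "(\<forall>i < 2. Q i) \<longleftrightarrow> Q 0 \<and> Q (1 :: nat)"
  by (auto simp: less_2_cases_iff)

lemma sum_rep_mats_2:
  "(\<Sum>V \<in> rep_mats N 2. g V) = (\<Sum>x \<in> reps N. \<Sum>y \<in> reps N. \<Sum>z \<in> reps N. \<Sum>w \<in> reps N. g (mat2 x y z w))"
proof -
  let ?h = "\<lambda>(x, y, z, w). mat2 x y z w"
  let ?R = "reps N \<times> reps N \<times> reps N \<times> reps N"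
  have "bij_betw ?h ?R (rep_mats N 2)"
  proof (rule bij_betw_byWitness[where f' = "\<lambda>V. (V $$ (0, 0), V $$ (0, 1), V $$ (1, 0), V $$ (1, 1))"])
    show "\<forall>V \<in> rep_mats N 2. ?h (V $$ (0, 0), V $$ (0, 1), V $$ (1, 0), V $$ (1, 1)) = V"
      using mat2_eta by (auto simp: rep_mats_def)
    show "?h ` ?R \<subseteq> rep_mats N 2" by (auto simp: rep_mats_def all_less_2)
    show "(\<lambda>V. (V $$ (0, 0), V $$ (0, 1), V $$ (1, 0), V $$ (1, 1))) ` rep_mats N 2 \<subseteq> ?R"
      by (auto simp: rep_mats_def all_less_2)
  qed auto
  from sum.reindex_bij_betw[OF this, of g] show ?thesis
    by (simp add: sum.cartesian_product split_beta)
qed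

definition mat_mean :: "nat \<Rightarrow> nat \<Rightarrow> ('a mat \<Rightarrow> complex) \<Rightarrow> complex" where
  "mat_mean N m g = (\<Sum>V \<in> rep_mats N m. g V) / of_nat (card (rep_mats N m))"

lemma card_rep_mats_2: "card (rep_mats N 2) = q ^ N * q ^ N * q ^ N * q ^ N"
  using sum_rep_mats_2[of "\<lambda>_. 1 :: nat" N] by (simp add: card_reps mult.assoc)

lemma card_rep_mats_stack: "card (rep_mats N (2 + m)) = card (rep_mats N 2) * card (rep_mats N m)"
  using sum_rep_mats_stack[of "\<lambda>_. 1 :: nat" N m] by simp

lemma rep_mats_0: "rep_mats N 0 = {0\<^sub>m 0 2}"
  by (auto simp: rep_mats_def intro: eq_matI)

lemma card_rep_mats_pos: "card (rep_mats N m) > 0"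
proof -
  have "reps N \<noteq> {}" using card_reps[of N] by (metis card.empty power_not_zero q_nonzero(1))
  then obtain x where "x \<in> reps N" by blast
  then have "mat m 2 (\<lambda>_. x) \<in> rep_mats N m" by (auto simp: rep_mats_def)
  then show ?thesis using finite_rep_mats card_gt_0_iff by blast
qed

lemma mat_mean_stack:
  assumes "\<And>V Y. V \<in> rep_mats N 2 \<Longrightarrow> Y \<in> rep_mats N m \<Longrightarrow> g (stack m V Y) = g1 V * g2 Y"
  shows "mat_mean N (2 + m) g = mat_mean N 2 g1 * mat_mean N m g2"
proof -
  have "(\<Sum>V \<in> rep_mats N (2 + m). g V) = (\<Sum>V \<in> rep_mats N 2. \<Sum>Y \<in> rep_mats N m. g1 V * g2 Y)"
    unfolding sum_rep_mats_stack using assms by (intro sum.cong refl)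
  also have "\<dots> = (\<Sum>V \<in> rep_mats N 2. g1 V) * (\<Sum>Y \<in> rep_mats N m. g2 Y)"
    by (simp add: sum_product)
  finally show ?thesis unfolding mat_mean_def card_rep_mats_stack by simp
qed

lemma mat_mean_2: "mat_mean N 2 g = mean N (\<lambda>x. mean N (\<lambda>y. mean N (\<lambda>z. mean N (\<lambda>w. g (mat2 x y z w)))))"
  by (simp add: mat_mean_def sum_rep_mats_2 sum_reps card_rep_mats_2 mean_mult_left)

text \<open>The trace of \<open>Y (V\<^sup>* S V)\<close>, written out in entries.\<close>

definition herm_trace :: "'a mat \<Rightarrow> 'a mat \<Rightarrow> 'a mat \<Rightarrow> 'a" where
  "herm_trace Y S V = (\<Sum>k < dim_row S. \<Sum>l < dim_row S. S $$ (k, l) *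
     (\<Sum>i < 2. \<Sum>j < 2. Y $$ (i, j) * bar (V $$ (k, j)) * V $$ (l, i)))"

lemma mat_tr_mult:
  assumes "A \<in> carrier_mat 2 2" "B \<in> carrier_mat 2 2"
  shows "mat_tr (A * B) = A $$ (0, 0) * B $$ (0, 0) + A $$ (0, 1) * B $$ (1, 0) + A $$ (1, 0) * B $$ (0, 1) + A $$ (1, 1) * B $$ (1, 1)"
proof -
  have d: "dim_row (A * B) = 2" using assms by simp
  show ?thesis
    unfolding mat_tr_def d sum_lessThan_2
    using mult_mat_entry[OF assms, of 0 0] mult_mat_entry[OF assms, of 1 1] by (simp add: sum_lessThan_2 add.assoc)
qed

lemma mat_tr_herm:
  assumes Y: "Y \<in> carrier_mat 2 2" and S: "S \<in> carrier_mat m m" and V: "V \<in> carrier_mat m 2" and T: "T \<in> carrier_mat 2 2"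
  shows "mat_tr (Y * (adj bar V * S * V - T)) = herm_trace Y S V - mat_tr (Y * T)"
proof -
  have aX: "adj bar V \<in> carrier_mat 2 m" using V by (auto simp: adj_def)
  have antidiagonal_unimodular_algebra: "adj bar V * S \<in> carrier_mat 2 m" using aX S by simp
  define W where "W = adj bar V * S * V"
  have Wc: "W \<in> carrier_mat 2 2" using antidiagonal_unimodular_algebra V by (simp add: W_def)
  have W: "W $$ (j, i) = (\<Sum>k < m. \<Sum>l < m. S $$ (k, l) * (bar (V $$ (k, j)) * V $$ (l, i)))" if "i < 2" "j < 2" for i j
  proof -
    have "W $$ (j, i) = (\<Sum>l < m. (\<Sum>k < m. bar (V $$ (k, j)) * S $$ (k, l)) * V $$ (l, i))"
      unfolding W_def mult_mat_entry[OF antidiagonal_unimodular_algebra V that(2,1)]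
    proof (intro sum.cong refl, goal_cases)
      case (1 l)
      then have "(adj bar V * S) $$ (j, l) = (\<Sum>k < m. adj bar V $$ (j, k) * S $$ (k, l))"
        using mult_mat_entry[OF aX S that(2)] by simp
      also have "\<dots> = (\<Sum>k < m. bar (V $$ (k, j)) * S $$ (k, l))"
        using V that by (intro sum.cong refl) (auto simp: adj_def)
      finally show ?case by simp
    qed
    also have "\<dots> = (\<Sum>l < m. \<Sum>k < m. S $$ (k, l) * (bar (V $$ (k, j)) * V $$ (l, i)))"
      unfolding sum_distrib_right by (intro sum.cong refl) (simp add: algebra_simps)
    finally show ?thesis by (subst sum.swap)
  qed
  have diagonal_unimodular_algebra: "dim_row S = m" using S by simp
  have "mat_tr (Y * (W - T)) = mat_tr (Y * W) - mat_tr (Y * T)"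
    using mat_tr_mult[OF Y minus_carrier_mat[OF T, of W]] mat_tr_mult[OF Y Wc] mat_tr_mult[OF Y T] Wc T by (simp add: algebra_simps)
  also have "mat_tr (Y * W) = herm_trace Y S V"
    unfolding mat_tr_mult[OF Y Wc] herm_trace_def diagonal_unimodular_algebra
    by (simp add: W sum_lessThan_2 sum_distrib_left sum.distrib algebra_simps)
  finally show ?thesis by (simp add: W_def)
qed

lemma herm_trace_stack:
  assumes A: "A \<in> carrier_mat 2 2" and D: "D \<in> carrier_mat m m"
  shows "herm_trace Y (four_block_mat A (0\<^sub>m 2 m) (0\<^sub>m m 2) D) (stack m V V') = herm_trace Y A V + herm_trace Y D V'"
proof -
  let ?B = "\<lambda>k l. \<Sum>i < 2. \<Sum>j < 2. Y $$ (i, j) * bar (stack m V V' $$ (k, j)) * stack m V V' $$ (l, i)"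
  have dims: "dim_row A = 2" "dim_col A = 2" "dim_row D = m" "dim_col D = m" using A D by auto
  have 1: "?B k l = (\<Sum>i < 2. \<Sum>j < 2. Y $$ (i, j) * bar (V $$ (k, j)) * V $$ (l, i))" if "k < 2" "l < 2" for k l
    using that by (simp add: stack_def sum_lessThan_2)
  have 2: "?B (2 + k) (2 + l) = (\<Sum>i < 2. \<Sum>j < 2. Y $$ (i, j) * bar (V' $$ (k, j)) * V' $$ (l, i))" if "k < m" "l < m" for k l
    using that by (simp add: stack_def sum_lessThan_2)
  have "herm_trace Y (four_block_mat A (0\<^sub>m 2 m) (0\<^sub>m m 2) D) (stack m V V')
      = (\<Sum>k < 2. \<Sum>l < 2. A $$ (k, l) * ?B k l) + (\<Sum>k < m. \<Sum>l < m. D $$ (k, l) * ?B (2 + k) (2 + l))"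
    unfolding herm_trace_def index_mat_four_block(2) dims sum_lessThan_add sum.distrib[symmetric]
    by (simp add: dims)
  also have "\<dots> = herm_trace Y A V + herm_trace Y D V'"
    unfolding herm_trace_def dims using 1 2 by (intro arg_cong2[of _ _ _ _ "(+)"] sum.cong refl) auto
  finally show ?thesis .
qed

lemma diag_block_carrier:
  assumes "\<And>A. A \<in> set As \<Longrightarrow> A \<in> carrier_mat 2 2"
  shows "diag_block_mat As \<in> carrier_mat (2 * length As) (2 * length As)"
  using assms
proof (induction As)
  case (Cons A As)
  then have "A \<in> carrier_mat 2 2" "diag_block_mat As \<in> carrier_mat (2 * length As) (2 * length As)" by auto
  from four_block_carrier_mat[OF this] show ?case by (simp add: Let_def)
qed simp

text \<open>Orthogonal sums: the phase is additive over the blocks, which involve disjoint sets of rows.\<close>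

lemma mat_mean_diag_block:
  assumes "\<And>A. A \<in> set As \<Longrightarrow> A \<in> carrier_mat 2 2"
    and "\<And>A V. A \<in> set As \<Longrightarrow> herm_trace Y A V \<in> F0"
  shows "(\<forall>V. V \<in> carrier_mat (2 * length As) 2 \<longrightarrow> herm_trace Y (diag_block_mat As) V \<in> F0) \<and>
    mat_mean N (2 * length As) (\<lambda>V. \<psi> (herm_trace Y (diag_block_mat As) V)) = (\<Prod>A \<leftarrow> As. mat_mean N 2 (\<lambda>V. \<psi> (herm_trace Y A V)))"
  using assms
proof (induction As)
  case Nil
  show ?case using F0 by (simp add: herm_trace_def mat_mean_def rep_mats_0)
next
  case (Cons A As)
  let ?m = "2 * length As"
  have A: "A \<in> carrier_mat 2 2" using Cons.prems by simp
  have D: "diag_block_mat As \<in> carrier_mat ?m ?m" using diag_block_carrier[of As] Cons.prems(1) by simp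
  have e: "2 * length (A # As) = 2 + ?m" by simp
  have db: "diag_block_mat (A # As) = four_block_mat A (0\<^sub>m 2 ?m) (0\<^sub>m ?m 2) (diag_block_mat As)"
    using A D by (simp add: Let_def)
  have IH: "\<And>V. V \<in> carrier_mat ?m 2 \<Longrightarrow> herm_trace Y (diag_block_mat As) V \<in> F0"
    "mat_mean N ?m (\<lambda>V. \<psi> (herm_trace Y (diag_block_mat As) V)) = (\<Prod>A \<leftarrow> As. mat_mean N 2 (\<lambda>V. \<psi> (herm_trace Y A V)))"
    using Cons by auto
  have st: "herm_trace Y (diag_block_mat (A # As)) (stack ?m V V') = herm_trace Y A V + herm_trace Y (diag_block_mat As) V'" for V V'
    unfolding db by (rule herm_trace_stack[OF A D])
  have "herm_trace Y (diag_block_mat (A # As)) V \<in> F0" if V: "V \<in> carrier_mat (2 + ?m) 2" for V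
  proof -
    let ?V = "mat 2 2 (\<lambda>(i, j). V $$ (i, j))" and ?V' = "mat ?m 2 (\<lambda>(i, j). V $$ (2 + i, j))"
    from stack_split[OF V] have "V = stack ?m ?V ?V'" by simp
    moreover have "?V' \<in> carrier_mat ?m 2" by simp
    ultimately show ?thesis using st[of ?V ?V'] IH(1) Cons.prems(2)[of A ?V] F0(4) by simp
  qed
  moreover have "mat_mean N (2 + ?m) (\<lambda>V. \<psi> (herm_trace Y (diag_block_mat (A # As)) V))
      = mat_mean N 2 (\<lambda>V. \<psi> (herm_trace Y A V)) * mat_mean N ?m (\<lambda>V. \<psi> (herm_trace Y (diag_block_mat As) V))"
    using IH(1) Cons.prems(2)[of A] by (intro mat_mean_stack) (simp add: st psi_add rep_mats_def del: diag_block_mat.simps)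
  ultimately show ?case unfolding e by (simp add: IH(2) del: diag_block_mat.simps)
qed


subsection \<open>The two building blocks\<close>

lemma bar_inverse: "bar (inverse x) = inverse (bar x)"
proof (cases "x = 0")
  case False
  then have "bar (inverse x) * bar x = 1" using bar_mult[of "inverse x" x] by simp
  then show ?thesis by (metis inverse_unique mult.commute)
qed simp

lemma diag2_eq: "diag2 (x :: 'a) y = mat2 x 0 0 y" and antidiag2_eq: "antidiag2 (x :: 'a) y = mat2 0 x y 0"
  unfolding diag2_def antidiag2_def mat_of_rows_list_def mat2_def
  by (intro eq_matI; auto simp: less_2_cases_iff)+

lemma diag2_simps [simp]: "diag2 (x :: 'a) y \<in> carrier_mat 2 2" "dim_row (diag2 x y) = 2" "dim_col (diag2 x y) = 2"
  "diag2 x y $$ (0, 0) = x" "diag2 x y $$ (0, Suc 0) = 0" "diag2 x y $$ (Suc 0, 0) = 0" "diag2 x y $$ (Suc 0, Suc 0) = y"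
  by (simp_all add: diag2_eq)

lemma antidiag2_simps [simp]: "antidiag2 (x :: 'a) y \<in> carrier_mat 2 2" "dim_row (antidiag2 x y) = 2" "dim_col (antidiag2 x y) = 2"
  "antidiag2 x y $$ (0, 0) = 0" "antidiag2 x y $$ (0, Suc 0) = x" "antidiag2 x y $$ (Suc 0, 0) = y" "antidiag2 x y $$ (Suc 0, Suc 0) = 0"
  by (simp_all add: antidiag2_eq)

definition gram :: "'a \<Rightarrow> 'a \<Rightarrow> 'a \<Rightarrow> 'a mat" where
  "gram a d c = mat2 a c (bar c) d"

lemma gram_simps [simp]: "gram a d c \<in> carrier_mat 2 2" "dim_row (gram a d c) = 2" "dim_col (gram a d c) = 2"
  "gram a d c $$ (0, 0) = a" "gram a d c $$ (0, Suc 0) = c" "gram a d c $$ (Suc 0, 0) = bar c" "gram a d c $$ (Suc 0, Suc 0) = d"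
  by (simp_all add: gram_def)

lemma herm_trace_diag2:
  assumes v: "v \<in> F0"
  shows "herm_trace (gram a d c) (diag2 v 1) V =
    qform (v * a) (v * d) (v * c) (V $$ (0, 0)) (V $$ (0, 1)) + qform a d c (V $$ (1, 0)) (V $$ (1, 1))"
  by (simp add: herm_trace_def sum_lessThan_2 qform_def Nm_def Tr_def bar_mult bar_F0[OF v] algebra_simps)

lemma herm_trace_hyperbolic:
  assumes "a \<in> F0" "d \<in> F0"
  shows "herm_trace (gram a d c) (hyperbolic \<pi>) V =
    Tr (inverse \<pi> * (a * bar (V $$ (0, 0)) + c * bar (V $$ (0, 1))) * V $$ (1, 0)) +
    Tr (inverse \<pi> * (bar c * bar (V $$ (0, 0)) + d * bar (V $$ (0, 1))) * V $$ (1, 1))"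
  using assms
  by (simp add: herm_trace_def hyperbolic_def sum_lessThan_2 Tr_def bar_mult bar_add bar_F0 bar_inverse algebra_simps)

lemma mat_mean_diag2:
  assumes v: "v \<in> F0" and F: "a \<in> F0" "d \<in> F0"
  shows "mat_mean N 2 (\<lambda>V. \<psi> (herm_trace (gram a d c) (diag2 v 1) V))
    = form_gauss N (v * a) (v * d) (v * c) * form_gauss N a d c"
proof -
  have "\<psi> (qform (v * a) (v * d) (v * c) x y + qform a d c z w) = \<psi> (qform (v * a) (v * d) (v * c) x y) * \<psi> (qform a d c z w)" for x y z w
    using v F F0 by (intro psi_add qform_F0) auto
  then show ?thesis
    by (simp add: mat_mean_2 herm_trace_diag2[OF v] form_gauss_def mean_mult_left mean_mult_right)
qed

text \<open>The hyperbolic form is linear in each of the two rows of \<open>V\<close>. Integrating over one row leaves the condition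
  that the Gram matrix maps the other row to an integral vector; the entry \<open>\<pi>\<^sup>-\<^sup>1\<close> of the plane cancels the
  inverse different.\<close>

lemma mat_mean_hyperbolic:
  assumes a: "a \<in> P0 (- int l)" "d \<in> P0 (- int l)" "c \<in> P (- 2 * int l)" and N: "N \<ge> 2 * l"
  shows "mat_mean N 2 (\<lambda>V. \<psi> (herm_trace (gram a d c) (hyperbolic \<pi>) V)) = form_volume N a d c"
proof -
  have F: "a \<in> F0" "d \<in> F0" using a P0_F0 by auto
  have i: "inverse \<pi> * x \<in> P k \<longleftrightarrow> x \<in> P (k + 1)" for x k
    using P_mult_iff[of "inverse \<pi>" "- 1" x k] by (simp add: av_inverse power_int_minus)
  have m: "mean N (\<lambda>z. \<psi> (Tr (inverse \<pi> * w * z))) = of_bool (w \<in> P 0)" if "w \<in> P (- 2 * int l)" for w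
  proof -
    have "w \<in> P (- int N)" using that P_antimono[of "- int N" "- 2 * int l"] N by auto
    then have "inverse \<pi> * w \<in> P (- int N - 1)" using i[of w "- int N - 1"] by simp
    then show ?thesis using mean_psi_Tr i[of w "- 1"] by simp
  qed
  have aP: "a \<in> P (- 2 * int l)" "d \<in> P (- 2 * int l)" using P0_P[OF a(1)] P0_P[OF a(2)] by auto
  have "mat_mean N 2 (\<lambda>V. \<psi> (herm_trace (gram a d c) (hyperbolic \<pi>) V)) =
      mean N (\<lambda>x. mean N (\<lambda>y. mean N (\<lambda>z. \<psi> (Tr (inverse \<pi> * (a * bar x + c * bar y) * z))) *
        mean N (\<lambda>w. \<psi> (Tr (inverse \<pi> * (bar c * bar x + d * bar y) * w)))))"
    by (simp add: mat_mean_2 herm_trace_hyperbolic[OF F] psi_add Tr_F0 mean_mult_left mean_mult_right)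
  also have "\<dots> = form_volume N a d c"
    unfolding form_volume_def
  proof (intro mean_cong)
    fix x y assume xy: "x \<in> P 0" "y \<in> P 0"
    have 1: "a * bar x + c * bar y \<in> P (- 2 * int l)" "bar c * bar x + d * bar y \<in> P (- 2 * int l)"
      using P_mult[OF aP(1), of "bar x" 0] P_mult[OF a(3), of "bar y" 0] P_mult[of "bar c" "- 2 * int l" "bar x" 0]
        P_mult[OF aP(2), of "bar y" 0] a(3) xy by (auto intro!: P_add)
    have 2: "a * bar x + c * bar y \<in> P 0 \<longleftrightarrow> a * x + bar c * y \<in> P 0"
      using bar_P[of "a * bar x + c * bar y" 0] F by (simp add: bar_add bar_mult bar_F0)
    have 3: "bar c * bar x + d * bar y \<in> P 0 \<longleftrightarrow> c * x + d * y \<in> P 0"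
      using bar_P[of "bar c * bar x + d * bar y" 0] F by (simp add: bar_add bar_mult bar_F0)
    show "mean N (\<lambda>z. \<psi> (Tr (inverse \<pi> * (a * bar x + c * bar y) * z))) *
        mean N (\<lambda>w. \<psi> (Tr (inverse \<pi> * (bar c * bar x + d * bar y) * w)))
      = of_bool (a * x + bar c * y \<in> P 0) * of_bool (c * x + d * y \<in> P 0)"
      unfolding m[OF 1(1)] m[OF 1(2)] 2 3 ..
  qed
  finally show ?thesis .
qed

subsection \<open>The truncated density\<close>

lemma P_sum: "(\<And>i. i \<in> I \<Longrightarrow> g i \<in> P k) \<Longrightarrow> sum g I \<in> P k"
  by (induction I rule: infinite_finite_induct) (auto intro: P_add)

lemma herm_trace_cong:
  assumes Y: "\<And>i j. i < 2 \<Longrightarrow> j < 2 \<Longrightarrow> Y $$ (i, j) \<in> P (- 2 * int l)"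
    and S: "S \<in> carrier_mat m m" "\<And>i j. i < m \<Longrightarrow> j < m \<Longrightarrow> S $$ (i, j) \<in> P (- 1)"
    and V: "\<And>i j. i < m \<Longrightarrow> j < 2 \<Longrightarrow> V $$ (i, j) \<in> P 0" "\<And>i j. i < m \<Longrightarrow> j < 2 \<Longrightarrow> V' $$ (i, j) \<in> P 0"
    and d: "\<And>i j. i < m \<Longrightarrow> j < 2 \<Longrightarrow> V $$ (i, j) - V' $$ (i, j) \<in> P (2 * int l + 1)"
  shows "herm_trace Y S V - herm_trace Y S V' \<in> P 0"
proof -
  have "herm_trace Y S V - herm_trace Y S V' = (\<Sum>k < m. \<Sum>n < m. \<Sum>i < 2. \<Sum>j < 2.
      S $$ (k, n) * (Y $$ (i, j) * ((bar (V $$ (k, j)) - bar (V' $$ (k, j))) * V $$ (n, i) + bar (V' $$ (k, j)) * (V $$ (n, i) - V' $$ (n, i)))))"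
    using S(1) unfolding herm_trace_def
    by (simp add: sum_lessThan_2 algebra_simps flip: sum_subtractf)
  also have "\<dots> \<in> P 0"
  proof (intro P_sum)
    fix k n i j :: nat assume "k \<in> {..<m}" "n \<in> {..<m}" "i \<in> {..<2}" "j \<in> {..<2}"
    then have *: "k < m" "n < m" "i < 2" "j < 2" by auto
    have "(bar (V $$ (k, j)) - bar (V' $$ (k, j))) * V $$ (n, i) \<in> P (2 * int l + 1 + 0)"
      using * V d by (intro P_mult) (simp_all flip: bar_diff)
    moreover have "bar (V' $$ (k, j)) * (V $$ (n, i) - V' $$ (n, i)) \<in> P (0 + (2 * int l + 1))"
      using * V d by (intro P_mult) simp_all
    ultimately have "(bar (V $$ (k, j)) - bar (V' $$ (k, j))) * V $$ (n, i) + bar (V' $$ (k, j)) * (V $$ (n, i) - V' $$ (n, i)) \<in> P (2 * int l + 1)"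
      by (intro P_add) simp_all
    from P_mult[OF S(2)[OF *(1,2)] P_mult[OF Y[OF *(3,4)] this]]
    show "S $$ (k, n) * (Y $$ (i, j) * ((bar (V $$ (k, j)) - bar (V' $$ (k, j))) * V $$ (n, i) + bar (V' $$ (k, j)) * (V $$ (n, i) - V' $$ (n, i)))) \<in> P 0"
      by simp
  qed
  finally show ?thesis .
qed

lemma int_mats_ball: "int_mats av m n = matrix_ball (carrier_mat m n) m n 0"
  by (auto simp: int_mats_def matrix_ball_def P_int_ring)

lemma int_mats_reps:
  assumes V: "V \<in> int_mats av m 2"
  shows "\<exists>!t. t \<in> rep_mats N m \<and> V - t \<in> matrix_ball (carrier_mat m 2) m 2 (int N)"
proof -
  have Vc: "V \<in> carrier_mat m 2" and VP: "\<And>i j. i < m \<Longrightarrow> j < 2 \<Longrightarrow> V $$ (i, j) \<in> P 0"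
    using V by (auto simp: int_mats_ball matrix_ball_def)
  define c where "c = (\<lambda>x. THE t. t \<in> reps N \<and> x - t \<in> P (int N))"
  have c: "c x \<in> reps N \<and> x - c x \<in> P (int N)" if "x \<in> P 0" for x
    unfolding c_def by (rule theI') (use reps_facts(2) that in \<open>auto simp: transversal_def\<close>)
  show ?thesis
  proof (rule ex1I[of _ "mat m 2 (\<lambda>p. c (V $$ p))"])
    show "mat m 2 (\<lambda>p. c (V $$ p)) \<in> rep_mats N m \<and> V - mat m 2 (\<lambda>p. c (V $$ p)) \<in> matrix_ball (carrier_mat m 2) m 2 (int N)"
      using c VP Vc by (auto simp: rep_mats_def matrix_ball_def)
    fix t assume t: "t \<in> rep_mats N m \<and> V - t \<in> matrix_ball (carrier_mat m 2) m 2 (int N)"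
    then have tc: "t \<in> carrier_mat m 2" by (simp add: rep_mats_def)
    show "t = mat m 2 (\<lambda>p. c (V $$ p))"
    proof (rule eq_matI)
      fix i j assume "i < dim_row (mat m 2 (\<lambda>p. c (V $$ p)))" "j < dim_col (mat m 2 (\<lambda>p. c (V $$ p)))"
      then have ij: "i < m" "j < 2" by auto
      have "V $$ (i, j) - t $$ (i, j) \<in> P (int N)" "t $$ (i, j) \<in> reps N"
        using t tc ij by (auto simp: matrix_ball_def rep_mats_def)
      then have "t $$ (i, j) = c (V $$ (i, j))"
        using transversal_unique[OF reps_facts(2) VP[OF ij], where s = "t $$ (i, j)" and t = "c (V $$ (i, j))"] c[OF VP[OF ij]] by blast
      then show "t $$ (i, j) = mat m 2 (\<lambda>p. c (V $$ p)) $$ (i, j)" using ij by simp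
    qed (use tc in auto)
  qed
qed

text \<open>The integrand is constant modulo \<open>\<pi>\<^sup>N\<close>, so the Haar integral is an average over representatives.\<close>

lemma inner_integral:
  assumes f: "\<And>V t. V \<in> int_mats av m 2 \<Longrightarrow> t \<in> int_mats av m 2 \<Longrightarrow>
      (\<And>i j. i < m \<Longrightarrow> j < 2 \<Longrightarrow> V $$ (i, j) - t $$ (i, j) \<in> P (int N)) \<Longrightarrow> f V = f t"
  shows "(LINT V : int_mats av m 2 | \<mu> m 2. f V) = mat_mean N m f"
proof -
  let ?G = "carrier_mat m 2 :: 'a mat set"
  have sub: "rep_mats N m \<subseteq> int_mats av m 2"
    using reps_facts(3) by (auto simp: rep_mats_def int_mats_ball matrix_ball_def)
  have cl: "V \<in> int_mats av m 2" if h: "V \<in> ?G" "t \<in> rep_mats N m" "V - t \<in> matrix_ball ?G m 2 (int N)" for V t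
  proof -
    have tc: "t \<in> int_mats av m 2" using sub h by blast
    have "V $$ (i, j) \<in> P 0" if ij: "i < m" "j < 2" for i j
    proof -
      have "V $$ (i, j) - t $$ (i, j) \<in> P (int N)" "t $$ (i, j) \<in> P 0"
        using h(3) tc ij by (auto simp: matrix_ball_def int_mats_ball)
      then have "(V $$ (i, j) - t $$ (i, j)) + t $$ (i, j) \<in> P 0"
        using P_antimono[of 0 "int N"] by (intro P_add) auto
      then show ?thesis by simp
    qed
    then show ?thesis using h(1) by (simp add: int_mats_ball matrix_ball_def)
  qed
  note hc = haar_cosets[OF mu[of m 2], of m 2 "int_mats av m 2" "rep_mats N m" "int N"]
  have em: "emeasure (\<mu> m 2) (int_mats av m 2) = 1" using mu[of m 2] by (simp add: is_haar_measure_def)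
  let ?c = "real (card (rep_mats N m))"
  have cpos: "?c > 0" using card_rep_mats_pos by simp
  let ?e = "emeasure (\<mu> m 2) (matrix_ball ?G m 2 (int N))"
  have mG: "int_mats av m 2 \<subseteq> ?G" by (auto simp: int_mats_def)
  have minus: "A - B \<in> ?G" if "B \<in> ?G" for A B using that by (rule minus_carrier_mat)
  from mG have "1 = of_nat (card (rep_mats N m)) * ?e"
    using hc(1)[OF subset_refl _ _ _ finite_rep_mats sub int_mats_reps cl] em minus by auto
  then have "ennreal (1 / ?c) * 1 = ennreal (1 / ?c) * (ennreal ?c * ?e)" by (simp add: ennreal_of_nat_eq_real_of_nat)
  also have "\<dots> = ?e" using cpos by (simp add: mult.assoc[symmetric] ennreal_mult[symmetric])
  finally have e: "?e = ennreal (1 / ?c)" by simp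
  have "(LINT V : int_mats av m 2 | \<mu> m 2. f V) = (1 / ?c) *\<^sub>R (\<Sum>t \<in> rep_mats N m. f t)"
  proof (rule hc(2)[OF _ _ _ _ finite_rep_mats sub _ _ e])
    show "f V = f t" if "V \<in> int_mats av m 2" "t \<in> rep_mats N m" "V - t \<in> matrix_ball ?G m 2 (int N)" for V t
    proof (rule f[OF that(1)])
      show t: "t \<in> int_mats av m 2" using sub that by blast
      fix i j :: nat assume "i < m" "j < 2"
      then show "V $$ (i, j) - t $$ (i, j) \<in> P (int N)"
        using that t by (auto simp: matrix_ball_def int_mats_def)
    qed
  qed (use cl int_mats_reps mG minus in auto)
  then show ?thesis by (simp add: mat_mean_def scaleR_conv_of_real divide_inverse mult.commute)
qed

lemma herm_eq_gram: "V \<in> herm bar 2 \<longleftrightarrow> (\<exists>a \<in> F0. \<exists>d \<in> F0. \<exists>c. V = gram a d c)"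
proof
  assume "V \<in> herm bar 2"
  then have V: "V \<in> carrier_mat 2 2" "adj bar V = V" by (auto simp: herm_def)
  then have e: "bar (V $$ (j, i)) = V $$ (i, j)" if "i < 2" "j < 2" for i j
  proof -
    have "V $$ (i, j) = adj bar V $$ (i, j)" using V(2) by simp
    also have "\<dots> = bar (V $$ (j, i))" using V(1) that by (simp add: adj_def)
    finally show ?thesis by simp
  qed
  have "V = gram (V $$ (0, 0)) (V $$ (1, 1)) (V $$ (0, 1))"
    unfolding gram_def using mat2_eta[OF V(1)] e[of 1 0] by simp
  moreover have "V $$ (0, 0) \<in> F0" "V $$ (1, 1) \<in> F0" using e[of 0 0] e[of 1 1] bar_fixed_iff by auto
  ultimately show "\<exists>a \<in> F0. \<exists>d \<in> F0. \<exists>c. V = gram a d c" by blast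
next
  assume "\<exists>a \<in> F0. \<exists>d \<in> F0. \<exists>c. V = gram a d c"
  then obtain a d c where "a \<in> F0" "d \<in> F0" "V = gram a d c" by blast
  then show "V \<in> herm bar 2"
    by (auto simp: herm_def adj_def bar_F0 less_2_cases_iff intro!: eq_matI)
qed

lemma gram_inject: "gram a d c = gram a' d' c' \<longleftrightarrow> a = a' \<and> d = d' \<and> c = c'"
  by (metis gram_simps(4,5,7))

lemma herm_closed:
  assumes "A \<in> herm bar 2" "B \<in> herm bar 2"
  shows "A + B \<in> herm bar 2" "A - B \<in> herm bar 2" 
proof -
  obtain a d c a' d' c' where *: "a \<in> F0" "d \<in> F0" "A = gram a d c" "a' \<in> F0" "d' \<in> F0" "B = gram a' d' c'"
    using assms herm_eq_gram by metis
  have "A + B = gram (a + a') (d + d') (c + c')" "A - B = gram (a - a') (d - d') (c - c')"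
    using * by (auto simp: less_2_cases_iff bar_add bar_diff intro!: eq_matI)
  moreover have "a + a' \<in> F0" "d + d' \<in> F0" "a - a' \<in> F0" "d - d' \<in> F0" using * F0(4,5) by simp_all
  ultimately show "A + B \<in> herm bar 2" "A - B \<in> herm bar 2" unfolding herm_eq_gram by blast+
qed

lemma gram_ball: "gram a d c \<in> matrix_ball (herm bar 2) 2 2 k \<longleftrightarrow> a \<in> F0 \<and> a \<in> P k \<and> d \<in> F0 \<and> d \<in> P k \<and> c \<in> P k"
proof -
  have "gram a d c \<in> herm bar 2 \<longleftrightarrow> a \<in> F0 \<and> d \<in> F0" using herm_eq_gram gram_inject by metis
  then show ?thesis by (auto simp: matrix_ball_def all_less_2)
qed

lemma outer_domain:
  "(\<lambda>Y. inverse ((\<pi>\<^sup>2) ^ l) \<cdot>\<^sub>m Y) ` int_herm av bar 2 = {gram a d c | a d c. a \<in> P0 (- int l) \<and> d \<in> P0 (- int l) \<and> c \<in> P (- int (2 * l))}"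
proof -
  let ?u = "inverse ((\<pi>\<^sup>2) ^ l)"
  have ih: "V \<in> int_herm av bar 2 \<longleftrightarrow> (\<exists>a d c. V = gram a d c \<and> a \<in> P0 0 \<and> d \<in> P0 0 \<and> c \<in> P 0)" for V
  proof -
    have "V \<in> int_herm av bar 2 \<longleftrightarrow> V \<in> matrix_ball (herm bar 2) 2 2 0"
      by (auto simp: int_herm_def int_mats_ball matrix_ball_def herm_def)
    also have "\<dots> \<longleftrightarrow> (\<exists>a d c. V = gram a d c \<and> a \<in> P0 0 \<and> d \<in> P0 0 \<and> c \<in> P 0)"
    proof
      assume V: "V \<in> matrix_ball (herm bar 2) 2 2 0"
      then obtain a d c where "V = gram a d c" using herm_eq_gram by (auto simp: matrix_ball_def)
      with V show "\<exists>a d c. V = gram a d c \<and> a \<in> P0 0 \<and> d \<in> P0 0 \<and> c \<in> P 0"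
        using gram_ball[of a d c 0] by (auto simp: P0_def)
    next
      assume "\<exists>a d c. V = gram a d c \<and> a \<in> P0 0 \<and> d \<in> P0 0 \<and> c \<in> P 0"
      then obtain a d c where "V = gram a d c" "a \<in> P0 0" "d \<in> P0 0" "c \<in> P 0" by blast
      then show "V \<in> matrix_ball (herm bar 2) 2 2 0" using gram_ball[of a d c 0] by (simp add: P0_def)
    qed
    finally show ?thesis .
  qed
  have uF: "?u \<in> F0" using pi2_F0 F0 by simp
  have uav: "av ?u = av \<pi> powi (2 * - int l)"
  proof -
    have "av ?u = inverse (av \<pi> ^ (2 * l))" by (simp add: av_inverse av_power power_mult)
    also have "\<dots> = av \<pi> powi (- int (2 * l))" by (simp only: power_int_minus power_int_of_nat)
    finally show ?thesis by simp
  qed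
  have u0: "?u \<noteq> 0" using pi_nonzero by simp
  have sm: "?u \<cdot>\<^sub>m gram a d c = gram (?u * a) (?u * d) (?u * c)" for a d c
    using uF by (auto simp: less_2_cases_iff bar_mult bar_F0 intro!: eq_matI)
  have i0: "?u * x \<in> P0 (- int l) \<longleftrightarrow> x \<in> P0 0" for x using P0_mult_iff[OF uF uav, of x "- int l"] by simp
  have i: "?u * x \<in> P (- int (2 * l)) \<longleftrightarrow> x \<in> P 0" for x using P_mult_iff[OF uav, of x "- int (2 * l)"] by simp
  show ?thesis
  proof (intro equalityI subsetI)
    fix V assume "V \<in> (\<lambda>Y. ?u \<cdot>\<^sub>m Y) ` int_herm av bar 2"
    then obtain W where W: "V = ?u \<cdot>\<^sub>m W" "W \<in> int_herm av bar 2" by blast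
    then obtain a d c where "W = gram a d c" "a \<in> P0 0" "d \<in> P0 0" "c \<in> P 0" using ih[of W] by blast
    then have "V = gram (?u * a) (?u * d) (?u * c)" "?u * a \<in> P0 (- int l)" "?u * d \<in> P0 (- int l)" "?u * c \<in> P (- int (2 * l))"
      using W(1) sm i0 i by simp_all
    then show "V \<in> {gram a d c | a d c. a \<in> P0 (- int l) \<and> d \<in> P0 (- int l) \<and> c \<in> P (- int (2 * l))}" by blast
  next
    fix V assume "V \<in> {gram a d c | a d c. a \<in> P0 (- int l) \<and> d \<in> P0 (- int l) \<and> c \<in> P (- int (2 * l))}"
    then obtain a d c where V: "V = gram a d c" "a \<in> P0 (- int l)" "d \<in> P0 (- int l)" "c \<in> P (- int (2 * l))" by blast
    have e: "?u * (x / ?u) = x" for x using u0 by simp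
    have "gram (a / ?u) (d / ?u) (c / ?u) \<in> int_herm av bar 2"
    proof -
      have "a / ?u \<in> P0 0" "d / ?u \<in> P0 0" "c / ?u \<in> P 0"
        using V e i0[of "a / ?u"] i0[of "d / ?u"] i[of "c / ?u"] by simp_all
      then show ?thesis unfolding ih by blast
    qed
    moreover have "?u \<cdot>\<^sub>m gram (a / ?u) (d / ?u) (c / ?u) = V" unfolding sm V(1) e ..
    ultimately show "V \<in> (\<lambda>Y. ?u \<cdot>\<^sub>m Y) ` int_herm av bar 2" by blast
  qed
qed

text \<open>The measure gives the integral hermitian matrices volume one, so the integral is a sum over classes.\<close>

lemma outer_integral:
  fixes f :: "'a mat \<Rightarrow> complex"
  assumes f: "\<And>a d c a' d' c'. \<lbrakk>a \<in> P0 (- int l); d \<in> P0 (- int l); c \<in> P (- int (2 * l));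
      a' \<in> P0 (- int l); d' \<in> P0 (- int l); c' \<in> P (- int (2 * l));
      a - a' \<in> P0 0; d - d' \<in> P0 0; c - c' \<in> P 0\<rbrakk> \<Longrightarrow> f (gram a d c) = f (gram a' d' c')"
  shows "(LINT Y : (\<lambda>Y. inverse ((\<pi>\<^sup>2) ^ l) \<cdot>\<^sub>m Y) ` int_herm av bar 2 | \<nu> 2. f Y)
    = qsum (P0 (- int l)) (P0 0) (\<lambda>a. qsum (P0 (- int l)) (P0 0) (\<lambda>d. qsum (P (- int (2 * l))) (P 0) (\<lambda>c. f (gram a d c))))"
proof -
  define A where "A = {gram a d c | a d c. a \<in> P0 (- int l) \<and> d \<in> P0 (- int l) \<and> c \<in> P (- int (2 * l))}"
  define R where "R = some_transversal (P0 (- int l)) (P0 0)"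
  define R' where "R' = some_transversal (P (- int (2 * l))) (P 0)"
  define T where "T = (\<lambda>(a, d, c). gram a d c) ` (R \<times> R \<times> R')"
  note r = finite_indexD(4,5,6)[OF fin_P0_neg[of l], folded R_def] and r' = finite_indexD(4,5,6)[OF fin_P_neg[of "2 * l"], folded R'_def]
  have diff: "gram a d c - gram a' d' c' = gram (a - a') (d - d') (c - c')" for a d c a' d' c'
    by (auto simp: less_2_cases_iff bar_diff intro!: eq_matI)
  have ball: "gram a d c - gram a' d' c' \<in> matrix_ball (herm bar 2) 2 2 0 \<longleftrightarrow> a - a' \<in> P0 0 \<and> d - d' \<in> P0 0 \<and> c - c' \<in> P 0" for a d c a' d' c'
    unfolding diff gram_ball by (auto simp: P0_def)
  have TA: "T \<subseteq> A"
  proof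
    fix V assume "V \<in> T"
    then obtain a d c where "V = gram a d c" "a \<in> R" "d \<in> R" "c \<in> R'" by (auto simp: T_def)
    then show "V \<in> A" unfolding A_def using subsetD[OF r(3)] subsetD[OF r'(3)] by blast
  qed
  have AG: "A \<subseteq> herm bar 2"
  proof
    fix V assume "V \<in> A"
    then obtain a d c where "V = gram a d c" "a \<in> F0" "d \<in> F0" using P0_F0 by (auto simp: A_def)
    then show "V \<in> herm bar 2" using herm_eq_gram by blast
  qed
  have rep: "\<exists>!t. t \<in> T \<and> V - t \<in> matrix_ball (herm bar 2) 2 2 0" if V: "V \<in> A" for V
  proof -
    obtain a d c where v: "V = gram a d c" "a \<in> P0 (- int l)" "d \<in> P0 (- int l)" "c \<in> P (- int (2 * l))"
      using V by (auto simp: A_def)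
    obtain a' where a': "a' \<in> R" "a - a' \<in> P0 0" using transversalE[OF r(2) v(2)] by blast
    obtain d' where d': "d' \<in> R" "d - d' \<in> P0 0" using transversalE[OF r(2) v(3)] by blast
    obtain c' where c': "c' \<in> R'" "c - c' \<in> P 0" using transversalE[OF r'(2) v(4)] by blast
    show ?thesis
    proof (rule ex1I[of _ "gram a' d' c'"])
      show "gram a' d' c' \<in> T \<and> V - gram a' d' c' \<in> matrix_ball (herm bar 2) 2 2 0"
        unfolding v(1) ball using a' d' c' unfolding T_def by (auto intro!: image_eqI[of _ _ "(a', d', c')"])
      fix t assume t: "t \<in> T \<and> V - t \<in> matrix_ball (herm bar 2) 2 2 0"
      then obtain a'' d'' c'' where t': "t = gram a'' d'' c''" "a'' \<in> R" "d'' \<in> R" "c'' \<in> R'" by (auto simp: T_def)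
      have "a - a'' \<in> P0 0" "d - d'' \<in> P0 0" "c - c'' \<in> P 0" using t unfolding t'(1) v(1) ball by auto
      then have "a'' = a'" "d'' = d'" "c'' = c'"
        using transversal_unique[OF r(2) v(2) t'(2) a'(1)] transversal_unique[OF r(2) v(3) t'(3) d'(1)]
          transversal_unique[OF r'(2) v(4) t'(4) c'(1)] a' d' c' by auto
      then show "t = gram a' d' c'" using t' by simp
    qed
  qed
  have closed: "V \<in> A" if h: "V \<in> herm bar 2" "t \<in> T" "V - t \<in> matrix_ball (herm bar 2) 2 2 0" for V t
  proof -
    obtain a d c where v: "V = gram a d c" using h(1) herm_eq_gram by blast
    obtain a' d' c' where t': "t = gram a' d' c'" "a' \<in> P0 (- int l)" "d' \<in> P0 (- int l)" "c' \<in> P (- int (2 * l))"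
      using TA h(2) by (auto simp: A_def)
    have "a - a' \<in> P0 0" "d - d' \<in> P0 0" "c - c' \<in> P 0" using h(3) unfolding v t'(1) ball by auto
    then have "a - a' \<in> P0 (- int l)" "d - d' \<in> P0 (- int l)" "c - c' \<in> P (- int (2 * l))"
      using P0_antimono[of "- int l" 0] P_antimono[of "- int (2 * l)" 0] by auto
    then have "(a - a') + a' \<in> P0 (- int l)" "(d - d') + d' \<in> P0 (- int l)" "(c - c') + c' \<in> P (- int (2 * l))"
      using t' by (blast intro: P0_add P_add)+
    then show ?thesis using v by (auto simp: A_def)
  qed
  have em: "emeasure (\<nu> 2) (matrix_ball (herm bar 2) 2 2 0) = ennreal 1"
  proof -
    have "matrix_ball (herm bar 2) 2 2 0 = int_herm av bar 2"
      by (auto simp: int_herm_def int_mats_ball matrix_ball_def herm_def)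
    then show ?thesis using nu[of 2] by (simp add: is_haar_measure_def)
  qed
  have "(LINT Y : A | \<nu> 2. f Y) = 1 *\<^sub>R (\<Sum>t \<in> T. f t)"
  proof (rule haar_cosets(2)[OF nu[of 2] _ herm_closed AG _ TA rep closed em])
    show "herm bar 2 \<subseteq> carrier_mat 2 2" by (auto simp: herm_def)
    show "finite T" using r r' by (simp add: T_def)
    show "f V = f t" if h: "V \<in> A" "t \<in> T" "V - t \<in> matrix_ball (herm bar 2) 2 2 0" for V t
    proof -
      obtain a d c where v: "V = gram a d c" "a \<in> P0 (- int l)" "d \<in> P0 (- int l)" "c \<in> P (- int (2 * l))"
        using h(1) by (auto simp: A_def)
      obtain a' d' c' where t': "t = gram a' d' c'" "a' \<in> P0 (- int l)" "d' \<in> P0 (- int l)" "c' \<in> P (- int (2 * l))"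
        using TA h(2) by (auto simp: A_def)
      have "a - a' \<in> P0 0" "d - d' \<in> P0 0" "c - c' \<in> P 0" using h(3) unfolding v t'(1) ball by auto
      then show ?thesis unfolding v(1) t'(1) using v t' by (intro f)
    qed
  qed simp_all
  also have "\<dots> = (\<Sum>p \<in> R \<times> R \<times> R'. f ((\<lambda>(a, d, c). gram a d c) p))"
    unfolding T_def by (simp add: sum.reindex inj_on_def gram_inject)
  also have "\<dots> = (\<Sum>a \<in> R. \<Sum>d \<in> R. \<Sum>c \<in> R'. f (gram a d c))"
    by (simp add: sum.cartesian_product split_beta)
  finally show ?thesis unfolding outer_domain A_def[symmetric] by (simp add: qsum_def R_def R'_def)
qed

text \<open>A unimodular or \<open>\<pi>\<^sup>-\<^sup>1\<close>-modular binary hermitian block.\<close>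

definition admissible_block :: "'a mat \<Rightarrow> bool" where
  "admissible_block B \<longleftrightarrow> B \<in> carrier_mat 2 2 \<and> (\<forall>i < 2. \<forall>j < 2. B $$ (i, j) \<in> P (- 1)) \<and>
     (\<forall>a \<in> F0. \<forall>d \<in> F0. \<forall>c V. herm_trace (gram a d c) B V \<in> F0)"

lemma herm_trace_diff:
  "herm_trace (gram a d c) S V - herm_trace (gram a' d' c') S V = herm_trace (gram (a - a') (d - d') (c - c')) S V"
  unfolding herm_trace_def by (simp add: sum_lessThan_2 bar_diff algebra_simps flip: sum_subtractf)

lemma block_mean_cong:
  assumes B: "admissible_block B" and F: "a \<in> F0" "a' \<in> F0" "d \<in> F0" "d' \<in> F0"
    and diff: "a - a' \<in> P0 0" "d - d' \<in> P0 0" "c - c' \<in> P 0"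
  shows "mat_mean N 2 (\<lambda>V. \<psi> (herm_trace (gram a d c) B V)) = mat_mean N 2 (\<lambda>V. \<psi> (herm_trace (gram a' d' c') B V))"
proof -
  have "\<psi> (herm_trace (gram a d c) B V) = \<psi> (herm_trace (gram a' d' c') B V)" if V: "V \<in> rep_mats N 2" for V
  proof (rule psi_cong)
    show "herm_trace (gram a d c) B V \<in> F0" "herm_trace (gram a' d' c') B V \<in> F0"
      using B F by (auto simp: admissible_block_def)
    let ?Y = "gram (a - a') (d - d') (c - c')"
    have Y: "?Y $$ (i, j) \<in> P 0" if "i < 2" "j < 2" for i j
      using that diff P0_P[OF diff(1)] P0_P[OF diff(2)] by (auto simp: less_2_cases_iff)
    have Bd: "dim_row B = 2" "\<And>i j. i < 2 \<Longrightarrow> j < 2 \<Longrightarrow> B $$ (i, j) \<in> P (- 1)"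
      using B by (auto simp: admissible_block_def)
    have VP: "V $$ (i, j) \<in> P 0" if "i < 2" "j < 2" for i j
      using V that reps_facts(3) by (auto simp: rep_mats_def)
    have "herm_trace ?Y B V \<in> P (- 1)"
      unfolding herm_trace_def Bd(1)
    proof (intro P_sum)
      fix k n assume kn: "k \<in> {..<2 :: nat}" "n \<in> {..<2 :: nat}"
      have "Y0 * bar (V $$ (k, j)) * V $$ (n, i) \<in> P (0 + 0 + 0)" if "Y0 \<in> P 0" "i < 2" "j < 2" for Y0 i j
        using that kn VP by (intro P_mult) auto
      then have "(\<Sum>i < 2. \<Sum>j < 2. ?Y $$ (i, j) * bar (V $$ (k, j)) * V $$ (n, i)) \<in> P 0"
        using Y by (intro P_sum) auto
      then show "B $$ (k, n) * (\<Sum>i < 2. \<Sum>j < 2. ?Y $$ (i, j) * bar (V $$ (k, j)) * V $$ (n, i)) \<in> P (- 1)"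
        using P_mult[OF Bd(2), of k n _ 0] kn by simp
    qed
    moreover have "herm_trace ?Y B V \<in> F0" using B F F0 by (auto simp: admissible_block_def)
    ultimately have "herm_trace ?Y B V \<in> P0 0" using F0_P_odd[of _ 0] by simp
    then show "herm_trace (gram a d c) B V - herm_trace (gram a' d' c') B V \<in> P0 0"
      by (simp only: herm_trace_diff)
  qed
  then show ?thesis by (simp add: mat_mean_def)
qed

lemma form_volume_cong:
  assumes F: "a \<in> F0" "a' \<in> F0" "d \<in> F0" "d' \<in> F0"
    and diff: "a - a' \<in> P0 0" "d - d' \<in> P0 0" "c - c' \<in> P 0"
  shows "form_volume N a d c = form_volume N a' d' c'"
  unfolding form_volume_def
proof (intro mean_cong)
  fix x y assume xy: "x \<in> P 0" "y \<in> P 0"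
  have iff: "u + v \<in> P 0 \<longleftrightarrow> u' + v' \<in> P 0" if "u - u' \<in> P 0" "v - v' \<in> P 0" for u u' v v'
  proof -
    have "(u + v) - (u' + v') \<in> P 0" using P_add[OF that] by (simp add: algebra_simps)
    then show ?thesis using P_add[of "(u + v) - (u' + v')" 0 "u' + v'"] P_diff[of "u + v" 0 "(u + v) - (u' + v')"] by auto
  qed
  have b: "bar c - bar c' \<in> P 0" using diff(3) by (metis bar_P bar_diff)
  have "a * x - a' * x \<in> P 0" "d * y - d' * y \<in> P 0" "c * x - c' * x \<in> P 0" "bar c * y - bar c' * y \<in> P 0"
    using P_mult[OF P0_P[OF diff(1)], of x 0] P_mult[OF P0_P[OF diff(2)], of y 0] P_mult[OF diff(3), of x 0]
      P_mult[OF b, of y 0] xy by (simp_all add: left_diff_distrib)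
  then show "of_bool (a * x + bar c * y \<in> P 0) * of_bool (c * x + d * y \<in> P 0)
      = (of_bool (a' * x + bar c' * y \<in> P 0) * of_bool (c' * x + d' * y \<in> P 0) :: complex)"
    using iff by simp
qed

lemma admissible_diag2: "v \<in> P0 0 \<Longrightarrow> admissible_block (diag2 v 1)"
  using herm_trace_diag2[of v] qform_F0 P0_F0[of v 0] F0 P_antimono[of "- 1" 0] P0_P[of v 0]
  by (auto simp: admissible_block_def all_less_2 P_def[of 0])

lemma admissible_hyperbolic: "admissible_block (hyperbolic \<pi>)"
proof -
  have "inverse \<pi> \<in> P (- 1)" by (simp add: P_def av_inverse power_int_minus)
  then show ?thesis
    using herm_trace_hyperbolic Tr_F0 F0 by (auto simp: admissible_block_def all_less_2 hyperbolic_def)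
qed

lemma diag_block_entries:
  assumes "\<And>A. A \<in> set As \<Longrightarrow> admissible_block A" "i < 2 * length As" "j < 2 * length As"
  shows "diag_block_mat As $$ (i, j) \<in> P (- 1)"
  using assms
proof (induction As arbitrary: i j)
  case (Cons A As)
  have c: "diag_block_mat As \<in> carrier_mat (2 * length As) (2 * length As)"
    using Cons.prems(1) by (intro diag_block_carrier) (auto simp: admissible_block_def)
  have A: "A \<in> carrier_mat 2 2" "\<And>i j. i < 2 \<Longrightarrow> j < 2 \<Longrightarrow> A $$ (i, j) \<in> P (- 1)"
    using Cons.prems(1)[of A] by (auto simp: admissible_block_def)
  have d: "dim_row A = 2" "dim_col A = 2" "dim_row (diag_block_mat As) = 2 * length As" "dim_col (diag_block_mat As) = 2 * length As"
    using A(1) c by auto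
  have ij: "i < 2 + 2 * length As" "j < 2 + 2 * length As" using Cons.prems by auto
  show ?case
    using ij A(2)[of i j] Cons.IH[of "i - 2" "j - 2"] Cons.prems(1) by (auto simp: Let_def d)
qed simp

theorem truncated_density_eq:
  assumes B: "admissible_block B" and t: "t1 \<in> P0 0" "t2 \<in> P0 0" "\<tau> \<in> P (- 1)"
    and N_def: "N = 2 * l + 1"
  shows "truncated_density av bar \<pi> \<psi> \<mu> \<nu> (diag_block_mat (B # replicate r (hyperbolic \<pi>))) (gram t1 t2 (bar \<tau>)) l =
    qsum (P0 (- int l)) (P0 0) (\<lambda>a. qsum (P0 (- int l)) (P0 0) (\<lambda>d. qsum (P (- int (2 * l))) (P 0) (\<lambda>c.
      mat_mean N 2 (\<lambda>V. \<psi> (herm_trace (gram a d c) B V)) * form_volume N a d c ^ r * \<psi> (- (a * t1 + d * t2 + Tr (c * \<tau>))))))"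
proof -
  define As where "As = B # replicate r (hyperbolic \<pi>)"
  define S where "S = diag_block_mat As"
  define T where "T = gram t1 t2 (bar \<tau>)"
  define m where "m = 2 * length As"
  have adm: "admissible_block A" if "A \<in> set As" for A
    using that B admissible_hyperbolic by (auto simp: As_def)
  have S: "S \<in> carrier_mat m m" "\<And>i j. i < m \<Longrightarrow> j < m \<Longrightarrow> S $$ (i, j) \<in> P (- 1)"
    unfolding S_def m_def using adm diag_block_carrier[of As] diag_block_entries[of As] by (auto simp: admissible_block_def)
  have tF: "t1 \<in> F0" "t2 \<in> F0" using t P0_F0 by auto
  define g where "g = (\<lambda>Y. LINT V : int_mats av m 2 | \<mu> m 2. \<psi> (mat_tr (Y * (adj bar V * S * V - T))))"
  have Tc: "T \<in> carrier_mat 2 2" by (simp add: T_def)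
  have trT: "mat_tr (gram a d c * T) = a * t1 + d * t2 + Tr (c * \<tau>)" for a d c
    by (simp add: mat_tr_mult T_def Tr_def bar_mult algebra_simps)
  have g: "g (gram a d c) = mat_mean N 2 (\<lambda>V. \<psi> (herm_trace (gram a d c) B V)) * form_volume N a d c ^ r * \<psi> (- (a * t1 + d * t2 + Tr (c * \<tau>)))"
    if a: "a \<in> P0 (- int l)" "d \<in> P0 (- int l)" "c \<in> P (- int (2 * l))" for a d c
  proof -
    let ?Y = "gram a d c"
    have F: "a \<in> F0" "d \<in> F0" using a P0_F0 by auto
    have mm: "(\<forall>V. V \<in> carrier_mat m 2 \<longrightarrow> herm_trace ?Y S V \<in> F0) \<and>
        mat_mean N m (\<lambda>V. \<psi> (herm_trace ?Y S V)) = (\<Prod>A \<leftarrow> As. mat_mean N 2 (\<lambda>V. \<psi> (herm_trace ?Y A V)))"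
      unfolding m_def S_def using adm F by (intro mat_mean_diag_block) (auto simp: admissible_block_def)
    have pF: "a * t1 + d * t2 + Tr (c * \<tau>) \<in> F0" using F tF Tr_F0 F0 by simp
    have val: "\<psi> (mat_tr (?Y * (adj bar V * S * V - T))) = \<psi> (herm_trace ?Y S V) * \<psi> (- (a * t1 + d * t2 + Tr (c * \<tau>)))"
      if "V \<in> carrier_mat m 2" for V
    proof -
      have "mat_tr (?Y * (adj bar V * S * V - T)) = herm_trace ?Y S V + - (a * t1 + d * t2 + Tr (c * \<tau>))"
        using mat_tr_herm[OF gram_simps(1) S(1) that Tc, of a d c] by (simp add: trT)
      then show ?thesis using psi_add mm that F0(3)[OF pF] by metis
    qed
    have YP: "?Y $$ (i, j) \<in> P (- 2 * int l)" if "i < 2" "j < 2" for i j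
      using that a P0_P[OF a(1)] P0_P[OF a(2)] by (auto simp: less_2_cases_iff)
    have "g ?Y = mat_mean N m (\<lambda>V. \<psi> (mat_tr (?Y * (adj bar V * S * V - T))))"
      unfolding g_def
    proof (rule inner_integral)
      fix V V' assume V: "V \<in> int_mats av m 2" "V' \<in> int_mats av m 2"
        and d: "\<And>i j. i < m \<Longrightarrow> j < 2 \<Longrightarrow> V $$ (i, j) - V' $$ (i, j) \<in> P (int N)"
      have c: "V \<in> carrier_mat m 2" "V' \<in> carrier_mat m 2"
        "\<And>i j. i < m \<Longrightarrow> j < 2 \<Longrightarrow> V $$ (i, j) \<in> P 0" "\<And>i j. i < m \<Longrightarrow> j < 2 \<Longrightarrow> V' $$ (i, j) \<in> P 0"
        using V by (auto simp: int_mats_ball matrix_ball_def)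
      have F: "herm_trace ?Y S V \<in> F0" "herm_trace ?Y S V' \<in> F0" using mm c by auto
      have "herm_trace ?Y S V - herm_trace ?Y S V' \<in> P 0"
        using YP S c(3,4) d by (intro herm_trace_cong) (auto simp: N_def add.commute)
      then have "\<psi> (herm_trace ?Y S V) = \<psi> (herm_trace ?Y S V')"
        using F F0(5)[OF F] by (intro psi_cong) (auto simp: P0_def)
      then show "\<psi> (mat_tr (?Y * (adj bar V * S * V - T))) = \<psi> (mat_tr (?Y * (adj bar V' * S * V' - T)))"
        using val c by simp
    qed
    also have "\<dots> = mat_mean N m (\<lambda>V. \<psi> (herm_trace ?Y S V)) * \<psi> (- (a * t1 + d * t2 + Tr (c * \<tau>)))"
    proof -
      have "(\<Sum>V \<in> rep_mats N m. \<psi> (mat_tr (?Y * (adj bar V * S * V - T))))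
          = (\<Sum>V \<in> rep_mats N m. \<psi> (herm_trace ?Y S V) * \<psi> (- (a * t1 + d * t2 + Tr (c * \<tau>))))"
        by (intro sum.cong refl val) (simp add: rep_mats_def)
      then show ?thesis by (simp add: mat_mean_def sum_distrib_right)
    qed
    also have "mat_mean N m (\<lambda>V. \<psi> (herm_trace ?Y S V)) = mat_mean N 2 (\<lambda>V. \<psi> (herm_trace ?Y B V)) * form_volume N a d c ^ r"
      using mm mat_mean_hyperbolic[OF a(1,2), of c N] a(3) by (simp add: As_def N_def)
    finally show ?thesis .
  qed
  have "truncated_density av bar \<pi> \<psi> \<mu> \<nu> S T l = (LINT Y : (\<lambda>Y. inverse ((\<pi>\<^sup>2) ^ l) \<cdot>\<^sub>m Y) ` int_herm av bar 2 | \<nu> 2. g Y)"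
    using S(1) by (simp add: truncated_density_def g_def T_def)
  also have "\<dots> = qsum (P0 (- int l)) (P0 0) (\<lambda>a. qsum (P0 (- int l)) (P0 0) (\<lambda>d. qsum (P (- int (2 * l))) (P 0) (\<lambda>c. g (gram a d c))))"
  proof (rule outer_integral)
    fix a d c a' d' c'
    assume 1: "a \<in> P0 (- int l)" "d \<in> P0 (- int l)" "c \<in> P (- int (2 * l))"
      and 2: "a' \<in> P0 (- int l)" "d' \<in> P0 (- int l)" "c' \<in> P (- int (2 * l))"
      and d: "a - a' \<in> P0 0" "d - d' \<in> P0 0" "c - c' \<in> P 0"
    have F: "a \<in> F0" "a' \<in> F0" "d \<in> F0" "d' \<in> F0" using 1 2 P0_F0 by auto
    show "g (gram a d c) = g (gram a' d' c')"
      unfolding g[OF 1] g[OF 2] block_mean_cong[OF B F d] form_volume_cong[OF F d] psi_phase_cong[OF t F d] ..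
  qed
  also have "\<dots> = qsum (P0 (- int l)) (P0 0) (\<lambda>a. qsum (P0 (- int l)) (P0 0) (\<lambda>d. qsum (P (- int (2 * l))) (P 0) (\<lambda>c.
      mat_mean N 2 (\<lambda>V. \<psi> (herm_trace (gram a d c) B V)) * form_volume N a d c ^ r * \<psi> (- (a * t1 + d * t2 + Tr (c * \<tau>))))))"
    using g by (intro qsum_cong fin_P0_neg fin_P_neg)
  finally show ?thesis unfolding S_def T_def As_def .
qed

end

section \<open>Counting values of the norm form\<close>

context local_density_setting
begin

lemma P0_iff_order: "d \<in> F0 \<Longrightarrow> av d = av \<pi> powi (2 * m) \<Longrightarrow> d \<in> P0 k \<longleftrightarrow> k \<le> m"
  by (simp add: P0_def P_def powi_le_iff)

lemma Nm_P0_iff: "Nm z \<in> P0 m \<longleftrightarrow> z \<in> P m"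
proof (cases "z = 0")
  case False
  obtain k where k: "av z = av \<pi> powi k" using value_group[OF False] .
  have "av (Nm z) = av \<pi> powi (2 * k)" using powi_add[of k k] k by (simp add: av_Nm power2_eq_square)
  then show ?thesis using P0_iff_order[OF Nm_F0] k by (simp add: P_def powi_le_iff)
qed simp

text \<open>A sum over \<open>O\<^sub>F\<close> modulo \<open>\<pi>\<^sub>0\<^sup>m\<close>, in the coordinates of \<open>F = F0 + \<pi> F0\<close>.\<close>

lemma qsum_decomp:
  fixes g :: "'a \<Rightarrow> complex"
  assumes g: "periodic (P 0) (P (2 * int m)) g"
  shows "qsum (P 0) (P (2 * int m)) g = qsum (P0 0) (P0 (int m)) (\<lambda>\<beta>. qsum (P0 0) (P0 (int m)) (\<lambda>\<alpha>. g (\<alpha> + \<pi> * \<beta>)))"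
proof -
  define T where "T = some_transversal (P0 0) (P0 (int m))"
  have "finite_index (P0 0) (P0 (int m))" by (rule finite_index_P0) simp
  note fi = finite_indexD[OF this, folded T_def]
  have TF: "x \<in> F0" "x \<in> P0 0" if "x \<in> T" for x using that fi(6) P0_F0 by auto
  have mem: "\<alpha> + \<pi> * \<beta> \<in> P (2 * k) \<longleftrightarrow> \<alpha> \<in> P0 k \<and> \<beta> \<in> P0 k" if "\<alpha> \<in> F0" "\<beta> \<in> F0" for \<alpha> \<beta> k
    using P_decomp_iff[OF that, of "2 * k"] by simp
  have eq: "(\<alpha> + \<pi> * \<beta>) - (\<alpha>' + \<pi> * \<beta>') = (\<alpha> - \<alpha>') + \<pi> * (\<beta> - \<beta>')" for \<alpha> \<beta> \<alpha>' \<beta>' :: 'a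
    by (simp add: algebra_simps)
  let ?h = "\<lambda>(\<beta>, \<alpha>). \<alpha> + \<pi> * \<beta>"
  have inj: "inj_on ?h (T \<times> T)"
  proof (rule inj_onI, clarify)
    fix \<alpha> \<beta> \<alpha>' \<beta>' assume *: "\<alpha> \<in> T" "\<beta> \<in> T" "\<alpha>' \<in> T" "\<beta>' \<in> T" and "\<alpha> + \<pi> * \<beta> = \<alpha>' + \<pi> * \<beta>'"
    then have "(\<alpha> - \<alpha>') + \<pi> * (\<beta> - \<beta>') = 0" by (simp add: algebra_simps)
    moreover have "\<alpha> - \<alpha>' \<in> F0" "\<beta> - \<beta>' \<in> F0" using TF * F0 by auto
    ultimately have "\<alpha> - \<alpha>' = 0" "\<beta> - \<beta>' = 0" using F0_decomp_unique by blast+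
    then show "\<beta> = \<beta>' \<and> \<alpha> = \<alpha>'" by simp
  qed
  have tr: "transversal (P 0) (P (2 * int m)) (?h ` (T \<times> T))"
    unfolding transversal_def
  proof (intro conjI ballI)
    show "?h ` (T \<times> T) \<subseteq> P 0" using mem[of _ _ 0] TF by auto
    fix x assume x: "x \<in> P 0"
    obtain \<alpha> \<beta> where ab: "\<alpha> \<in> F0" "\<beta> \<in> F0" "x = \<alpha> + \<pi> * \<beta>" by (rule F0_decomp)
    then have O: "\<alpha> \<in> P0 0" "\<beta> \<in> P0 0" using mem[of \<alpha> \<beta> 0] x by auto
    obtain s where s: "s \<in> T" "\<alpha> - s \<in> P0 (int m)" using transversalE[OF fi(5) O(1)] by blast
    obtain t where t: "t \<in> T" "\<beta> - t \<in> P0 (int m)" using transversalE[OF fi(5) O(2)] by blast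
    have iff: "x - (s' + \<pi> * t') \<in> P (2 * int m) \<longleftrightarrow> \<alpha> - s' \<in> P0 (int m) \<and> \<beta> - t' \<in> P0 (int m)"
      if "s' \<in> T" "t' \<in> T" for s' t'
      unfolding ab(3) eq using mem ab TF that F0(5) by auto
    show "\<exists>!u. u \<in> ?h ` (T \<times> T) \<and> x - u \<in> P (2 * int m)"
    proof (rule ex1I[of _ "s + \<pi> * t"])
      show "s + \<pi> * t \<in> ?h ` (T \<times> T) \<and> x - (s + \<pi> * t) \<in> P (2 * int m)"
        using iff s t by auto
      fix u assume "u \<in> ?h ` (T \<times> T) \<and> x - u \<in> P (2 * int m)"
      then obtain s' t' where u: "s' \<in> T" "t' \<in> T" "u = s' + \<pi> * t'" "x - (s' + \<pi> * t') \<in> P (2 * int m)" by auto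
      then have "\<alpha> - s' \<in> P0 (int m)" "\<beta> - t' \<in> P0 (int m)" using iff by auto
      then have "s' = s" "t' = t"
        using transversal_unique[OF fi(5) O(1) u(1) s(1)] transversal_unique[OF fi(5) O(2) u(2) t(1)] s t by auto
      then show "u = s + \<pi> * t" using u by simp
    qed
  qed
  have "qsum (P 0) (P (2 * int m)) g = (\<Sum>p \<in> T \<times> T. g (?h p))"
    using qsum_eq_sum[OF finite_index_P tr g] inj by (simp add: sum.reindex)
  then show ?thesis by (simp add: qsum_def T_def sum.cartesian_product split_beta)
qed

lemma periodic_norm_congruence:
  assumes "c \<in> F0" "2 * m \<le> N + 1" "N \<ge> 1"
  shows "periodic_O N (\<lambda>z. of_bool (Nm z - c \<in> P0 (int m)) :: complex)"
  unfolding periodic_def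
proof (intro ballI impI)
  fix x y assume "x \<in> P 0" "y \<in> P 0" "x - y \<in> P (int N)"
  then have "Nm x - Nm y \<in> P0 ((int N + 1) div 2)" using assms by (intro Nm_cong) auto
  moreover have "int m \<le> (int N + 1) div 2" using assms by linarith
  ultimately have d: "Nm x - Nm y \<in> P0 (int m)" using P0_antimono by blast
  have "Nm x - c \<in> P0 (int m) \<longleftrightarrow> Nm y - c \<in> P0 (int m)"
    using P0_add[OF d, of "Nm y - c"] P0_diff[of "Nm x - c" "int m" "Nm x - Nm y"] d by (auto simp: algebra_simps)
  then show "of_bool (Nm x - c \<in> P0 (int m)) = (of_bool (Nm y - c \<in> P0 (int m)) :: complex)" by simp
qed

text \<open>For \<open>z = \<alpha> + \<pi> \<beta>\<close>, the congruence says that \<open>\<alpha>\<^sup>2\<close> is congruent to \<open>c + \<pi>\<^sup>2 \<beta>\<^sup>2\<close>. This unit has the same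
  residue as \<open>c\<close>, so for each \<open>\<beta>\<close> there are \<open>1 + \<chi>(c)\<close> solutions \<open>\<alpha>\<close>.\<close>

lemma mean_norm_unit:
  assumes c: "c \<in> F0" "av c = 1" and m: "m \<ge> 1" and N: "2 * m \<le> N + 1"
  shows "mean N (\<lambda>z. of_bool (Nm z - c \<in> P0 (int m))) = (1 + of_int (chi c)) / of_nat q ^ m"
proof -
  let ?g = "\<lambda>z. of_bool (Nm z - c \<in> P0 (int m)) :: complex"
  have per: "periodic_O M ?g" if "2 * m \<le> M + 1" "M \<ge> 1" for M
    using periodic_norm_congruence[OF c(1) that] .
  have "mean N ?g = mean (2 * m - 1) ?g" using per[of "2 * m - 1"] m N by (intro mean_coarser) auto
  also have "\<dots> = mean (2 * m) ?g" using per[of "2 * m - 1"] m by (intro mean_coarser[symmetric]) auto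
  finally have 1: "mean N ?g = qsum (P 0) (P (2 * int m)) ?g / of_nat q ^ (2 * m)" by (simp add: mean_def)
  have "qsum (P 0) (P (2 * int m)) ?g
      = qsum (P0 0) (P0 (int m)) (\<lambda>\<beta>. qsum (P0 0) (P0 (int m)) (\<lambda>\<alpha>. ?g (\<alpha> + \<pi> * \<beta>)))"
    using per[of "2 * m"] m by (intro qsum_decomp) simp
  also have "\<dots> = qsum (P0 0) (P0 (int m)) (\<lambda>\<beta>. 1 + of_int (chi c))"
  proof (intro qsum_cong finite_index_P0)
    fix \<beta> assume b: "\<beta> \<in> P0 0"
    define c' where "c' = c + \<pi> ^ 2 * \<beta> ^ 2"
    have bF: "\<beta> \<in> F0" using b P0_F0 by blast
    have small: "\<pi> ^ 2 * \<beta> ^ 2 \<in> P0 1"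
    proof -
      have "\<beta> ^ 2 \<in> P0 0" using P0_mult[OF b b] by (simp add: power2_eq_square)
      moreover have "av (\<pi> ^ 2) = av \<pi> powi (2 * 1)" by (simp add: power2_eq_square av_mult)
      ultimately show ?thesis using P0_mult_iff[OF pi2_F0, of 1 "\<beta> ^ 2" 1] by simp
    qed
    have c'F: "c' \<in> F0" using c bF pi2_F0 F0 by (simp add: c'_def)
    have "c' \<notin> P0 1"
    proof
      assume "c' \<in> P0 1"
      then have "c \<in> P0 1" using P0_diff[OF _ small, of c'] by (simp add: c'_def)
      then show False using c one_notin_P0 F0 by (simp add: P0_def P_def)
    qed
    moreover have "c' \<in> P0 0"
      using P0_add[of c 0 "\<pi> ^ 2 * \<beta> ^ 2"] small P0_antimono[of 0 1] c by (auto simp: c'_def P0_def P_def)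
    ultimately have c'u: "av c' = 1" using shell0_iff[of c' 0] by simp
    have "c' - z ^ 2 \<in> P0 1 \<longleftrightarrow> c - z ^ 2 \<in> P0 1" for z
      using P0_add[OF _ small, of "c - z ^ 2"] P0_diff[OF _ small, of "c' - z ^ 2"] by (auto simp: c'_def algebra_simps)
    then have "chi c' = chi c"
      using chi_eq_1_iff_residue[OF c] chi_eq_1_iff_residue[OF c'F c'u] chi_cases[of c] chi_cases[of c'] by auto
    moreover have "qsum (P0 0) (P0 (int m)) (\<lambda>\<alpha>. ?g (\<alpha> + \<pi> * \<beta>)) = qsum (P0 0) (P0 (int m)) (\<lambda>\<alpha>. of_bool (\<alpha> ^ 2 - c' \<in> P0 (int m)))"
    proof (intro qsum_cong finite_index_P0)
      fix \<alpha> assume "\<alpha> \<in> P0 0"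
      then have "Nm (\<alpha> + \<pi> * \<beta>) - c = \<alpha> ^ 2 - c'" using Nm_decomp[of \<alpha> \<beta>] P0_F0 bF by (simp add: c'_def)
      then show "?g (\<alpha> + \<pi> * \<beta>) = of_bool (\<alpha> ^ 2 - c' \<in> P0 (int m))" by simp
    qed simp
    ultimately show "qsum (P0 0) (P0 (int m)) (\<lambda>\<alpha>. ?g (\<alpha> + \<pi> * \<beta>)) = 1 + of_int (chi c)"
      using count_square_roots[OF c'F c'u, of "int m"] m by simp
  qed simp
  also have "\<dots> = of_nat q ^ m * (1 + of_int (chi c))"
    by (simp only: qsum_const idx_P0[of 0 "int m"] of_nat_power) simp
  finally show ?thesis unfolding 1 mult_2 power_add by (simp only: mult_divide_mult_cancel_left[OF power_not_zero[OF q_nonzero(2)]])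
qed

lemma unit_norm_order:
  assumes "u \<in> F0" "av u = 1"
  shows "u * Nm \<pi> ^ k \<in> F0" "av (u * Nm \<pi> ^ k) = av \<pi> powi (2 * int k)"
proof -
  have "av (Nm \<pi> ^ k) = av (Nm \<pi>) ^ k" by (rule av_power)
  also have "\<dots> = av \<pi> ^ (2 * k)" by (simp add: av_Nm power_mult)
  also have "\<dots> = av \<pi> powi int (2 * k)" by (simp only: power_int_of_nat)
  finally show "av (u * Nm \<pi> ^ k) = av \<pi> powi (2 * int k)" using assms by (simp add: av_mult)
  show "u * Nm \<pi> ^ k \<in> F0" using assms Nm_F0 F0 by simp
qed

text \<open>The density of \<open>z\<close> with \<open>N(z)\<close> congruent to a given element of order \<open>k\<close> modulo \<open>\<pi>\<^sub>0\<^sup>m\<close>.\<close>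

lemma mean_norm:
  assumes c: "c \<in> F0" "av c = 1" and N: "2 * m \<le> N + 1" "m \<le> N" "N \<ge> 1"
  shows "mean N (\<lambda>z. of_bool (Nm z - c * Nm \<pi> ^ k \<in> P0 (int m)))
    = (if m \<le> k then 1 else 1 + of_int (chi c)) / of_nat q ^ m"
proof -
  have NkF: "Nm \<pi> ^ k \<in> F0" and Nkav: "av (Nm \<pi> ^ k) = av \<pi> powi (2 * int k)"
    using unit_norm_order[of 1 k] F0 by simp_all
  note ck = unit_norm_order[OF c, of k]
  show ?thesis
  proof (cases "m \<le> k")
    case True
    have "c * Nm \<pi> ^ k \<in> P0 (int m)" using P0_iff_order[OF ck] True by simp
    then have "Nm z - c * Nm \<pi> ^ k \<in> P0 (int m) \<longleftrightarrow> z \<in> P (int m)" for z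
      using P0_add[of "Nm z - c * Nm \<pi> ^ k" "int m" "c * Nm \<pi> ^ k"] P0_diff[of "Nm z" "int m" "c * Nm \<pi> ^ k"] Nm_P0_iff[of z "int m"] by auto
    then show ?thesis using True mean_ball[OF N(2)] by simp
  next
    case False
    let ?g = "\<lambda>z. of_bool (Nm z - c * Nm \<pi> ^ k \<in> P0 (int m)) :: complex"
    have "mean N ?g = mean N (\<lambda>z. of_bool (z \<in> P (int k)) * ?g z)"
    proof (rule mean_cong)
      fix z
      have "z \<in> P (int k)" if "Nm z - c * Nm \<pi> ^ k \<in> P0 (int m)"
      proof -
        have "Nm z - c * Nm \<pi> ^ k \<in> P0 (int k)" using that P0_antimono[of "int k" "int m"] False by auto
        moreover have "c * Nm \<pi> ^ k \<in> P0 (int k)" using P0_iff_order[OF ck] by simp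
        ultimately have "(Nm z - c * Nm \<pi> ^ k) + c * Nm \<pi> ^ k \<in> P0 (int k)" by (rule P0_add)
        then show ?thesis using Nm_P0_iff by simp
      qed
      then show "?g z = of_bool (z \<in> P (int k)) * ?g z" by auto
    qed
    also have "\<dots> = mean N (\<lambda>z. ?g (\<pi> ^ k * z)) / of_nat q ^ k"
      using periodic_norm_congruence[OF ck(1) N(1,3)] False N by (intro mean_restrict) auto
    also have "mean N (\<lambda>z. ?g (\<pi> ^ k * z)) = mean N (\<lambda>z. of_bool (Nm z - c \<in> P0 (int (m - k))))"
    proof (rule mean_cong)
      fix z
      have "Nm (\<pi> ^ k) = Nm \<pi> ^ k" by (induction k) (simp_all add: Nm_mult)
      then have "Nm (\<pi> ^ k * z) - c * Nm \<pi> ^ k = Nm \<pi> ^ k * (Nm z - c)" by (simp add: Nm_mult algebra_simps)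
      then show "?g (\<pi> ^ k * z) = of_bool (Nm z - c \<in> P0 (int (m - k)))"
        using P0_mult_iff[OF NkF Nkav, of "Nm z - c" "int m"] False by (simp add: of_nat_diff)
    qed
    also have "\<dots> = (1 + of_int (chi c)) / of_nat q ^ (m - k)"
      using False N by (intro mean_norm_unit c) auto
    finally show ?thesis using False by (simp flip: power_add)
  qed
qed

end

section \<open>Closed forms of the sums\<close>

text \<open>With \<open>x = q\<^sup>2 Z\<close>, these are the value of \<open>pole_sum\<close> and the sum of all parts of order at most \<open>n\<close> as long as
  \<open>T\<close> is divisible by the poles involved, that is, as if \<open>T\<close> were zero.\<close>

definition pole_part :: "complex \<Rightarrow> complex \<Rightarrow> complex \<Rightarrow> nat \<Rightarrow> complex" where
  "pole_part Q x \<theta> s = 1 + \<theta> * (1 - 1 / Q) * (\<Sum>\<sigma> = 1..s. (x / Q) ^ \<sigma>)"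

definition generic :: "complex \<Rightarrow> complex \<Rightarrow> complex \<Rightarrow> nat \<Rightarrow> complex" where
  "generic Q x \<theta> n = 1 + (\<Sum>s = 1..n. \<theta> ^ 2 * (Q - 1) / Q ^ 2 * (x ^ (2 * s - 1) + x ^ (2 * s)) +
     \<theta> * (Q * x) ^ s * (1 - 1 / Q) * (pole_part Q x \<theta> s + pole_part Q x \<theta> (s - 1) / Q))"

lemma power_quotient_sum:
  fixes x Q :: complex
  assumes "Q \<noteq> 0"
  shows "x * (x / Q) ^ n = x - (Q - x) * (\<Sum>e = 1..n. (x / Q) ^ e)"
proof (induction n)
  case (Suc n)
  define W where "W = (x / Q) ^ n"
  have "x * W - (Q - x) * (x / Q * W) = x * (x / Q * W)" using assms by (simp add: field_simps)
  moreover have "(\<Sum>e = 1..Suc n. (x / Q) ^ e) = (\<Sum>e = 1..n. (x / Q) ^ e) + x / Q * W" by (simp add: W_def)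
  moreover have "(x / Q) ^ Suc n = x / Q * W" by (simp add: W_def)
  moreover have "(c - d * s) - d * y = c - d * (s + y)" for c d s y :: complex by (simp add: algebra_simps)
  ultimately show ?case using Suc by (metis W_def)
qed simp

text \<open>Both geometric sums are kept as indeterminates, which avoids the denominators \<open>Q - x\<close> and \<open>Qx - 1\<close>, which may
  vanish.\<close>

lemma generic_closed:
  assumes "Q \<noteq> 0"
  shows "generic Q x \<theta> n = 1 + \<theta> * (Q - 1) * (Q + 1) / Q ^ 2 * ((\<Sum>e = 0..n. (Q * x) ^ e) - 1) +
    \<theta> ^ 2 * (Q - 1) / Q * (((\<Sum>e = 0..n. (Q * x) ^ e) - 1) / Q ^ 2 + (\<Sum>e = 1..n. (x / Q) ^ e) * (Q * x) ^ n)"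
proof (induction n)
  case 0
  show ?case by (simp add: generic_def)
next
  case (Suc n)
  define W where "W = (x / Q) ^ n"
  define V where "V = (Q * x) ^ n"
  define S where "S = (\<Sum>e = 0..n. (Q * x) ^ e)"
  define w where "w = (\<Sum>e = 1..n. (x / Q) ^ e)"
  define Qi where "Qi = 1 / Q"
  define T where "T = x * W"
  have s: "generic Q x \<theta> (Suc n) = generic Q x \<theta> n + (\<theta> ^ 2 * (Q - 1) / Q ^ 2 * (x ^ (2 * n + 1) + x ^ (2 * n + 2)) +
     \<theta> * (Q * x) ^ Suc n * (1 - 1 / Q) * (pole_part Q x \<theta> (Suc n) + pole_part Q x \<theta> n / Q))"
    by (simp only: generic_def sum.cl_ivl_Suc) simp
  have T: "T = x - (Q - x) * w" unfolding T_def W_def w_def by (rule power_quotient_sum[OF assms])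
  have i: "Q * Qi = 1" "Q * (Qi * y) = y" for y using assms by (simp_all add: Qi_def)
  have div: "y / Q = y * Qi" "y / Q ^ 2 = y * Qi ^ 2" for y by (simp_all add: Qi_def power2_eq_square)
  have xQ: "x * Qi = x / Q" by (simp add: Qi_def)
  have WV: "x ^ (2 * n) = W * V"
    using assms by (simp add: W_def V_def power_mult power2_eq_square flip: power_mult_distrib)
  have e: "x ^ (2 * n + 1) = T * V" "x ^ (2 * n + 2) = x * T * V" "(Q * x) ^ Suc n = Q * x * V"
    "(\<Sum>e = 0..Suc n. (Q * x) ^ e) = S + Q * x * V" "(\<Sum>e = 1..Suc n. (x / Q) ^ e) = w + T * Qi"
    using WV by (simp_all add: W_def V_def S_def w_def Qi_def T_def power_add power2_eq_square)
  have u: "\<theta> ^ 2 * (Q - 1) * Qi ^ 2 * (T * V + x * T * V) + \<theta> * (Q * x * V) * (1 - 1 * Qi) *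
       ((1 + \<theta> * (1 - 1 * Qi) * (w + T * Qi)) + (1 + \<theta> * (1 - 1 * Qi) * w) * Qi)
     = \<theta> * (Q - 1) * (Q + 1) * Qi ^ 2 * (Q * x * V) + \<theta> ^ 2 * (Q - 1) * Qi * (Q * x * V * Qi ^ 2 + (w + T * Qi) * (Q * x * V) - w * V)"
    unfolding T by (simp add: algebra_simps power2_eq_square i)
  have lin: "G + k * (a - 1) + m * ((a - 1) * Qi ^ 2 + y) + I = G + k * (a + c - 1) + m * ((a + c - 1) * Qi ^ 2 + y')"
    if "I = k * c + m * (c * Qi ^ 2 + y' - y)" for G k a c m y y' I
    using that by (simp add: algebra_simps)
  show ?case
    unfolding s Suc pole_part_def div
    unfolding xQ e S_def[symmetric] w_def[symmetric] V_def[symmetric] by (rule lin, rule u)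
qed

text \<open>The final comparisons, as polynomial identities. The indeterminates stand for \<open>Qi = 1/Q\<close>, the geometric sums
  \<open>S\<close> of \<open>(Qx)\<^sup>e\<close> for \<open>0 \<le> e \<le> b\<close> and \<open>w\<close> of \<open>(x/Q)\<^sup>e\<close> for \<open>1 \<le> e \<le> b\<close>, and \<open>U = x(Qx)\<^sup>b\<close>, \<open>T = x(x/Q)\<^sup>b\<close>,
  \<open>E = x\<^sup>a Q\<^sup>b\<close>, \<open>p = w(Qx)\<^sup>b\<close>. The only relations between them are the two formulas for geometric sums. In the
  antidiagonal case \<open>b\<close> is \<open>a\<close>.\<close>

lemma diagonal_hyperbolic_algebra:
  fixes Q x Qi E e U T p S w :: complex
  assumes i: "Q * Qi = 1" "\<And>y. Q * (Qi * y) = y" and T: "T = x - (Q - x) * w" and U: "U = Qi * (1 + (Q * x - 1) * S)"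
  shows "(1 + (Q - 1) * (Q + 1) * Qi ^ 2 * (S - 1) + (Q - 1) * Qi * ((S - 1) * Qi ^ 2 + p))
    + (Q - 1) * Qi ^ 2 * (U - Q * p + w * U) - U * Qi * (1 + (1 - Qi) * w)
    + e * x * E * ((1 + (1 - Qi) * w) - T * Qi ^ 2)
   = (1 - x * Qi ^ 2) * (S + e * x * E * (1 + w))"
  unfolding T U by (simp add: algebra_simps power2_eq_square i)

lemma diagonal_unimodular_algebra:
  fixes Q x Qi E e U T p S w e2 :: complex
  assumes i: "Q * Qi = 1" "\<And>y. Q * (Qi * y) = y" and T: "T = x - (Q - x) * w" and U: "U = Qi * (1 + (Q * x - 1) * S)"
    and e2: "e2 * e2 = 1" "\<And>y. e2 * (e2 * y) = y"
  shows "(1 + (e2 * Q) * (Q - 1) * (Q + 1) * Qi ^ 2 * (S - 1) + (e2 * Q) ^ 2 * (Q - 1) * Qi * ((S - 1) * Qi ^ 2 + p))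
    + (e2 * Q) ^ 2 * (Q - 1) * Qi ^ 2 * (U - Q * p + w * U) - (e2 * Q) * U * Qi * (1 + (e2 * Q) * (1 - Qi) * w)
    + (e2 * Q) * e * x * E * ((1 + (e2 * Q) * (1 - Qi) * w) - (e2 * Q) * T * Qi ^ 2)
   = (1 - x) * (1 + e2 + Q * e2) * S - e * (Q * x * E) * (1 - x) * (1 + w)
     - e * (1 + Q) * (x * E * T) - (1 + Q) * e2 + (1 + e2) * (Q * U) + (1 + e2) * e * (Q * x * E)"
  unfolding T U by (simp add: algebra_simps power2_eq_square i e2)

lemma antidiagonal_hyperbolic_algebra:
  fixes Q x Qi U T p S w :: complex
  assumes i: "Q * Qi = 1" "\<And>y. Q * (Qi * y) = y" and T: "T = x - (Q - x) * w" and U: "U = Qi * (1 + (Q * x - 1) * S)"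
  shows "(1 + (Q - 1) * (Q + 1) * Qi ^ 2 * (S - 1) + (Q - 1) * Qi * ((S - 1) * Qi ^ 2 + p)) - (U - Q * p + w * U) * Qi ^ 2
   = (1 - x * Qi ^ 2) * S + p - U * w * Qi ^ 2"
  unfolding T U by (simp add: algebra_simps power2_eq_square i)

lemma antidiagonal_unimodular_algebra:
  fixes Q x Qi U T p S w e2 :: complex
  assumes i: "Q * Qi = 1" "\<And>y. Q * (Qi * y) = y" and T: "T = x - (Q - x) * w" and U: "U = Qi * (1 + (Q * x - 1) * S)"
    and e2: "e2 * e2 = 1" "\<And>y. e2 * (e2 * y) = y"
  shows "(1 + (e2 * Q) * (Q - 1) * (Q + 1) * Qi ^ 2 * (S - 1) + (e2 * Q) ^ 2 * (Q - 1) * Qi * ((S - 1) * Qi ^ 2 + p))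
    - (e2 * Q) ^ 2 * (U - Q * p + w * U) * Qi ^ 2
   = (1 - x) * (1 + e2 + Q * e2) * S - Q * p + Q * U * w
     - (Q + 1) * (U - Q * p + w * U) - (Q + 1) * e2 + (Q + 1) * (1 + e2) * U"
  unfolding T U by (simp add: algebra_simps power2_eq_square i e2)

section \<open>Values of binary forms and traces\<close>

context local_density_setting
begin

lemma unit_norm_P0_iff:
  assumes "u \<in> F0" "av u = 1"
  shows "u * Nm \<pi> ^ k \<in> P0 m \<longleftrightarrow> m \<le> int k"
  by (rule P0_iff_order[OF unit_norm_order[OF assms]])

lemma Nm_integral: "z \<in> P 0 \<Longrightarrow> Nm z \<in> P0 0"
  using Nm_P0_iff[of z 0] by simp

text \<open>If \<open>i < j\<close>, the first term determines the order of the sum. Otherwise the power of \<open>N(\<pi>)\<close> with exponent \<open>j\<close>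
  is a common factor, and the norms near \<open>- u/w\<close> times a power of \<open>N(\<pi>)\<close> have to be counted.\<close>

lemma mean_binary_norm:
  assumes u: "u \<in> F0" "av u = 1" and w: "w \<in> F0" "av w = 1" and N: "2 * m \<le> N + 1" "m \<le> N" "N \<ge> 1"
  shows "i < j \<Longrightarrow> mean N (\<lambda>z. of_bool (u * Nm \<pi> ^ i + w * Nm \<pi> ^ j * Nm z \<in> P0 (int m))) = of_bool (m \<le> i)"
    and "j \<le> i \<Longrightarrow> mean N (\<lambda>z. of_bool (u * Nm \<pi> ^ i + w * Nm \<pi> ^ j * Nm z \<in> P0 (int m)))
      = (if m \<le> j then 1 else (if m \<le> i then 1 else 1 + of_int (chi (- u * w))) / of_nat q ^ (m - j))"
proof -
  note uP = unit_norm_P0_iff[OF u] and wP = unit_norm_P0_iff[OF w]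
  have wz: "w * Nm \<pi> ^ j * Nm z \<in> P0 (int j)" if "z \<in> P 0" for z
    using P0_mult[OF _ Nm_integral[OF that], of "w * Nm \<pi> ^ j" "int j"] wP by simp
  show "mean N (\<lambda>z. of_bool (u * Nm \<pi> ^ i + w * Nm \<pi> ^ j * Nm z \<in> P0 (int m))) = of_bool (m \<le> i)" if "i < j"
  proof -
    have "u * Nm \<pi> ^ i + w * Nm \<pi> ^ j * Nm z \<in> P0 (int m) \<longleftrightarrow> m \<le> i" if z: "z \<in> P 0" for z
    proof
      assume m: "m \<le> i"
      have "w * Nm \<pi> ^ j * Nm z \<in> P0 (int m)" using wz[OF z] P0_antimono[of "int m" "int j"] m \<open>i < j\<close> by auto
      then show "u * Nm \<pi> ^ i + w * Nm \<pi> ^ j * Nm z \<in> P0 (int m)" using m by (intro P0_add) (simp_all add: uP)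
    next
      assume s: "u * Nm \<pi> ^ i + w * Nm \<pi> ^ j * Nm z \<in> P0 (int m)"
      show "m \<le> i"
      proof (rule ccontr)
        assume "\<not> m \<le> i"
        then have "u * Nm \<pi> ^ i + w * Nm \<pi> ^ j * Nm z \<in> P0 (int i + 1)" using s P0_antimono[of "int i + 1" "int m"] by auto
        moreover have "w * Nm \<pi> ^ j * Nm z \<in> P0 (int i + 1)" using wz[OF z] P0_antimono[of "int i + 1" "int j"] \<open>i < j\<close> by auto
        ultimately have "u * Nm \<pi> ^ i + w * Nm \<pi> ^ j * Nm z - w * Nm \<pi> ^ j * Nm z \<in> P0 (int i + 1)" by (rule P0_diff)
        then show False by (simp add: uP)
      qed
    qed
    then have "mean N (\<lambda>z. of_bool (u * Nm \<pi> ^ i + w * Nm \<pi> ^ j * Nm z \<in> P0 (int m))) = mean N (\<lambda>_. of_bool (m \<le> i))"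
      by (intro mean_cong) simp
    then show ?thesis by simp
  qed
  assume ji: "j \<le> i"
  \<comment> \<open>\<open>- u / w\<close> and \<open>- u w\<close> differ by the square of \<open>w\<close>\<close>
  define c where "c = - u / w"
  have w0: "w \<noteq> 0" using w by auto
  have c: "c \<in> F0" "av c = 1" using u w F0 w0 by (simp_all add: c_def av_divide)
  have "w ^ 2 * c = - u * w" using w0 by (simp add: c_def power2_eq_square)
  then have chi: "chi (- u * w) = chi c" using chi_mult_square[OF w(1) w0, of c] by simp
  have e: "u * Nm \<pi> ^ i + w * Nm \<pi> ^ j * Nm z \<in> P0 (int m) \<longleftrightarrow> Nm z - c * Nm \<pi> ^ (i - j) \<in> P0 (int m - int j)" for z
  proof -
    have "w * c * (Nm \<pi> ^ j * Nm \<pi> ^ (i - j)) = - u * Nm \<pi> ^ i" using w0 ji by (simp add: c_def flip: power_add)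
    then have "w * Nm \<pi> ^ j * (Nm z - c * Nm \<pi> ^ (i - j)) = u * Nm \<pi> ^ i + w * Nm \<pi> ^ j * Nm z"
      by (simp add: algebra_simps)
    then show ?thesis using P0_mult_iff[OF unit_norm_order[OF w], of j "Nm z - c * Nm \<pi> ^ (i - j)" "int m"] by simp
  qed
  show "mean N (\<lambda>z. of_bool (u * Nm \<pi> ^ i + w * Nm \<pi> ^ j * Nm z \<in> P0 (int m)))
      = (if m \<le> j then 1 else (if m \<le> i then 1 else 1 + of_int (chi (- u * w))) / of_nat q ^ (m - j))"
  proof (cases "m \<le> j")
    case True
    have "Nm z - c * Nm \<pi> ^ (i - j) \<in> P0 (int m - int j)" if "z \<in> P 0" for z
    proof -
      have "Nm z - c * Nm \<pi> ^ (i - j) \<in> P0 0"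
        using Nm_integral[OF that] unit_norm_P0_iff[OF c, of "i - j" 0] by (intro P0_diff) simp_all
      then show ?thesis using P0_antimono[of "int m - int j" 0] True by auto
    qed
    then have "mean N (\<lambda>z. of_bool (Nm z - c * Nm \<pi> ^ (i - j) \<in> P0 (int m - int j))) = mean N (\<lambda>_. 1)"
      by (intro mean_cong) simp
    then show ?thesis using True by (simp only: e mean_const if_True)
  next
    case False
    then have "int m - int j = int (m - j)" by simp
    moreover have "mean N (\<lambda>z. of_bool (Nm z - c * Nm \<pi> ^ (i - j) \<in> P0 (int (m - j))))
        = (if m - j \<le> i - j then 1 else 1 + of_int (chi c)) / of_nat q ^ (m - j)"
      using N by (intro mean_norm[OF c]) auto
    moreover have "m - j \<le> i - j \<longleftrightarrow> m \<le> i" using False ji by auto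
    ultimately show ?thesis using False by (simp only: e chi if_False)
  qed
qed

lemma mean_ramanujan:
  assumes "s \<ge> 1"
  shows "mean N (\<lambda>z. ramanujan s (g z)) = of_nat q ^ s * mean N (\<lambda>z. of_bool (g z \<in> P0 (int s)))
    - of_nat q ^ (s - 1) * mean N (\<lambda>z. of_bool (g z \<in> P0 (int (s - 1))))"
proof -
  have "int s - 1 = int (s - 1)" using assms by simp
  then show ?thesis
    by (simp only: ramanujan_def mean_def qsum_diff qsum_mult_left diff_divide_distrib times_divide_eq_right)
qed

text \<open>The mean is the difference of two consecutive values of \<open>q\<^sup>m\<close> times the density at level \<open>m\<close>. This product is
  \<open>q\<^sup>m\<close> up to the smaller exponent and constant from there on, except for a jump when \<open>m\<close> exceeds \<open>i\<close>.\<close>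

lemma mean_ramanujan_binary:
  assumes u: "u \<in> F0" "av u = 1" and w: "w \<in> F0" "av w = 1" and s: "s \<ge> 1" "2 * s \<le> N + 1"
  shows "i < j \<Longrightarrow> mean N (\<lambda>z. ramanujan s (u * Nm \<pi> ^ i + w * Nm \<pi> ^ j * Nm z))
      = of_bool (s \<le> i) * (of_nat q ^ s - of_nat q ^ (s - 1)) - of_bool (s = i + 1) * of_nat q ^ i"
    and "j \<le> i \<Longrightarrow> mean N (\<lambda>z. ramanujan s (u * Nm \<pi> ^ i + w * Nm \<pi> ^ j * Nm z))
      = of_bool (s \<le> j) * (of_nat q ^ s - of_nat q ^ (s - 1)) + of_bool (s = i + 1) * of_int (chi (- u * w)) * of_nat q ^ j"
proof -
  note m1 = mean_binary_norm[OF u w, where m = s and N = N and i = i and j = j]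
    and m2 = mean_binary_norm[OF u w, where m = "s - 1" and N = N and i = i and j = j]
  have N: "s \<le> N" "2 * (s - 1) \<le> N + 1" "s - 1 \<le> N" "N \<ge> 1" using s by auto
  show "mean N (\<lambda>z. ramanujan s (u * Nm \<pi> ^ i + w * Nm \<pi> ^ j * Nm z))
      = of_bool (s \<le> i) * (of_nat q ^ s - of_nat q ^ (s - 1)) - of_bool (s = i + 1) * of_nat q ^ i" if ij: "i < j"
    unfolding mean_ramanujan[OF s(1)] m1(1)[OF s(2) N(1,4) ij] m2(1)[OF N(2,3,4) ij]
    using s(1) by (cases "s \<le> i"; cases "s = i + 1") auto
  assume ji: "j \<le> i"
  let ?Q = "of_nat q :: complex" and ?e = "of_int (chi (- u * w)) :: complex"
  have c: "?Q ^ n * (y / ?Q ^ (n - j)) = y * ?Q ^ j" if "j \<le> n" for n y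
    using that power_add[of ?Q j "n - j"] by simp
  consider "s \<le> j" | "j < s" "s \<le> i" | "s = i + 1" | "s > i + 1" by linarith
  then show "mean N (\<lambda>z. ramanujan s (u * Nm \<pi> ^ i + w * Nm \<pi> ^ j * Nm z))
      = of_bool (s \<le> j) * (?Q ^ s - ?Q ^ (s - 1)) + of_bool (s = i + 1) * ?e * ?Q ^ j"
    unfolding mean_ramanujan[OF s(1)] m1(2)[OF s(2) N(1,4) ji] m2(2)[OF N(2,3,4) ji]
  proof cases
    case 1
    then have "s \<le> i" "s - 1 \<le> j" using ji by auto
    then show "?Q ^ s * (if s \<le> j then 1 else (if s \<le> i then 1 else 1 + ?e) / ?Q ^ (s - j)) -
      ?Q ^ (s - 1) * (if s - 1 \<le> j then 1 else (if s - 1 \<le> i then 1 else 1 + ?e) / ?Q ^ (s - 1 - j)) =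
      of_bool (s \<le> j) * (?Q ^ s - ?Q ^ (s - 1)) + of_bool (s = i + 1) * ?e * ?Q ^ j" using 1 by simp
  next
    case 2
    have "?Q ^ (s - 1) * (if s - 1 \<le> j then 1 else (if s - 1 \<le> i then 1 else 1 + ?e) / ?Q ^ (s - 1 - j)) = ?Q ^ j"
      using 2 c[of "s - 1" 1] by (cases "s - 1 = j") auto
    then show "?Q ^ s * (if s \<le> j then 1 else (if s \<le> i then 1 else 1 + ?e) / ?Q ^ (s - j)) -
      ?Q ^ (s - 1) * (if s - 1 \<le> j then 1 else (if s - 1 \<le> i then 1 else 1 + ?e) / ?Q ^ (s - 1 - j)) =
      of_bool (s \<le> j) * (?Q ^ s - ?Q ^ (s - 1)) + of_bool (s = i + 1) * ?e * ?Q ^ j" using 2 c[of s 1] by simp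
  next
    case 3
    have "?Q ^ (s - 1) * (if s - 1 \<le> j then 1 else (if s - 1 \<le> i then 1 else 1 + ?e) / ?Q ^ (s - 1 - j)) = ?Q ^ j"
      using 3 c[of "s - 1" 1] ji by (cases "s - 1 = j") auto
    then show "?Q ^ s * (if s \<le> j then 1 else (if s \<le> i then 1 else 1 + ?e) / ?Q ^ (s - j)) -
      ?Q ^ (s - 1) * (if s - 1 \<le> j then 1 else (if s - 1 \<le> i then 1 else 1 + ?e) / ?Q ^ (s - 1 - j)) =
      of_bool (s \<le> j) * (?Q ^ s - ?Q ^ (s - 1)) + of_bool (s = i + 1) * ?e * ?Q ^ j"
      using 3 ji c[of s "1 + ?e"] by (simp only: if_False) (simp add: algebra_simps)
  next
    case 4
    then have "\<not> s \<le> j" "\<not> s \<le> i" "\<not> s - 1 \<le> j" "\<not> s - 1 \<le> i" "j \<le> s" "j \<le> s - 1" "s \<noteq> i + 1" using ji by auto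
    then show "?Q ^ s * (if s \<le> j then 1 else (if s \<le> i then 1 else 1 + ?e) / ?Q ^ (s - j)) -
      ?Q ^ (s - 1) * (if s - 1 \<le> j then 1 else (if s - 1 \<le> i then 1 else 1 + ?e) / ?Q ^ (s - 1 - j)) =
      of_bool (s \<le> j) * (?Q ^ s - ?Q ^ (s - 1)) + of_bool (s = i + 1) * ?e * ?Q ^ j"
      by (simp only: if_False c) simp
  qed
qed

lemma mean_qsum_swap: "mean N (\<lambda>z. qsum A B (\<lambda>d. f z d)) = qsum A B (\<lambda>d. mean N (\<lambda>z. f z d))"
  unfolding mean_def qsum_def sum_divide_distrib by (rule sum.swap)

text \<open>Expand the indicator function into characters. Only those \<open>d\<close> survive for which \<open>d \<tau>\<close> lies in the inverse
  different.\<close>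

lemma mean_trace:
  assumes \<tau>: "\<tau> \<in> P (- 1)" "\<And>d. d \<in> F0 \<Longrightarrow> d * \<tau> \<in> P (- 1) \<longleftrightarrow> d \<in> P0 (- int a)"
    and N: "\<And>d. d \<in> P0 (- int m) \<Longrightarrow> d * \<tau> \<in> P (- int N - 1)"
  shows "of_nat q ^ m * mean N (\<lambda>z. of_bool (Tr (z * \<tau>) \<in> P0 (int m))) = of_nat q ^ min m a"
proof -
  have t: "Tr (z * \<tau>) \<in> P0 0" if "z \<in> P 0" for z
    using Tr_P[of "z * \<tau>" "- 1"] P_mult[OF that \<tau>(1)] by simp
  have "of_nat q ^ m * mean N (\<lambda>z. of_bool (Tr (z * \<tau>) \<in> P0 (int m)))
      = mean N (\<lambda>z. qsum (P0 (- int m)) (P0 0) (\<lambda>d. \<psi> (- (d * Tr (z * \<tau>)))))"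
    unfolding mean_mult_left[symmetric] by (intro mean_cong qsum_psi_neg[symmetric] t)
  also have "\<dots> = qsum (P0 (- int m)) (P0 0) (\<lambda>d. mean N (\<lambda>z. \<psi> (- (d * Tr (z * \<tau>)))))"
    by (rule mean_qsum_swap)
  also have "\<dots> = qsum (P0 (- int m)) (P0 0) (\<lambda>d. if d \<in> P0 (- int (min m a)) then 1 else 0)"
  proof (intro qsum_cong fin_P0_neg)
    fix d assume d: "d \<in> P0 (- int m)"
    then have dF: "d \<in> F0" by (rule P0_F0)
    have "- (d * Tr (z * \<tau>)) = Tr ((- (d * \<tau>)) * z)" for z
      using Tr_mult_F0[OF dF, of "z * \<tau>"] Tr_minus by (simp add: mult_ac)
    then have "mean N (\<lambda>z. \<psi> (- (d * Tr (z * \<tau>)))) = of_bool (- (d * \<tau>) \<in> P (- 1))"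
      using mean_psi_Tr[of "- (d * \<tau>)" N] N[OF d] by simp
    also have "- (d * \<tau>) \<in> P (- 1) \<longleftrightarrow> d \<in> P0 (- int a)" using \<tau>(2)[OF dF] by simp
    also have "d \<in> P0 (- int a) \<longleftrightarrow> d \<in> P0 (- int (min m a))"
      using d P0_antimono[of "- int a" "- int m"] by (cases "m \<le> a") (auto simp: min_def)
    finally show "mean N (\<lambda>z. \<psi> (- (d * Tr (z * \<tau>)))) = (if d \<in> P0 (- int (min m a)) then 1 else 0)" by simp
  qed
  also have "\<dots> = qsum (P0 (- int (min m a))) (P0 0) (\<lambda>_. 1)"
    by (intro qsum_restrict finite_index_P0) (simp_all add: periodic_def)
  also have "\<dots> = of_nat q ^ min m a" by (simp add: qsum_const idx_P0)
  finally show ?thesis .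
qed

lemma mean_ramanujan_trace:
  assumes \<tau>: "\<tau> \<in> P (- 1)" "\<And>d. d \<in> F0 \<Longrightarrow> d * \<tau> \<in> P (- 1) \<longleftrightarrow> d \<in> P0 (- int a)"
    and N: "\<And>d. d \<in> P0 (- int s) \<Longrightarrow> d * \<tau> \<in> P (- int N - 1)" and s: "s \<ge> 1"
  shows "mean N (\<lambda>z. ramanujan s (Tr (z * \<tau>))) = of_bool (s \<le> a) * (of_nat q ^ s - of_nat q ^ (s - 1))"
proof -
  have N': "d * \<tau> \<in> P (- int N - 1)" if "d \<in> P0 (- int (s - 1))" for d
    using N[of d] that P0_antimono[of "- int s" "- int (s - 1)"] by auto
  have m: "of_nat q ^ s * mean N (\<lambda>z. of_bool (Tr (z * \<tau>) \<in> P0 (int s))) = of_nat q ^ min s a"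
    by (intro mean_trace \<tau> N)
  have m': "of_nat q ^ (s - 1) * mean N (\<lambda>z. of_bool (Tr (z * \<tau>) \<in> P0 (int (s - 1)))) = of_nat q ^ min (s - 1) a"
    by (intro mean_trace \<tau> N')
  show ?thesis unfolding mean_ramanujan[OF s] m m' using s by (cases "s \<le> a"; cases "s = a + 1") (auto simp: min_def)
qed

lemma ramanujan_cong:
  assumes "t - t' \<in> P0 (int s)"
  shows "ramanujan s t = ramanujan s t'"
proof -
  have "t \<in> P0 k \<longleftrightarrow> t' \<in> P0 k" if "k \<le> int s" for k
  proof -
    have "t - t' \<in> P0 k" using assms P0_antimono[OF that] by auto
    then show ?thesis using P0_add[of "t - t'" k t'] P0_diff[of t k "t - t'"] by auto
  qed
  then show ?thesis by (simp add: ramanujan_def)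
qed

lemma qsum_eq_mean:
  "qsum (P 0) (P (2 * int s)) g = of_nat q ^ (2 * s) * mean (2 * s) g"
  by (simp add: mean_def)

text \<open>Substitute \<open>\<pi> z\<close> for \<open>z\<close>, to reduce to a mean over all integers.\<close>

lemma qsum_ramanujan_odd:
  assumes t: "t' \<in> P0 0" "\<tau> \<in> P (- 1)" and s: "s \<ge> 1"
  shows "qsum (P 1) (P (2 * int s)) (\<lambda>z. ramanujan s (t + t' * Nm z + Tr (z * \<tau>)))
    = of_nat q ^ (2 * s - 1) * mean (2 * s - 1) (\<lambda>z. ramanujan s (t + t' * Nm \<pi> * Nm z + Tr (z * (\<pi> * \<tau>))))"
proof -
  let ?g = "\<lambda>z. ramanujan s (t + t' * Nm z + Tr (z * \<tau>))"
  have per: "periodic (P 1) (P (2 * int s)) ?g"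
    unfolding periodic_def
  proof (intro ballI impI ramanujan_cong)
    fix x y assume xy: "x \<in> P 1" "y \<in> P 1" "x - y \<in> P (2 * int s)"
    then have O: "x \<in> P 0" "y \<in> P 0" using P_antimono[of 0 1] by auto
    have "Nm x - Nm y \<in> P0 ((int (2 * s) + 1) div 2)" using O xy(3) s by (intro Nm_cong) auto
    then have "t' * (Nm x - Nm y) \<in> P0 (int s)" using P0_mult[OF t(1)] by fastforce
    moreover have "(x - y) * \<tau> \<in> P (2 * int s - 1)" using P_mult[OF xy(3) t(2)] by simp
    then have "Tr ((x - y) * \<tau>) \<in> P0 (int s)" using Tr_P by fastforce
    ultimately have "t' * (Nm x - Nm y) + Tr ((x - y) * \<tau>) \<in> P0 (int s)" by (rule P0_add)
    then show "t + t' * Nm x + Tr (x * \<tau>) - (t + t' * Nm y + Tr (y * \<tau>)) \<in> P0 (int s)"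
      by (simp add: algebra_simps Tr_diff)
  qed
  have p: "av \<pi> = av \<pi> powi 1" by simp
  note it = P_mult_iff[OF p]
  have pi0: "\<pi> \<noteq> 0" using av_powi_nonzero[OF p] .
  have "qsum (P 1) (P (2 * int s)) ?g = qsum (P 0) (P (int (2 * s - 1))) (\<lambda>z. ?g (\<pi> * z))"
  proof (rule qsum_bij(2)[OF fin_O P_subgroup P_subgroup P_antimono _ _ _ per])
    show "1 \<le> 2 * int s" using s by simp
    show "\<pi> * z \<in> P 1" if "z \<in> P 0" for z using it that by simp
    show "\<pi> * x - \<pi> * y \<in> P (2 * int s) \<longleftrightarrow> x - y \<in> P (int (2 * s - 1))" for x y
      using it[of "x - y" "2 * int s"] s by (simp add: right_diff_distrib of_nat_diff)
    fix y assume y: "y \<in> P 1"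
    have "\<pi> * (y / \<pi>) = y" using pi0 by simp
    moreover have "y / \<pi> \<in> P 0" using it[of "y / \<pi>" 1] y pi0 by simp
    ultimately show "\<exists>x \<in> P 0. y - \<pi> * x \<in> P (2 * int s)" by force
  qed
  also have "\<dots> = of_nat q ^ (2 * s - 1) * mean (2 * s - 1) (\<lambda>z. ?g (\<pi> * z))" by (simp add: mean_def)
  also have "mean (2 * s - 1) (\<lambda>z. ?g (\<pi> * z)) = mean (2 * s - 1) (\<lambda>z. ramanujan s (t + t' * Nm \<pi> * Nm z + Tr (z * (\<pi> * \<tau>))))"
    by (simp add: Nm_mult mult_ac)
  finally show ?thesis .
qed

lemma pole_sum_integral:
  assumes "\<And>m. m \<le> s \<Longrightarrow> t \<in> P0 (int m)"
  shows "pole_sum \<theta> Z s t = pole_part (of_nat q) (of_nat q ^ 2 * Z) \<theta> s"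
proof -
  let ?Q = "of_nat q :: complex"
  have "(\<Sum>\<sigma> = 1..s. Z ^ \<sigma> * ramanujan \<sigma> t) = (\<Sum>\<sigma> = 1..s. (1 - 1 / ?Q) * (?Q ^ 2 * Z / ?Q) ^ \<sigma>)"
  proof (intro sum.cong refl)
    fix \<sigma> assume s: "\<sigma> \<in> {1..s}"
    then obtain n where n: "\<sigma> = Suc n" by (cases \<sigma>) auto
    have r: "ramanujan (Suc n) t = ?Q ^ Suc n - ?Q ^ n"
      using assms[of \<sigma>] assms[of n] s n by (simp add: ramanujan_def)
    have eq: "?Q ^ 2 * Z / ?Q = ?Q * Z" by (simp add: power2_eq_square)
    have y: "(1 - 1 / ?Q) * y = y - y / ?Q" for y by (simp add: left_diff_distrib)
    show "Z ^ \<sigma> * ramanujan \<sigma> t = (1 - 1 / ?Q) * (?Q ^ 2 * Z / ?Q) ^ \<sigma>"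
      unfolding r n eq y power_mult_distrib right_diff_distrib by (simp add: mult_ac)
  qed
  then show ?thesis by (simp add: pole_sum_def pole_part_def sum_distrib_left[symmetric])
qed

text \<open>At order \<open>k + 1\<close> the Ramanujan sum is \<open>- q\<^sup>k\<close>, and it is zero beyond.\<close>

lemma pole_sum_past_order:
  assumes t: "\<And>m. t \<in> P0 (int m) \<longleftrightarrow> m \<le> k" and s: "s > k"
  shows "pole_sum \<theta> Z s t = pole_part (of_nat q) (of_nat q ^ 2 * Z) \<theta> k
    - \<theta> * (of_nat q ^ 2 * Z / of_nat q) ^ (k + 1) / of_nat q"
proof -
  have r: "ramanujan (Suc n) t = - of_bool (n = k) * of_nat q ^ k" if "n \<ge> k" for n
    using t[of "Suc n"] t[of n] that by (auto simp: ramanujan_def)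
  have step: "pole_sum \<theta> Z (Suc n) t = pole_sum \<theta> Z n t + \<theta> * (Z ^ Suc n * ramanujan (Suc n) t)" for n
    by (simp add: pole_sum_def algebra_simps)
  let ?Q = "of_nat q :: complex"
  have "?Q ^ 2 * Z / ?Q = ?Q * Z" by (simp add: power2_eq_square)
  then have y: "(?Q ^ 2 * Z / ?Q) ^ (k + 1) / ?Q = Z ^ Suc k * ?Q ^ k" by (simp add: power_mult_distrib)
  then have 1: "pole_sum \<theta> Z (Suc k) t = pole_part ?Q (?Q ^ 2 * Z) \<theta> k - \<theta> * (?Q ^ 2 * Z / ?Q) ^ (k + 1) / ?Q"
    unfolding step r[OF order_refl] times_divide_eq_right[of \<theta> "(?Q ^ 2 * Z / ?Q) ^ (k + 1)" ?Q, symmetric] y using pole_sum_integral[of k t \<theta> Z] t by simp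
  from s have "Suc k \<le> s" by simp
  then show ?thesis
    by (induction s rule: dec_induct) (simp_all add: 1, simp add: step r 1)
qed

end

section \<open>The sum for diagonal and for antidiagonal matrices\<close>

lemma sum_of_bool_cases:
  fixes F g :: "nat \<Rightarrow> complex"
  assumes "\<And>s. s \<ge> 1 \<Longrightarrow> F s = of_bool (s \<le> n) * g s + of_bool (s = i) * A + of_bool (s = j) * B"
    and "n \<le> l" "1 \<le> i" "i \<le> l" "1 \<le> j" "j \<le> l"
  shows "(\<Sum>s = 1..l. F s) = (\<Sum>s = 1..n. g s) + A + B"
proof -
  have "(\<Sum>s = 1..l. F s) = (\<Sum>s = 1..l. of_bool (s \<le> n) * g s) + (\<Sum>s = 1..l. of_bool (s = i) * A) + (\<Sum>s = 1..l. of_bool (s = j) * B)"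
    unfolding sum.distrib[symmetric] using assms(1) by (intro sum.cong) auto
  moreover have "(\<Sum>s = 1..l. of_bool (s \<le> n) * g s) = (\<Sum>s = 1..n. g s)"
    using assms(2) by (intro sum.mono_neutral_cong_right) auto
  moreover have "(\<Sum>s = 1..l. of_bool (s = k) * C) = C" if "1 \<le> k" "k \<le> l" for k and C :: complex
  proof -
    have "(\<Sum>s = 1..l. of_bool (s = k) * C) = (\<Sum>s = 1..l. if s = k then C else 0)" by (intro sum.cong) auto
    then show ?thesis using that by simp
  qed
  ultimately show ?thesis using assms by simp
qed

text \<open>The part of order \<open>b + 1\<close> when \<open>b < a\<close>: here the even antidiagonal part cancels the last step of \<open>pole_part\<close>.\<close>

lemma diagonal_corner:
  fixes Q V y p z \<theta> Y :: complex
  assumes Q: "Q \<noteq> 0" and Y: "Y = Q * V * y"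
  shows "\<theta> ^ 2 * z / Q ^ 2 * (Q - 1) + \<theta> * Y / Q * p * (Q * V - V) + \<theta> ^ 2 * (Y * Y) / Q ^ 2 * (Q - 1)
      + \<theta> * Y * (p + \<theta> * (1 - 1 / Q) * y) * (- V) = \<theta> ^ 2 * z / Q ^ 2 * (Q - 1) - \<theta> * Y * V / Q * p"
proof -
  define Qi where "Qi = 1 / Q"
  have i: "Q * Qi = 1" "Q * (Qi * w) = w" for w using Q by (simp_all add: Qi_def)
  have div: "w / Q = w * Qi" "w / Q ^ 2 = w * Qi ^ 2" for w by (simp_all add: Qi_def power2_eq_square)
  show ?thesis unfolding Y div by (simp add: algebra_simps power2_eq_square i)
qed

context polar_sum
begin

abbreviation Q :: complex where "Q \<equiv> of_nat q"

abbreviation x :: complex where "x \<equiv> Q ^ 2 * Z"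

definition generic_term :: "nat \<Rightarrow> complex" where
  "generic_term s = \<theta> ^ 2 * (Q - 1) / Q ^ 2 * (x ^ (2 * s - 1) + x ^ (2 * s)) +
     \<theta> * (Q * x) ^ s * (1 - 1 / Q) * (pole_part Q x \<theta> s + pole_part Q x \<theta> (s - 1) / Q)"

lemma antidiagonal_part_odd:
  "antidiagonal_part (2 * Suc n - 1) = \<theta> ^ 2 * x ^ (2 * n + 1) / Q ^ 2 * of_bool (t1 \<in> P0 (int n)) * of_bool (t2 \<in> P0 (int n)) *
     (Q * of_bool (\<tau> \<in> P (2 * int n)) - of_bool (\<tau> \<in> P (2 * int n - 1)))"
proof -
  have e: "2 * Suc n - 1 = 2 * n + 1" "(2 * n + 1) div 2 = n" "(2 * n + 1 - 1) div 2 = n"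
    "2 * n + 1 - 1 = 2 * n" "2 * n div 2 = n" "int (2 * n + 1) - 1 = 2 * int n" "int (2 * n + 1) - 2 = 2 * int n - 1" by auto
  have "(Q ^ 2) ^ (2 * n + 1) = Q ^ 2 * (Q ^ n * Q ^ n * Q ^ (2 * n))"
    by (simp only: power_mult[symmetric] power_add[symmetric]) (rule arg_cong[of _ _ "power Q"], simp)
  then have x: "x ^ (2 * n + 1) = Q ^ 2 * (Q ^ n * Q ^ n * Q ^ (2 * n)) * Z ^ (2 * n + 1)" unfolding power_mult_distrib by simp
  have c: "\<theta> ^ 2 * (Q ^ 2 * y) / Q ^ 2 = \<theta> ^ 2 * y" for y by simp
  have Q1: "Q ^ (2 * n + 1) = Q * Q ^ (2 * n)" by simp
  show ?thesis
    unfolding antidiagonal_part_def e x mult.assoc[of "Q ^ 2"] c Q1 by (simp only: right_diff_distrib mult_ac)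
qed

lemma antidiagonal_part_even:
  "antidiagonal_part (2 * Suc n) = \<theta> ^ 2 * x ^ (2 * n + 2) / Q ^ 2 * of_bool (t1 \<in> P0 (int n + 1)) * of_bool (t2 \<in> P0 (int n)) *
     (Q * of_bool (\<tau> \<in> P (2 * int n + 1)) - of_bool (\<tau> \<in> P (2 * int n)))"
proof -
  have e: "2 * Suc n = 2 * n + 2" "(2 * n + 2) div 2 = n + 1" "(2 * n + 2 - 1) div 2 = n" "int (n + 1) = int n + 1"
    "2 * n + 2 - 1 = 2 * n + 1" "(2 * n + 1) div 2 = n" "int (2 * n + 2) - 1 = 2 * int n + 1" "int (2 * n + 2) - 2 = 2 * int n" by auto
  have "(Q ^ 2) ^ (2 * n + 2) = Q ^ 2 * (Q ^ (n + 1) * Q ^ n * Q ^ (2 * n + 1))"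
    by (simp only: power_mult[symmetric] power_add[symmetric]) (rule arg_cong[of _ _ "power Q"], simp)
  then have x: "x ^ (2 * n + 2) = Q ^ 2 * (Q ^ (n + 1) * Q ^ n * Q ^ (2 * n + 1)) * Z ^ (2 * n + 2)" unfolding power_mult_distrib by simp
  have c: "\<theta> ^ 2 * (Q ^ 2 * y) / Q ^ 2 = \<theta> ^ 2 * y" for y by simp
  have Q1: "Q ^ (2 * n + 2) = Q * Q ^ (2 * n + 1)" by simp
  show ?thesis
    unfolding antidiagonal_part_def e x mult.assoc[of "Q ^ 2"] c Q1 by (simp only: right_diff_distrib mult_ac)
qed

lemma diagonal_part2_eq:
  "diagonal_part2 s = \<theta> * x ^ s * pole_sum \<theta> Z s t1 * mean (2 * s) (\<lambda>z. ramanujan s (t2 + t1 * Nm z + Tr (z * \<tau>)))"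
proof -
  have "x ^ s = Q ^ (2 * s) * Z ^ s" unfolding power_mult_distrib power_mult by simp
  then show ?thesis unfolding diagonal_part2_def qsum_eq_mean by (simp only: mult_ac)
qed

lemma diagonal_part1_eq:
  assumes "s \<ge> 1"
  shows "diagonal_part1 s = \<theta> * x ^ s / Q * pole_sum \<theta> Z (s - 1) t2 *
     mean (2 * s - 1) (\<lambda>z. ramanujan s (t1 + t2 * Nm \<pi> * Nm z + Tr (z * (\<pi> * \<tau>))))"
proof -
  have "Q ^ (2 * s) = Q * Q ^ (2 * s - 1)" using assms by (cases s) simp_all
  then have "x ^ s = Q * (Q ^ (2 * s - 1) * Z ^ s)" unfolding power_mult_distrib power_mult[symmetric] by simp
  then have "\<theta> * x ^ s / Q = \<theta> * (Q ^ (2 * s - 1) * Z ^ s)" by simp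
  then show ?thesis
    unfolding diagonal_part1_def qsum_ramanujan_odd[OF t2 tau assms] by (simp only: mult_ac)
qed

lemma generic_term_eq:
  "generic_term (Suc n) = \<theta> ^ 2 * x ^ (2 * n + 1) / Q ^ 2 * (Q - 1)
    + \<theta> * x ^ Suc n / Q * pole_part Q x \<theta> n * (Q ^ Suc n - Q ^ n)
    + \<theta> ^ 2 * x ^ (2 * n + 2) / Q ^ 2 * (Q - 1)
    + \<theta> * x ^ Suc n * pole_part Q x \<theta> (Suc n) * (Q ^ Suc n - Q ^ n)"
proof -
  define Y where "Y = x ^ Suc n"
  define D where "D = Q ^ Suc n - Q ^ n"
  have Q: "(Q * x) ^ Suc n * (1 - 1 / Q) = Y * D"
  proof -
    have "(Q * x) ^ Suc n = Q ^ Suc n * Y" unfolding Y_def by (rule power_mult_distrib)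
    then show ?thesis unfolding D_def right_diff_distrib by simp
  qed
  have e: "2 * Suc n = 2 * n + 2" "2 * n + 2 - 1 = 2 * n + 1" "Suc n - 1 = n" by auto
  have ac: "\<theta> ^ 2 * (Q - 1) / Q ^ 2 * (y + z) + \<theta> * (Y * D) * (p + p' / Q) =
    \<theta> ^ 2 * y / Q ^ 2 * (Q - 1) + \<theta> * Y / Q * p' * D + \<theta> ^ 2 * z / Q ^ 2 * (Q - 1) + \<theta> * Y * p * D" for y z p p'
  proof -
    have "\<theta> ^ 2 * (Q - 1) / Q ^ 2 * (y + z) = \<theta> ^ 2 * y / Q ^ 2 * (Q - 1) + \<theta> ^ 2 * z / Q ^ 2 * (Q - 1)"
      by (simp only: distrib_left distrib_right add_divide_distrib times_divide_eq_left times_divide_eq_right mult_ac)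
    moreover have "\<theta> * (Y * D) * (p + p' / Q) = \<theta> * Y * p * D + \<theta> * Y / Q * p' * D"
      by (simp only: distrib_left distrib_right add_divide_distrib times_divide_eq_left times_divide_eq_right mult_ac)
    ultimately show ?thesis by simp
  qed
  show ?thesis
    unfolding generic_term_def e mult.assoc[of \<theta> "(Q * x) ^ Suc n"] Q ac Y_def[symmetric] D_def[symmetric] by (rule refl)
qed

lemma form_sum_generic:
  assumes "\<And>n. antidiagonal_part (2 * Suc n - 1) + diagonal_part1 (Suc n) + antidiagonal_part (2 * Suc n) + diagonal_part2 (Suc n)
      = of_bool (n < k) * generic_term (Suc n) + of_bool (n = i) * A + of_bool (n = j) * B"
    and "k \<le> l" "i < l" "j < l"
  shows "form_sum l l (2 * l) = generic Q x \<theta> k + A + B"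
proof -
  have "antidiagonal_part (2 * s - 1) + diagonal_part1 s + antidiagonal_part (2 * s) + diagonal_part2 s
      = of_bool (s \<le> k) * generic_term s + of_bool (s = Suc i) * A + of_bool (s = Suc j) * B" if "s \<ge> 1" for s
    using assms(1)[of "s - 1"] that by (cases s) (simp_all add: Suc_le_eq)
  then have "(\<Sum>s = 1..l. antidiagonal_part (2 * s - 1) + diagonal_part1 s + antidiagonal_part (2 * s) + diagonal_part2 s)
      = (\<Sum>s = 1..k. generic_term s) + A + B"
    by (rule sum_of_bool_cases) (use assms in auto)
  then show ?thesis unfolding form_sum_eq[OF order_refl] generic_def generic_term_def by (simp only: add.assoc)
qed

text \<open>The diagonal parts stop at order \<open>a\<close>; only the antidiagonal part of order \<open>2a + 1\<close> is left beyond it.\<close>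

theorem antidiagonal_form_sum:
  assumes T: "t1 = 0" "t2 = 0" "av \<tau> = av \<pi> powi (2 * int a - 1)" and l: "a < l"
  shows "form_sum l l (2 * l) = generic Q x \<theta> a - \<theta> ^ 2 * x ^ (2 * a + 1) / Q ^ 2"
proof -
  have \<tau>P: "\<tau> \<in> P k \<longleftrightarrow> k \<le> 2 * int a - 1" for k using T(3) by (simp add: P_def powi_le_iff)
  have pt: "av (\<pi> * \<tau>) = av \<pi> powi (2 * int a)" using T(3) powi_add[of 1 "2 * int a - 1"] by (simp add: av_mult)
  have tP: "d * \<tau> \<in> P (- 1) \<longleftrightarrow> d \<in> P0 (- int a)" if "d \<in> F0" for d
    using P_mult_iff[OF T(3), of d "- 1"] that by (simp add: P0_def mult.commute)
  have ptP: "d * (\<pi> * \<tau>) \<in> P (- 1) \<longleftrightarrow> d \<in> P0 (- int a)" if "d \<in> F0" for d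
  proof -
    have "(- 1 - 2 * int a + 1) div 2 = - int a" by presburger
    then show ?thesis
      using P_mult_iff[OF pt, of d "- 1"] F0_P_iff[OF that, of "- 1 - 2 * int a"] by (simp only: mult.commute)
  qed
  have \<pi>\<tau>: "\<pi> * \<tau> \<in> P 0" using pt by (simp add: P_def powi_le_iff[of _ 0, simplified])
  have m2: "mean (2 * s) (\<lambda>z. ramanujan s (Tr (z * \<tau>))) = of_bool (s \<le> a) * (Q ^ s - Q ^ (s - 1))" if s: "s \<ge> 1" for s
  proof (rule mean_ramanujan_trace[OF tau tP _ s])
    fix d assume "d \<in> P0 (- int s)"
    then show "d * \<tau> \<in> P (- int (2 * s) - 1)" using P_mult[OF P0_P tau] by fastforce
  qed
  have m1: "mean (2 * s - 1) (\<lambda>z. ramanujan s (Tr (z * (\<pi> * \<tau>)))) = of_bool (s \<le> a) * (Q ^ s - Q ^ (s - 1))" if s: "s \<ge> 1" for s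
  proof (rule mean_ramanujan_trace[OF _ ptP _ s])
    show "\<pi> * \<tau> \<in> P (- 1)" using \<pi>\<tau> P_antimono[of "- 1" 0] by auto
    fix d assume "d \<in> P0 (- int s)"
    then have "d * (\<pi> * \<tau>) \<in> P (2 * (- int s) + 0)" by (intro P_mult P0_P \<pi>\<tau>)
    moreover have "- int (2 * s - 1) - 1 = 2 * (- int s) + 0" using s by (simp add: of_nat_diff)
    ultimately show "d * (\<pi> * \<tau>) \<in> P (- int (2 * s - 1) - 1)" by metis
  qed
  have p: "pole_sum \<theta> Z s 0 = pole_part Q x \<theta> s" for s by (rule pole_sum_integral) simp
  have "form_sum l l (2 * l) = generic Q x \<theta> a + (- (\<theta> ^ 2 * x ^ (2 * a + 1) / Q ^ 2)) + 0"
  proof (rule form_sum_generic[where i = a and j = a])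
    fix n
    have b: "2 * int n \<le> 2 * int a - 1 \<longleftrightarrow> n < a" "2 * int n - 1 \<le> 2 * int a - 1 \<longleftrightarrow> n \<le> a"
      "2 * int n + 1 \<le> 2 * int a - 1 \<longleftrightarrow> n < a" by auto
    have A1: "antidiagonal_part (2 * Suc n - 1) = \<theta> ^ 2 * x ^ (2 * n + 1) / Q ^ 2 * (Q * of_bool (n < a) - of_bool (n \<le> a))"
      unfolding antidiagonal_part_odd \<tau>P b by (simp add: T(1,2))
    have A2: "antidiagonal_part (2 * Suc n) = \<theta> ^ 2 * x ^ (2 * n + 2) / Q ^ 2 * (Q * of_bool (n < a) - of_bool (n < a))"
      unfolding antidiagonal_part_even \<tau>P b by (simp add: T(1,2))
    have "1 \<le> Suc n" by simp
    then have D1: "diagonal_part1 (Suc n) = \<theta> * x ^ Suc n / Q * pole_part Q x \<theta> n * (of_bool (Suc n \<le> a) * (Q ^ Suc n - Q ^ n))"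
      unfolding diagonal_part1_eq[OF \<open>1 \<le> Suc n\<close>]
      by (simp only: T(1,2) mult_zero_left add_0_left m1[OF \<open>1 \<le> Suc n\<close>] p diff_Suc_1)
    have D2: "diagonal_part2 (Suc n) = \<theta> * x ^ Suc n * pole_part Q x \<theta> (Suc n) * (of_bool (Suc n \<le> a) * (Q ^ Suc n - Q ^ n))"
      unfolding diagonal_part2_eq
      by (simp only: T(1,2) mult_zero_left add_0_left m2[OF \<open>1 \<le> Suc n\<close>] p diff_Suc_1)
    show "antidiagonal_part (2 * Suc n - 1) + diagonal_part1 (Suc n) + antidiagonal_part (2 * Suc n) + diagonal_part2 (Suc n)
      = of_bool (n < a) * generic_term (Suc n) + of_bool (n = a) * (- (\<theta> ^ 2 * x ^ (2 * a + 1) / Q ^ 2)) + of_bool (n = a) * 0"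
    proof (cases "n < a")
      case True
      then have "of_bool (n < a) = (1 :: complex)" "of_bool (n \<le> a) = (1 :: complex)" "of_bool (Suc n \<le> a) = (1 :: complex)" "of_bool (n = a) = (0 :: complex)" by auto
      then show ?thesis unfolding A1 A2 D1 D2 generic_term_eq by (simp only: mult_1_left mult_1_right mult_zero_left add_0_right)
    next
      case False
      then show ?thesis unfolding A1 A2 D1 D2 by simp
    qed
  qed (use l in simp_all)
  then show ?thesis by simp
qed

text \<open>The boundary terms come from the first orders beyond \<open>b\<close> and \<open>a\<close>. When \<open>a = b\<close>, both occur at order \<open>b + 1\<close>:
  then the character comes from the part dominated by \<open>d\<close>, and otherwise from the part dominated by \<open>a\<close>.\<close>

theorem diagonal_form_sum:
  assumes T: "t1 = u1 * Nm \<pi> ^ a" "t2 = u2 * Nm \<pi> ^ b" "\<tau> = 0"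
    and u1: "u1 \<in> F0" "av u1 = 1" and u2: "u2 \<in> F0" "av u2 = 1" and ba: "b \<le> a" and l: "a < l"
  shows "form_sum l l (2 * l) = generic Q x \<theta> b
    + (\<theta> ^ 2 * x ^ (2 * b + 1) / Q ^ 2 * (Q - 1) - \<theta> * x ^ (b + 1) * Q ^ b / Q * pole_part Q x \<theta> b)
    + \<theta> * x ^ (a + 1) * (pole_part Q x \<theta> b - \<theta> * (x / Q) ^ (b + 1) / Q) * (of_int (chi (- u1 * u2)) * Q ^ b)"
    (is "_ = _ + ?A + ?B")
proof (rule form_sum_generic[where i = b and j = a])
  fix n
  let ?e = "of_int (chi (- u1 * u2)) :: complex"
  have t1P: "t1 \<in> P0 m \<longleftrightarrow> m \<le> int a" and t2P: "t2 \<in> P0 m \<longleftrightarrow> m \<le> int b" for m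
    unfolding T by (simp_all only: unit_norm_P0_iff u1 u2)
  have tau0: "\<tau> \<in> P k" for k using T(3) by simp
  have b: "int n \<le> int k \<longleftrightarrow> n \<le> k" "int n + 1 \<le> int k \<longleftrightarrow> n < k" for k by auto
  have A1: "antidiagonal_part (2 * Suc n - 1) = \<theta> ^ 2 * x ^ (2 * n + 1) / Q ^ 2 * of_bool (n \<le> a) * of_bool (n \<le> b) * (Q - 1)"
    unfolding antidiagonal_part_odd t1P t2P b by (simp add: tau0)
  have A2: "antidiagonal_part (2 * Suc n) = \<theta> ^ 2 * x ^ (2 * n + 2) / Q ^ 2 * of_bool (n < a) * of_bool (n \<le> b) * (Q - 1)"
    unfolding antidiagonal_part_even t1P t2P b by (simp add: tau0)
  have s: "1 \<le> Suc n" "2 * Suc n \<le> 2 * Suc n + 1" "2 * Suc n \<le> (2 * Suc n - 1) + 1" by auto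
  have v: "t2 + t1 * Nm z + Tr (z * \<tau>) = u2 * Nm \<pi> ^ b + u1 * Nm \<pi> ^ a * Nm z"
    "t1 + t2 * Nm \<pi> * Nm z + Tr (z * (\<pi> * \<tau>)) = u1 * Nm \<pi> ^ a + u2 * Nm \<pi> ^ (b + 1) * Nm z" for z
    unfolding T by (simp_all add: mult_ac)
  define R1 where "R1 = mean (2 * Suc n - 1) (\<lambda>z. ramanujan (Suc n) (u1 * Nm \<pi> ^ a + u2 * Nm \<pi> ^ (b + 1) * Nm z))"
  define R2 where "R2 = mean (2 * Suc n) (\<lambda>z. ramanujan (Suc n) (u2 * Nm \<pi> ^ b + u1 * Nm \<pi> ^ a * Nm z))"
  have D1: "diagonal_part1 (Suc n) = \<theta> * x ^ Suc n / Q * pole_sum \<theta> Z n t2 * R1"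
    unfolding diagonal_part1_eq[OF s(1)] v R1_def by simp
  have D2: "diagonal_part2 (Suc n) = \<theta> * x ^ Suc n * pole_sum \<theta> Z (Suc n) t1 * R2"
    unfolding diagonal_part2_eq v R2_def by simp
  have pole1: "pole_sum \<theta> Z k t1 = pole_part Q x \<theta> k" if "k \<le> a" for k
    using that by (intro pole_sum_integral) (simp add: t1P)
  have pole2: "pole_sum \<theta> Z k t2 = pole_part Q x \<theta> k" if "k \<le> b" for k
    using that by (intro pole_sum_integral) (simp add: t2P)
  have pole1': "pole_sum \<theta> Z k t1 = pole_part Q x \<theta> a - \<theta> * (x / Q) ^ (a + 1) / Q" if "k > a" for k
    using that by (intro pole_sum_past_order) (simp_all add: t1P)
  have pole2': "pole_sum \<theta> Z k t2 = pole_part Q x \<theta> b - \<theta> * (x / Q) ^ (b + 1) / Q" if "k > b" for k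
    using that by (intro pole_sum_past_order) (simp_all add: t2P)
  have e: "chi (- u2 * u1) = chi (- u1 * u2)" by (simp add: mult.commute)
  note R = mean_ramanujan_binary[OF u2 u1 s(1,2), where i = b and j = a, folded R2_def, unfolded e]
    mean_ramanujan_binary[OF u1 u2 s(1,3), where i = a and j = "b + 1", folded R1_def]
  let ?F = "antidiagonal_part (2 * Suc n - 1) + diagonal_part1 (Suc n) + antidiagonal_part (2 * Suc n) + diagonal_part2 (Suc n)"
  have "?F = generic_term (Suc n)" if n: "n < b"
  proof -
    have "R1 = Q ^ Suc n - Q ^ n" using R(3,4) n ba by (cases "a = b") simp_all
    moreover have "R2 = Q ^ Suc n - Q ^ n" using R(1,2) n ba by (cases "a = b") simp_all
    moreover have "of_bool (n \<le> a) = (1 :: complex)" "of_bool (n < a) = (1 :: complex)" "of_bool (n \<le> b) = (1 :: complex)"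
      using n ba by auto
    ultimately show ?thesis
      unfolding A1 A2 D1 D2 generic_term_eq using pole1[of "Suc n"] pole2[of n] n ba by (simp only: mult_1_right)
  qed
  moreover have "?F = ?A + of_bool (a = b) * ?B" if n: "n = b"
  proof (cases "a = b")
    case True
    then have R': "R1 = - (Q ^ n)" "R2 = ?e * Q ^ n" using R n by simp_all
    have "?F = \<theta> ^ 2 * x ^ (2 * n + 1) / Q ^ 2 * (Q - 1) + \<theta> * x ^ Suc n / Q * pole_part Q x \<theta> n * - (Q ^ n)
        + \<theta> * x ^ Suc n * (pole_part Q x \<theta> n - \<theta> * (x / Q) ^ (n + 1) / Q) * (?e * Q ^ n)"
      unfolding A1 A2 D1 D2 R' using pole1'[of "Suc n"] pole2[of n] n True by simp
    then show ?thesis using n True by simp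
  next
    case False
    then have R': "R1 = Q * Q ^ n - Q ^ n" "R2 = - (Q ^ n)" using R n ba by simp_all
    define Y where "Y = x ^ Suc n"
    have Y: "Y = Q * Q ^ n * (x / Q) ^ (n + 1)" by (simp add: Y_def power_divide)
    have YY: "x ^ (2 * n + 2) = Y * Y" unfolding Y_def power_add[symmetric] by (rule arg_cong[of _ _ "power x"]) simp
    \<comment> \<open>only the second diagonal part reaches the pole of order \<open>b + 1\<close>\<close>
    have P: "pole_part Q x \<theta> (Suc n) = pole_part Q x \<theta> n + \<theta> * (1 - 1 / Q) * (x / Q) ^ (n + 1)"
      by (simp add: pole_part_def distrib_left)
    have "?F = \<theta> ^ 2 * x ^ (2 * n + 1) / Q ^ 2 * (Q - 1) + \<theta> * Y / Q * pole_part Q x \<theta> n * (Q * Q ^ n - Q ^ n)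
        + \<theta> ^ 2 * (Y * Y) / Q ^ 2 * (Q - 1) + \<theta> * Y * (pole_part Q x \<theta> n + \<theta> * (1 - 1 / Q) * (x / Q) ^ (n + 1)) * - (Q ^ n)"
      unfolding A1 A2 D1 D2 R' P[symmetric] YY[symmetric] Y_def[symmetric] using pole1[of "Suc n"] pole2[of n] n ba False by simp
    also have "\<dots> = \<theta> ^ 2 * x ^ (2 * n + 1) / Q ^ 2 * (Q - 1) - \<theta> * Y * Q ^ n / Q * pole_part Q x \<theta> n"
      by (rule diagonal_corner[OF q_nonzero(2) Y])
    finally show ?thesis using n False by (simp add: Y_def)
  qed
  moreover have "?F = of_bool (n = a) * ?B" if n: "b < n"
  proof -
    have "R2 = 0" using R(1,2) n ba by (cases "a = b") auto
    moreover have "R1 = of_bool (n = a) * (?e * (Q * Q ^ b))" using R(3,4) n ba by (cases "a = b") auto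
    ultimately show ?thesis unfolding A1 A2 D1 D2 using pole2'[OF n] n by (cases "n = a") simp_all
  qed
  ultimately show "?F = of_bool (n < b) * generic_term (Suc n) + of_bool (n = b) * ?A + of_bool (n = a) * ?B"
    using ba by (cases n b rule: linorder_cases) auto
qed (use ba l in simp_all)

end

section \<open>Local density polynomials\<close>

lemma power_product_sum:
  fixes x Q :: complex
  shows "Q * (x * (Q * x) ^ n) = 1 + (Q * x - 1) * (\<Sum>e = 0..n. (Q * x) ^ e)"
proof (induction n)
  case (Suc n)
  have s: "(\<Sum>e = 0..Suc n. (Q * x) ^ e) = (\<Sum>e = 0..n. (Q * x) ^ e) + Q * x * (Q * x) ^ n" by simp
  have "Q * (x * (Q * x) ^ Suc n) = Q * (x * (Q * x) ^ n) + (Q * x - 1) * (Q * x * (Q * x) ^ n)"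
    by (simp add: algebra_simps)
  then show ?case unfolding Suc s by (simp only: distrib_left add.assoc)
qed simp

lemma odd_power_eq:
  fixes x Q :: complex
  assumes "Q \<noteq> 0" and w: "w = (\<Sum>e = 1..n. (x / Q) ^ e)"
  shows "x ^ (2 * n + 1) = x * (Q * x) ^ n - Q * (w * (Q * x) ^ n) + w * (x * (Q * x) ^ n)"
proof -
  have "x ^ (2 * n + 1) = x * ((x / Q) ^ n * (Q * x) ^ n)"
    using assms(1) by (simp add: power_mult power2_eq_square flip: power_mult_distrib)
  also have "\<dots> = (x * (x / Q) ^ n) * (Q * x) ^ n" by simp
  finally show ?thesis unfolding power_quotient_sum[OF assms(1)] w[symmetric] by (simp add: algebra_simps)
qed

lemma reflected_sums:
  fixes x Q :: complex
  assumes Q: "Q \<noteq> 0"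
  shows "(\<Sum>e = 0..b. (x / Q) ^ e) = 1 + (\<Sum>e = 1..b. (x / Q) ^ e)"
    and "(\<Sum>e = a + 1..a + b + 1. Q ^ (a + b + 1 - e) * x ^ e) = x * (x ^ a * Q ^ b) * (\<Sum>e = 0..b. (x / Q) ^ e)"
    and "(\<Sum>e = a + 1..2 * a. Q ^ (2 * a - e) * x ^ e) = (\<Sum>e = 1..a. (x / Q) ^ e) * (Q * x) ^ a"
    and "Q ^ (2 * a + 1) * (\<Sum>e = a + 1..2 * a. (x / Q) ^ e) = Q * ((\<Sum>e = 1..a. (x / Q) ^ e) * (Q * x) ^ a)"
proof -
  show "(\<Sum>e = 0..b. (x / Q) ^ e) = 1 + (\<Sum>e = 1..b. (x / Q) ^ e)"
    by (simp add: sum.atLeast_Suc_atMost)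
  have shift: "(\<Sum>e = k + i..k + j. f e) = (\<Sum>e = i..j. f (k + e))" for f :: "nat \<Rightarrow> complex" and i j k
    by (rule sum.reindex_bij_witness[of _ "\<lambda>e. k + e" "\<lambda>e. e - k"]) auto
  have pd: "Q ^ n * (x / Q) ^ k = Q ^ (n - k) * x ^ k" if "k \<le> n" for k n
    using Q power_add[of Q k "n - k"] that by (simp add: power_divide)
  have "(\<Sum>e = a + 1..a + b + 1. Q ^ (a + b + 1 - e) * x ^ e) = (\<Sum>e = 0..b. Q ^ (b - e) * x ^ (a + 1 + e))"
    by (rule sum.reindex_bij_witness[of _ "\<lambda>e. a + 1 + e" "\<lambda>e. e - (a + 1)"]) (auto simp: add.commute)
  also have "\<dots> = (\<Sum>e = 0..b. x * (x ^ a * Q ^ b) * (x / Q) ^ e)"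
  proof (intro sum.cong refl)
    fix e assume "e \<in> {0..b}"
    then show "Q ^ (b - e) * x ^ (a + 1 + e) = x * (x ^ a * Q ^ b) * (x / Q) ^ e"
      using pd[of e b] by (simp add: power_add)
  qed
  finally show "(\<Sum>e = a + 1..a + b + 1. Q ^ (a + b + 1 - e) * x ^ e) = x * (x ^ a * Q ^ b) * (\<Sum>e = 0..b. (x / Q) ^ e)"
    by (simp add: sum_distrib_left)
  have 2: "2 * a = a + a" by simp
  have "(\<Sum>e = a + 1..2 * a. Q ^ (2 * a - e) * x ^ e) = (\<Sum>e = 1..a. Q ^ (a - e) * x ^ (a + e))"
    unfolding 2 using shift[where k = a and i = 1 and j = a] by simp
  also have "\<dots> = (\<Sum>e = 1..a. (x / Q) ^ e * (Q * x) ^ a)"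
  proof (intro sum.cong refl)
    fix e assume "e \<in> {1..a}"
    then show "Q ^ (a - e) * x ^ (a + e) = (x / Q) ^ e * (Q * x) ^ a"
      using pd[of e a] by (simp add: power_add power_mult_distrib mult.commute)
  qed
  finally show "(\<Sum>e = a + 1..2 * a. Q ^ (2 * a - e) * x ^ e) = (\<Sum>e = 1..a. (x / Q) ^ e) * (Q * x) ^ a"
    by (simp add: sum_distrib_right)
  have "(\<Sum>e = a + 1..2 * a. (x / Q) ^ e) = (\<Sum>e = 1..a. (x / Q) ^ a * (x / Q) ^ e)"
    unfolding 2 using shift[where k = a and i = 1 and j = a] by (simp add: power_add)
  then have "(\<Sum>e = a + 1..2 * a. (x / Q) ^ e) = (x / Q) ^ a * (\<Sum>e = 1..a. (x / Q) ^ e)"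
    by (simp only: sum_distrib_left)
  moreover have "Q ^ (2 * a + 1) * (x / Q) ^ a = Q * (Q * x) ^ a"
    using Q by (simp add: mult_2 power_add power_divide power_mult_distrib)
  ultimately show "Q ^ (2 * a + 1) * (\<Sum>e = a + 1..2 * a. (x / Q) ^ e) = Q * ((\<Sum>e = 1..a. (x / Q) ^ e) * (Q * x) ^ a)"
    by (simp only: mult.assoc[symmetric]) (simp only: mult_ac)
qed

text \<open>The values of \<open>form_sum\<close> that were found for the two kinds of matrices \<open>T\<close>, with \<open>e = \<chi>(- u\<^sub>1 u\<^sub>2)\<close>.\<close>

definition diagonal_total :: "complex \<Rightarrow> complex \<Rightarrow> complex \<Rightarrow> complex \<Rightarrow> nat \<Rightarrow> nat \<Rightarrow> complex" where
  "diagonal_total Q x \<theta> e a b = generic Q x \<theta> b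
    + (\<theta> ^ 2 * x ^ (2 * b + 1) / Q ^ 2 * (Q - 1) - \<theta> * x ^ (b + 1) * Q ^ b / Q * pole_part Q x \<theta> b)
    + \<theta> * x ^ (a + 1) * (pole_part Q x \<theta> b - \<theta> * (x / Q) ^ (b + 1) / Q) * (e * Q ^ b)"

definition antidiagonal_total :: "complex \<Rightarrow> complex \<Rightarrow> complex \<Rightarrow> nat \<Rightarrow> complex" where
  "antidiagonal_total Q x \<theta> a = generic Q x \<theta> a - \<theta> ^ 2 * x ^ (2 * a + 1) / Q ^ 2"

lemma diagonal_total_eq:
  fixes Q x \<theta> e :: complex and a b :: nat
  defines "w \<equiv> (\<Sum>e = 1..b. (x / Q) ^ e)" and "S \<equiv> (\<Sum>e = 0..b. (Q * x) ^ e)" and "U \<equiv> x * (Q * x) ^ b"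
    and "E \<equiv> x ^ a * Q ^ b" and "Qi \<equiv> 1 / Q" and "T \<equiv> x * (x / Q) ^ b"
  defines "p \<equiv> w * (Q * x) ^ b"
  assumes Q: "Q \<noteq> 0"
  shows "diagonal_total Q x \<theta> e a b = (1 + \<theta> * (Q - 1) * (Q + 1) * Qi ^ 2 * (S - 1) + \<theta> ^ 2 * (Q - 1) * Qi * ((S - 1) * Qi ^ 2 + p))
    + \<theta> ^ 2 * (Q - 1) * Qi ^ 2 * (U - Q * p + w * U) - \<theta> * U * Qi * (1 + \<theta> * (1 - Qi) * w)
    + \<theta> * e * x * E * ((1 + \<theta> * (1 - Qi) * w) - \<theta> * T * Qi ^ 2)"
proof -
  have P: "pole_part Q x \<theta> b = 1 + \<theta> * (1 - Qi) * w" by (simp add: pole_part_def w_def Qi_def)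
  have G: "generic Q x \<theta> b = 1 + \<theta> * (Q - 1) * (Q + 1) * Qi ^ 2 * (S - 1) + \<theta> ^ 2 * (Q - 1) * Qi * ((S - 1) * Qi ^ 2 + p)"
    unfolding generic_closed[OF Q] by (simp add: w_def S_def Qi_def p_def power_one_over)
  have U: "x ^ (b + 1) * Q ^ b = U" by (simp add: U_def power_mult_distrib)
  have T: "(x / Q) ^ (b + 1) / Q = T * Qi ^ 2" by (simp add: T_def Qi_def power2_eq_square)
  have E: "x ^ (a + 1) * Q ^ b = x * E" by (simp add: E_def)
  have "\<theta> ^ 2 * x ^ (2 * b + 1) / Q ^ 2 * (Q - 1) = \<theta> ^ 2 * (Q - 1) * Qi ^ 2 * (U - Q * p + w * U)"
    unfolding odd_power_eq[OF Q w_def[THEN meta_eq_to_obj_eq]] U_def p_def Qi_def by (simp add: power_one_over mult_ac)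
  moreover have "\<theta> * x ^ (b + 1) * Q ^ b / Q * pole_part Q x \<theta> b = \<theta> * U * Qi * (1 + \<theta> * (1 - Qi) * w)"
    unfolding P U[symmetric] Qi_def by simp
  moreover have "\<theta> * x ^ (a + 1) * (pole_part Q x \<theta> b - \<theta> * (x / Q) ^ (b + 1) / Q) * (e * Q ^ b)
      = \<theta> * e * x * E * ((1 + \<theta> * (1 - Qi) * w) - \<theta> * T * Qi ^ 2)"
  proof -
    have "\<theta> * x ^ (a + 1) * (pole_part Q x \<theta> b - \<theta> * (x / Q) ^ (b + 1) / Q) * (e * Q ^ b)
        = \<theta> * e * (x ^ (a + 1) * Q ^ b) * (pole_part Q x \<theta> b - \<theta> * ((x / Q) ^ (b + 1) / Q))"
      by (simp only: mult_ac times_divide_eq_right)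
    then show ?thesis unfolding E T P by (simp only: mult.assoc)
  qed
  ultimately show ?thesis unfolding diagonal_total_def G by simp
qed

lemma antidiagonal_total_eq:
  fixes Q x \<theta> :: complex and a :: nat
  defines "w \<equiv> (\<Sum>e = 1..a. (x / Q) ^ e)" and "S \<equiv> (\<Sum>e = 0..a. (Q * x) ^ e)" and "U \<equiv> x * (Q * x) ^ a"
    and "Qi \<equiv> 1 / Q"
  defines "p \<equiv> w * (Q * x) ^ a"
  assumes Q: "Q \<noteq> 0"
  shows "antidiagonal_total Q x \<theta> a = (1 + \<theta> * (Q - 1) * (Q + 1) * Qi ^ 2 * (S - 1) + \<theta> ^ 2 * (Q - 1) * Qi * ((S - 1) * Qi ^ 2 + p))
    - \<theta> ^ 2 * (U - Q * p + w * U) * Qi ^ 2"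
proof -
  have G: "generic Q x \<theta> a = 1 + \<theta> * (Q - 1) * (Q + 1) * Qi ^ 2 * (S - 1) + \<theta> ^ 2 * (Q - 1) * Qi * ((S - 1) * Qi ^ 2 + p)"
    unfolding generic_closed[OF Q] by (simp add: w_def S_def Qi_def p_def power_one_over)
  have "\<theta> ^ 2 * x ^ (2 * a + 1) / Q ^ 2 = \<theta> ^ 2 * (U - Q * p + w * U) * Qi ^ 2"
    unfolding odd_power_eq[OF Q w_def[THEN meta_eq_to_obj_eq]] U_def p_def Qi_def by (simp add: power_one_over mult_ac)
  then show ?thesis unfolding antidiagonal_total_def G by simp
qed

context
  fixes Q x :: complex
  assumes Q: "Q \<noteq> 0"
begin

lemma inverse_cancel: "Q * (1 / Q) = 1" "Q * (1 / Q * y) = y"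
  using Q by simp_all

lemma product_sum: "x * (Q * x) ^ n = 1 / Q * (1 + (Q * x - 1) * (\<Sum>e = 0..n. (Q * x) ^ e))"
  unfolding power_product_sum[symmetric] using Q by simp

lemma diagonal_total_hyperbolic:
  "diagonal_total Q x 1 e a b = (1 - (1 / Q) ^ 2 * x)
     * ((\<Sum>e = 0..b. Q ^ e * x ^ e) + e * (\<Sum>e = a + 1..a + b + 1. Q ^ (a + b + 1 - e) * x ^ e))"
proof -
  have "diagonal_total Q x 1 e a b = (1 - x * (1 / Q) ^ 2)
     * ((\<Sum>e = 0..b. (Q * x) ^ e) + e * x * (x ^ a * Q ^ b) * (1 + (\<Sum>e = 1..b. (x / Q) ^ e)))"
    unfolding diagonal_total_eq[OF Q] mult_1_left power_one
    by (rule diagonal_hyperbolic_algebra[OF inverse_cancel power_quotient_sum[OF Q] product_sum])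
  then show ?thesis
    unfolding reflected_sums(2)[OF Q] reflected_sums(1)[OF Q] by (simp only: power_mult_distrib mult_ac)
qed

lemma antidiagonal_total_hyperbolic:
  "antidiagonal_total Q x 1 a = (1 - (1 / Q) ^ 2 * x)
     * ((\<Sum>e = 0..a. Q ^ e * x ^ e) + (\<Sum>e = a + 1..2 * a. Q ^ (2 * a - e) * x ^ e))"
proof -
  let ?w = "\<Sum>e = 1..a. (x / Q) ^ e" and ?U = "x * (Q * x) ^ a"
  have "antidiagonal_total Q x 1 a = (1 - x * (1 / Q) ^ 2) * (\<Sum>e = 0..a. (Q * x) ^ e) + ?w * (Q * x) ^ a - ?U * ?w * (1 / Q) ^ 2"
    unfolding antidiagonal_total_eq[OF Q] mult_1_left power_one
    by (rule antidiagonal_hyperbolic_algebra[OF inverse_cancel power_quotient_sum[OF Q] product_sum])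
  also have "\<dots> = (1 - (1 / Q) ^ 2 * x) * ((\<Sum>e = 0..a. (Q * x) ^ e) + ?w * (Q * x) ^ a)"
    by (simp add: algebra_simps)
  finally show ?thesis unfolding reflected_sums(3)[OF Q] by (simp only: power_mult_distrib mult_ac)
qed

lemma diagonal_total_unimodular:
  assumes e: "e1 * e1 = 1" "e2 * e2 = 1" and ba: "b \<le> a"
  shows "diagonal_total Q x (e2 * Q) e1 a b = (1 - x) * (1 + e2 + Q * e2) * (\<Sum>e = 0..b. (Q * x) ^ e)
    - e1 * Q ^ (b + 1) * x ^ (a + 1) * (1 - x) * (\<Sum>e = 0..b. (1 / Q * x) ^ e)
    - e1 * (1 + Q) * (x ^ (a + b + 2) + e1 * e2) + (1 + e2) * Q ^ (b + 1) * x ^ (b + 1) * (1 + e1 * x ^ (a - b))"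
proof -
  let ?w = "\<Sum>e = 1..b. (x / Q) ^ e" and ?S = "\<Sum>e = 0..b. (Q * x) ^ e" and ?U = "x * (Q * x) ^ b"
    and ?E = "x ^ a * Q ^ b" and ?T = "x * (x / Q) ^ b"
  have e2: "e2 * (e2 * y) = y" for y using e(2) by (simp add: mult.assoc[symmetric])
  have 1: "diagonal_total Q x (e2 * Q) e1 a b = (1 - x) * (1 + e2 + Q * e2) * ?S - e1 * (Q * x * ?E) * (1 - x) * (1 + ?w)
     - e1 * (1 + Q) * (x * ?E * ?T) - (1 + Q) * e2 + (1 + e2) * (Q * ?U) + (1 + e2) * e1 * (Q * x * ?E)"
    unfolding diagonal_total_eq[OF Q]
    by (rule diagonal_unimodular_algebra[OF inverse_cancel power_quotient_sum[OF Q] product_sum e(2) e2])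
  have 2: "e1 * Q ^ (b + 1) * x ^ (a + 1) = e1 * (Q * x * ?E)" by simp
  have 3: "e1 * (1 + Q) * (x ^ (a + b + 2) + e1 * e2) = e1 * (1 + Q) * (x * ?E * ?T) + (1 + Q) * e2"
  proof -
    have "Q ^ b * (x / Q) ^ b = x ^ b" using Q by (simp add: power_divide)
    then have "x * ?E * ?T = x ^ (a + b + 2)" by (simp add: power_add power2_eq_square)
    moreover have "e1 * (1 + Q) * (e1 * e2) = (1 + Q) * e2" using e(1) by (simp add: mult_ac)
    ultimately show ?thesis by (simp only: distrib_left)
  qed
  have 4: "(1 + e2) * Q ^ (b + 1) * x ^ (b + 1) * (1 + e1 * x ^ (a - b)) = (1 + e2) * (Q * ?U) + (1 + e2) * e1 * (Q * x * ?E)"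
  proof -
    have U: "(1 + e2) * Q ^ (b + 1) * x ^ (b + 1) = (1 + e2) * (Q * ?U)" by (simp add: power_mult_distrib)
    have "x ^ a = x ^ b * x ^ (a - b)" using ba by (simp flip: power_add)
    then have E: "Q * x * ?E = Q * ?U * x ^ (a - b)" by (simp add: power_mult_distrib)
    show ?thesis unfolding U E distrib_left mult_1_right by (simp only: mult_ac)
  qed
  have 5: "(\<Sum>e = 0..b. (1 / Q * x) ^ e) = 1 + ?w" using reflected_sums(1)[OF Q, of x b] by simp
  show ?thesis unfolding 1 2 3 4 5 by simp
qed

lemma antidiagonal_total_unimodular:
  assumes e: "e2 * e2 = 1"
  shows "antidiagonal_total Q x (e2 * Q) a = (1 - x) * (1 + e2 + Q * e2) * (\<Sum>e = 0..a. (Q * x) ^ e)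
    - Q ^ (2 * a + 1) * (1 - x) * (\<Sum>e = a + 1..2 * a. (1 / Q * x) ^ e)
    - (Q + 1) * (x ^ (2 * a + 1) + e2) + (Q + 1) * (1 + e2) * Q ^ a * x ^ (a + 1)"
proof -
  let ?w = "\<Sum>e = 1..a. (x / Q) ^ e" and ?S = "\<Sum>e = 0..a. (Q * x) ^ e" and ?U = "x * (Q * x) ^ a"
  let ?p = "?w * (Q * x) ^ a"
  have e2: "e2 * (e2 * y) = y" for y using e by (simp add: mult.assoc[symmetric])
  have 1: "antidiagonal_total Q x (e2 * Q) a = (1 - x) * (1 + e2 + Q * e2) * ?S - Q * ?p + Q * ?U * ?w
     - (Q + 1) * (?U - Q * ?p + ?w * ?U) - (Q + 1) * e2 + (Q + 1) * (1 + e2) * ?U"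
    unfolding antidiagonal_total_eq[OF Q]
    by (rule antidiagonal_unimodular_algebra[OF inverse_cancel power_quotient_sum[OF Q] product_sum e e2])
  have "Q ^ (2 * a + 1) * (1 - x) * (\<Sum>e = a + 1..2 * a. (1 / Q * x) ^ e)
      = (1 - x) * (Q ^ (2 * a + 1) * (\<Sum>e = a + 1..2 * a. (x / Q) ^ e))"
    by (simp add: mult_ac)
  also have "\<dots> = Q * ?p - Q * ?U * ?w"
    unfolding reflected_sums(4)[OF Q] by (simp add: algebra_simps)
  finally have 2: "Q ^ (2 * a + 1) * (1 - x) * (\<Sum>e = a + 1..2 * a. (1 / Q * x) ^ e) = Q * ?p - Q * ?U * ?w" .
  have 3: "(Q + 1) * (1 + e2) * Q ^ a * x ^ (a + 1) = (Q + 1) * (1 + e2) * ?U" by (simp add: power_mult_distrib)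
  show ?thesis unfolding 1 2 3 odd_power_eq[OF Q refl, of x a] by (simp add: distrib_left)
qed

end

context polar_sum
begin

lemma truncated_density_form_sum:
  assumes B: "admissible_block B" and N: "N = 2 * l + 1"
    and f: "\<And>a d c. \<lbrakk>a \<in> P0 (- int l); d \<in> P0 (- int l); c \<in> P (- int (2 * l))\<rbrakk>
      \<Longrightarrow> f a d c = mat_mean N 2 (\<lambda>V. \<psi> (herm_trace (gram a d c) B V)) * form_volume N a d c ^ r"
  shows "truncated_density av bar \<pi> \<psi> \<mu> \<nu> (diag_block_mat (B # replicate r (hyperbolic \<pi>))) (gram t1 t2 (bar \<tau>)) l
    = form_sum l l (2 * l)"
  unfolding truncated_density_eq[OF B t1 t2 tau N] form_sum_def summand_def
  by (intro qsum_cong fin_P0_neg fin_P_neg) (simp only: f)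

end

context local_density_setting
begin

text \<open>The binary form with matrix \<open>B\<close> contributes the polar weight \<open>w\<close> with parameter \<open>\<theta>\<close>.\<close>

definition block_weight :: "'a mat \<Rightarrow> complex \<Rightarrow> (nat \<Rightarrow> 'a \<Rightarrow> 'a \<Rightarrow> 'a \<Rightarrow> complex) \<Rightarrow> bool" where
  "block_weight B \<theta> w \<longleftrightarrow> admissible_block B \<and>
     (\<forall>l N. 2 * l + 1 = N \<longrightarrow> polar_weight l \<theta> (1 / of_nat q ^ 2) (w N)) \<and>
     (\<forall>N a a' d d' c c'. a \<in> F0 \<and> a' \<in> F0 \<and> d \<in> F0 \<and> d' \<in> F0 \<and> a - a' \<in> P0 0 \<and> d - d' \<in> P0 0 \<and> c - c' \<in> P 0
        \<longrightarrow> w N a d c = w N a' d' c') \<and>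
     (\<forall>l N. \<forall>a \<in> P0 (- int l). \<forall>d \<in> P0 (- int l). \<forall>c \<in> P (- int (2 * l)). 2 * l + 1 = N \<longrightarrow>
        w N a d c = mat_mean N 2 (\<lambda>V. \<psi> (herm_trace (gram a d c) B V)))"

lemma block_weight_hyperbolic: "block_weight (hyperbolic \<pi>) 1 form_volume"
  unfolding block_weight_def
  using admissible_hyperbolic polar_weight_volume form_volume_cong
  by (auto simp: mat_mean_hyperbolic)

lemma block_weight_diag2:
  assumes v: "v \<in> F0" "av v = 1"
  shows "block_weight (diag2 v 1) (of_int (chi (- v)) * of_nat q)
    (\<lambda>N a d c. form_gauss N (v * a) (v * d) (v * c) * form_gauss N a d c)"
proof -
  have "v \<in> P0 0" using v by (simp add: P0_def P_def)
  then have B: "admissible_block (diag2 v 1)" by (rule admissible_diag2)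
  note m = mat_mean_diag2[OF v(1), symmetric]
  show ?thesis
    unfolding block_weight_def
  proof (intro conjI allI impI ballI B)
    show "polar_weight l (of_int (chi (- v)) * of_nat q) (1 / of_nat q ^ 2)
        (\<lambda>a d c. form_gauss N (v * a) (v * d) (v * c) * form_gauss N a d c)" if "2 * l + 1 = N" for l N
      using that by (intro polar_weight_gauss v) auto
    show "form_gauss N (v * a) (v * d) (v * c) * form_gauss N a d c = form_gauss N (v * a') (v * d') (v * c') * form_gauss N a' d' c'"
      if "a \<in> F0 \<and> a' \<in> F0 \<and> d \<in> F0 \<and> d' \<in> F0 \<and> a - a' \<in> P0 0 \<and> d - d' \<in> P0 0 \<and> c - c' \<in> P 0" for N a a' d d' c c'
      using that m[of a d] m[of a' d'] block_mean_cong[OF B] by auto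
    show "form_gauss N (v * a) (v * d) (v * c) * form_gauss N a d c = mat_mean N 2 (\<lambda>V. \<psi> (herm_trace (gram a d c) (diag2 v 1) V))"
      if "a \<in> P0 (- int l)" "d \<in> P0 (- int l)" for l N a d c
      using that P0_F0 m by blast
  qed
qed

lemma truncated_density_block:
  fixes r :: nat
  assumes w: "block_weight B \<theta> w" and t: "t1 \<in> P0 0" "t2 \<in> P0 0" "\<tau> \<in> P (- 1)"
    and N: "N = 2 * l + 1"
  defines "f \<equiv> \<lambda>a d c. w N a d c * form_volume N a d c ^ r"
  shows "polar_sum p av Qp F0 bar \<pi> \<psi> \<mu> \<nu> l \<theta> (1 / of_nat q ^ 2 * (1 / of_nat q ^ 2) ^ r) f t1 t2 \<tau>"
    and "truncated_density av bar \<pi> \<psi> \<mu> \<nu> (diag_block_mat (B # replicate r (hyperbolic \<pi>))) (gram t1 t2 (bar \<tau>)) l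
      = polar_sum.form_sum av F0 bar \<pi> \<psi> f t1 t2 \<tau> l l (2 * l)"
proof -
  have B: "admissible_block B" and pw: "polar_weight l \<theta> (1 / of_nat q ^ 2) (w N)"
    using w N by (auto simp: block_weight_def)
  have wc: "w N a d c = w N a' d' c'"
    if "a \<in> F0" "a' \<in> F0" "d \<in> F0" "d' \<in> F0" "a - a' \<in> P0 0" "d - d' \<in> P0 0" "c - c' \<in> P 0" for a a' d d' c c'
    using w that unfolding block_weight_def by blast
  have wm: "w N a d c = mat_mean N 2 (\<lambda>V. \<psi> (herm_trace (gram a d c) B V))"
    if "a \<in> P0 (- int l)" "d \<in> P0 (- int l)" "c \<in> P (- int (2 * l))" for a d c
    using w that N unfolding block_weight_def by blast
  have vol: "polar_weight l 1 (1 / of_nat q ^ 2) (form_volume N)" using N by (intro polar_weight_volume) simp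
  show ps: "polar_sum p av Qp F0 bar \<pi> \<psi> \<mu> \<nu> l \<theta> (1 / of_nat q ^ 2 * (1 / of_nat q ^ 2) ^ r) f t1 t2 \<tau>"
  proof unfold_locales
    show "polar_weight l \<theta> (1 / of_nat q ^ 2 * (1 / of_nat q ^ 2) ^ r) f"
      unfolding f_def by (rule polar_weight_power[OF pw vol])
    show "f a d c = f a' d' c'"
      if "a \<in> F0" "a' \<in> F0" "d \<in> F0" "d' \<in> F0" "a - a' \<in> P0 0" "d - d' \<in> P0 0" "c - c' \<in> P 0" for a d c a' d' c'
      unfolding f_def wc[OF that] form_volume_cong[OF that] ..
  qed (fact t)+
  show "truncated_density av bar \<pi> \<psi> \<mu> \<nu> (diag_block_mat (B # replicate r (hyperbolic \<pi>))) (gram t1 t2 (bar \<tau>)) l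
      = polar_sum.form_sum av F0 bar \<pi> \<psi> f t1 t2 \<tau> l l (2 * l)"
    by (rule polar_sum.truncated_density_form_sum[OF ps B N]) (simp only: f_def wm)
qed

text \<open>Adding \<open>r\<close> hyperbolic planes amounts to evaluating at \<open>q\<^sup>-\<^sup>2\<^sup>r\<close>.\<close>

lemma density_variable: "of_nat q ^ 2 * (1 / of_nat q ^ 2 * (1 / of_nat q ^ 2) ^ r) = (1 / of_nat q ^ (2 * r) :: complex)"
  by (simp add: power_one_over power_mult)

lemma has_local_density_eventually:
  assumes "\<And>l. l > n \<Longrightarrow> truncated_density av bar \<pi> \<psi> \<mu> \<nu> S T l = c"
  shows "has_local_density av bar \<pi> \<psi> \<mu> \<nu> S T c"
  unfolding has_local_density_def
  by (rule tendsto_eventually) (use assms in \<open>auto simp: eventually_sequentially intro!: exI[of _ "Suc n"]\<close>)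

theorem local_density_diagonal:
  assumes w: "block_weight B \<theta> w" and u1: "u1 \<in> F0" "av u1 = 1" and u2: "u2 \<in> F0" "av u2 = 1" and ba: "b \<le> a"
  shows "has_local_density av bar \<pi> \<psi> \<mu> \<nu> (diag_block_mat (B # replicate r (hyperbolic \<pi>)))
    (diag2 (u1 * Nm \<pi> ^ a) (u2 * Nm \<pi> ^ b))
    (diagonal_total (of_nat q) (1 / of_nat q ^ (2 * r)) \<theta> (of_int (chi (- u1 * u2))) a b)"
proof (rule has_local_density_eventually)
  fix l assume l: "a < l"
  have t: "u1 * Nm \<pi> ^ a \<in> P0 0" "u2 * Nm \<pi> ^ b \<in> P0 0" "0 \<in> P (- 1)"
    by (simp_all add: unit_norm_P0_iff u1 u2)
  have g: "diag2 (u1 * Nm \<pi> ^ a) (u2 * Nm \<pi> ^ b) = gram (u1 * Nm \<pi> ^ a) (u2 * Nm \<pi> ^ b) (bar 0)"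
    by (simp add: diag2_eq gram_def)
  show "truncated_density av bar \<pi> \<psi> \<mu> \<nu> (diag_block_mat (B # replicate r (hyperbolic \<pi>)))
      (diag2 (u1 * Nm \<pi> ^ a) (u2 * Nm \<pi> ^ b)) l
    = diagonal_total (of_nat q) (1 / of_nat q ^ (2 * r)) \<theta> (of_int (chi (- u1 * u2))) a b"
    unfolding g truncated_density_block(2)[OF w t refl] density_variable[symmetric] diagonal_total_def
    by (rule polar_sum.diagonal_form_sum[OF truncated_density_block(1)[OF w t refl] refl refl refl u1 u2 ba l])
qed

theorem local_density_antidiagonal:
  assumes w: "block_weight B \<theta> w"
  shows "has_local_density av bar \<pi> \<psi> \<mu> \<nu> (diag_block_mat (B # replicate r (hyperbolic \<pi>)))
    (antidiag2 ((- \<pi>) powi (2 * int a - 1)) (\<pi> powi (2 * int a - 1)))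
    (antidiagonal_total (of_nat q) (1 / of_nat q ^ (2 * r)) \<theta> a)"
proof (rule has_local_density_eventually)
  fix l assume l: "a < l"
  let ?\<tau> = "\<pi> powi (2 * int a - 1)"
  have \<tau>: "av ?\<tau> = av \<pi> powi (2 * int a - 1)" by (rule av_powi)
  have t: "0 \<in> P0 0" "0 \<in> P0 0" by simp_all
  have t3: "?\<tau> \<in> P (- 1)" unfolding P_def mem_Collect_eq \<tau> powi_le_iff by simp
  have pow: "bar (\<pi> ^ n) = (- \<pi>) ^ n" for n by (induction n) (simp_all add: bar_mult)
  have "bar ?\<tau> = (- \<pi>) powi (2 * int a - 1)"
    by (simp add: power_int_def pow bar_inverse)
  moreover have "bar (bar ?\<tau>) = ?\<tau>" by simp
  ultimately have g: "antidiag2 ((- \<pi>) powi (2 * int a - 1)) ?\<tau> = gram 0 0 (bar ?\<tau>)"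
    by (simp add: antidiag2_eq gram_def)
  show "truncated_density av bar \<pi> \<psi> \<mu> \<nu> (diag_block_mat (B # replicate r (hyperbolic \<pi>)))
      (antidiag2 ((- \<pi>) powi (2 * int a - 1)) ?\<tau>) l
    = antidiagonal_total (of_nat q) (1 / of_nat q ^ (2 * r)) \<theta> a"
    unfolding g truncated_density_block(2)[OF w t t3 refl] density_variable[symmetric] antidiagonal_total_def
    by (rule polar_sum.antidiagonal_form_sum[OF truncated_density_block(1)[OF w t t3 refl] refl refl \<tau> l])
qed

end

theorem theorem6p2:
  fixes p :: nat and av :: "'a :: field_char_0 \<Rightarrow> real" and Qp F0 :: "'a set"
    and bar :: "'a \<Rightarrow> 'a" and \<pi> \<pi>0 u1 u2 v :: 'a
    and \<psi> :: "'a \<Rightarrow> complex"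
    and \<mu> :: "nat \<Rightarrow> nat \<Rightarrow> 'a mat measure" and \<nu> :: "nat \<Rightarrow> 'a mat measure"
    and a b :: nat and q qinv \<epsilon>1 \<epsilon>2 x :: "rat poly" and S H :: "'a mat"
  assumes "local_density_setting p av Qp F0 bar \<pi> \<psi> \<mu> \<nu>"
    and "\<pi>0 = \<pi>\<^sup>2"
    and "u1 \<in> F0" "av u1 = 1"
    and "u2 \<in> F0" "av u2 = 1"
    and "v \<in> F0" "av v = 1"
    and "b \<le> a"
    and "q = of_nat (residue_card av F0)"
    and "qinv = [:1 / of_nat (residue_card av F0):]"
    and "\<epsilon>1 = of_int (quad_char bar (- u1 * u2))"
    and "\<epsilon>2 = of_int (quad_char bar (- v))"
    and "x = [:0, 1:]"
    and "S = diag2 v 1"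
    and "H = hyperbolic \<pi>"
  shows
    "has_density_poly av F0 bar \<pi> \<psi> \<mu> \<nu> S (diag2 (u1 * (- \<pi>0) ^ a) (u2 * (- \<pi>0) ^ b))
       ((1 - x) * (1 + \<epsilon>2 + q * \<epsilon>2) * (\<Sum>e = 0..b. (q * x) ^ e)
        - \<epsilon>1 * q ^ (b + 1) * x ^ (a + 1) * (1 - x)
            * (\<Sum>e = 0..b. (qinv * x) ^ e)
        - \<epsilon>1 * (1 + q) * (x ^ (a + b + 2) + \<epsilon>1 * \<epsilon>2)
        + (1 + \<epsilon>2) * q ^ (b + 1) * x ^ (b + 1) * (1 + \<epsilon>1 * x ^ (a - b)))
     \<and> has_density_poly av F0 bar \<pi> \<psi> \<mu> \<nu> H (diag2 (u1 * (- \<pi>0) ^ a) (u2 * (- \<pi>0) ^ b))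
       ((1 - qinv ^ 2 * x)
        * ((\<Sum>e = 0..b. q ^ e * x ^ e)
           + \<epsilon>1 * (\<Sum>e = a + 1..a + b + 1. q ^ (a + b + 1 - e) * x ^ e)))
     \<and> has_density_poly av F0 bar \<pi> \<psi> \<mu> \<nu> S
         (antidiag2 ((- \<pi>) powi (2 * int a - 1)) (\<pi> powi (2 * int a - 1)))
       ((1 - x) * (1 + \<epsilon>2 + q * \<epsilon>2) * (\<Sum>e = 0..a. (q * x) ^ e)
        - q ^ (2 * a + 1) * (1 - x)
            * (\<Sum>e = a + 1..2 * a. (qinv * x) ^ e)
        - (q + 1) * (x ^ (2 * a + 1) + \<epsilon>2)
        + (q + 1) * (1 + \<epsilon>2) * q ^ a * x ^ (a + 1))
     \<and> has_density_poly av F0 bar \<pi> \<psi> \<mu> \<nu> H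
         (antidiag2 ((- \<pi>) powi (2 * int a - 1)) (\<pi> powi (2 * int a - 1)))
       ((1 - qinv ^ 2 * x)
        * ((\<Sum>e = 0..a. q ^ e * x ^ e)
           + (\<Sum>e = a + 1..2 * a. q ^ (2 * a - e) * x ^ e)))"
proof -
  interpret local_density_setting p av Qp F0 bar \<pi> \<psi> \<mu> \<nu> by fact
  have pi0: "- \<pi>0 = Nm \<pi>" using assms(2) Nm_pi by simp
  have chi2: "of_int (chi c) * of_int (chi c) = (1 :: complex)" for c using chi_cases[of c] by auto
  let ?Q = "of_nat (residue_card av F0)" and ?e1 = "of_int (chi (- u1 * u2))" and ?e2 = "of_int (chi (- v))"
  note hom = of_rat_add of_rat_mult of_rat_diff of_rat_power of_rat_sum of_rat_of_nat_eq of_rat_of_int_eq of_rat_divide of_rat_1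
    poly_add poly_mult poly_diff poly_power poly_sum poly_of_nat poly_of_int poly_1
  have x: "poly x y = y" and qinv: "poly qinv y = 1 / of_nat (residue_card av F0)" for y using assms by simp_all
  note S = local_density_diagonal[OF block_weight_diag2[OF assms(7,8)] assms(3-6,9)]
    local_density_antidiagonal[OF block_weight_diag2[OF assms(7,8)]]
  note H = local_density_diagonal[OF block_weight_hyperbolic assms(3-6,9)]
    local_density_antidiagonal[OF block_weight_hyperbolic]
  note totals = diagonal_total_unimodular[OF q_nonzero(2) chi2 chi2 assms(9)] antidiagonal_total_unimodular[OF q_nonzero(2) chi2]
    diagonal_total_hyperbolic[OF q_nonzero(2)] antidiagonal_total_hyperbolic[OF q_nonzero(2)]
  show ?thesis
    unfolding has_density_poly_def assms(15,16) pi0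
    using S H unfolding totals
    by (simp only: assms(10,12,13) hom x qinv simp_thms)
qed

end
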